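(* Let $D\subset\mathbb{C}$ be the open unit disk and let $\sigma\in L^\infty(D)$ be complex-valued with $\operatorname{supp}(\sigma-1)$ a compact subset of $D$ and $\varsigma_-\le\operatorname{Re}(\sigma)\le\varsigma_+$ almost everywhere in $D$ for some constants $\varsigma_-,\varsigma_+>0$. Let $\Upsilon(\sigma)$ be the relative Neumann-to-Dirichlet map on $\partial D$, let $P_\diamond,Q_M,F_M,G_M$ be the operators defined in the context, and let $f_n(\theta)=e^{\mathrm{i}n\theta}$. Then for every $s>\frac12$ there is a constant $C=C(s,\sigma)>0$, independent of $n$ and $M$, such that for all $M\in\mathbb{N}$ and $n\in\mathbb{Z}\setminus\{0\}$ $$\|(\Upsilon(\sigma)-P_\diamond Q_M\Upsilon(\sigma)F_MG_M)f_n\|_{L^2}\le C\left(\frac{|n|}{\frac12+M}\right)^s.$$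
   Context: $\mathbb{N}=\{1,2,\dots\}$. Periodic Sobolev spaces: for a $2\pi$-periodic distribution $g$ on $\mathbb{R}$, $\hat g(n)=\frac1{2\pi}\langle g,f_{-n}\rangle$ are its Fourier coefficients ($\hat g(n)=\frac1{2\pi}\int_{-\pi}^{\pi}g(\theta)e^{-\mathrm{i}n\theta}d\theta$ for functions). With $\underline n=\max\{1,|n|\}$, $H^s$ ($s\in\mathbb{R}$) is the Hilbert space of $2\pi$-periodic distributions with $\|g\|_s=(2\pi\sum_{n\in\mathbb{Z}}\underline n^{2s}|\hat g(n)|^2)^{1/2}<\infty$; $H^s_\diamond=\{g\in H^s:\hat g(0)=0\}$; $L^2=H^0$, so that $\|g\|_{L^2}^2=\int_{-\pi}^\pi|g|^2d\theta$. $H^s$ is identified with $H^s(\partial D)$ via $\theta\leftrightarrow e^{\mathrm{i}\theta}$. For $s>\frac12$ elements of $H^s$ are identified with continuous $2\pi$-periodic functions. $P_\diamond g=\sum_{n\ne0}\hat g(n)f_n$. Relative Neumann-to-Dirichlet map: for $f\in H^s_\diamond(\partial D)$ let $u$ be the solution, unique up to an additive constant, of $\nabla\cdot(\sigma\nabla u)=0$ in $D$, $\partial u/\partial\nu=f$ on $\partial D$ ($\nu$ the exterior unit normal). $\Lambda(\sigma):H^s_\diamond(\partial D)\to H^{s+1}_\diamond(\partial D)$ maps $f$ to $u|_{\partial D}$, with the constant chosen so that the trace has zero mean. Put $\Upsilon(\sigma)=\Lambda(\sigma)-\Lambda(1)$. Because $\sigma=1$ near $\partial D$, it is known that $\Upsilon(\sigma)$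 is bounded (extends boundedly) from $H^t_\diamond$ to $H^r_\diamond$ for all $t,r\in\mathbb{R}$. Discretization operators: for $|m|\le M$ let $\theta_m=\frac{2\pi m}{2M+1}$ and $\phi_m(\theta)=\frac1{2M+1}\sum_{k=-M}^Me^{\mathrm{i}k(\theta-\theta_m)}$. For $g\in H^s$, $s>\frac12$, $$Q_Mg=\sum_{|m|\le M}g(\theta_m)\phi_m,\quad F_Mg=\frac{2\pi}{2M+1}\sum_{|m|\le M}g(\theta_m)\delta_{\theta_m},\quad G_Mg=g-\frac1{2M+1}\sum_{|m|\le M}g(\theta_m),$$ where $\delta_{\theta_m}$ is the $2\pi$-periodized Dirac delta at $\theta_m$ (which belongs to $H^t$ for all $t<-\frac12$). $F_MG_M$ maps $H^s$ into $H^t_\diamond$ for $s>\frac12$, $t<-\frac12$. *)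

theory Defs
  imports "HOL-Analysis.Analysis"
begin

section \<open>Smooth functions\<close>

definition dir_deriv :: "'a \<Rightarrow> ('a::euclidean_space \<Rightarrow> 'b::real_normed_vector) \<Rightarrow> 'a \<Rightarrow> 'b" where
  "dir_deriv b v z = frechet_derivative v (at z) b"

text \<open>All iterated partial derivatives exist and are totally differentiable, which is the
  real \<open>C\<close>-infinity property; on the complex plane the basis directions are \<open>1\<close> and \<open>\<i>\<close>.\<close>

definition smooth :: "('a::euclidean_space \<Rightarrow> 'b::real_normed_vector) \<Rightarrow> bool" where
  "smooth v \<longleftrightarrow> (\<forall>bs \<in> lists Basis. \<forall>z. foldr dir_deriv bs v differentiable (at z))"


section \<open>Periodic distributions and Sobolev spaces on the circle\<close>

definition test_fun :: "(real \<Rightarrow> complex) set" where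
  "test_fun = {\<phi>. smooth \<phi> \<and> (\<forall>x. \<phi> (x + 2 * pi) = \<phi> x)}"

text \<open>Periodic distributions are the continuous \<open>\<complex>\<close>-linear (not conjugate linear) functionals on
  the test functions.  To make equality of distributions equality in HOL, they take the value \<open>0\<close>
  outside \<^const>\<open>test_fun\<close>.\<close>

type_synonym pdist = "(real \<Rightarrow> complex) \<Rightarrow> complex"

definition distributions :: "pdist set" where
  "distributions = {g.
     (\<forall>\<phi>\<in>test_fun. \<forall>\<psi>\<in>test_fun. \<forall>c. g (\<lambda>x. \<phi> x + c * \<psi> x) = g \<phi> + c * g \<psi>) \<and>
     (\<exists>N::nat. \<exists>C. \<forall>\<phi>\<in>test_fun.
        cmod (g \<phi>) \<le> C * (\<Sum>k\<le>N. SUP x. cmod ((dir_deriv (1::real) ^^ k) \<phi> x))) \<and>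
     (\<forall>\<phi>. \<phi> \<notin> test_fun \<longrightarrow> g \<phi> = 0)}"

definition dist_of :: "(real \<Rightarrow> complex) \<Rightarrow> pdist" where
  "dist_of h = (\<lambda>\<phi>. if \<phi> \<in> test_fun then LINT x|lebesgue_on {-pi..pi}. h x * \<phi> x else 0)"

definition delta :: "real \<Rightarrow> pdist" where
  "delta a = (\<lambda>\<phi>. if \<phi> \<in> test_fun then \<phi> a else 0)"

definition fmode :: "int \<Rightarrow> real \<Rightarrow> complex" where
  "fmode n \<theta> = exp (\<i> * of_int n * of_real \<theta>)"

definition fcoeff :: "pdist \<Rightarrow> int \<Rightarrow> complex" where
  "fcoeff g n = g (fmode (- n)) / (2 * pi)"

definition sob_term :: "real \<Rightarrow> pdist \<Rightarrow> int \<Rightarrow> real" where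
  "sob_term s g n = real_of_int (max 1 \<bar>n\<bar>) powr (2 * s) * (cmod (fcoeff g n))\<^sup>2"

definition sob :: "real \<Rightarrow> pdist set" where
  "sob s = {g \<in> distributions. sob_term s g summable_on UNIV}"

definition sob_norm :: "real \<Rightarrow> pdist \<Rightarrow> real" where
  "sob_norm s g = sqrt (2 * pi * (\<Sum>\<^sub>\<infinity>n\<in>UNIV. sob_term s g n))"

definition sob_diamond :: "real \<Rightarrow> pdist set" where
  "sob_diamond s = {g \<in> sob s. fcoeff g 0 = 0}"

text \<open>The continuous periodic function representing an element of \<open>sob s\<close>, \<open>s > 1/2\<close>.\<close>

definition cont_rep :: "pdist \<Rightarrow> real \<Rightarrow> complex" where
  "cont_rep g = (THE h. continuous_on UNIV h \<and> (\<forall>x. h (x + 2 * pi) = h x) \<and> dist_of h = g)"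


section \<open>Discretization operators\<close>

definition P_diamond :: "pdist \<Rightarrow> pdist" where
  "P_diamond g = (\<lambda>\<phi>. \<Sum>\<^sub>\<infinity>n\<in>-{0}. fcoeff g n * dist_of (fmode n) \<phi>)"

definition node :: "nat \<Rightarrow> int \<Rightarrow> real" where
  "node M m = 2 * pi * of_int m / (2 * real M + 1)"

definition interp_basis :: "nat \<Rightarrow> int \<Rightarrow> real \<Rightarrow> complex" where
  "interp_basis M m \<theta> =
     1 / (2 * of_nat M + 1) * (\<Sum>k\<in>{- int M..int M}. fmode k (\<theta> - node M m))"

definition Q_op :: "nat \<Rightarrow> pdist \<Rightarrow> pdist" where
  "Q_op M g =
     dist_of (\<lambda>\<theta>. \<Sum>m\<in>{- int M..int M}. cont_rep g (node M m) * interp_basis M m \<theta>)"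

definition F_op :: "nat \<Rightarrow> pdist \<Rightarrow> pdist" where
  "F_op M g = (\<lambda>\<phi>. 2 * pi / (2 * of_nat M + 1) *
     (\<Sum>m\<in>{- int M..int M}. cont_rep g (node M m) * delta (node M m) \<phi>))"

definition G_op :: "nat \<Rightarrow> pdist \<Rightarrow> pdist" where
  "G_op M g = dist_of (\<lambda>\<theta>. cont_rep g \<theta> -
     1 / (2 * of_nat M + 1) * (\<Sum>m\<in>{- int M..int M}. cont_rep g (node M m)))"


section \<open>The Neumann problem in the unit disk\<close>

abbreviation disk :: "complex measure" where
  "disk \<equiv> lebesgue_on (ball 0 1)"

definition ess_support :: "(complex \<Rightarrow> complex) \<Rightarrow> complex set" where
  "ess_support h = {z \<in> ball 0 1. \<forall>e>0. \<not> (AE x in disk. x \<in> ball z e \<longrightarrow> h x = 0)}"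

definition L2_fun :: "'a measure \<Rightarrow> ('a \<Rightarrow> complex) set" where
  "L2_fun N = {h \<in> borel_measurable N. integrable N (\<lambda>x. (cmod (h x))\<^sup>2)}"

definition L2_conv :: "'a measure \<Rightarrow> (nat \<Rightarrow> 'a \<Rightarrow> complex) \<Rightarrow> ('a \<Rightarrow> complex) \<Rightarrow> bool" where
  "L2_conv N v h \<longleftrightarrow> h \<in> L2_fun N \<and> (\<forall>k. v k \<in> L2_fun N) \<and>
     (\<lambda>k. LINT x|N. (cmod (v k x - h x))\<^sup>2) \<longlonglongrightarrow> 0"

text \<open>The space \<open>H\<^sup>1\<close> of the disk is the completion of the restrictions of smooth functions on the
  plane.  In \<open>H1_approx v u ux uy\<close>, the smooth \<open>v k\<close> converge in \<open>H\<^sup>1\<close> to \<open>u\<close>, whose weak gradient is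
  \<open>(ux, uy)\<close>.\<close>

definition H1_approx ::
  "(nat \<Rightarrow> complex \<Rightarrow> complex) \<Rightarrow> (complex \<Rightarrow> complex) \<Rightarrow> (complex \<Rightarrow> complex) \<Rightarrow> (complex \<Rightarrow> complex) \<Rightarrow> bool"
where
  "H1_approx v u ux uy \<longleftrightarrow> (\<forall>k. smooth (v k)) \<and> L2_conv disk v u \<and>
     L2_conv disk (\<lambda>k. dir_deriv 1 (v k)) ux \<and> L2_conv disk (\<lambda>k. dir_deriv \<i> (v k)) uy"

definition H1_gradient ::
  "(complex \<Rightarrow> complex) \<Rightarrow> (complex \<Rightarrow> complex) \<Rightarrow> (complex \<Rightarrow> complex) \<Rightarrow> bool" where
  "H1_gradient u ux uy \<longleftrightarrow> (\<exists>v. H1_approx v u ux uy)"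

text \<open>The trace is the continuous extension of restriction to the boundary.\<close>

definition H1_trace :: "(complex \<Rightarrow> complex) \<Rightarrow> (real \<Rightarrow> complex) \<Rightarrow> bool" where
  "H1_trace u h \<longleftrightarrow> (\<exists>v ux uy. H1_approx v u ux uy \<and>
     L2_conv (lebesgue_on {-pi..pi}) (\<lambda>k \<theta>. v k (cis \<theta>)) h)"

text \<open>Variational form of \<open>\<nabla>\<cdot>(\<sigma>\<nabla>u) = 0\<close> in the disk with \<open>\<partial>u/\<partial>\<nu> = f\<close> on the circle, for \<open>\<sigma> = 1\<close> near
  the circle; the smooth test functions \<open>w\<close> are dense in \<open>H\<^sup>1\<close>.\<close>

definition neumann_solution :: "(complex \<Rightarrow> complex) \<Rightarrow> pdist \<Rightarrow> (complex \<Rightarrow> complex) \<Rightarrow> bool" where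
  "neumann_solution \<sigma> f u \<longleftrightarrow> (\<exists>ux uy. H1_gradient u ux uy \<and>
     (\<forall>w. smooth w \<longrightarrow>
        (LINT z|disk. \<sigma> z * (ux z * dir_deriv 1 w z + uy z * dir_deriv \<i> w z))
          = f (\<lambda>\<theta>. w (cis \<theta>))))"

text \<open>The Neumann-to-Dirichlet map on \<open>sob_diamond (-1/2)\<close>, the natural space of Neumann data for
  \<open>H\<^sup>1\<close> solutions.\<close>

definition ND_map :: "(complex \<Rightarrow> complex) \<Rightarrow> pdist \<Rightarrow> pdist" where
  "ND_map \<sigma> f = (THE g. fcoeff g 0 = 0 \<and>
     (\<exists>u h. neumann_solution \<sigma> f u \<and> H1_trace u h \<and> g = dist_of h))"

text \<open>The relative map on all of the spaces \<open>sob_diamond t\<close>: the linear extension of the difference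
  of Neumann-to-Dirichlet maps that is bounded from \<open>sob_diamond t\<close> to \<open>sob_diamond r\<close> for all \<open>t\<close>
  and \<open>r\<close>.  It is unique because \<open>sob_diamond (-1/2)\<close> meets each \<open>sob_diamond t\<close> in a dense subspace;
  the last conjunct fixes irrelevant values.\<close>

definition is_relative_ND :: "(complex \<Rightarrow> complex) \<Rightarrow> (pdist \<Rightarrow> pdist) \<Rightarrow> bool" where
  "is_relative_ND \<sigma> T \<longleftrightarrow>
     (\<forall>f \<in> sob_diamond (-1/2). T f = ND_map \<sigma> f - ND_map (\<lambda>_. 1) f) \<and>
     (\<forall>t. \<forall>f \<in> sob_diamond t. \<forall>g \<in> sob_diamond t. \<forall>c.
        T (\<lambda>\<phi>. f \<phi> + c * g \<phi>) = (\<lambda>\<phi>. T f \<phi> + c * T g \<phi>)) \<and>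
     (\<forall>t r. \<exists>C. \<forall>f \<in> sob_diamond t.
        T f \<in> sob_diamond r \<and> sob_norm r (T f) \<le> C * sob_norm t f) \<and>
     (\<forall>f. f \<notin> (\<Union>t. sob_diamond t) \<longrightarrow> T f = (\<lambda>_. 0))"

definition Upsilon :: "(complex \<Rightarrow> complex) \<Rightarrow> pdist \<Rightarrow> pdist" where
  "Upsilon \<sigma> = (THE T. is_relative_ND \<sigma> T)"

end

theory Submission
  imports Defs
begin

text \<open>
Write \<open>h_m\<close> for the harmonic extension of \<open>fmode m\<close>.  Testing the two weak
Neumann problems with \<open>h_n\<close> shows that the Fourier coefficient \<open>-n\<close> of the relative
Neumann-to-Dirichlet image of a datum is \<open>-1 / (2 \<pi> |n|)\<close> times the integral of
\<open>(\<sigma> - 1) grad u \<cdot> grad h_n\<close>, where \<open>u\<close> solves the problem for \<open>\<sigma>\<close>.  As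
\<open>\<sigma> = 1\<close> outside a disk of radius \<open>R < 1\<close>, the matrix of the relative map in the Fourier
basis is bounded by a multiple of \<open>R\<^sup>|\<^sup>n\<^sup>|\<^sup>+\<^sup>|\<^sup>m\<^sup>|\<close>, and it maps every Sobolev space
boundedly into every other one.  The weak problem itself is solved by an approximate Lax-Milgram
argument on smooth functions, and uniqueness of traces rests on the closability of the gradient.

With \<open>N = 2 M + 1\<close>, the discretization \<open>F_op M \<circ> G_op M\<close> turns \<open>fmode n\<close> into the comb of
all frequencies congruent to \<open>n\<close> modulo \<open>N\<close> (or into zero), whose distance to \<open>fmode n\<close> in the
space of order \<open>-s\<close> is at most of order \<open>N\<close> to the power \<open>-s\<close> if \<open>|n| \<le> M\<close>.  The
interpolation error of the smooth image is controlled by the rapid decay of its coefficients.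
If \<open>|n| > M\<close>, the right-hand side is bounded below and uniform bounds suffice.
\<close>

section \<open>Smooth functions\<close>

text \<open>\<open>ND_map\<close> and \<open>Upsilon\<close> are definite descriptions, so neither
  can be evaluated before existence and uniqueness are settled; this shapes most of the proof. Since
  \<sigma> is complex, the variational form is not Hermitian and its solution does not minimize an
  energy. A contraction reduces the problem to a constant coefficient, where minimization is
  available. Elements of the Sobolev space of the disk occur only as limits of smooth functions, and
  the sequences that define the weak gradient and the trace of one function are unrelated, which is
  why closability is needed. The decay of the matrix has two sources: in n it is the test mode, in m
  the datum, whose solution stays comparable with the harmonic one on the inner disk. The hypothesis
  s > 1/2 is what puts the comb, with coefficients 0 and 1, into the space of order -s. The scale
  1/2 + M is N/2: for |n| <= M every alias n + j N has modulus at least |j| N/2.\<close>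

lemma smooth_coinduct:
  assumes "f \<in> S" and "\<And>g z. g \<in> S \<Longrightarrow> g differentiable (at z)"
    and "\<And>g b. g \<in> S \<Longrightarrow> b \<in> Basis \<Longrightarrow> dir_deriv b g \<in> S"
  shows "smooth f"
proof -
  have "foldr dir_deriv bs f \<in> S" if "bs \<in> lists Basis" for bs
    using that by (induction bs) (use assms in auto)
  then show ?thesis unfolding smooth_def using assms(2) by blast
qed

lemma smooth_dir_deriv:
  assumes "smooth v" "b \<in> Basis"
  shows "smooth (dir_deriv b v)"
  unfolding smooth_def
proof (intro ballI allI)
  fix bs :: "'a list" and z assume "bs \<in> lists Basis"
  then have "bs @ [b] \<in> lists Basis" using assms by auto
  then have "foldr dir_deriv (bs @ [b]) v differentiable at z"
    using assms(1) unfolding smooth_def by blast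
  then show "foldr dir_deriv bs (dir_deriv b v) differentiable at z" by simp
qed

lemma smooth_differentiable: "smooth v \<Longrightarrow> v differentiable (at z)"
  unfolding smooth_def by (metis foldr.simps(1) id_apply lists.Nil)

lemma dir_deriv_eqI: "(f has_derivative f') (at z) \<Longrightarrow> dir_deriv b f z = f' b"
  unfolding dir_deriv_def using frechet_derivative_at by metis

lemma smooth_has_derivative:
  "smooth v \<Longrightarrow> (v has_derivative (\<lambda>h. dir_deriv h v z)) (at z)"
  using smooth_differentiable[of v z] unfolding dir_deriv_def
  by (simp add: frechet_derivative_works)

lemma smooth_continuous: "smooth v \<Longrightarrow> continuous_on S v"
  by (meson continuous_at_imp_continuous_on differentiable_imp_continuous_within smooth_differentiable)

text \<open>The product rule leads out of a family of functions, but not out of the algebra that it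
  generates. With this closure, smoothness has to be checked on generators only, and the product
  rule becomes one case of an induction.\<close>

inductive_set alg_closure :: "('a \<Rightarrow> complex) set \<Rightarrow> ('a \<Rightarrow> complex) set" for G where
  alg_gen: "g \<in> G \<Longrightarrow> g \<in> alg_closure G"
| alg_const: "(\<lambda>_. c) \<in> alg_closure G"
| alg_add: "f \<in> alg_closure G \<Longrightarrow> g \<in> alg_closure G \<Longrightarrow> (\<lambda>x. f x + g x) \<in> alg_closure G"
| alg_mult: "f \<in> alg_closure G \<Longrightarrow> g \<in> alg_closure G \<Longrightarrow> (\<lambda>x. f x * g x) \<in> alg_closure G"

lemma dir_deriv_const: "dir_deriv b (\<lambda>_. c) = (\<lambda>_. 0)"
  by (rule ext, subst dir_deriv_eqI[OF has_derivative_const]) simp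

lemma dir_deriv_add:
  assumes "f differentiable (at z)" "g differentiable (at z)"
  shows "dir_deriv b (\<lambda>x. f x + g x) z = dir_deriv b f z + dir_deriv b g z"
  using assms unfolding frechet_derivative_works
  by (subst dir_deriv_eqI[OF has_derivative_add]) (auto simp: dir_deriv_def)

lemma dir_deriv_mult:
  fixes f g :: "'a::euclidean_space \<Rightarrow> complex"
  assumes "f differentiable (at z)" "g differentiable (at z)"
  shows "dir_deriv b (\<lambda>x. f x * g x) z = f z * dir_deriv b g z + dir_deriv b f z * g z"
  using assms unfolding frechet_derivative_works
  by (subst dir_deriv_eqI[OF has_derivative_mult]) (auto simp: dir_deriv_def)

text \<open>If the derivatives of the generators lie in the generated algebra, the sum and product
  rules keep the whole algebra stable under \<open>dir_deriv\<close>, so it is the invariant set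
  required by \<open>smooth_coinduct\<close>.\<close>

lemma smooth_alg_closure:
  fixes G :: "('a::euclidean_space \<Rightarrow> complex) set"
  assumes dG: "\<And>g z. g \<in> G \<Longrightarrow> g differentiable (at z)"
    and DG: "\<And>g b. g \<in> G \<Longrightarrow> b \<in> Basis \<Longrightarrow> dir_deriv b g \<in> alg_closure G"
    and f: "f \<in> alg_closure G"
  shows "smooth f"
proof (rule smooth_coinduct[OF f])
  show diff: "g differentiable (at z)" if "g \<in> alg_closure G" for g z
    using that by (induction) (auto intro: dG differentiable_add differentiable_mult)
  show "dir_deriv b g \<in> alg_closure G" if "g \<in> alg_closure G" "b \<in> Basis" for g b
    using that
  proof (induction)
    case (alg_add f g)
    have "dir_deriv b (\<lambda>x. f x + g x) = (\<lambda>x. dir_deriv b f x + dir_deriv b g x)"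
      using dir_deriv_add diff alg_add by blast
    then show ?case using alg_add alg_closure.alg_add by auto
  next
    case (alg_mult f g)
    have "dir_deriv b (\<lambda>x. f x * g x) = (\<lambda>x. f x * dir_deriv b g x + dir_deriv b f x * g x)"
      using dir_deriv_mult diff alg_mult by blast
    then show ?case using alg_mult by (auto intro!: alg_closure.intros(3,4))
  qed (auto simp: DG dir_deriv_const intro: alg_closure.intros)
qed

section \<open>Closure properties of smooth functions\<close>

lemma smooth_const: "smooth (\<lambda>_. c)"
  by (rule smooth_coinduct[of _ "range (\<lambda>c _. c)"]) (auto simp: dir_deriv_const)

lemma smooth_alg_closure_smooth:
  fixes f :: "'a::euclidean_space \<Rightarrow> complex"
  assumes "f \<in> alg_closure {v. smooth v}"
  shows "smooth f"
  by (rule smooth_alg_closure[OF _ _ assms])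
     (auto intro: smooth_differentiable smooth_dir_deriv alg_gen)

lemma smooth_add: 
  fixes f :: "'a::euclidean_space \<Rightarrow> complex"
  assumes "smooth f" "smooth g"
  shows "smooth (\<lambda>x. f x + g x)"
  by (rule smooth_alg_closure_smooth) (intro alg_add alg_gen CollectI assms)

lemma smooth_mult: 
  fixes f :: "'a::euclidean_space \<Rightarrow> complex"
  assumes "smooth f" "smooth g"
  shows "smooth (\<lambda>x. f x * g x)"
  by (rule smooth_alg_closure_smooth) (intro alg_mult alg_gen CollectI assms)

lemma smooth_cmult: 
  fixes f :: "'a::euclidean_space \<Rightarrow> complex"
  shows "smooth f \<Longrightarrow> smooth (\<lambda>x. c * f x)"
  by (intro smooth_mult smooth_const)

lemma smooth_diff: 
  fixes f :: "'a::euclidean_space \<Rightarrow> complex"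
  shows "smooth f \<Longrightarrow> smooth g \<Longrightarrow> smooth (\<lambda>x. f x - g x)"
  using smooth_add[of f "\<lambda>x. -1 * g x"] smooth_cmult[of g "-1"] by simp

lemma smooth_sum:
  fixes f :: "'i \<Rightarrow> 'a::euclidean_space \<Rightarrow> complex"
  assumes "\<And>i. i \<in> I \<Longrightarrow> smooth (f i)"
  shows "smooth (\<lambda>x. \<Sum>i\<in>I. f i x)"
  using assms by (induction I rule: infinite_finite_induct) (auto intro: smooth_add smooth_const)

lemma smooth_power: 
  fixes f :: "'a::euclidean_space \<Rightarrow> complex"
  shows "smooth f \<Longrightarrow> smooth (\<lambda>x. f x ^ n)"
  by (induction n) (auto intro: smooth_mult smooth_const)

lemma dir_deriv_linear: "bounded_linear f \<Longrightarrow> dir_deriv b f = (\<lambda>_. f b)"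
  by (rule ext) (metis bounded_linear_imp_has_derivative dir_deriv_eqI)

lemma smooth_linear:
  fixes f :: "'a::euclidean_space \<Rightarrow> complex"
  assumes "bounded_linear f"
  shows "smooth f"
  by (rule smooth_alg_closure[of "{f}"])
     (auto simp: dir_deriv_linear assms intro!: alg_closure.intros bounded_linear_imp_differentiable)

lemma smooth_ident: "smooth (\<lambda>z::complex. z)"
  by (intro smooth_linear bounded_linear_ident)

lemma dir_deriv_cnj:
  assumes "v differentiable (at z)"
  shows "dir_deriv b (\<lambda>x. cnj (v x)) z = cnj (dir_deriv b v z)"
  using assms unfolding frechet_derivative_works
  by (subst dir_deriv_eqI[OF bounded_linear.has_derivative[OF bounded_linear_cnj]])
     (auto simp: dir_deriv_def)

text \<open>Conjugation is only real linear, so sums and products do not produce it. It commutes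
  with every real directional derivative, and the conjugates of smooth functions form the invariant
  set.\<close>

lemma smooth_cnj:
  assumes "smooth v"
  shows "smooth (\<lambda>x. cnj (v x))"
proof (rule smooth_coinduct[of _ "(\<lambda>v x. cnj (v x)) ` {v. smooth v}"])
  show "(\<lambda>x. cnj (v x)) \<in> (\<lambda>v x. cnj (v x)) ` {v. smooth v}" using assms by auto
  fix g and z :: 'a assume "g \<in> (\<lambda>v (x::'a). cnj (v x)) ` {v. smooth v}"
  then obtain w where w: "smooth w" "g = (\<lambda>x. cnj (w x))" by blast
  show "g differentiable (at z)"
    using smooth_has_derivative[OF w(1)] w(2) bounded_linear.has_derivative[OF bounded_linear_cnj]
    unfolding differentiable_def by blast
  fix b :: 'a assume "b \<in> Basis"
  have "dir_deriv b g = (\<lambda>x. cnj (dir_deriv b w x))"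
    using w dir_deriv_cnj smooth_differentiable by blast
  then show "dir_deriv b g \<in> (\<lambda>v x. cnj (v x)) ` {v. smooth v}"
    using smooth_dir_deriv[OF w(1) \<open>b \<in> Basis\<close>] by blast
qed

text \<open>Lets the polynomials supplied by the Stone-Weierstrass theorem serve as smooth test
  functions in the proof that gradients are closable.\<close>

lemma smooth_real_polynomial:
  fixes p :: "'a::euclidean_space \<Rightarrow> real"
  assumes "real_polynomial_function p"
  shows "smooth (\<lambda>x. complex_of_real (p x))"
  using assms
  by (induction)
     (auto intro: smooth_const smooth_add smooth_mult smooth_linear 
       bounded_linear_compose[OF bounded_linear_of_real])

section \<open>Derivatives on the line and along the unit circle\<close>

lemma dir_deriv_1_real:
  assumes "(f has_vector_derivative f') (at x)"
  shows "dir_deriv (1::real) f x = f'"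
  using dir_deriv_eqI assms unfolding has_vector_derivative_def by (metis scaleR_one)

lemma has_vector_derivative_smooth:
  "smooth f \<Longrightarrow> (f has_vector_derivative dir_deriv (1::real) f x) (at x)"
proof -
  assume "smooth f"
  then obtain f' where "(f has_derivative f') (at x)"
    using smooth_differentiable unfolding differentiable_def by blast
  moreover have "f' = (\<lambda>h. h *\<^sub>R f' 1)"
  proof
    fix h show "f' h = h *\<^sub>R f' 1"
      using linear_scale[OF has_derivative_linear[OF calculation], of h 1] by (simp only: real_scaleR_def mult_1_right)
  qed
  ultimately have "(f has_vector_derivative f' 1) (at x)"
    unfolding has_vector_derivative_def by metis
  then show ?thesis using dir_deriv_1_real by metis
qed

lemma has_derivative_complex_dirs:
  assumes "smooth (v :: complex \<Rightarrow> 'b::real_normed_vector)"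
  shows "(v has_derivative (\<lambda>h. Re h *\<^sub>R dir_deriv 1 v z + Im h *\<^sub>R dir_deriv \<i> v z)) (at z)"
proof -
  have lin: "linear (\<lambda>h. dir_deriv h v z)"
    using smooth_has_derivative[OF assms] has_derivative_linear by blast
  have "dir_deriv h v z = Re h *\<^sub>R dir_deriv 1 v z + Im h *\<^sub>R dir_deriv \<i> v z" for h
  proof -
    have "h = Re h *\<^sub>R 1 + Im h *\<^sub>R \<i>" by (simp add: complex_eq_iff)
    then have "dir_deriv h v z = dir_deriv (Re h *\<^sub>R 1 + Im h *\<^sub>R \<i>) v z" by simp
    then show ?thesis by (simp only: linear_add[OF lin] linear_scale[OF lin])
  qed
  then show ?thesis by (intro has_derivative_eq_rhs[OF smooth_has_derivative[OF assms]] ext)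
qed

lemma vector_derivative_cis_comp:
  assumes "smooth (v :: complex \<Rightarrow> complex)"
  shows "((\<lambda>t. v (cis t)) has_vector_derivative
     (cos t * dir_deriv \<i> v (cis t) - sin t * dir_deriv 1 v (cis t))) (at t)"
proof -
  have c: "(cis has_derivative (\<lambda>h. h *\<^sub>R Complex (- sin t) (cos t))) (at t)"
    using has_vector_derivative_complex_iff
    by (auto simp: has_vector_derivative_def[symmetric] has_vector_derivative_complex_iff
       simp flip: has_real_derivative_iff_has_vector_derivative intro!: derivative_eq_intros)
  show ?thesis
    using has_derivative_compose[OF c has_derivative_complex_dirs[OF assms]]
    by (auto simp: has_vector_derivative_def o_def scaleR_conv_of_real algebra_simps)
qed

text \<open>The chain rule produces \<open>cos\<close> and \<open>sin\<close> as coefficients of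
  derivatives of \<open>v\<close> along the circle, so the generators are these two together with
  all compositions of smooth functions with \<open>cis\<close>. The result makes traces of smooth
  functions admissible arguments of distributions.\<close>

lemma smooth_cis_comp:
  assumes "smooth (v :: complex \<Rightarrow> complex)"
  shows "smooth (\<lambda>t. v (cis t))"
proof -
  let ?G = "insert (\<lambda>t. complex_of_real (cos t)) (insert (\<lambda>t. complex_of_real (sin t)) {\<lambda>t. w (cis t) | w. smooth (w::complex \<Rightarrow> complex)})"
  have cos: "((\<lambda>t. complex_of_real (cos t)) has_vector_derivative - of_real (sin t)) (at t)" for t
    by (auto intro!: derivative_eq_intros simp: has_vector_derivative_complex_iff)
  have sin: "((\<lambda>t. complex_of_real (sin t)) has_vector_derivative of_real (cos t)) (at t)" for t
    by (auto intro!: derivative_eq_intros simp: has_vector_derivative_complex_iff)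
  have dcos: "dir_deriv 1 (\<lambda>t. complex_of_real (cos t)) = (\<lambda>t. - 1 * of_real (sin t))"
    using dir_deriv_1_real[OF cos] by auto
  have dsin: "dir_deriv 1 (\<lambda>t. complex_of_real (sin t)) = (\<lambda>t. of_real (cos t))"
    using dir_deriv_1_real[OF sin] by auto
  show ?thesis
  proof (rule smooth_alg_closure[of ?G])
    show "(\<lambda>t. v (cis t)) \<in> alg_closure ?G" using assms by (auto intro: alg_gen)
    fix g assume g: "g \<in> ?G"
    show "g differentiable (at z)" for z
      using g cos sin vector_derivative_cis_comp differentiableI_vector by blast
    fix b :: real assume "b \<in> Basis"
    then have b: "b = 1" by simp
    consider "g = (\<lambda>t. complex_of_real (cos t))" | "g = (\<lambda>t. complex_of_real (sin t))" 
      | w where "smooth w" "g = (\<lambda>t. w (cis t))" using g by auto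
    then show "dir_deriv b g \<in> alg_closure ?G"
    proof cases
      case 1
      show ?thesis unfolding 1 b dcos by (rule alg_mult[OF alg_const alg_gen]) simp
    next
      case 2
      show ?thesis unfolding 2 b dsin by (rule alg_gen) simp
    next
      case 3
      have eq: "dir_deriv b g = (\<lambda>t. of_real (cos t) * dir_deriv \<i> w (cis t) + (-1) * (of_real (sin t) * dir_deriv 1 w (cis t)))"
        using dir_deriv_1_real[OF vector_derivative_cis_comp[OF 3(1)]] 3 b by auto
      have s: "smooth (dir_deriv \<i> w)" "smooth (dir_deriv 1 w)"
        using 3 by (auto intro!: smooth_dir_deriv simp: Basis_complex_def)
      show ?thesis unfolding eq
        by (intro alg_add alg_mult alg_const; rule alg_gen; use s in blast)
    qed
  qed
qed

lemma test_fun_cis_comp: "smooth v \<Longrightarrow> (\<lambda>t. v (cis t)) \<in> test_fun"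
  using smooth_cis_comp[of v] by (simp add: test_fun_def cis_mult[symmetric])

section \<open>Fourier modes as test functions\<close>

lemma fmode_eq_cis: "fmode n t = cis (of_int n * t)"
  by (simp add: fmode_def cis_conv_exp mult.assoc)

lemma has_vector_derivative_fmode:
  "(fmode n has_vector_derivative \<i> * of_int n * fmode n t) (at t)"
  unfolding fmode_def[abs_def]
  by (auto intro!: derivative_eq_intros has_vector_derivative_real_field simp: algebra_simps)

lemma smooth_fmode: "smooth (fmode n)"
proof (rule smooth_alg_closure[of "{fmode n}"])
  show "g differentiable (at z)" if "g \<in> {fmode n}" for g z
    using that has_vector_derivative_fmode differentiableI_vector by blast
  show "dir_deriv b g \<in> alg_closure {fmode n}" if "g \<in> {fmode n}" "b \<in> Basis" for g and b :: real
  proof -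
    have eq: "dir_deriv b g = (\<lambda>t. \<i> * of_int n * fmode n t)"
      using that dir_deriv_1_real[OF has_vector_derivative_fmode] by auto
    show ?thesis unfolding eq by (rule alg_mult[OF alg_const alg_gen]) simp
  qed
qed (auto intro: alg_gen)

lemma fmode_periodic: "fmode n (x + 2 * pi) = fmode n x"
proof -
  have "of_int n * (x + 2 * pi) = of_int n * x + 2 * pi * of_int n" by (simp add: algebra_simps)
  moreover have "cis (of_int n * x + 2 * pi * of_int n) = cis (of_int n * x)"
    by (simp add: cis_mult[symmetric])
  ultimately show ?thesis by (simp add: fmode_eq_cis)
qed

lemma fmode_test_fun: "fmode n \<in> test_fun"
  by (simp add: test_fun_def smooth_fmode fmode_periodic)

lemma fmode_mult: "fmode n x * fmode m x = fmode (n + m) x"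
  by (simp add: fmode_eq_cis cis_mult algebra_simps)

lemma norm_fmode [simp]: "cmod (fmode n x) = 1" by (simp add: fmode_eq_cis)

lemma fmode_0 [simp]: "fmode 0 = (\<lambda>_. 1)" by (auto simp: fmode_eq_cis)

lemma cnj_fmode: "cnj (fmode n x) = fmode (- n) x"
  by (simp add: fmode_eq_cis cis_cnj)

section \<open>Square-integrable functions\<close>

text \<open>Unlike in \<open>L2_fun\<close>, vector values are allowed, so that a gradient can be
  treated as a single function with values in pairs. No equivalence classes are formed;
  \<open>L2n\<close> is only a seminorm.\<close>

definition L2s :: "'a measure \<Rightarrow> ('a \<Rightarrow> 'b::euclidean_space) set" where
  "L2s N = {h \<in> borel_measurable N. integrable N (\<lambda>x. (norm (h x))\<^sup>2)}"

definition L2n :: "'a measure \<Rightarrow> ('a \<Rightarrow> 'b::euclidean_space) \<Rightarrow> real" where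
  "L2n N h = sqrt (LINT x|N. (norm (h x))\<^sup>2)"

lemma L2_fun_eq: "L2_fun N = L2s N"
  by (simp add: L2_fun_def L2s_def)

lemma L2s_measurable: "h \<in> L2s N \<Longrightarrow> h \<in> borel_measurable N"
  by (simp add: L2s_def)

lemma L2s_integrable: "h \<in> L2s N \<Longrightarrow> integrable N (\<lambda>x. (norm (h x))\<^sup>2)"
  by (simp add: L2s_def)

lemma L2n_nonneg [simp]: "0 \<le> L2n N h" by (simp add: L2n_def)

lemma L2n_sq: "(L2n N h)\<^sup>2 = (LINT x|N. (norm (h x))\<^sup>2)"
  by (simp add: L2n_def)

lemma L2s_0 [simp]: "(\<lambda>_. 0) \<in> L2s N" by (simp add: L2s_def)

lemma L2s_bound:
  assumes "f \<in> L2s N" "g \<in> borel_measurable N" "AE x in N. norm (g x) \<le> c * norm (f x)"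
  shows "g \<in> L2s N"
proof -
  note [measurable] = assms(2) L2s_measurable[OF assms(1)]
  have "integrable N (\<lambda>x. c\<^sup>2 * (norm (f x))\<^sup>2)" using L2s_integrable[OF assms(1)] by simp
  then have "integrable N (\<lambda>x. (norm (g x))\<^sup>2)"
  proof (rule Bochner_Integration.integrable_bound)
    show "AE x in N. norm ((norm (g x))\<^sup>2) \<le> norm (c\<^sup>2 * (norm (f x))\<^sup>2)"
      using assms(3) 
    proof eventually_elim
      case (elim x)
      from power_mono[OF elim, of 2] show ?case by (simp add: power_mult_distrib)
    qed
  qed measurable
  then show ?thesis using assms(2) by (simp add: L2s_def)
qed

lemma L2n_bound:
  assumes "f \<in> L2s N" "g \<in> borel_measurable N" "AE x in N. norm (g x) \<le> c * norm (f x)" "0 \<le> c"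
  shows "L2n N g \<le> c * L2n N f"
proof -
  have "(LINT x|N. (norm (g x))\<^sup>2) \<le> (LINT x|N. c\<^sup>2 * (norm (f x))\<^sup>2)"
  proof (rule integral_mono_AE)
    show "integrable N (\<lambda>x. (norm (g x))\<^sup>2)" using L2s_bound[OF assms(1-3)] L2s_integrable by blast
    show "AE x in N. (norm (g x))\<^sup>2 \<le> c\<^sup>2 * (norm (f x))\<^sup>2"
      using assms(3) 
    proof eventually_elim
      case (elim x)
      from power_mono[OF elim, of 2] show ?case by (simp add: power_mult_distrib)
    qed
  qed (use L2s_integrable[OF assms(1)] in simp)
  then show ?thesis using assms(4)
    unfolding L2n_def by (metis integral_mult_right_zero real_sqrt_le_mono real_sqrt_mult real_sqrt_abs abs_of_nonneg)
qed

lemma L2s_scale: "f \<in> L2s N \<Longrightarrow> (\<lambda>x. c *\<^sub>R f x) \<in> L2s N"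
  by (rule L2s_bound[where c="\<bar>c\<bar>"]) (auto simp: L2s_def)

lemma L2s_add:
  assumes f: "f \<in> L2s N" and g: "g \<in> L2s N"
  shows "(\<lambda>x. f x + g x) \<in> L2s N"
proof -
  note [measurable] = L2s_measurable[OF f] L2s_measurable[OF g]
  have "integrable N (\<lambda>x. 2 * (norm (f x))\<^sup>2 + 2 * (norm (g x))\<^sup>2)"
    using L2s_integrable[OF f] L2s_integrable[OF g] by simp
  then have "integrable N (\<lambda>x. (norm (f x + g x))\<^sup>2)"
  proof (rule Bochner_Integration.integrable_bound)
    have "(norm (f x + g x))\<^sup>2 \<le> 2 * (norm (f x))\<^sup>2 + 2 * (norm (g x))\<^sup>2" for x
    proof -
      have "(norm (f x + g x))\<^sup>2 \<le> (norm (f x) + norm (g x))\<^sup>2"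
        by (simp add: norm_triangle_ineq power_mono)
      also have "\<dots> \<le> 2 * (norm (f x))\<^sup>2 + 2 * (norm (g x))\<^sup>2"
        using sum_squares_bound[of "norm (f x)" "norm (g x)"] by (simp add: power2_sum)
      finally show ?thesis .
    qed
    then show "AE x in N. norm ((norm (f x + g x))\<^sup>2) \<le> norm (2 * (norm (f x))\<^sup>2 + 2 * (norm (g x))\<^sup>2)"
      by auto
  qed measurable
  then show ?thesis by (simp add: L2s_def)
qed

lemma L2s_diff: "f \<in> L2s N \<Longrightarrow> g \<in> L2s N \<Longrightarrow> (\<lambda>x. f x - g x) \<in> L2s N"
  using L2s_add[of f N "\<lambda>x. (-1) *\<^sub>R g x"] L2s_scale[of g N "-1"] by simp

lemma L2s_cmult:
  fixes f :: "'a \<Rightarrow> complex"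
  shows "f \<in> L2s N \<Longrightarrow> (\<lambda>x. c * f x) \<in> L2s N"
  by (rule L2s_bound[where c="cmod c"]) (auto simp: L2s_def norm_mult)

lemma L2_integrable_mult:
  assumes f: "f \<in> L2s N" and g: "g \<in> L2s N"
  shows "integrable N (\<lambda>x. norm (f x) * norm (g x))"
proof -
  note [measurable] = L2s_measurable[OF f] L2s_measurable[OF g]
  have "integrable N (\<lambda>x. (norm (f x))\<^sup>2 + (norm (g x))\<^sup>2)"
    using L2s_integrable[OF f] L2s_integrable[OF g] by simp
  then show ?thesis
  proof (rule Bochner_Integration.integrable_bound)
    have "norm (f x) * norm (g x) \<le> (norm (f x))\<^sup>2 + (norm (g x))\<^sup>2" for x
    proof -
      have "2 * (norm (f x) * norm (g x)) \<le> (norm (f x))\<^sup>2 + (norm (g x))\<^sup>2"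
        using sum_squares_bound[of "norm (f x)" "norm (g x)"] by (simp add: mult.assoc)
      moreover have "0 \<le> norm (f x) * norm (g x)" by simp
      ultimately show ?thesis by linarith
    qed
    then show "AE x in N. norm (norm (f x) * norm (g x)) \<le> norm ((norm (f x))\<^sup>2 + (norm (g x))\<^sup>2)"
      by auto
  qed measurable
qed

lemma L2_Cauchy_Schwarz:
  assumes f: "f \<in> L2s N" and g: "g \<in> L2s N"
  shows "(LINT x|N. norm (f x) * norm (g x)) \<le> L2n N f * L2n N g"
proof -
  define I where "I = (LINT x|N. norm (f x) * norm (g x))"
  define F where "F = (L2n N f)\<^sup>2"
  define G where "G = (L2n N g)\<^sup>2"
  have I0: "I \<ge> 0" unfolding I_def by (intro integral_nonneg_AE) auto
  have quad: "0 \<le> t\<^sup>2 * F - 2 * t * I + G" for t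
  proof -
    have "0 \<le> (LINT x|N. (t * norm (f x) - norm (g x))\<^sup>2)"
      by (intro integral_nonneg_AE) auto
    also have "(LINT x|N. (t * norm (f x) - norm (g x))\<^sup>2) = 
      (LINT x|N. t\<^sup>2 * (norm (f x))\<^sup>2 - 2 * t * (norm (f x) * norm (g x)) + (norm (g x))\<^sup>2)"
      by (intro Bochner_Integration.integral_cong) (auto simp: power2_eq_square algebra_simps)
    also have "\<dots> = t\<^sup>2 * F - 2 * t * I + G"
      using L2s_integrable[OF f] L2s_integrable[OF g] L2_integrable_mult[OF f g]
      by (simp add: F_def G_def I_def L2n_sq)
    finally show ?thesis .
  qed
  have "I\<^sup>2 \<le> F * G"
  proof (cases "F = 0")
    case True
    have "I = 0"
    proof (rule ccontr)
      assume "I \<noteq> 0"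
      \<comment> \<open>For F = 0 the quadratic is affine in t, and this t gives it the value
        -1.\<close>
      then show False using quad[of "(G + 1) / (2 * I)"] True by simp
    qed
    then show ?thesis using True by simp
  next
    case False
    then have "F > 0" by (simp add: F_def)
    \<comment> \<open>The minimizer of the quadratic.\<close>
    then show ?thesis using quad[of "I / F"] by (simp add: power2_eq_square divide_simps mult.commute split: if_splits)
  qed
  then have "I\<^sup>2 \<le> (L2n N f * L2n N g)\<^sup>2" by (simp add: F_def G_def power_mult_distrib)
  then show ?thesis unfolding I_def[symmetric] by (rule power2_le_imp_le) simp
qed

lemma L2n_triangle:
  assumes f: "f \<in> L2s N" and g: "g \<in> L2s N"
  shows "L2n N (\<lambda>x. f x + g x) \<le> L2n N f + L2n N g"
proof -
  have "(L2n N (\<lambda>x. f x + g x))\<^sup>2 \<le> (LINT x|N. (norm (f x))\<^sup>2 + 2 * (norm (f x) * norm (g x)) + (norm (g x))\<^sup>2)"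
    unfolding L2n_sq
  proof (rule integral_mono)
    show "integrable N (\<lambda>x. (norm (f x + g x))\<^sup>2)" using L2s_integrable[OF L2s_add[OF f g]] .
    show "integrable N (\<lambda>x. (norm (f x))\<^sup>2 + 2 * (norm (f x) * norm (g x)) + (norm (g x))\<^sup>2)"
      using L2s_integrable[OF f] L2s_integrable[OF g] L2_integrable_mult[OF f g] by simp
    show "(norm (f x + g x))\<^sup>2 \<le> (norm (f x))\<^sup>2 + 2 * (norm (f x) * norm (g x)) + (norm (g x))\<^sup>2" for x
      using power_mono[OF norm_triangle_ineq[of "f x" "g x"], of 2] by (simp add: power2_sum)
  qed
  also have "\<dots> = (L2n N f)\<^sup>2 + 2 * (LINT x|N. norm (f x) * norm (g x)) + (L2n N g)\<^sup>2"
    using L2s_integrable[OF f] L2s_integrable[OF g] L2_integrable_mult[OF f g] by (simp add: L2n_sq)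
  also have "\<dots> \<le> (L2n N f + L2n N g)\<^sup>2"
    using L2_Cauchy_Schwarz[OF f g] by (simp add: power2_sum)
  finally show ?thesis by (rule power2_le_imp_le) simp
qed

lemma L2n_scale: "L2n N (\<lambda>x. c *\<^sub>R f x) = \<bar>c\<bar> * L2n N f"
  by (simp add: L2n_def power_mult_distrib real_sqrt_mult)

lemma L2n_cmult:
  fixes f :: "'a \<Rightarrow> complex"
  shows "L2n N (\<lambda>x. c * f x) = cmod c * L2n N f"
  by (simp add: L2n_def norm_mult power_mult_distrib real_sqrt_mult)

lemma L2n_minus_commute: "L2n N (\<lambda>x. f x - g x) = L2n N (\<lambda>x. g x - f x)"
  by (simp add: L2n_def norm_minus_commute)

lemma L2n_triangle_diff:
  assumes f: "f \<in> L2s N" and g: "g \<in> L2s N" and h: "h \<in> L2s N"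
  shows "L2n N (\<lambda>x. f x - h x) \<le> L2n N (\<lambda>x. f x - g x) + L2n N (\<lambda>x. g x - h x)"
  using L2n_triangle[OF L2s_diff[OF f g] L2s_diff[OF g h]] by simp

lemma L2n_diff_le:
  assumes f: "f \<in> L2s N" and g: "g \<in> L2s N"
  shows "L2n N (\<lambda>x. f x - g x) \<le> L2n N f + L2n N g"
  using L2n_triangle[OF f L2s_scale[OF g, of "-1"]] L2n_scale[of N "-1" g] by simp

lemma L2n_le_add_diff:
  assumes f: "f \<in> L2s N" and g: "g \<in> L2s N"
  shows "L2n N f \<le> L2n N (\<lambda>x. f x - g x) + L2n N g"
  using L2n_triangle[OF L2s_diff[OF f g] g] by simp

lemma L2n_eq_0_iff: "f \<in> L2s N \<Longrightarrow> L2n N f = 0 \<longleftrightarrow> (AE x in N. f x = 0)"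
  by (subst L2n_def) (auto simp: L2s_def integral_nonneg_eq_0_iff_AE)

text \<open>A subsequence with \<open>\<parallel>v (r (k+1)) - v (r k)\<parallel> \<le> 2\<^sup>-\<^sup>k\<close> has \<open>\<Sum>k. 2\<^sup>k |v (r (k+1)) - v (r k)|\<^sup>2\<close>
  integrable, so it converges almost everywhere; Fatou's lemma turns this into convergence in the
  mean square.\<close>

lemma L2_complete:
  fixes v :: "nat \<Rightarrow> 'a \<Rightarrow> 'b::euclidean_space"
  assumes v: "\<And>k. v k \<in> L2s N"
    and cauchy: "\<And>e. e > 0 \<Longrightarrow> \<exists>K. \<forall>j\<ge>K. \<forall>k\<ge>K. L2n N (\<lambda>x. v j x - v k x) < e"
  shows "\<exists>h\<in>L2s N. (\<lambda>k. L2n N (\<lambda>x. v k x - h x)) \<longlonglongrightarrow> 0"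
proof -
  note [measurable] = L2s_measurable[OF v]
  obtain K where K: "\<And>e j k. e > 0 \<Longrightarrow> j \<ge> K e \<Longrightarrow> k \<ge> K e \<Longrightarrow> L2n N (\<lambda>x. v j x - v k x) < e"
    using cauchy by metis
  \<comment> \<open>The maximum with \<open>Suc p\<close> makes \<open>r\<close> strictly
    increasing, while the second entry puts \<open>r k\<close> beyond the index from which distances
    are below 2 to the power -k.\<close>
  define r where "r = rec_nat (K 1) (\<lambda>k p. max (Suc p) (K ((1/2) ^ Suc k)))"
  have r0: "r 0 = K 1" and rS: "r (Suc k) = max (Suc (r k)) (K ((1/2) ^ Suc k))" for k
    by (simp_all add: r_def)
  have rK: "r k \<ge> K ((1/2) ^ k)" for k by (cases k) (simp_all add: r0 rS)
  have rm: "r k \<le> r (Suc k)" for k by (simp add: rS)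
  have mono: "strict_mono r" by (rule strict_monoI_Suc) (simp add: rS)
  have step: "L2n N (\<lambda>x. v (r (Suc k)) x - v (r k) x) < (1/2) ^ k" for k
    by (rule K) (use rK[of k] rm[of k] in auto)
  define d where "d k x = norm (v (r (Suc k)) x - v (r k) x)" for k x
  have [measurable]: "d k \<in> borel_measurable N" for k unfolding d_def by measurable
  have int_d: "(\<integral>\<^sup>+x. ennreal ((d k x)\<^sup>2) \<partial>N) \<le> ennreal (((1/2) ^ k)\<^sup>2)" for k
  proof -
    have "(\<integral>\<^sup>+x. ennreal ((d k x)\<^sup>2) \<partial>N) = ennreal ((L2n N (\<lambda>x. v (r (Suc k)) x - v (r k) x))\<^sup>2)"
      unfolding L2n_sq d_def using L2s_integrable[OF L2s_diff[OF v v]]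
      by (intro nn_integral_eq_integral) auto
    also have "\<dots> \<le> ennreal (((1/2) ^ k)\<^sup>2)"
      using step[of k] by (intro ennreal_leI power_mono) auto
    finally show ?thesis .
  qed
  have "(\<integral>\<^sup>+x. (\<Sum>k. ennreal (2 ^ k * (d k x)\<^sup>2)) \<partial>N) = (\<Sum>k. \<integral>\<^sup>+x. ennreal (2 ^ k * (d k x)\<^sup>2) \<partial>N)"
    by (rule nn_integral_suminf) measurable
  also have "\<dots> \<le> (\<Sum>k. ennreal ((1/2) ^ k))"
  proof (rule suminf_le)
    fix k
    have "(\<integral>\<^sup>+x. ennreal (2 ^ k * (d k x)\<^sup>2) \<partial>N) = ennreal (2 ^ k) * (\<integral>\<^sup>+x. ennreal ((d k x)\<^sup>2) \<partial>N)"
      by (simp add: ennreal_mult nn_integral_cmult)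
    also have "\<dots> \<le> ennreal (2 ^ k) * ennreal (((1/2) ^ k)\<^sup>2)"
      by (intro mult_left_mono int_d) simp
    also have "\<dots> = ennreal ((1/2) ^ k)"
      by (simp add: ennreal_mult[symmetric] power2_eq_square power_one_over divide_simps)
    finally show "(\<integral>\<^sup>+x. ennreal (2 ^ k * (d k x)\<^sup>2) \<partial>N) \<le> ennreal ((1/2) ^ k)" .
  qed auto
  also have "\<dots> < \<infinity>"
    by (subst suminf_ennreal2) (auto simp: summable_geometric)
  finally have fin: "(\<integral>\<^sup>+x. (\<Sum>k. ennreal (2 ^ k * (d k x)\<^sup>2)) \<partial>N) \<noteq> \<infinity>" by simp
  have "AE x in N. (\<Sum>k. ennreal (2 ^ k * (d k x)\<^sup>2)) \<noteq> \<infinity>"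
    by (rule nn_integral_PInf_AE[OF _ fin]) measurable
  then have conv: "AE x in N. convergent (\<lambda>k. v (r k) x)"
  proof eventually_elim
    case (elim x)
    have sm: "summable (\<lambda>k. 2 ^ k * (d k x)\<^sup>2)"
      by (rule summable_suminf_not_top) (use elim in auto)
    define C where "C = (\<Sum>k. 2 ^ k * (d k x)\<^sup>2)"
    have C0: "C \<ge> 0" unfolding C_def by (rule suminf_nonneg[OF sm]) auto
    \<comment> \<open>The weight 2 to the power k pays off here: each summand is at most the finite
      sum \<open>C\<close>, so \<open>d k x\<close> is dominated by a geometric sequence with ratio
      \<open>sqrt (1/2)\<close>.\<close>
    have dk: "d k x \<le> sqrt C * (sqrt (1/2)) ^ k" for k
    proof -
      have "2 ^ k * (d k x)\<^sup>2 \<le> C"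
        unfolding C_def using sum_le_suminf[OF sm, of "{k}"] by auto
      then have "(d k x)\<^sup>2 \<le> C * (1/2) ^ k" by (simp add: power_one_over field_simps)
      then have "sqrt ((d k x)\<^sup>2) \<le> sqrt (C * (1/2) ^ k)" by (rule real_sqrt_le_mono)
      then show ?thesis by (simp add: d_def real_sqrt_mult real_sqrt_power)
    qed
    have "summable (\<lambda>k. sqrt C * (sqrt (1/2)) ^ k)"
      by (intro summable_mult summable_geometric) (simp add: real_sqrt_lt_1_iff)
    then have "summable (\<lambda>k. v (r (Suc k)) x - v (r k) x)"
      by (rule summable_comparison_test') (use dk in \<open>auto simp: d_def\<close>)
    then have "convergent (\<lambda>n. v (r n) x - v (r 0) x)"
      unfolding summable_iff_convergent by (subst (asm) sum_lessThan_telescope)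
    from convergent_add[OF this convergent_const[of "v (r 0) x"]] show ?case by simp
  qed
  define h where "h x = lim (\<lambda>k. v (r k) x)" for x
  have [measurable]: "h \<in> borel_measurable N" unfolding h_def by (rule borel_measurable_lim_metric) measurable
  have lim: "AE x in N. (\<lambda>k. v (r k) x) \<longlonglongrightarrow> h x"
    using conv unfolding h_def by eventually_elim (simp add: convergent_LIMSEQ_iff)
  \<comment> \<open>The index j stays fixed while k runs along the subsequence, so the estimate
    concerns the full sequence and not just the subsequence.\<close>
  have fatou: "(\<integral>\<^sup>+x. ennreal ((norm (v j x - h x))\<^sup>2) \<partial>N) \<le> ennreal (e\<^sup>2)" if "e > 0" "j \<ge> K e" for e j
  proof -
    have "(\<integral>\<^sup>+x. ennreal ((norm (v j x - h x))\<^sup>2) \<partial>N) 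
        = (\<integral>\<^sup>+x. liminf (\<lambda>k. ennreal ((norm (v j x - v (r k) x))\<^sup>2)) \<partial>N)"
    proof (rule nn_integral_cong_AE, use lim in eventually_elim)
      fix x assume "(\<lambda>k. v (r k) x) \<longlonglongrightarrow> h x"
      then have "(\<lambda>k. ennreal ((norm (v j x - v (r k) x))\<^sup>2)) \<longlonglongrightarrow> ennreal ((norm (v j x - h x))\<^sup>2)"
        by (intro tendsto_ennrealI tendsto_intros)
      then show "ennreal ((norm (v j x - h x))\<^sup>2) = liminf (\<lambda>k. ennreal ((norm (v j x - v (r k) x))\<^sup>2))"
        by (rule lim_imp_Liminf[OF sequentially_bot, symmetric])
    qed
    also have "\<dots> \<le> liminf (\<lambda>k. \<integral>\<^sup>+x. ennreal ((norm (v j x - v (r k) x))\<^sup>2) \<partial>N)"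
      by (rule nn_integral_liminf) measurable
    also have "\<dots> \<le> ennreal (e\<^sup>2)"
    proof (rule order_trans[OF Liminf_mono[of _ "\<lambda>_. ennreal (e\<^sup>2)"]])
      have "\<forall>\<^sub>F k in sequentially. r k \<ge> K e"
        using filterlim_subseq[OF mono] by (simp add: filterlim_at_top)
      then show "\<forall>\<^sub>F k in sequentially. (\<integral>\<^sup>+x. ennreal ((norm (v j x - v (r k) x))\<^sup>2) \<partial>N) \<le> ennreal (e\<^sup>2)"
      proof eventually_elim
        case (elim k)
        have "(\<integral>\<^sup>+x. ennreal ((norm (v j x - v (r k) x))\<^sup>2) \<partial>N) = ennreal ((L2n N (\<lambda>x. v j x - v (r k) x))\<^sup>2)"
          unfolding L2n_sq using L2s_integrable[OF L2s_diff[OF v v]]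
          by (intro nn_integral_eq_integral) auto
        also have "\<dots> \<le> ennreal (e\<^sup>2)"
          using K[OF that elim] by (intro ennreal_leI power_mono) auto
        finally show ?case .
      qed
    qed (simp add: Liminf_const)
    finally show ?thesis .
  qed
  have int: "integrable N (\<lambda>x. (norm (v j x - h x))\<^sup>2)" and 
    le: "L2n N (\<lambda>x. v j x - h x) \<le> e" if "e > 0" "j \<ge> K e" for e j
  proof -
    have "(\<integral>\<^sup>+x. ennreal ((norm (v j x - h x))\<^sup>2) \<partial>N) < \<infinity>"
      using fatou[OF that] by (simp add: order_le_less_trans)
    then show i: "integrable N (\<lambda>x. (norm (v j x - h x))\<^sup>2)"
      by (intro integrableI_bounded) auto
    have "ennreal ((L2n N (\<lambda>x. v j x - h x))\<^sup>2) \<le> ennreal (e\<^sup>2)"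
      unfolding L2n_sq using fatou[OF that] nn_integral_eq_integral[OF i] by simp
    then have "(L2n N (\<lambda>x. v j x - h x))\<^sup>2 \<le> e\<^sup>2" by (subst (asm) ennreal_le_iff) auto
    then show "L2n N (\<lambda>x. v j x - h x) \<le> e" by (rule power2_le_imp_le) (use that in simp)
  qed
  have "(\<lambda>x. v (K 1) x - h x) \<in> L2s N" using int[of 1 "K 1"] by (simp add: L2s_def)
  from L2s_diff[OF v[of "K 1"] this] have "h \<in> L2s N" by simp
  moreover have "(\<lambda>k. L2n N (\<lambda>x. v k x - h x)) \<longlonglongrightarrow> 0"
  proof (rule LIMSEQ_I)
    fix e :: real assume "e > 0"
    then have "norm (L2n N (\<lambda>x. v k x - h x) - 0) < e" if "k \<ge> K (e/2)" for k
      using le[of "e/2" k] that by simp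
    then show "\<exists>K. \<forall>k\<ge>K. norm (L2n N (\<lambda>x. v k x - h x) - 0) < e" by blast
  qed
  ultimately show ?thesis by blast
qed

lemma L2_conv_iff:
  "L2_conv N v h \<longleftrightarrow> h \<in> L2s N \<and> (\<forall>k. v k \<in> L2s N) \<and> (\<lambda>k. L2n N (\<lambda>x. v k x - h x)) \<longlonglongrightarrow> 0"
proof -
  have "(\<lambda>k. L2n N (\<lambda>x. v k x - h x)) \<longlonglongrightarrow> 0 \<longleftrightarrow> (\<lambda>k. (L2n N (\<lambda>x. v k x - h x))\<^sup>2) \<longlonglongrightarrow> 0"
    using tendsto_real_sqrt[of "\<lambda>k. (L2n N (\<lambda>x. v k x - h x))\<^sup>2" 0 sequentially] tendsto_power[of _ 0 sequentially 2] 
    by fastforce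
  then show ?thesis by (simp add: L2_conv_def L2_fun_eq L2n_sq)
qed

lemma L2n_tendsto:
  assumes "h \<in> L2s N" "\<And>k. v k \<in> L2s N" "(\<lambda>k. L2n N (\<lambda>x. v k x - h x)) \<longlonglongrightarrow> 0"
  shows "(\<lambda>k. L2n N (v k)) \<longlonglongrightarrow> L2n N h"
proof (rule LIM_zero_cancel, rule Lim_null_comparison[OF _ assms(3)], rule always_eventually, rule allI)
  fix k show "norm (L2n N (v k) - L2n N h) \<le> L2n N (\<lambda>x. v k x - h x)"
    using L2n_le_add_diff[OF assms(2)[of k] assms(1)] L2n_le_add_diff[OF assms(1) assms(2)[of k]] L2n_minus_commute[of N "v k" h]
    by (simp add: abs_le_iff)
qed

section \<open>Fourier series on the circle\<close>

abbreviation circ :: "real measure" where "circ \<equiv> lebesgue_on {-pi..pi}"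

definition fc :: "(real \<Rightarrow> complex) \<Rightarrow> int \<Rightarrow> complex" where
  "fc h n = (LINT x|circ. h x * fmode (- n) x) / (2 * pi)"

lemma LINT_norm_bound:
  fixes f :: "'a \<Rightarrow> 'b::{banach,second_countable_topology}"
  assumes "integrable M g" "AE x in M. norm (f x) \<le> g x"
  shows "norm (LINT x|M. f x) \<le> (LINT x|M. g x)"
proof -
  have "norm (LINT x|M. f x) \<le> (LINT x|M. norm (f x))" by simp
  also have "\<dots> \<le> (LINT x|M. g x)"
    using assms(2) by (intro integral_mono_AE' assms) (auto elim!: eventually_mono intro: order_trans[OF norm_ge_zero])
  finally show ?thesis .
qed

lemma fcoeff_dist_of: "fcoeff (dist_of h) n = fc h n"
  by (simp add: fcoeff_def dist_of_def fmode_test_fun fc_def)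

lemma test_fun_smooth: "\<psi> \<in> test_fun \<Longrightarrow> smooth \<psi>" by (simp add: test_fun_def)

lemma continuous_fmode: "continuous_on S (fmode n)"
  by (rule smooth_continuous[OF smooth_fmode])

lemma integrable_circ_mult:
  assumes "integrable circ h" "continuous_on {-pi..pi} g"
  shows "integrable circ (\<lambda>x. h x * g x :: complex)"
proof -
  obtain B where "\<forall>y\<in>g ` {-pi..pi}. cmod y \<le> B"
    using compact_imp_bounded[OF compact_continuous_image[OF assms(2) compact_Icc]]
    unfolding bounded_iff by blast
  then have B: "\<And>x. x \<in> {-pi..pi} \<Longrightarrow> cmod (g x) \<le> B" by blast
  have "g \<in> borel_measurable circ"
    by (rule continuous_imp_measurable_on_sets_lebesgue[OF assms(2)]) simp
  then show ?thesis
    using assms(1) B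
    by (intro Bochner_Integration.integrable_bound[where f="\<lambda>x. B *\<^sub>R norm (h x)" and g="\<lambda>x. h x * g x"])
       (auto intro!: borel_measurable_times integrable_mult_right integrable_norm AE_I2 mult_right_mono
         simp: space_restrict_space norm_mult mult.commute[of "cmod (h _)"] intro: order_trans[OF _ abs_ge_self])
qed

lemma LINT_circ_fmode: "(LINT x|circ. fmode n x) = (if n = 0 then 2 * pi else 0)"
proof (cases "n = 0")
  case True
  have "measure circ (space circ) = 2 * pi"
    by (simp add: measure_restrict_space space_restrict_space)
  then show ?thesis using True by (simp add: measure_restrict_space space_restrict_space scaleR_conv_of_real)
next
  case False
  have "((\<lambda>x. fmode n x) has_integral fmode n pi / (\<i> * n) - fmode n (-pi) / (\<i> * n)) {-pi..pi}"
  proof (rule fundamental_theorem_of_calculus)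
    fix x assume "x \<in> {-pi..pi}"
    have "((\<lambda>x. fmode n x / (\<i> * n)) has_vector_derivative \<i> * n * fmode n x / (\<i> * n)) (at x within {-pi..pi})"
      by (rule has_vector_derivative_at_within[OF has_vector_derivative_divide[OF has_vector_derivative_fmode]])
    then show "((\<lambda>x. fmode n x / (\<i> * n)) has_vector_derivative fmode n x) (at x within {-pi..pi})"
      using False by simp
  qed simp
  moreover have "fmode n pi = fmode n (- pi)" using fmode_periodic[of n "-pi"] by simp
  ultimately have "integral {-pi..pi} (fmode n) = 0" by (simp add: integral_unique)
  then show ?thesis using False
    by (subst lebesgue_integral_eq_integral) (auto intro!: continuous_imp_integrable_real continuous_fmode)
qed

lemma LINT_circ_fmode_mult: "(LINT x|circ. fmode n x * fmode m x) = (if n + m = 0 then 2 * pi else 0)"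
  by (simp add: fmode_mult LINT_circ_fmode)

lemma fc_fmode: "fc (fmode n) m = (if n = m then 1 else 0)"
  by (simp add: fc_def LINT_circ_fmode_mult)

lemma periodic_int:
  fixes h :: "real \<Rightarrow> 'b"
  assumes "\<And>x. h (x + 2 * pi) = h x"
  shows "h (x + 2 * pi * of_int k) = h x"
proof (induction k rule: int_induct[of _ 0])
  case (step1 i)
  then show ?case using assms[of "x + 2 * pi * of_int i"] by (simp add: algebra_simps)
next
  case (step2 i)
  then show ?case using assms[of "x + 2 * pi * of_int (i - 1)"] by (simp add: algebra_simps)
qed simp

lemma periodic_cis:
  fixes h :: "real \<Rightarrow> 'b"
  assumes "\<And>x. h (x + 2 * pi) = h x" "cis x = cis y"
  shows "h x = h y"
proof -
  have "sin x = sin y \<and> cos x = cos y" using assms(2) by (simp add: complex_eq_iff)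
  then obtain n :: int where "x = y + 2 * pi * n" using sin_cos_eq_iff by blast
  then show ?thesis using periodic_int[of h, OF assms(1)] by simp
qed

text \<open>\<open>Arg (cis x)\<close> is the representative of x in (-pi, pi], which carries bounds
  and zeros from one period to the whole line.\<close>

lemma periodic_Arg:
  fixes h :: "real \<Rightarrow> 'b"
  assumes "\<And>x. h (x + 2 * pi) = h x"
  shows "h (Arg (cis x)) = h x"
  by (rule periodic_cis[of h], rule assms) (simp add: cis_Arg sgn_div_norm)

lemma periodic_bounded:
  fixes h :: "real \<Rightarrow> complex"
  assumes "\<And>x. h (x + 2 * pi) = h x" "continuous_on UNIV h"
  obtains B where "\<And>x. cmod (h x) \<le> B"
proof -
  obtain B where B: "\<And>x. x \<in> {-pi..pi} \<Longrightarrow> cmod (h x) \<le> B"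
    using compact_imp_bounded[OF compact_continuous_image[OF continuous_on_subset[OF assms(2)] compact_Icc]]
    unfolding bounded_iff by (metis image_eqI subset_UNIV)
  have "cmod (h x) \<le> B" for x
    using B[of "Arg (cis x)"] periodic_Arg[of h, OF assms(1), of x] Arg_bounded[of "cis x"] by auto
  then show thesis using that by blast
qed

section \<open>Trigonometric polynomials and uniqueness of Fourier coefficients\<close>

inductive_set trig :: "(real \<Rightarrow> complex) set" where
  trig_base: "(\<lambda>x. c * fmode n x) \<in> trig"
| trig_add: "f \<in> trig \<Longrightarrow> g \<in> trig \<Longrightarrow> (\<lambda>x. f x + g x) \<in> trig"

lemma trig_cmult: "f \<in> trig \<Longrightarrow> (\<lambda>x. c * f x) \<in> trig"
proof (induction rule: trig.induct)
  case (trig_base d n)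
  show ?case using trig.trig_base[of "c * d" n] by (simp add: mult.assoc)
next
  case (trig_add f g)
  then show ?case by (auto simp: distrib_left intro: trig.trig_add)
qed

lemma trig_const: "(\<lambda>x. c) \<in> trig"
  using trig_base[of c 0] by simp

lemma trig_mult:
  assumes "f \<in> trig" "g \<in> trig" shows "(\<lambda>x. f x * g x) \<in> trig"
  using assms(1)
proof (induction rule: trig.induct)
  case (trig_base c n)
  show ?case using assms(2)
  proof (induction rule: trig.induct)
    case (trig_base d m)
    have "(\<lambda>x. c * fmode n x * (d * fmode m x)) = (\<lambda>x. c * d * fmode (n + m) x)"
      by (auto simp: fmode_mult[symmetric])
    then show ?case using trig.trig_base by simp
  next
    case (trig_add f g)
    then show ?case by (auto simp: distrib_left intro: trig.trig_add)
  qed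
next
  case (trig_add f g)
  then show ?case by (auto simp: distrib_right intro: trig.trig_add)
qed

text \<open>A real linear functional on the plane is a combination of z and its conjugate, that is,
  of the modes 1 and -1 on the circle. Polynomials in two real variables thus restrict to
  trigonometric polynomials.\<close>

lemma trig_linear_cis:
  assumes "bounded_linear (l :: complex \<Rightarrow> real)"
  shows "(\<lambda>x. complex_of_real (l (cis x))) \<in> trig"
proof -
  have lin: "linear l" using assms bounded_linear.linear by blast
  have "(\<lambda>x. complex_of_real (l (cis x))) =
    (\<lambda>x. ((l 1 - \<i> * l \<i>) / 2) * fmode 1 x + ((l 1 + \<i> * l \<i>) / 2) * fmode (-1) x)"
  proof
    fix x
    have "cis x = cos x *\<^sub>R 1 + sin x *\<^sub>R \<i>" by (simp add: complex_eq_iff)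
    then have "l (cis x) = cos x * l 1 + sin x * l \<i>"
      by (simp only: linear_add[OF lin] linear_scale[OF lin] real_scaleR_def)
    then show "complex_of_real (l (cis x)) =
      ((l 1 - \<i> * l \<i>) / 2) * fmode 1 x + ((l 1 + \<i> * l \<i>) / 2) * fmode (-1) x"
      by (simp add: fmode_eq_cis complex_eq_iff field_simps)
  qed
  then show ?thesis by (simp only: trig_add trig_base)
qed

lemma trig_real_polynomial:
  assumes "real_polynomial_function (p :: complex \<Rightarrow> real)"
  shows "(\<lambda>x. complex_of_real (p (cis x))) \<in> trig"
  using assms
  by (induction) (auto intro: trig_linear_cis trig_const trig_add trig_mult)

lemma trig_polynomial:
  assumes "polynomial_function (p :: complex \<Rightarrow> complex)"
  shows "(\<lambda>x. p (cis x)) \<in> trig"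
proof -
  have "real_polynomial_function (Re \<circ> p)" "real_polynomial_function (Im \<circ> p)"
    using assms bounded_linear_Re bounded_linear_Im unfolding polynomial_function_def by auto
  from this[THEN trig_real_polynomial]
  have "(\<lambda>x. complex_of_real (Re (p (cis x))) + \<i> * complex_of_real (Im (p (cis x)))) \<in> trig"
    by (auto intro: trig_add trig_cmult)
  moreover have "complex_of_real (Re (p (cis x))) + \<i> * complex_of_real (Im (p (cis x))) = p (cis x)" for x
    using complex_eq[of "p (cis x)"] by simp
  ultimately show ?thesis by simp
qed

text \<open>The function is moved to the circle, where the Stone-Weierstrass theorem for polynomials
  in the plane applies, and the polynomial is pulled back by \<open>cis\<close>. Only the continuity
  of \<open>H\<close> across the branch cut of \<open>Arg\<close> needs care.\<close>

lemma trig_dense: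
  fixes h :: "real \<Rightarrow> complex"
  assumes h: "\<And>x. h (x + 2 * pi) = h x" "continuous_on UNIV h" and e: "e > 0"
  shows "\<exists>p\<in>trig. \<forall>x. cmod (h x - p x) < e"
proof -
  define H where "H z = h (Arg z)" for z
  have cont1: "continuous (at z) (\<lambda>z. h (Arg z))" if "z \<notin> \<real>\<^sub>\<le>\<^sub>0" for z
    using continuous_at_Arg[OF that] h(2)
    by (intro continuous_at_compose[unfolded o_def, of z Arg h]) (auto simp: continuous_on_eq_continuous_at)
  \<comment> \<open>Near the cut, \<open>Arg (- z) + pi\<close> is a continuous choice of the angle;
    periodicity makes the choice invisible to \<open>h\<close>.\<close>
  have eq: "h (Arg (- z) + pi) = h (Arg z)" if "z \<noteq> 0" for z
  proof (rule periodic_cis[of h, OF h(1)])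
    show "cis (Arg (- z) + pi) = cis (Arg z)"
      using that by (simp add: cis_mult[symmetric] cis_Arg sgn_minus)
  qed
  have "continuous_on (sphere 0 1) H"
  proof (rule continuous_at_imp_continuous_on, rule ballI)
    fix z :: complex assume "z \<in> sphere 0 1"
    then have z0: "z \<noteq> 0" by auto
    show "isCont H z"
    proof (cases "z \<in> \<real>\<^sub>\<le>\<^sub>0")
      case False
      then show ?thesis unfolding H_def using cont1 by blast
    next
      case True
      then have "- z \<notin> \<real>\<^sub>\<le>\<^sub>0" using z0 by (auto simp: complex_nonpos_Reals_iff complex_eq_iff)
      have c: "isCont (\<lambda>z. Arg (- z)) z"
        by (rule continuous_at_compose[unfolded o_def, of z uminus Arg], intro continuous_intros)
           (rule continuous_at_Arg[OF \<open>- z \<notin> \<real>\<^sub>\<le>\<^sub>0\<close>])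
      have cc: "isCont (\<lambda>z. h (Arg (- z) + pi)) z"
        by (rule continuous_at_compose[unfolded o_def, of z "\<lambda>z. Arg (- z) + pi" h])
           (use c h(2) in \<open>auto intro: continuous_intros simp: continuous_on_eq_continuous_at\<close>)
      have ev: "\<forall>\<^sub>F w in nhds z. H w = h (Arg (- w) + pi)"
        using t1_space_nhds[OF z0] by eventually_elim (simp add: H_def eq)
      show ?thesis by (rule iffD2[OF isCont_cong[OF ev] cc])
    qed
  qed
  from Stone_Weierstrass_polynomial_function[OF compact_sphere this e]
  obtain p where p: "polynomial_function p" "\<forall>z\<in>sphere 0 1. cmod (H z - p z) < e"
    by blast
  show ?thesis
  proof (rule bexI[of _ "\<lambda>x. p (cis x)"], rule allI)
    fix x show "cmod (h x - p (cis x)) < e"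
      using bspec[OF p(2), of "cis x"] periodic_Arg[of h, OF h(1), of x] by (simp add: H_def)
  qed (rule trig_polynomial[OF p(1)])
qed

lemma integrable_circ_continuous: "continuous_on UNIV (h :: real \<Rightarrow> 'b::euclidean_space) \<Longrightarrow> integrable circ h"
  by (rule continuous_imp_integrable_real) (rule continuous_on_subset, auto)

lemma continuous_trig: "f \<in> trig \<Longrightarrow> continuous_on S f"
  by (induction rule: trig.induct) (auto intro!: continuous_intros continuous_fmode)

text \<open>Vanishing coefficients make \<open>h\<close> orthogonal to all trigonometric
  polynomials, hence to the conjugate of \<open>h\<close>, which they approximate uniformly. So the
  integral of |h|^2 is zero, and continuity makes \<open>h\<close> vanish everywhere.\<close>

lemma fc_eq_0_imp:
  fixes h :: "real \<Rightarrow> complex"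
  assumes h: "\<And>x. h (x + 2 * pi) = h x" "continuous_on UNIV h" and fc: "\<And>n. fc h n = 0"
  shows "h x = 0"
proof -
  have ih: "integrable circ h" by (rule integrable_circ_continuous[OF h(2)])
  have trig0: "(LINT x|circ. h x * p x) = 0" if "p \<in> trig" for p
    using that
  proof (induction rule: trig.induct)
    case (trig_base c n)
    have "(LINT x|circ. h x * (c * fmode n x)) = (LINT x|circ. c * (h x * fmode (- (- n)) x))"
      by (simp add: algebra_simps)
    also have "\<dots> = c * (LINT x|circ. h x * fmode (- (- n)) x)" by simp
    also have "(LINT x|circ. h x * fmode (- (- n)) x) = 2 * pi * fc h (- n)" by (simp add: fc_def)
    finally show ?case using fc by simp
  next
    case (trig_add f g)
    then show ?case
      using integrable_circ_mult[OF ih continuous_trig, of f] integrable_circ_mult[OF ih continuous_trig, of g]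
      by (simp add: distrib_left)
  qed
  have c: "continuous_on UNIV (\<lambda>x. cnj (h x))" by (intro continuous_intros h)
  define A where "A = (LINT x|circ. cmod (h x))"
  have "cmod (LINT x|circ. h x * cnj (h x)) \<le> e * A" if e: "e > 0" for e
  proof -
    obtain p where p: "p \<in> trig" "\<And>x. cmod (cnj (h x) - p x) < e"
      using trig_dense[of "\<lambda>x. cnj (h x)", OF _ c e] h(1) by auto
    have "(LINT x|circ. h x * cnj (h x)) = (LINT x|circ. h x * (cnj (h x) - p x))"
      using trig0[OF p(1)] integrable_circ_mult[OF ih continuous_trig[OF p(1)]]
        integrable_circ_mult[OF ih continuous_on_subset[OF c]]
      by (simp add: right_diff_distrib)
    also have "cmod \<dots> \<le> (LINT x|circ. e * cmod (h x))"
    proof (rule LINT_norm_bound, goal_cases)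
      case 1
      show ?case using ih by simp
    next
      case 2
      show ?case
        using mult_left_mono[OF less_imp_le[OF p(2)] norm_ge_zero, of "h _"]
        by (intro AE_I2) (simp only: norm_mult mult.commute[of e])
    qed
    finally show ?thesis by (simp add: A_def)
  qed
  then have "cmod (LINT x|circ. h x * cnj (h x)) \<le> 0 + e" if "e > 0" for e
  proof -
    have A0: "A \<ge> 0" by (simp add: A_def)
    \<comment> \<open>Dividing by A + 1 instead of A covers the case A = 0.\<close>
    have "cmod (LINT x|circ. h x * cnj (h x)) \<le> (e / (A + 1)) * A"
      using \<open>\<And>e. e > 0 \<Longrightarrow> _\<close>[of "e / (A + 1)"] that A0 by simp
    also have "\<dots> \<le> e" using A0 that by (simp add: field_simps)
    finally show ?thesis by simp
  qed
  then have z: "(LINT x|circ. h x * cnj (h x)) = 0"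
    using field_le_epsilon[of "cmod (LINT x|circ. h x * cnj (h x))" 0] by simp
  have "(LINT x|circ. (cmod (h x))\<^sup>2) = Re (LINT x|circ. h x * cnj (h x))"
    using integrable_circ_mult[OF ih continuous_on_subset[OF c]]
    by (subst integral_Re[symmetric]) (auto simp: complex_norm_square[symmetric])
  then have "(LINT x|circ. (cmod (h x))\<^sup>2) = 0" using z by simp
  moreover have "continuous_on UNIV (\<lambda>x. (cmod (h x))\<^sup>2)" by (intro continuous_intros h)
  ultimately have "integral {-pi..pi} (\<lambda>x. (cmod (h x))\<^sup>2) = 0"
    using lebesgue_integral_eq_integral[OF integrable_circ_continuous] by fastforce
  then have "\<forall>x\<in>{-pi..pi}. (cmod (h x))\<^sup>2 = 0"
    by (subst (asm) integral_eq_0_iff) (auto intro!: continuous_intros continuous_on_subset[OF h(2)])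
  moreover have "Arg (cis x) \<in> {-pi..pi}" using Arg_bounded[of "cis x"] by auto
  ultimately have "h (Arg (cis x)) = 0" by simp
  then show ?thesis using periodic_Arg[of h, OF h(1)] by simp
qed

lemma fc_diff:
  assumes "integrable circ f" "integrable circ g"
  shows "fc (\<lambda>x. f x - g x) n = fc f n - fc g n"
  using integrable_circ_mult[OF assms(1) continuous_fmode, of "-n"]
    integrable_circ_mult[OF assms(2) continuous_fmode, of "-n"]
  by (simp add: fc_def left_diff_distrib diff_divide_distrib)

lemma continuous_periodic_eqI:
  fixes h g :: "real \<Rightarrow> complex"
  assumes "\<And>x. h (x + 2 * pi) = h x" "continuous_on UNIV h"
    "\<And>x. g (x + 2 * pi) = g x" "continuous_on UNIV g" "\<And>n. fc h n = fc g n"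
  shows "h = g"
proof
  fix x
  have "(\<lambda>x. h x - g x) x = 0"
    by (rule fc_eq_0_imp)
       (use assms in \<open>auto intro!: continuous_intros simp: fc_diff integrable_circ_continuous\<close>)
  then show "h x = g x" by simp
qed

section \<open>Absolutely convergent Fourier series\<close>

definition fser :: "(int \<Rightarrow> complex) \<Rightarrow> real \<Rightarrow> complex" where
  "fser c x = (\<Sum>\<^sub>\<infinity>n\<in>UNIV. c n * fmode n x)"

lemma uniform_limit_fser:
  assumes "(\<lambda>n. cmod (c n)) summable_on UNIV"
  shows "uniform_limit UNIV (\<lambda>A x. \<Sum>n\<in>A. c n * fmode n x) (fser c) (finite_subsets_at_top UNIV)"
  unfolding fser_def
  by (rule Weierstrass_m_test_general[OF _ assms]) (simp add: norm_mult)

lemma continuous_fser: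
  assumes "(\<lambda>n. cmod (c n)) summable_on UNIV"
  shows "continuous_on UNIV (fser c)"
  by (rule uniform_limit_theorem[OF _ uniform_limit_fser[OF assms]])
     (auto intro!: always_eventually continuous_intros continuous_fmode)

lemma fser_periodic: "fser c (x + 2 * pi) = fser c x"
  by (simp add: fser_def fmode_periodic)

text \<open>The series converges uniformly, so it may be integrated term by term against any
  integrable function. Applied with a mode for \<open>h\<close> it gives \<open>fc_fser\<close>,
  with a conjugated test function Parseval's identity.\<close>

lemma has_sum_LINT_fser:
  assumes c: "(\<lambda>n. cmod (c n)) summable_on UNIV" and h: "integrable circ h"
  shows "((\<lambda>n. c n * (LINT x|circ. h x * fmode n x)) has_sum (LINT x|circ. h x * fser c x)) UNIV"
  unfolding has_sum_def
proof (rule tendstoI)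
  fix e :: real assume e: "e > 0"
  define B where "B = (LINT x|circ. cmod (h x))"
  have B0: "B \<ge> 0" by (simp add: B_def)
  have "\<forall>\<^sub>F A in finite_subsets_at_top UNIV. \<forall>x\<in>UNIV. dist (\<Sum>n\<in>A. c n * fmode n x) (fser c x) < e / (B + 1)"
    using uniform_limitD[OF uniform_limit_fser[OF c], of "e / (B + 1)"] e B0 by simp
  then show "\<forall>\<^sub>F A in finite_subsets_at_top UNIV.
      dist (\<Sum>n\<in>A. c n * (LINT x|circ. h x * fmode n x)) (LINT x|circ. h x * fser c x) < e"
  proof eventually_elim
    case (elim A)
    let ?S = "\<lambda>x. \<Sum>n\<in>A. c n * fmode n x"
    have cS: "continuous_on {-pi..pi} ?S" by (intro continuous_intros continuous_fmode)
    have cf: "continuous_on {-pi..pi} (fser c)" using continuous_fser[OF c] continuous_on_subset by blast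
    have "(\<Sum>n\<in>A. c n * (LINT x|circ. h x * fmode n x)) = (\<Sum>n\<in>A. LINT x|circ. c n * (h x * fmode n x))"
      by simp
    also have "\<dots> = (LINT x|circ. (\<Sum>n\<in>A. c n * (h x * fmode n x)))"
      by (rule Bochner_Integration.integral_sum[symmetric])
         (intro integrable_mult_right integrable_circ_mult[OF h] continuous_fmode)
    also have "\<dots> = (LINT x|circ. h x * ?S x)"
      by (simp add: sum_distrib_left mult.left_commute)
    finally have "dist (\<Sum>n\<in>A. c n * (LINT x|circ. h x * fmode n x)) (LINT x|circ. h x * fser c x)
       = cmod (LINT x|circ. h x * (?S x - fser c x))"
      using integrable_circ_mult[OF h cS] integrable_circ_mult[OF h cf]
      by (simp add: dist_norm right_diff_distrib)
    also have "\<dots> \<le> (LINT x|circ. (e / (B + 1)) * cmod (h x))"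
    proof (rule LINT_norm_bound)
      show "integrable circ (\<lambda>x. (e / (B + 1)) * cmod (h x))" using h by simp
      show "AE x in circ. cmod (h x * (?S x - fser c x)) \<le> e / (B + 1) * cmod (h x)"
      proof (rule AE_I2)
        fix x
        have "cmod (?S x - fser c x) \<le> e / (B + 1)" using elim by (simp add: dist_norm less_imp_le)
        from mult_left_mono[OF this norm_ge_zero, of "h x"]
        show "cmod (h x * (?S x - fser c x)) \<le> e / (B + 1) * cmod (h x)"
          by (simp only: norm_mult mult.commute[of "e / (B + 1)"])
      qed
    qed
    also have "\<dots> = e * (B / (B + 1))" by (simp add: B_def)
    also have "\<dots> < e" using e B0 by (simp add: field_simps)
    finally show ?case .
  qed
qed

lemma fc_fser:
  assumes c: "(\<lambda>n. cmod (c n)) summable_on UNIV"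
  shows "fc (fser c) m = c m"
proof -
  have "((\<lambda>n. c n * (LINT x|circ. fmode (-m) x * fmode n x)) has_sum (LINT x|circ. fmode (-m) x * fser c x)) UNIV"
    by (intro has_sum_LINT_fser c integrable_circ_continuous continuous_fmode)
  moreover have "((\<lambda>n. c n * (LINT x|circ. fmode (-m) x * fmode n x)) has_sum (2 * pi * c m)) UNIV"
  proof -
    have "((\<lambda>n. if n = m then c n * (2 * pi) else 0) has_sum (c m * (2 * pi))) UNIV"
      by (rule has_sum_finite_neutralI[of "{m}"]) auto
    moreover have "(\<lambda>n. c n * (LINT x|circ. fmode (-m) x * fmode n x)) = (\<lambda>n. if n = m then c n * (2 * pi) else 0)"
      by (auto simp: LINT_circ_fmode_mult)
    ultimately show ?thesis by (simp add: mult.commute)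
  qed
  ultimately have "(LINT x|circ. fmode (-m) x * fser c x) = 2 * pi * c m" by (rule has_sum_unique)
  then show ?thesis by (simp add: fc_def mult.commute)
qed

lemma fser_fc:
  assumes "\<And>x. h (x + 2 * pi) = h x" "continuous_on UNIV h" "(\<lambda>n. cmod (fc h n)) summable_on UNIV"
  shows "fser (fc h) = h"
  by (rule continuous_periodic_eqI)
     (use assms in \<open>auto simp: fser_periodic fc_fser intro: continuous_fser\<close>)

lemma summable_on_int_inverse:
  assumes "s > 1"
  shows "(\<lambda>n. real_of_int (max 1 \<bar>n\<bar>) powr - s) summable_on UNIV"
proof -
  let ?f = "\<lambda>n::int. real_of_int (max 1 \<bar>n\<bar>) powr - s"
  have s: "summable (\<lambda>n. real n powr - s)" using assms summable_real_powr_iff[of "-s"] by simp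
  then have N: "(\<lambda>n. real n powr - s) summable_on UNIV"
    by (intro norm_summable_imp_summable_on) simp
  then have N': "(\<lambda>n. real n powr - s) summable_on {1..}" by (rule summable_on_subset) auto
  have "?f summable_on {1..} \<longleftrightarrow> (\<lambda>n. real n powr - s) summable_on {1..}"
    by (rule summable_on_reindex_bij_witness[of _ int nat]) auto
  then have 1: "?f summable_on {1..}" using N' by simp
  have "?f summable_on {..-1} \<longleftrightarrow> ?f summable_on {1..}"
    by (rule summable_on_reindex_bij_witness[of _ uminus uminus]) auto
  then have 2: "?f summable_on {..-1}" using 1 by simp
  have "?f summable_on {0} \<union> {1..} \<union> {..-1}"
    by (intro summable_on_Un_disjoint 1 2) auto
  moreover have "{0} \<union> {1..} \<union> {..-1} = (UNIV :: int set)" by auto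
  ultimately show ?thesis by simp
qed

section \<open>Test functions and periodic distributions\<close>

lemma test_fun_continuous: "\<psi> \<in> test_fun \<Longrightarrow> continuous_on S \<psi>"
  by (simp add: smooth_continuous test_fun_smooth)

lemma test_fun_periodic: "\<psi> \<in> test_fun \<Longrightarrow> \<psi> (x + 2 * pi) = \<psi> x"
  by (simp add: test_fun_def)

lemma test_fun_add_cmult:
  "\<phi> \<in> test_fun \<Longrightarrow> \<psi> \<in> test_fun \<Longrightarrow> (\<lambda>x. \<phi> x + c * \<psi> x) \<in> test_fun"
  by (auto simp: test_fun_def intro!: smooth_add smooth_cmult)

lemma test_fun_0: "(\<lambda>x. 0) \<in> test_fun"
  by (simp add: test_fun_def smooth_const)

lemma test_fun_cmult: "\<psi> \<in> test_fun \<Longrightarrow> (\<lambda>x. c * \<psi> x) \<in> test_fun"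
  by (auto simp: test_fun_def intro!: smooth_cmult)

lemma test_fun_sum:
  assumes "\<And>i. i \<in> I \<Longrightarrow> f i \<in> test_fun"
  shows "(\<lambda>x. \<Sum>i\<in>I. f i x) \<in> test_fun"
  using assms by (auto simp: test_fun_def intro!: smooth_sum)

lemma test_fun_fpoly: "(\<lambda>x. \<Sum>n\<in>A. c n * fmode n x) \<in> test_fun"
  by (intro test_fun_sum test_fun_cmult fmode_test_fun)

lemma test_fun_deriv:
  assumes "\<psi> \<in> test_fun"
  shows "dir_deriv (1::real) \<psi> \<in> test_fun"
proof -
  have "dir_deriv 1 \<psi> (x + 2 * pi) = dir_deriv 1 \<psi> x" for x :: real
  proof -
    have "((\<lambda>y. y + 2 * pi) has_vector_derivative 1) (at x)"
      by (auto intro!: derivative_eq_intros)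
    from vector_diff_chain_at[OF this has_vector_derivative_smooth[OF test_fun_smooth[OF assms]]]
    have "(\<psi> has_vector_derivative dir_deriv 1 \<psi> (x + 2 * pi)) (at x)"
      by (simp add: o_def test_fun_periodic[OF assms])
    from dir_deriv_1_real[OF this] show ?thesis by simp
  qed
  then show ?thesis
    using smooth_dir_deriv[OF test_fun_smooth[OF assms], of 1] by (simp add: test_fun_def)
qed

lemma test_fun_iter_deriv: "\<psi> \<in> test_fun \<Longrightarrow> (dir_deriv (1::real) ^^ k) \<psi> \<in> test_fun"
  by (induction k) (auto intro: test_fun_deriv)

lemma fc_deriv:
  assumes "\<psi> \<in> test_fun"
  shows "fc (dir_deriv 1 \<psi>) n = \<i> * n * fc \<psi> n"
proof -
  let ?D = "dir_deriv (1::real) \<psi>"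
  have "((\<lambda>x. ?D x * fmode (-n) x - \<i> * n * (\<psi> x * fmode (-n) x)) has_integral
      \<psi> pi * fmode (-n) pi - \<psi> (-pi) * fmode (-n) (-pi)) {-pi..pi}"
  proof (rule fundamental_theorem_of_calculus)
    fix x :: real
    have "((\<lambda>x. \<psi> x * fmode (-n) x) has_vector_derivative
       \<psi> x * (\<i> * of_int (-n) * fmode (-n) x) + ?D x * fmode (-n) x) (at x)"
      by (intro has_vector_derivative_mult has_vector_derivative_fmode
        has_vector_derivative_smooth test_fun_smooth assms)
    then show "((\<lambda>x. \<psi> x * fmode (-n) x) has_vector_derivative
       ?D x * fmode (-n) x - \<i> * n * (\<psi> x * fmode (-n) x)) (at x within {-pi..pi})"
      by (rule has_vector_derivative_at_within[OF has_vector_derivative_eq_rhs]) (simp add: algebra_simps)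
  qed simp
  moreover have "\<psi> pi * fmode (-n) pi = \<psi> (-pi) * fmode (-n) (-pi)"
    using fmode_periodic[of "-n" "-pi"] test_fun_periodic[OF assms, of "-pi"] by simp
  ultimately have 0: "integral {-pi..pi} (\<lambda>x. ?D x * fmode (-n) x - \<i> * n * (\<psi> x * fmode (-n) x)) = 0"
    by (simp add: integral_unique)
  have i: "integrable circ (\<lambda>x. ?D x * fmode (-n) x)" "integrable circ (\<lambda>x. \<psi> x * fmode (-n) x)"
    by (intro integrable_circ_continuous continuous_intros continuous_fmode test_fun_continuous
      test_fun_deriv assms)+
  have "(LINT x|circ. ?D x * fmode (-n) x - \<i> * n * (\<psi> x * fmode (-n) x)) = 0"
    by (subst lebesgue_integral_eq_integral) (use i 0 in auto)
  then show ?thesis using i by (simp add: fc_def)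
qed

lemma fc_iter_deriv:
  "\<psi> \<in> test_fun \<Longrightarrow> fc ((dir_deriv 1 ^^ k) \<psi>) n = (\<i> * n) ^ k * fc \<psi> n"
  by (induction k) (auto simp: fc_deriv test_fun_iter_deriv)

lemma fc_bound:
  assumes "integrable circ h"
  shows "cmod (fc h n) \<le> (LINT x|circ. cmod (h x)) / (2 * pi)"
proof -
  have "cmod (LINT x|circ. h x * fmode (-n) x) \<le> (LINT x|circ. cmod (h x))"
    by (rule LINT_norm_bound) (use assms in \<open>auto simp: norm_mult\<close>)
  then show ?thesis by (simp add: fc_def norm_divide divide_right_mono)
qed

text \<open>Two derivatives give coefficients of the order of n to the power -2. The bound for
  \<psi> itself is added to cover n = 0.\<close>

lemma fc_test_fun_summable:
  assumes "\<psi> \<in> test_fun"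
  shows "(\<lambda>n. cmod (fc \<psi> n)) summable_on UNIV"
proof -
  define B where "B h = (LINT x|circ. cmod (h x)) / (2 * pi)" for h :: "real \<Rightarrow> complex"
  have B0: "B h \<ge> 0" for h by (simp add: B_def)
  have B: "cmod (fc h n) \<le> B h" if "h \<in> test_fun" for h n
    unfolding B_def using that by (intro fc_bound integrable_circ_continuous test_fun_continuous)
  let ?D2 = "(dir_deriv (1::real) ^^ 2) \<psi>"
  have "cmod (fc \<psi> n) \<le> (B \<psi> + B ?D2) * real_of_int (max 1 \<bar>n\<bar>) powr - 2" for n
  proof (cases "n = 0")
    case True
    then show ?thesis using B[OF assms, of 0] B0[of ?D2] by simp
  next
    case False
    then have n: "max 1 \<bar>n\<bar> = \<bar>n\<bar>" by simp
    have "(real_of_int \<bar>n\<bar>)\<^sup>2 * cmod (fc \<psi> n) = cmod (fc ?D2 n)"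
      by (simp add: fc_iter_deriv[OF assms] norm_mult norm_power)
    also have "\<dots> \<le> B \<psi> + B ?D2" using B[OF test_fun_iter_deriv[OF assms]] B0[of \<psi>] by (simp add: add_increasing)
    finally show ?thesis using False unfolding n by (simp add: powr_minus field_simps)
  qed
  moreover have s: "(\<lambda>n. (B \<psi> + B ?D2) * real_of_int (max 1 \<bar>n\<bar>) powr - 2) summable_on UNIV"
    by (intro summable_on_cmult_right summable_on_int_inverse) simp
  ultimately show ?thesis by (intro summable_on_comparison_test[OF s]) auto
qed

lemma fser_fc_test_fun: "\<psi> \<in> test_fun \<Longrightarrow> fser (fc \<psi>) = \<psi>"
  by (rule fser_fc) (auto simp: test_fun_periodic test_fun_continuous fc_test_fun_summable)

lemma iter_deriv_add_cmult:
  assumes "\<phi> \<in> test_fun" "\<psi> \<in> test_fun"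
  shows "(dir_deriv (1::real) ^^ k) (\<lambda>x. \<phi> x + c * \<psi> x) =
    (\<lambda>x. (dir_deriv 1 ^^ k) \<phi> x + c * (dir_deriv 1 ^^ k) \<psi> x)"
proof (induction k)
  case (Suc k)
  let ?f = "(dir_deriv (1::real) ^^ k) \<phi>" and ?g = "(dir_deriv (1::real) ^^ k) \<psi>"
  have fg: "smooth ?f" "smooth ?g" using assms by (auto intro: test_fun_smooth test_fun_iter_deriv)
  have "dir_deriv 1 (\<lambda>x. ?f x + c * ?g x) x = dir_deriv 1 ?f x + c * dir_deriv 1 ?g x" for x
    by (intro dir_deriv_1_real has_vector_derivative_add has_vector_derivative_smooth fg
      has_vector_derivative_mult_right)
  then show ?case by (simp add: Suc)
qed simp

lemma iter_deriv_fmode: "(dir_deriv (1::real) ^^ k) (fmode n) = (\<lambda>x. (\<i> * n) ^ k * fmode n x)"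
proof (induction k)
  case (Suc k)
  have "dir_deriv 1 (\<lambda>x. (\<i> * n) ^ k * fmode n x) x = (\<i> * n) ^ k * (\<i> * n * fmode n x)" for x
    by (intro dir_deriv_1_real has_vector_derivative_mult_right has_vector_derivative_fmode)
  then show ?case by (simp add: Suc mult_ac)
qed simp

lemma iter_deriv_fpoly_diff:
  assumes "\<psi> \<in> test_fun" "finite A"
  shows "(dir_deriv (1::real) ^^ k) (\<lambda>x. \<psi> x - (\<Sum>n\<in>A. c n * fmode n x)) =
    (\<lambda>x. (dir_deriv 1 ^^ k) \<psi> x - (\<Sum>n\<in>A. (\<i> * n) ^ k * c n * fmode n x))"
  using assms(2)
proof (induction A)
  case (insert a A)
  have t: "(\<lambda>x. \<psi> x - (\<Sum>n\<in>A. c n * fmode n x)) \<in> test_fun"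
    using test_fun_add_cmult[OF assms(1) test_fun_fpoly, of "-1" c A] by simp
  have "(\<lambda>x. \<psi> x - (\<Sum>n\<in>insert a A. c n * fmode n x)) = 
     (\<lambda>x. (\<psi> x - (\<Sum>n\<in>A. c n * fmode n x)) + (- c a) * fmode a x)"
    using insert by (auto simp: algebra_simps)
  then show ?case using insert
    by (simp only: iter_deriv_add_cmult[OF t fmode_test_fun] iter_deriv_fmode) (auto simp: algebra_simps)
qed simp

lemma test_fun_bdd:
  assumes "\<psi> \<in> test_fun"
  shows "bdd_above (range (\<lambda>x. cmod (\<psi> x)))"
proof -
  obtain B where "\<And>x. cmod (\<psi> x) \<le> B"
    using periodic_bounded[of \<psi>, OF test_fun_periodic[OF assms] test_fun_continuous[OF assms]] by blast
  then show ?thesis by (auto intro!: bdd_aboveI)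
qed

section \<open>Distributions and their Fourier coefficients\<close>

lemma dist_linear:
  assumes "g \<in> distributions" "\<phi> \<in> test_fun" "\<psi> \<in> test_fun"
  shows "g (\<lambda>x. \<phi> x + c * \<psi> x) = g \<phi> + c * g \<psi>"
  using assms by (auto simp: distributions_def)

lemma dist_zero:
  assumes "g \<in> distributions" shows "g (\<lambda>_. 0) = 0"
  using dist_linear[OF assms test_fun_0 test_fun_0, of 1] by simp

lemma dist_outside: "g \<in> distributions \<Longrightarrow> \<phi> \<notin> test_fun \<Longrightarrow> g \<phi> = 0"
  by (auto simp: distributions_def)

lemma dist_fpoly:
  assumes "g \<in> distributions" "finite A"
  shows "g (\<lambda>x. \<Sum>n\<in>A. c n * fmode n x) = (\<Sum>n\<in>A. c n * g (fmode n))"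
  using assms(2)
proof (induction A)
  case (insert a A)
  have "(\<lambda>x. \<Sum>n\<in>insert a A. c n * fmode n x) = (\<lambda>x. (\<Sum>n\<in>A. c n * fmode n x) + c a * fmode a x)"
    using insert by auto
  then show ?case using insert
    by (simp only: dist_linear[OF assms(1) test_fun_fpoly fmode_test_fun]) simp
qed (use dist_zero[OF assms(1)] in simp)

text \<open>The continuity bound of a distribution involves derivatives up to a finite order
  \<open>N\<close>. Each of these has a uniformly convergent Fourier series, obtained by
  differentiating that of \<psi> term by term, so the partial sums converge to \<psi> in the
  seminorms that control \<open>g\<close>.\<close>

lemma dist_has_sum:
  assumes g: "g \<in> distributions" and \<psi>: "\<psi> \<in> test_fun"
  shows "((\<lambda>n. fc \<psi> n * g (fmode n)) has_sum g \<psi>) UNIV"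
  unfolding has_sum_def
proof (rule tendstoI)
  fix e :: real assume e: "e > 0"
  obtain N C where NC: "\<And>\<phi>. \<phi> \<in> test_fun \<Longrightarrow>
      cmod (g \<phi>) \<le> C * (\<Sum>k\<le>N::nat. SUP x. cmod ((dir_deriv (1::real) ^^ k) \<phi> x))"
    using g unfolding distributions_def by blast
  \<comment> \<open>There are \<open>N + 1\<close> seminorms, and \<open>C\<close> may be negative
    or zero; the summand 1 keeps the total below \<open>e\<close> in every case.\<close>
  define d where "d = e / (\<bar>C\<bar> * (real N + 1) + 1)"
  have d: "d > 0" using e by (simp add: d_def add_nonneg_pos)
  have ev: "\<forall>\<^sub>F A in finite_subsets_at_top UNIV. \<forall>x\<in>UNIV.
      dist (\<Sum>n\<in>A. fc ((dir_deriv (1::real) ^^ k) \<psi>) n * fmode n x) ((dir_deriv (1::real) ^^ k) \<psi> x) < d" for k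
    using uniform_limitD[OF uniform_limit_fser[OF fc_test_fun_summable[OF test_fun_iter_deriv[OF \<psi>]]] d, of k]
    by (simp add: fser_fc_test_fun[OF test_fun_iter_deriv[OF \<psi>]])
  have "\<forall>\<^sub>F A in finite_subsets_at_top UNIV. \<forall>k\<in>{..N}. \<forall>x\<in>UNIV.
      dist (\<Sum>n\<in>A. fc ((dir_deriv (1::real) ^^ k) \<psi>) n * fmode n x) ((dir_deriv (1::real) ^^ k) \<psi> x) < d"
    by (intro eventually_ball_finite ballI ev) simp
  moreover have "\<forall>\<^sub>F A in finite_subsets_at_top (UNIV::int set). finite A"
    by (simp add: eventually_finite_subsets_at_top)  auto
  ultimately show "\<forall>\<^sub>F A in finite_subsets_at_top UNIV. dist (\<Sum>n\<in>A. fc \<psi> n * g (fmode n)) (g \<psi>) < e"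
  proof eventually_elim
    case (elim A)
    let ?r = "\<lambda>x. \<psi> x - (\<Sum>n\<in>A. fc \<psi> n * fmode n x)"
    have r_eq: "?r = (\<lambda>x. \<psi> x + (-1) * (\<Sum>n\<in>A. fc \<psi> n * fmode n x))" by simp
    have r: "?r \<in> test_fun" unfolding r_eq by (intro test_fun_add_cmult \<psi> test_fun_fpoly)
    have "g ?r = g \<psi> - (\<Sum>n\<in>A. fc \<psi> n * g (fmode n))"
      unfolding r_eq dist_linear[OF g \<psi> test_fun_fpoly] dist_fpoly[OF g elim(2)] by simp
    then have "dist (\<Sum>n\<in>A. fc \<psi> n * g (fmode n)) (g \<psi>) = cmod (g ?r)"
      by (simp add: dist_norm norm_minus_commute)
    also have "\<dots> \<le> C * (\<Sum>k\<le>N. SUP x. cmod ((dir_deriv (1::real) ^^ k) ?r x))" by (rule NC[OF r])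
    also have "\<dots> \<le> \<bar>C\<bar> * (\<Sum>k\<le>N. d)"
    proof -
      have "(SUP x. cmod ((dir_deriv (1::real) ^^ k) ?r x)) \<le> d" if "k \<le> N" for k
      proof (rule cSUP_least)
        fix x
        show "cmod ((dir_deriv (1::real) ^^ k) ?r x) \<le> d"
          using elim(1) that fc_iter_deriv[OF \<psi>]
          by (simp add: iter_deriv_fpoly_diff[OF \<psi> elim(2)] dist_norm norm_minus_commute less_imp_le)
      qed simp
      moreover have "(SUP x. cmod ((dir_deriv (1::real) ^^ k) ?r x)) \<ge> 0" for k
        by (rule cSUP_upper2[OF test_fun_bdd[OF test_fun_iter_deriv[OF r]]]) auto
      ultimately have "(\<Sum>k\<le>N. SUP x. cmod ((dir_deriv (1::real) ^^ k) ?r x)) \<le> (\<Sum>k\<le>N. d)"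
        "0 \<le> (\<Sum>k\<le>N. SUP x. cmod ((dir_deriv (1::real) ^^ k) ?r x))"
        by (intro sum_mono sum_nonneg; simp)+
      then show ?thesis by (meson abs_ge_self abs_ge_zero mult_mono)
    qed
    also have "\<dots> = (\<bar>C\<bar> * (real N + 1)) * d" by (simp add: algebra_simps)
    also have "\<dots> < e"
    proof -
      define K where "K = \<bar>C\<bar> * (real N + 1)"
      have "K \<ge> 0" by (simp add: K_def)
      then show ?thesis using e unfolding d_def K_def[symmetric] by (simp add: field_simps)
    qed
    finally show ?case .
  qed
qed

lemma dist_fmode: "g (fmode n) = 2 * pi * fcoeff g (- n)"
  by (simp add: fcoeff_def)

text \<open>The device behind all later identities between distributions. Outside
  \<open>test_fun\<close> both sides vanish by convention, so that they are equal as
  functions.\<close>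

lemma dist_eqI:
  assumes "g \<in> distributions" "g' \<in> distributions" "\<And>n. fcoeff g n = fcoeff g' n"
  shows "g = g'"
proof
  fix \<psi>
  show "g \<psi> = g' \<psi>"
  proof (cases "\<psi> \<in> test_fun")
    case True
    from dist_has_sum[OF assms(1) True] dist_has_sum[OF assms(2) True] assms(3)
    show ?thesis by (simp add: dist_fmode has_sum_unique)
  qed (use assms dist_outside in metis)
qed

lemma dist_of_distribution:
  assumes "integrable circ h"
  shows "dist_of h \<in> distributions"
proof -
  define C where "C = (LINT x|circ. cmod (h x))"
  have lin: "dist_of h (\<lambda>x. \<phi> x + c * \<psi> x) = dist_of h \<phi> + c * dist_of h \<psi>"
    if "\<phi> \<in> test_fun" "\<psi> \<in> test_fun" for \<phi> \<psi> c
    using that integrable_circ_mult[OF assms test_fun_continuous[OF that(1)]]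
      integrable_circ_mult[OF assms test_fun_continuous[OF that(2)]]
    by (simp add: dist_of_def test_fun_add_cmult distrib_left mult.left_commute)
  have "cmod (dist_of h \<phi>) \<le> C * (\<Sum>k\<le>0. SUP x. cmod ((dir_deriv (1::real) ^^ k) \<phi> x))"
    if "\<phi> \<in> test_fun" for \<phi>
  proof -
    have "cmod (LINT x|circ. h x * \<phi> x) \<le> (LINT x|circ. (SUP x. cmod (\<phi> x)) * cmod (h x))"
      by (rule LINT_norm_bound)
         (use assms in \<open>auto simp: norm_mult mult.commute[of _ "cmod (h _)"] intro!: AE_I2 mult_left_mono cSUP_upper test_fun_bdd that\<close>)
    then show ?thesis using that by (simp add: dist_of_def C_def mult.commute)
  qed
  then have "\<exists>N::nat. \<exists>C. \<forall>\<phi>\<in>test_fun.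
      cmod (dist_of h \<phi>) \<le> C * (\<Sum>k\<le>N. SUP x. cmod ((dir_deriv (1::real) ^^ k) \<phi> x))"
    by blast
  then show ?thesis unfolding distributions_def using lin by (simp add: dist_of_def)
qed

lemma dist_add_cmult:
  assumes "g \<in> distributions" "g' \<in> distributions"
  shows "(\<lambda>\<phi>. g \<phi> + c * g' \<phi>) \<in> distributions"
proof -
  obtain N C where NC: "\<And>\<phi>. \<phi> \<in> test_fun \<Longrightarrow>
      cmod (g \<phi>) \<le> C * (\<Sum>k\<le>N::nat. SUP x. cmod ((dir_deriv (1::real) ^^ k) \<phi> x))"
    using assms(1) unfolding distributions_def by blast
  obtain N' C' where NC': "\<And>\<phi>. \<phi> \<in> test_fun \<Longrightarrow>
      cmod (g' \<phi>) \<le> C' * (\<Sum>k\<le>N'::nat. SUP x. cmod ((dir_deriv (1::real) ^^ k) \<phi> x))"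
    using assms(2) unfolding distributions_def by blast
  have "cmod (g \<phi> + c * g' \<phi>) \<le> (\<bar>C\<bar> + cmod c * \<bar>C'\<bar>) *
      (\<Sum>k\<le>max N N'. SUP x. cmod ((dir_deriv (1::real) ^^ k) \<phi> x))" if \<phi>: "\<phi> \<in> test_fun" for \<phi>
  proof -
    let ?s = "\<lambda>k. SUP x. cmod ((dir_deriv (1::real) ^^ k) \<phi> x)"
    have s0: "?s k \<ge> 0" for k
      by (rule cSUP_upper2[OF test_fun_bdd[OF test_fun_iter_deriv[OF \<phi>]]]) auto
    have m: "C * (\<Sum>k\<le>K. ?s k) \<le> \<bar>C\<bar> * (\<Sum>k\<le>max N N'. ?s k)" if "K \<le> max N N'" for C K
      using that s0 by (intro mult_mono sum_mono2 sum_nonneg) auto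
    have "cmod (g \<phi>) \<le> \<bar>C\<bar> * (\<Sum>k\<le>max N N'. ?s k)" using NC[OF \<phi>] m[of N C] by simp
    moreover have "cmod (g' \<phi>) \<le> \<bar>C'\<bar> * (\<Sum>k\<le>max N N'. ?s k)" using NC'[OF \<phi>] m[of N' C'] by simp
    ultimately have "cmod (g \<phi>) + cmod c * cmod (g' \<phi>) \<le> \<bar>C\<bar> * (\<Sum>k\<le>max N N'. ?s k) + cmod c * (\<bar>C'\<bar> * (\<Sum>k\<le>max N N'. ?s k))"
      by (intro add_mono mult_left_mono) auto
    then show ?thesis using norm_triangle_ineq[of "g \<phi>" "c * g' \<phi>"]
      by (simp add: norm_mult distrib_right mult.assoc)
  qed
  moreover have "g (\<lambda>x. \<phi> x + d * \<psi> x) + c * g' (\<lambda>x. \<phi> x + d * \<psi> x) = g \<phi> + c * g' \<phi> + d * (g \<psi> + c * g' \<psi>)"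
    if "\<phi> \<in> test_fun" "\<psi> \<in> test_fun" for \<phi> \<psi> d
    using dist_linear[OF assms(1) that, of d] dist_linear[OF assms(2) that, of d] by (simp add: algebra_simps)
  moreover have "g \<phi> + c * g' \<phi> = 0" if "\<phi> \<notin> test_fun" for \<phi>
    using dist_outside[OF assms(1) that] dist_outside[OF assms(2) that] by simp
  ultimately show ?thesis unfolding distributions_def by (intro CollectI conjI ballI allI impI; blast)
qed

lemma fcoeff_add_cmult: "fcoeff (\<lambda>\<phi>. g \<phi> + c * g' \<phi>) n = fcoeff g n + c * fcoeff g' n"
  by (simp add: fcoeff_def add_divide_distrib)

lemma dist_diff_eq: "(g :: pdist) - g' = (\<lambda>\<phi>. g \<phi> + (-1) * g' \<phi>)"
  by (auto simp: fun_eq_iff)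

lemma dist_diff: "g \<in> distributions \<Longrightarrow> g' \<in> distributions \<Longrightarrow> g - g' \<in> distributions"
  unfolding dist_diff_eq by (rule dist_add_cmult)

lemma fcoeff_diff: "fcoeff (g - g') n = fcoeff g n - fcoeff g' n"
  unfolding dist_diff_eq fcoeff_add_cmult by simp

text \<open>Continuous periodic functions are determined by their Fourier coefficients, hence by
  their distributions; this resolves the definite description in \<open>cont_rep\<close>.\<close>

lemma cont_rep_dist_of:
  assumes "continuous_on UNIV h" "\<And>x. h (x + 2 * pi) = h x"
  shows "cont_rep (dist_of h) = h"
  unfolding cont_rep_def
proof (rule the_equality)
  fix h' assume h': "continuous_on UNIV h' \<and> (\<forall>x. h' (x + 2 * pi) = h' x) \<and> dist_of h' = dist_of h"
  show "h' = h"
    by (rule continuous_periodic_eqI) (use assms h' in \<open>auto simp flip: fcoeff_dist_of\<close>)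
qed (use assms in auto)

lemma dist_of_fser:
  assumes "(\<lambda>n. cmod (c n)) summable_on UNIV"
  shows "dist_of (fser c) \<in> distributions" "fcoeff (dist_of (fser c)) n = c n"
    "cont_rep (dist_of (fser c)) = fser c"
  using assms by (auto intro!: dist_of_distribution integrable_circ_continuous continuous_fser
    cont_rep_dist_of fser_periodic simp: fcoeff_dist_of fc_fser)

lemma cont_rep_eq_fser:
  assumes "g \<in> distributions" "(\<lambda>n. cmod (fcoeff g n)) summable_on UNIV"
  shows "cont_rep g = fser (fcoeff g)"
  using dist_of_fser[OF assms(2)] dist_eqI[OF assms(1)] by metis

lemma Parseval_test_fun:
  assumes "\<psi> \<in> test_fun"
  shows "((\<lambda>n. (cmod (fc \<psi> n))\<^sup>2) has_sum (LINT x|circ. (cmod (\<psi> x))\<^sup>2) / (2 * pi)) UNIV"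
proof -
  have i: "integrable circ (\<lambda>x. cnj (\<psi> x))"
    by (intro integrable_circ_continuous continuous_intros test_fun_continuous assms)
  have "((\<lambda>n. fc \<psi> n * (LINT x|circ. cnj (\<psi> x) * fmode n x)) has_sum (LINT x|circ. cnj (\<psi> x) * \<psi> x)) UNIV"
    using has_sum_LINT_fser[OF fc_test_fun_summable[OF assms] i] by (simp add: fser_fc_test_fun[OF assms])
  moreover have "(LINT x|circ. cnj (\<psi> x) * fmode n x) = 2 * pi * cnj (fc \<psi> n)" for n
    by (simp add: fc_def) (simp add: cnj_fmode flip: Bochner_Integration.integral_cnj)
  moreover have "(LINT x|circ. cnj (\<psi> x) * \<psi> x) = of_real (LINT x|circ. (cmod (\<psi> x))\<^sup>2)"
    by (simp add: mult.commute complex_norm_square[symmetric] flip: of_real_power)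
  ultimately have "((\<lambda>n. of_real (2 * pi * (cmod (fc \<psi> n))\<^sup>2)) has_sum complex_of_real (LINT x|circ. (cmod (\<psi> x))\<^sup>2)) UNIV"
    by (simp add: mult_ac flip: complex_norm_square)
  then have "((\<lambda>n. 2 * pi * (cmod (fc \<psi> n))\<^sup>2) has_sum (LINT x|circ. (cmod (\<psi> x))\<^sup>2)) UNIV"
    unfolding has_sum_of_real_iff .
  from has_sum_cmult_right[OF this, of "1 / (2 * pi)"] show ?thesis by simp
qed

section \<open>The divergence theorem on the disk\<close>

lemma FTC_at:
  fixes f :: "real \<Rightarrow> 'b::banach"
  assumes "a \<le> b" "\<And>x. x \<in> {a..b} \<Longrightarrow> (f has_vector_derivative f' x) (at x)"
  shows "(f' has_integral (f b - f a)) {a..b}"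
  using assms by (intro fundamental_theorem_of_calculus) (auto intro: has_vector_derivative_at_within)

definition plane :: "bool \<Rightarrow> real \<Rightarrow> real \<Rightarrow> complex" where
  "plane sw x y = (if sw then Complex y x else Complex x y)"

text \<open>The flag exchanges the coordinates, so that Fubini's theorem can be applied in either order.\<close>

definition dir1 :: "bool \<Rightarrow> complex" where "dir1 sw = (if sw then \<i> else 1)"

lemma continuous_Complex: "continuous_on S f \<Longrightarrow> continuous_on S g \<Longrightarrow> continuous_on S (\<lambda>x. Complex (f x) (g x))"
  by (simp add: Complex_eq) (intro continuous_intros)

lemma continuous_plane: "continuous_on S f \<Longrightarrow> continuous_on S g \<Longrightarrow> continuous_on S (\<lambda>x. plane sw (f x) (g x))"
  unfolding plane_def by (cases sw) (simp_all add: continuous_Complex)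

lemma measurable_plane [measurable]: "(\<lambda>(x, y). plane sw x y) \<in> borel_measurable (borel \<Otimes>\<^sub>M borel)"
  unfolding borel_prod case_prod_beta
  by (intro borel_measurable_continuous_onI continuous_plane continuous_intros)

lemma norm_plane: "cmod (plane sw x y) = sqrt (x\<^sup>2 + y\<^sup>2)"
  by (simp add: plane_def cmod_def add.commute)

text \<open>Lebesgue measure is characterized by its values on boxes, and the volume of a box is
  symmetric in the two coordinates, so one statement serves both orders of integration.\<close>

lemma lborel_plane: "(lborel :: complex measure) = distr (lborel \<Otimes>\<^sub>M lborel) borel (\<lambda>(x, y). plane sw x y)"
proof (rule lborel_eqI)
  fix l u :: complex assume le: "\<And>b. b \<in> Basis \<Longrightarrow> l \<bullet> b \<le> u \<bullet> b"
  then have l: "Re l \<le> Re u" "Im l \<le> Im u" using le[of 1] le[of \<i>] by (auto simp: Basis_complex_def)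
  let ?X = "if sw then {Im l<..<Im u} else {Re l<..<Re u}"
  let ?Y = "if sw then {Re l<..<Re u} else {Im l<..<Im u}"
  have "(\<lambda>(x, y). plane sw x y) -` box l u \<inter> space (lborel \<Otimes>\<^sub>M lborel) = ?X \<times> ?Y"
    by (auto simp: box_def Basis_complex_def plane_def space_pair_measure)
  moreover have "emeasure (lborel \<Otimes>\<^sub>M lborel) (?X \<times> ?Y) = emeasure lborel ?X * emeasure lborel ?Y"
    by (intro lborel.emeasure_pair_measure_Times) auto
  ultimately show "emeasure (distr (lborel \<Otimes>\<^sub>M lborel) borel (\<lambda>(x, y). plane sw x y)) (box l u) = (\<Prod>b\<in>Basis. (u - l) \<bullet> b)"
    using l by (subst emeasure_distr)
      (auto simp: Basis_complex_def ennreal_mult[symmetric] mult.commute)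
qed simp

lemma borel_measurable_indicator_disk:
  fixes g :: "complex \<Rightarrow> 'b::{banach,second_countable_topology}"
  shows "g \<in> borel_measurable borel \<Longrightarrow> (\<lambda>z. indicator (ball 0 1) z *\<^sub>R g z) \<in> borel_measurable borel"
  by (intro borel_measurable_scaleR borel_measurable_indicator) auto

lemma LINT_disk_lborel:
  fixes g :: "complex \<Rightarrow> 'b::{banach,second_countable_topology}"
  assumes "g \<in> borel_measurable borel"
  shows "(LINT z|disk. g z) = (LINT z|lborel. indicator (ball 0 1) z *\<^sub>R g z)"
  using assms by (subst integral_restrict_space) (auto intro!: integral_completion borel_measurable_indicator_disk)

lemma integrable_lborel_disk:
  fixes g :: "complex \<Rightarrow> complex"
  assumes "continuous_on UNIV g"
  shows "integrable lborel (\<lambda>z. indicator (ball 0 1) z *\<^sub>R g z)"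
proof (rule Bochner_Integration.integrable_bound)
  show "integrable lborel (\<lambda>z. indicator (cball 0 1) z *\<^sub>R g z)"
    by (intro borel_integrable_compact continuous_on_subset[OF assms]) auto
  have "g \<in> borel_measurable borel" using assms by (rule borel_measurable_continuous_onI)
  then show "(\<lambda>z. indicator (ball 0 1) z *\<^sub>R g z) \<in> borel_measurable lborel"
    by (simp add: borel_measurable_indicator_disk)
qed (auto split: split_indicator)

text \<open>Fubini's theorem on the open disk: \<open>y\<close> selects a chord and \<open>x\<close>
  runs along it. The end points are null sets, which permits closed intervals in the result.\<close>

lemma LINT_disk_iterated:
  fixes g :: "complex \<Rightarrow> complex"
  assumes g: "continuous_on UNIV g"
  shows "(LINT z|disk. g z) =
    integral {-1..1} (\<lambda>y. integral {- sqrt (1 - y\<^sup>2)..sqrt (1 - y\<^sup>2)} (\<lambda>x. g (plane sw x y)))"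
proof -
  let ?f = "\<lambda>z. indicator (ball 0 1) z *\<^sub>R g z"
  have gm [measurable]: "g \<in> borel_measurable borel" using g by (rule borel_measurable_continuous_onI)
  have fm: "?f \<in> borel_measurable borel" by (intro borel_measurable_indicator_disk gm)
  have int: "integrable (lborel \<Otimes>\<^sub>M lborel) (\<lambda>(x, y). ?f (plane sw x y))"
    using integrable_lborel_disk[OF g] fm unfolding lborel_plane[of sw]
    by (subst (asm) integrable_distr_eq) (auto simp: case_prod_beta')
  have "(LINT z|disk. g z) = (LINT z|lborel. ?f z)" by (rule LINT_disk_lborel[OF gm])
  also have "\<dots> = (LINT p|(lborel \<Otimes>\<^sub>M lborel). (\<lambda>(x, y). ?f (plane sw x y)) p)"
    by (subst lborel_plane[of sw], subst integral_distr) (use fm in \<open>auto simp: case_prod_beta'\<close>)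
  also have "\<dots> = (LINT y|lborel. LINT x|lborel. ?f (plane sw x y))"
    by (rule lborel_pair.integral_snd[OF int, symmetric])
  finally have 1: "(LINT z|disk. g z) = (LINT y|lborel. LINT x|lborel. ?f (plane sw x y))" .
  have int2: "integrable lborel (\<lambda>y. LINT x|lborel. ?f (plane sw x y))"
    by (rule lborel_pair.integrable_snd[OF int])
  define I where "I y = integral {- sqrt (1 - y\<^sup>2)..sqrt (1 - y\<^sup>2)} (\<lambda>x. g (plane sw x y))" for y
  have inner: "(LINT x|lborel. ?f (plane sw x y)) = indicator {-1<..<1} y *\<^sub>R I y" for y
  proof (cases "\<bar>y\<bar> < 1")
    case True
    let ?c = "sqrt (1 - y\<^sup>2)"
    have y2: "y\<^sup>2 < 1" using True by (simp add: abs_square_less_1)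
    have "?f (plane sw x y) = indicator {- ?c<..<?c} x *\<^sub>R g (plane sw x y)" for x
    proof -
      have "plane sw x y \<in> ball 0 1 \<longleftrightarrow> \<bar>x\<bar> < ?c"
        using y2 real_sqrt_less_iff[of "x\<^sup>2" "1 - y\<^sup>2"]
        by (simp add: norm_plane real_sqrt_lt_1_iff algebra_simps)
      then show ?thesis by (auto simp: indicator_def abs_less_iff)
    qed
    then have "(LINT x|lborel. ?f (plane sw x y)) = (LINT x:{- ?c<..<?c}|lborel. g (plane sw x y))"
      unfolding set_lebesgue_integral_def by (simp only:)
    also have "\<dots> = integral {- ?c<..<?c} (\<lambda>x. g (plane sw x y))"
    proof (rule set_borel_integral_eq_integral)
      have "set_integrable lborel {- ?c..?c} (\<lambda>x. g (plane sw x y))"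
        unfolding set_integrable_def
        by (intro borel_integrable_compact continuous_on_compose2[OF g] continuous_plane continuous_intros) auto
      then show "set_integrable lborel {- ?c<..<?c} (\<lambda>x. g (plane sw x y))"
        by (rule set_integrable_subset) auto
    qed
    also have "\<dots> = I y" unfolding I_def by (rule integral_open_interval_real[symmetric])
    finally show ?thesis using True by (simp add: indicator_def abs_less_iff)
  next
    case False
    then have "1 \<le> y\<^sup>2" using abs_square_less_1[of y] by linarith
    then have "1 \<le> x\<^sup>2 + y\<^sup>2" for x by (simp add: add_increasing)
    then have "plane sw x y \<notin> ball 0 1" for x by (simp add: norm_plane not_less)
    then show ?thesis using False by (auto simp: indicator_def abs_less_iff)
  qed
  have "(LINT z|disk. g z) = (LINT y:{-1<..<1}|lborel. I y)"
    unfolding 1 inner by (simp add: set_lebesgue_integral_def)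
  also have "\<dots> = integral {-1<..<1} I"
    using int2 unfolding inner by (intro set_borel_integral_eq_integral) (simp add: set_integrable_def)
  also have "\<dots> = integral {-1..1} I" by (rule integral_open_interval_real[symmetric])
  finally show ?thesis unfolding I_def .
qed

lemma dir_deriv_plane:
  assumes "smooth (F :: complex \<Rightarrow> complex)"
  shows "((\<lambda>x. F (plane sw x y)) has_vector_derivative dir_deriv (dir1 sw) F (plane sw x y)) (at x)"
proof -
  have p: "((\<lambda>x. plane sw x y) has_vector_derivative dir1 sw) (at x)"
    by (cases sw) (auto simp: plane_def dir1_def has_vector_derivative_complex_iff intro!: derivative_eq_intros)
  show ?thesis
    using has_derivative_compose[OF p[unfolded has_vector_derivative_def] has_derivative_complex_dirs[OF assms]]
    by (cases sw) (auto simp: has_vector_derivative_def o_def dir1_def)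
qed

lemma smooth_dir1: "smooth F \<Longrightarrow> smooth (dir_deriv (dir1 sw) F)"
  by (rule smooth_dir_deriv) (auto simp: dir1_def Basis_complex_def)

text \<open>The fundamental theorem of calculus along each chord leaves the difference of
  \<open>F\<close> at its two end points; the substitution y = sin t then parametrizes these end
  points by two half circles.\<close>

lemma LINT_disk_dir_deriv_aux:
  fixes F :: "complex \<Rightarrow> complex"
  assumes F: "smooth F"
  shows "((\<lambda>t. cos t *\<^sub>R (F (plane sw (cos t) (sin t)) - F (plane sw (- cos t) (sin t))))
    has_integral (LINT z|disk. dir_deriv (dir1 sw) F z)) {-(pi/2)..pi/2}"
proof -
  define J where "J y = F (plane sw (sqrt (1 - y\<^sup>2)) y) - F (plane sw (- sqrt (1 - y\<^sup>2)) y)" for y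
  have cF: "continuous_on UNIV F" by (rule smooth_continuous[OF F])
  have "integral {- sqrt (1 - y\<^sup>2)..sqrt (1 - y\<^sup>2)} (\<lambda>x. dir_deriv (dir1 sw) F (plane sw x y)) = J y"
    if "y \<in> {-1..1}" for y
  proof -
    have y: "y\<^sup>2 \<le> 1" using that by (simp add: abs_square_le_1 abs_le_iff)
    have "((\<lambda>x. dir_deriv (dir1 sw) F (plane sw x y)) has_integral J y) {- sqrt (1 - y\<^sup>2)..sqrt (1 - y\<^sup>2)}"
      unfolding J_def
      by (rule FTC_at[where f="\<lambda>x. F (plane sw x y)"], use y in simp, rule dir_deriv_plane[OF F])
    then show ?thesis by (rule integral_unique)
  qed
  then have "(LINT z|disk. dir_deriv (dir1 sw) F z) = integral {-1..1} J"
    by (subst LINT_disk_iterated[where sw=sw]) (auto intro!: integral_cong smooth_continuous smooth_dir1 F)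
  moreover have "((\<lambda>t. cos t *\<^sub>R J (sin t)) has_integral integral {sin (-(pi/2))..sin (pi/2)} J) {-(pi/2)..pi/2}"
  proof (rule has_integral_substitution)
    show "continuous_on {-1..1} J" unfolding J_def
      by (intro continuous_intros continuous_on_compose2[OF cF] continuous_plane) (auto simp: abs_square_le_1 abs_le_iff)
    show "(sin has_real_derivative cos x) (at x within {-(pi/2)..pi/2})" for x
      by (intro derivative_eq_intros) auto
  qed auto
  ultimately have "((\<lambda>t. cos t *\<^sub>R J (sin t)) has_integral (LINT z|disk. dir_deriv (dir1 sw) F z)) {-(pi/2)..pi/2}"
    by simp
  then show ?thesis
  proof (rule has_integral_eq[rotated])
    fix t assume t: "t \<in> {-(pi/2)..pi/2}"
    then have "cos t \<ge> 0" by (intro cos_ge_zero) auto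
    then have "sqrt (1 - (sin t)\<^sup>2) = cos t" by (simp add: cos_squared_eq[symmetric])
    then show "cos t *\<^sub>R J (sin t) = cos t *\<^sub>R (F (plane sw (cos t) (sin t)) - F (plane sw (- cos t) (sin t)))"
      by (simp add: J_def)
  qed
qed

text \<open>The interval is twice as long as the period, so the arguments pi - t and 2 pi + t that
  occur below stay inside it. Integrals over arcs become differences of values of
  \<open>K\<close>.\<close>

lemma periodic_antiderivative:
  fixes k :: "real \<Rightarrow> complex"
  assumes k: "continuous_on UNIV k"
  obtains K where "\<And>x. x \<in> {-(2*pi)<..<2*pi} \<Longrightarrow> (K has_vector_derivative k x) (at x)"
    "(LINT x|circ. k x) = K pi - K (-pi)"
proof -
  from antiderivative_continuous[OF continuous_on_subset[OF k subset_UNIV], of "-(2*pi)" "2*pi"]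
  obtain K where K: "\<And>x. x \<in> {-(2*pi)..2*pi} \<Longrightarrow> (K has_vector_derivative k x) (at x within {-(2*pi)..2*pi})"
    by blast
  have K': "(K has_vector_derivative k x) (at x)" if "x \<in> {-(2*pi)<..<2*pi}" for x
    using K[of x] that at_within_Icc_at[of "-(2*pi)" x "2*pi"] by auto
  have "(k has_integral K pi - K (-pi)) {-pi..pi}"
  proof (rule FTC_at)
    show "- pi \<le> pi" using pi_gt_zero by linarith
    fix x assume "x \<in> {-pi..pi}"
    then have "x \<in> {-(2*pi)<..<2*pi}" using pi_gt_zero
      unfolding atLeastAtMost_iff greaterThanLessThan_iff by linarith
    then show "(K has_vector_derivative k x) (at x)" by (rule K')
  qed
  then have "(LINT x|circ. k x) = K pi - K (-pi)"
    by (subst lebesgue_integral_eq_integral) (auto intro: integrable_circ_continuous k simp: integral_unique)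
  then show thesis using that[of K] K' by blast
qed

lemma has_vector_derivative_shift:
  assumes "(K has_vector_derivative k (c + d * x)) (at (c + d * x))"
  shows "((\<lambda>x. K (c + d * x)) has_vector_derivative d *\<^sub>R k (c + d * x)) (at x)"
proof -
  have "((\<lambda>x. c + d * x) has_vector_derivative d) (at x)"
    by (auto intro!: derivative_eq_intros simp: has_real_derivative_iff_has_vector_derivative[symmetric])
  from vector_diff_chain_at[OF this assms] show ?thesis by (simp add: o_def)
qed

lemma divergence_disk_1:
  fixes F :: "complex \<Rightarrow> complex"
  assumes F: "smooth F"
  shows "(LINT z|disk. dir_deriv 1 F z) = (LINT t|circ. F (cis t) * cos t)"
proof -
  define k where "k t = F (cis t) * cos t" for t
  have cF: "continuous_on UNIV F" by (rule smooth_continuous[OF F])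
  have ck: "continuous_on S k" for S unfolding k_def
    by (intro continuous_intros continuous_on_compose2[OF cF]) (auto intro: continuous_intros)
  obtain K where K: "\<And>x. x \<in> {-(2*pi)<..<2*pi} \<Longrightarrow> (K has_vector_derivative k x) (at x)"
    and I: "(LINT x|circ. k x) = K pi - K (-pi)"
    using periodic_antiderivative[OF ck] by blast
  have per: "k (x + 2 * pi) = k x" for x by (simp add: k_def cis_mult[symmetric])
  \<comment> \<open>The half circles t and pi - t together cover the arc from -pi/2 to 3 pi/2 and
    not the interval of \<open>circ\<close>. By periodicity the piece from pi to 3 pi/2 contributes
    the same as the one from -pi to -pi/2, which is the content of \<open>E\<close>.\<close>
  have "((\<lambda>t. 1 *\<^sub>R k (2 * pi + 1 * t)) has_integral K (2 * pi + 1 * (-(pi/2))) - K (2 * pi + 1 * (-pi))) {-pi..-(pi/2)}"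
  proof (rule FTC_at[where f="\<lambda>t. K (2 * pi + 1 * t)"])
    show "-pi \<le> -(pi/2)" using pi_gt_zero by linarith
    fix t assume "t \<in> {-pi..-(pi/2)}"
    then have t: "-pi \<le> t" "t \<le> -(pi/2)" by auto
    have r: "2 * pi + 1 * t \<in> {-(2*pi)<..<2*pi}" using t pi_gt_zero
      unfolding greaterThanLessThan_iff by linarith
    show "((\<lambda>t. K (2 * pi + 1 * t)) has_vector_derivative 1 *\<^sub>R k (2 * pi + 1 * t)) (at t)"
      by (rule has_vector_derivative_shift[of K k "2 * pi" 1 t, OF K[OF r]])
  qed
  moreover have "(k has_integral K (-(pi/2)) - K (-pi)) {-pi..-(pi/2)}"
  proof (rule FTC_at[where f="K"])
    show "-pi \<le> -(pi/2)" using pi_gt_zero by linarith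
    fix t assume "t \<in> {-pi..-(pi/2)}"
    then have t: "-pi \<le> t" "t \<le> -(pi/2)" by auto
    have r: "t \<in> {-(2*pi)<..<2*pi}" using t pi_gt_zero
      unfolding greaterThanLessThan_iff by linarith
    show "(K has_vector_derivative k t) (at t)" by (rule K[OF r])
  qed
  ultimately have E: "K (2 * pi + 1 * (-(pi/2))) - K (2 * pi + 1 * (-pi)) = K (-(pi/2)) - K (-pi)"
    using per by (auto simp: add.commute intro: has_integral_unique)
  have A: "((\<lambda>t. k t - (-1) *\<^sub>R k (pi + (-1) * t)) has_integral
     (K (pi/2) - K (pi + (-1) * (pi/2))) - (K (-(pi/2)) - K (pi + (-1) * (-(pi/2))))) {-(pi/2)..pi/2}"
  proof (rule FTC_at[where f="\<lambda>t. K t - K (pi + (-1) * t)"])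
    show "-(pi/2) \<le> pi/2" using pi_gt_zero by linarith
    fix t assume "t \<in> {-(pi/2)..pi/2}"
    then have t: "-(pi/2) \<le> t" "t \<le> pi/2" by auto
    have r: "t \<in> {-(2*pi)<..<2*pi}" using t pi_gt_zero
      unfolding greaterThanLessThan_iff by linarith
    have r': "pi + (-1) * t \<in> {-(2*pi)<..<2*pi}" using t pi_gt_zero
      unfolding greaterThanLessThan_iff by linarith
    show "((\<lambda>t. K t - K (pi + (-1) * t)) has_vector_derivative k t - (-1) *\<^sub>R k (pi + (-1) * t)) (at t)"
      by (rule has_vector_derivative_diff[OF K[OF r] has_vector_derivative_shift[of K k pi "-1" t, OF K[OF r']]])
  qed
  \<comment> \<open>The end point with first coordinate \<open>- cos t\<close> is the point of the
    circle at the angle pi - t.\<close>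
  have B: "(\<lambda>t. cos t *\<^sub>R (F (plane False (cos t) (sin t)) - F (plane False (- cos t) (sin t)))) = (\<lambda>t. k t - (-1) *\<^sub>R k (pi + (-1) * t))"
    by (auto simp: k_def plane_def cis.ctr scaleR_conv_of_real algebra_simps)
  have "(LINT z|disk. dir_deriv (dir1 False) F z) = (K (pi/2) - K (pi + (-1) * (pi/2))) - (K (-(pi/2)) - K (pi + (-1) * (-(pi/2))))"
    by (rule has_integral_unique[OF LINT_disk_dir_deriv_aux[OF F, of False, unfolded B] A])
  also have "\<dots> = K pi - K (-pi)" using E by (simp add: algebra_simps)
  finally show ?thesis using I by (simp add: k_def dir1_def)
qed

lemma divergence_disk_ii:
  fixes F :: "complex \<Rightarrow> complex"
  assumes F: "smooth F"
  shows "(LINT z|disk. dir_deriv \<i> F z) = (LINT t|circ. F (cis t) * sin t)"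
proof -
  define k where "k t = F (cis t) * sin t" for t
  have cF: "continuous_on UNIV F" by (rule smooth_continuous[OF F])
  have ck: "continuous_on S k" for S unfolding k_def
    by (intro continuous_intros continuous_on_compose2[OF cF]) (auto intro: continuous_intros)
  obtain K where K: "\<And>x. x \<in> {-(2*pi)<..<2*pi} \<Longrightarrow> (K has_vector_derivative k x) (at x)"
    and I: "(LINT x|circ. k x) = K pi - K (-pi)"
    using periodic_antiderivative[OF ck] by blast
  \<comment> \<open>With vertical chords the two half circles are -pi/2 + t and pi/2 - t. They cover
    the interval from -pi to pi exactly, so no shift by a period occurs here.\<close>
  have A: "((\<lambda>t. 1 *\<^sub>R k (-(pi/2) + 1 * t) - (-1) *\<^sub>R k (pi/2 + (-1) * t)) has_integral
     (K (-(pi/2) + 1 * (pi/2)) - K (pi/2 + (-1) * (pi/2))) - (K (-(pi/2) + 1 * (-(pi/2))) - K (pi/2 + (-1) * (-(pi/2))))) {-(pi/2)..pi/2}"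
  proof (rule FTC_at[where f="\<lambda>t. K (-(pi/2) + 1 * t) - K (pi/2 + (-1) * t)"])
    show "-(pi/2) \<le> pi/2" using pi_gt_zero by linarith
    fix t assume "t \<in> {-(pi/2)..pi/2}"
    then have t: "-(pi/2) \<le> t" "t \<le> pi/2" by auto
    have r: "-(pi/2) + 1 * t \<in> {-(2*pi)<..<2*pi}" using t pi_gt_zero
      unfolding greaterThanLessThan_iff by linarith
    have r': "pi/2 + (-1) * t \<in> {-(2*pi)<..<2*pi}" using t pi_gt_zero
      unfolding greaterThanLessThan_iff by linarith
    show "((\<lambda>t. K (-(pi/2) + 1 * t) - K (pi/2 + (-1) * t)) has_vector_derivative 1 *\<^sub>R k (-(pi/2) + 1 * t) - (-1) *\<^sub>R k (pi/2 + (-1) * t)) (at t)"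
      by (rule has_vector_derivative_diff[OF has_vector_derivative_shift[of K k "-(pi/2)" 1 t, OF K[OF r]] has_vector_derivative_shift[of K k "pi/2" "-1" t, OF K[OF r']]])
  qed
  have B: "cos t *\<^sub>R (F (plane True (cos t) (sin t)) - F (plane True (- cos t) (sin t))) = 1 *\<^sub>R k (-(pi/2) + 1 * t) - (-1) *\<^sub>R k (pi/2 + (-1) * t)" for t
  proof -
    have "cis (-(pi/2) + t) = Complex (sin t) (- cos t)" "cis (pi/2 - t) = Complex (sin t) (cos t)"
      "sin (-(pi/2) + t) = - cos t" "sin (pi/2 - t) = cos t"
      by (simp_all add: complex_eq_iff sin_add cos_add cos_diff sin_diff)
    then show ?thesis
      by (simp add: k_def plane_def scaleR_conv_of_real algebra_simps)
  qed
  have "(LINT z|disk. dir_deriv (dir1 True) F z) = (K (-(pi/2) + 1 * (pi/2)) - K (pi/2 + (-1) * (pi/2))) - (K (-(pi/2) + 1 * (-(pi/2))) - K (pi/2 + (-1) * (-(pi/2))))"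
    by (rule has_integral_unique[OF LINT_disk_dir_deriv_aux[OF F, of True, unfolded B] A])
  also have "\<dots> = K pi - K (-pi)" by (simp add: algebra_simps)
  finally show ?thesis using I by (simp add: k_def dir1_def)
qed

section \<open>Gradients and harmonic modes\<close>

definition grad :: "(complex \<Rightarrow> complex) \<Rightarrow> complex \<Rightarrow> complex \<times> complex" where
  "grad v z = (dir_deriv 1 v z, dir_deriv \<i> v z)"

text \<open>Bilinear, not Hermitian, because the weak formulation pairs gradients without
  conjugation. Norms arise by pairing with \<open>cnjp\<close>.\<close>

definition dot :: "complex \<times> complex \<Rightarrow> complex \<times> complex \<Rightarrow> complex" where
  "dot a b = fst a * fst b + snd a * snd b"

lemma dot_commute: "dot a b = dot b a" by (simp add: dot_def mult.commute)
lemma dot_add_left: "dot (a + b) c = dot a c + dot b c" by (simp add: dot_def algebra_simps)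
lemma dot_add_right: "dot c (a + b) = dot c a + dot c b" by (simp add: dot_def algebra_simps)
lemma dot_diff_left: "dot (a - b) c = dot a c - dot b c" by (simp add: dot_def algebra_simps)
lemma dot_diff_right: "dot c (a - b) = dot c a - dot c b" by (simp add: dot_def algebra_simps)
lemma dot_zero_left [simp]: "dot 0 c = 0" by (simp add: dot_def)

lemma norm_dot_le: "cmod (dot a b) \<le> norm a * norm b"
proof -
  obtain a1 a2 b1 b2 where ab: "a = (a1, a2)" "b = (b1, b2)" by (cases a, cases b) auto
  have "cmod (dot a b) \<le> cmod a1 * cmod b1 + cmod a2 * cmod b2"
    unfolding ab dot_def by (simp add: norm_triangle_mono norm_mult)
  also have "\<dots> = inner (cmod a1, cmod a2) (cmod b1, cmod b2)" by simp
  also have "\<dots> \<le> norm (cmod a1, cmod a2) * norm (cmod b1, cmod b2)" by (rule norm_cauchy_schwarz)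
  also have "\<dots> = norm a * norm b" unfolding ab by (simp add: norm_Pair)
  finally show ?thesis .
qed

definition cnjp :: "complex \<times> complex \<Rightarrow> complex \<times> complex" where "cnjp a = (cnj (fst a), cnj (snd a))"

lemma norm_cnjp [simp]: "norm (cnjp a) = norm a"
  by (cases a) (simp add: cnjp_def norm_Pair)

lemma dot_cnjp: "dot a (cnjp a) = complex_of_real ((norm a)\<^sup>2)"
  by (cases a) (simp add: dot_def cnjp_def norm_Pair complex_norm_square flip: of_real_power)

lemma finite_measure_disk: "finite_measure disk"
  by (rule finite_measure_lebesgue_on) simp

lemma sets_ball_lebesgue: "ball 0 1 \<in> sets (lebesgue :: complex measure)" by simp

lemma L2s_disk_bounded:
  fixes f :: "complex \<Rightarrow> 'b::euclidean_space"
  assumes "f \<in> borel_measurable disk" "AE z in disk. norm (f z) \<le> B"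
  shows "f \<in> L2s disk"
proof -
  have "integrable disk (\<lambda>z. (norm (f z))\<^sup>2)"
  proof (rule finite_measure.integrable_const_bound[OF finite_measure_disk])
    show "AE z in disk. norm ((norm (f z))\<^sup>2) \<le> B\<^sup>2"
      using assms(2) by eventually_elim (simp add: power_mono)
  qed (use assms(1) in measurable)
  then show ?thesis using assms(1) by (simp add: L2s_def)
qed

lemma continuous_disk_bounded:
  fixes f :: "complex \<Rightarrow> 'b::euclidean_space"
  assumes "continuous_on UNIV f"
  obtains B where "B \<ge> 0" "\<And>z. z \<in> ball 0 1 \<Longrightarrow> norm (f z) \<le> B"
proof -
  have "bounded (f ` cball 0 1)"
    by (intro compact_imp_bounded compact_continuous_image continuous_on_subset[OF assms]) auto
  then obtain B where "\<forall>y\<in>f ` cball 0 1. norm y \<le> B" unfolding bounded_iff by blast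
  then have B: "\<And>z. z \<in> ball 0 1 \<Longrightarrow> norm (f z) \<le> B" by auto
  moreover have "norm (f 0) \<le> B" using B[of 0] by simp
  then have "B \<ge> 0" using norm_ge_zero order_trans by blast
  ultimately show thesis using that by blast
qed

lemma measurable_disk_continuous:
  "continuous_on UNIV f \<Longrightarrow> f \<in> borel_measurable disk"
  by (intro continuous_imp_measurable_on_sets_lebesgue sets_ball_lebesgue) (rule continuous_on_subset, auto)

lemma L2s_disk_continuous:
  fixes f :: "complex \<Rightarrow> 'b::euclidean_space"
  assumes "continuous_on UNIV f"
  shows "f \<in> L2s disk"
proof -
  obtain B where "B \<ge> 0" "\<And>z. z \<in> ball 0 1 \<Longrightarrow> norm (f z) \<le> B" by (rule continuous_disk_bounded[OF assms]) blast
  then show ?thesis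
    by (intro L2s_disk_bounded[where B=B] measurable_disk_continuous assms AE_I2) (simp add: space_restrict_space)
qed

lemma L2s_circ_continuous:
  fixes f :: "real \<Rightarrow> complex"
  assumes "continuous_on UNIV f"
  shows "f \<in> L2s circ"
  unfolding L2s_def using assms
  by (auto intro!: borel_measurable_integrable integrable_circ_continuous continuous_intros)

lemma smooth_dirs: "smooth v \<Longrightarrow> smooth (dir_deriv 1 (v :: complex \<Rightarrow> complex))"
  "smooth v \<Longrightarrow> smooth (dir_deriv \<i> (v :: complex \<Rightarrow> complex))"
  by (auto intro: smooth_dir_deriv simp: Basis_complex_def)

lemma continuous_grad: "smooth v \<Longrightarrow> continuous_on S (grad v)"
  unfolding grad_def[abs_def] by (intro continuous_on_Pair smooth_continuous smooth_dirs)

lemma L2s_grad: "smooth v \<Longrightarrow> grad v \<in> L2s disk"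
  by (rule L2s_disk_continuous[OF continuous_grad])

lemma L2s_smooth: "smooth v \<Longrightarrow> v \<in> L2s disk"
  for v :: "complex \<Rightarrow> complex"
  by (rule L2s_disk_continuous[OF smooth_continuous])

lemma continuous_cis_comp: "smooth (v :: complex \<Rightarrow> complex) \<Longrightarrow> continuous_on S (\<lambda>t. v (cis t))"
  by (rule smooth_continuous[OF smooth_cis_comp])

lemma grad_add: "smooth v \<Longrightarrow> smooth w \<Longrightarrow> grad (\<lambda>z. v z + w z) z = grad v z + grad w z"
  by (simp add: grad_def dir_deriv_add smooth_differentiable)

lemma dir_deriv_cmult: "smooth v \<Longrightarrow> dir_deriv b (\<lambda>z. c * v z) z = c * dir_deriv b v z"
  for v :: "complex \<Rightarrow> complex"
  by (subst dir_deriv_mult) (auto simp: smooth_differentiable dir_deriv_const)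

lemma grad_cmult: "smooth v \<Longrightarrow> grad (\<lambda>z. c * v z) z = (c * fst (grad v z), c * snd (grad v z))"
  by (simp add: grad_def dir_deriv_cmult)

lemma grad_diff: "smooth v \<Longrightarrow> smooth w \<Longrightarrow> grad (\<lambda>z. v z - w z) z = grad v z - grad w z"
  using grad_add[of v "\<lambda>z. -1 * w z" z] grad_cmult[of w "-1" z] smooth_cmult[of w "-1"]
  by (simp add: prod_eq_iff)

lemma grad_cnj: "smooth v \<Longrightarrow> grad (\<lambda>z. cnj (v z)) z = cnjp (grad v z)"
  by (simp add: grad_def cnjp_def dir_deriv_cnj smooth_differentiable)

lemma grad_const: "grad (\<lambda>_. c) z = 0"
  by (simp add: grad_def dir_deriv_const zero_prod_def)

lemma grad_sum:
  assumes "\<And>i. i \<in> I \<Longrightarrow> smooth (f i)"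
  shows "grad (\<lambda>z. \<Sum>i\<in>I. f i z) z = (\<Sum>i\<in>I. grad (f i) z)"
  using assms by (induction I rule: infinite_finite_induct) (auto simp: grad_const grad_add smooth_sum)

section \<open>Integrals of products of square-integrable fields\<close>

lemma measurable_dot [measurable]:
  assumes [measurable]: "U \<in> borel_measurable N" "V \<in> borel_measurable N"
  shows "(\<lambda>x. dot (U x) (V x)) \<in> borel_measurable N"
  unfolding dot_def
  by (intro borel_measurable_add borel_measurable_times
    measurable_compose[OF _ borel_measurable_continuous_onI[OF continuous_on_fst[OF continuous_on_id]]]
    measurable_compose[OF _ borel_measurable_continuous_onI[OF continuous_on_snd[OF continuous_on_id]]] assms)

lemma LINT_dot:
  assumes U: "U \<in> L2s N" and V: "V \<in> L2s N" and b: "b \<in> borel_measurable N" "AE x in N. cmod (b x) \<le> B"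
  shows "integrable N (\<lambda>x. b x * dot (U x) (V x))"
    "B \<ge> 0 \<Longrightarrow> cmod (LINT x|N. b x * dot (U x) (V x)) \<le> B * L2n N U * L2n N V"
proof -
  have le: "AE x in N. cmod (b x * dot (U x) (V x)) \<le> B * (norm (U x) * norm (V x))"
    using b(2)
  proof eventually_elim
    case (elim x)
    then show ?case unfolding norm_mult by (rule mult_mono[OF _ norm_dot_le]) (auto intro: order_trans[OF norm_ge_zero elim])
  qed
  have i: "integrable N (\<lambda>x. B * (norm (U x) * norm (V x)))"
    using L2_integrable_mult[OF U V] by simp
  show "integrable N (\<lambda>x. b x * dot (U x) (V x))"
  proof (rule Bochner_Integration.integrable_bound[OF i])
    show "(\<lambda>x. b x * dot (U x) (V x)) \<in> borel_measurable N"
      using b(1) L2s_measurable[OF U] L2s_measurable[OF V] by measurable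
    show "AE x in N. norm (b x * dot (U x) (V x)) \<le> norm (B * (norm (U x) * norm (V x)))"
      using le by eventually_elim (auto intro: order_trans[OF _ abs_ge_self])
  qed
  assume "B \<ge> 0"
  have "cmod (LINT x|N. b x * dot (U x) (V x)) \<le> (LINT x|N. B * (norm (U x) * norm (V x)))"
    by (rule LINT_norm_bound[OF i le])
  also have "\<dots> \<le> B * (L2n N U * L2n N V)"
    using L2_Cauchy_Schwarz[OF U V] \<open>B \<ge> 0\<close> by (simp add: mult_left_mono)
  finally show "cmod (LINT x|N. b x * dot (U x) (V x)) \<le> B * L2n N U * L2n N V" by (simp add: mult.assoc)
qed

lemma LINT_dot1:
  assumes U: "U \<in> L2s N" and V: "V \<in> L2s N"
  shows "integrable N (\<lambda>x. dot (U x) (V x))" "cmod (LINT x|N. dot (U x) (V x)) \<le> L2n N U * L2n N V"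
  using LINT_dot[OF U V, of "\<lambda>_. 1" 1] by auto

lemma LINT_times:
  fixes f g :: "'a \<Rightarrow> complex"
  assumes f: "f \<in> L2s N" and g: "g \<in> L2s N"
  shows "integrable N (\<lambda>x. f x * g x)" "cmod (LINT x|N. f x * g x) \<le> L2n N f * L2n N g"
proof -
  \<comment> \<open>Scalars are treated as pairs with second entry 0, which reduces the claim to the
    one for \<open>dot\<close>.\<close>
  have F: "(\<lambda>x. (f x, 0::complex)) \<in> L2s N" "(\<lambda>x. (g x, 0::complex)) \<in> L2s N"
    using f g by (auto simp: L2s_def norm_Pair intro!: borel_measurable_Pair)
  show "integrable N (\<lambda>x. f x * g x)" "cmod (LINT x|N. f x * g x) \<le> L2n N f * L2n N g"
    using LINT_dot1[OF F] by (auto simp: dot_def L2n_def norm_Pair)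
qed

lemma L2n_cnjp: "L2n N (\<lambda>x. cnjp (U x)) = L2n N U"
  by (simp add: L2n_def)

lemma LINT_dot_cnjp: "(LINT x|N. dot (U x) (cnjp (U x))) = complex_of_real ((L2n N U)\<^sup>2)"
  by (simp add: dot_cnjp L2n_sq del: of_real_power)

text \<open>The flag selects z or its conjugate, so that the harmonic extensions of modes of either
  sign are powers of one expression and share their proofs.\<close>

definition zc :: "bool \<Rightarrow> complex \<Rightarrow> complex" where "zc s z = (if s then z else cnj z)"

lemma zc_mult: "zc s (z * w) = zc s z * zc s w" by (simp add: zc_def)
lemma zc_add: "zc s (z + w) = zc s z + zc s w" by (simp add: zc_def)
lemma zc_of_real [simp]: "zc s (of_real x) = of_real x" by (simp add: zc_def)
lemma zc_1 [simp]: "zc s 1 = 1" by (simp add: zc_def)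
lemma norm_zc [simp]: "cmod (zc s z) = cmod z" by (simp add: zc_def)
lemma zc_ii: "zc s \<i> * zc s \<i> = -1" by (simp add: zc_def)
lemma bounded_linear_zc: "bounded_linear (zc s)"
  by (cases s) (simp_all add: zc_def[abs_def] bounded_linear_ident bounded_linear_cnj)
lemma smooth_zc: "smooth (zc s)" by (rule smooth_linear[OF bounded_linear_zc])

text \<open>For m = 0 the exponent m - 1 is truncated to 0, which does no harm because the factor m
  vanishes.\<close>

lemma dir_deriv_zc_power:
  "dir_deriv b (\<lambda>z. zc s z ^ m) z = of_nat m * zc s z ^ (m - 1) * zc s b"
proof (induction m)
  case (Suc m)
  have "dir_deriv b (\<lambda>z. zc s z * zc s z ^ m) z = zc s z * (of_nat m * zc s z ^ (m - 1) * zc s b) + zc s b * zc s z ^ m"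
    by (subst dir_deriv_mult)
       (auto simp: Suc dir_deriv_linear[OF bounded_linear_zc] intro!: smooth_differentiable smooth_zc smooth_power)
  also have "\<dots> = of_nat (Suc m) * zc s z ^ m * zc s b"
    by (cases m) (auto simp: algebra_simps)
  finally show ?case by simp
qed (simp add: dir_deriv_const)

definition harm_mode :: "int \<Rightarrow> complex \<Rightarrow> complex" where
  "harm_mode n z = zc (n \<ge> 0) z ^ nat \<bar>n\<bar>"

lemma smooth_harm: "smooth (harm_mode n)"
  unfolding harm_mode_def[abs_def] by (intro smooth_power smooth_zc)

lemma harm_cis: "harm_mode n (cis t) = fmode n t"
  by (auto simp: harm_mode_def zc_def fmode_eq_cis cis_cnj DeMoivre Complex.DeMoivre)

lemma cnj_harm: "cnj (harm_mode n z) = harm_mode (- n) z"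
  by (cases "n = 0") (auto simp: harm_mode_def zc_def)

lemma grad_harm:
  "grad (harm_mode n) z = (of_int \<bar>n\<bar> * zc (n \<ge> 0) z ^ (nat \<bar>n\<bar> - 1), of_int \<bar>n\<bar> * zc (n \<ge> 0) z ^ (nat \<bar>n\<bar> - 1) * zc (n \<ge> 0) \<i>)"
  unfolding grad_def harm_mode_def[abs_def] dir_deriv_zc_power by (simp add: of_nat_nat)

text \<open>Since \<open>harm_mode n\<close> is harmonic, the integrand is the divergence of \<phi>
  times its gradient. On the circle the exterior normal derivative of \<open>harm_mode n\<close> is
  |n| times \<open>fmode n\<close>, and the divergence theorem gives the right-hand side.\<close>

lemma Green_harm:
  assumes \<phi>: "smooth \<phi>" and n: "n \<noteq> 0"
  shows "(LINT z|disk. dot (grad \<phi> z) (grad (harm_mode n) z)) = of_int \<bar>n\<bar> * (LINT t|circ. \<phi> (cis t) * fmode n t)"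
proof -
  define s where "s = (n \<ge> 0)"
  define m where "m = nat \<bar>n\<bar>"
  have m: "m \<noteq> 0" and nm: "complex_of_int \<bar>n\<bar> = of_nat m"
    using n by (auto simp: m_def of_nat_nat)
  define c where "c = complex_of_nat m"
  define q where "q z = zc s z ^ (m - 1)" for z
  have q: "smooth q" unfolding q_def[abs_def] by (intro smooth_power smooth_zc)
  define F1 where "F1 z = \<phi> z * (c * q z)" for z
  define F2 where "F2 z = \<phi> z * (c * zc s \<i> * q z)" for z
  have F: "smooth F1" "smooth F2"
    unfolding F1_def[abs_def] F2_def[abs_def] by (intro smooth_mult smooth_cmult \<phi> q smooth_const)+
  have "dir_deriv 1 F1 z + dir_deriv \<i> F2 z = dot (grad \<phi> z) (grad (harm_mode n) z)" for z
  proof -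
    have 1: "dir_deriv 1 F1 z = \<phi> z * (c * dir_deriv 1 q z) + dir_deriv 1 \<phi> z * (c * q z)"
      unfolding F1_def[abs_def]
      by (simp add: dir_deriv_mult dir_deriv_const smooth_differentiable \<phi> q smooth_cmult smooth_const)
    have 2: "dir_deriv \<i> F2 z = \<phi> z * (c * zc s \<i> * dir_deriv \<i> q z) + dir_deriv \<i> \<phi> z * (c * zc s \<i> * q z)"
      unfolding F2_def[abs_def]
      by (simp add: dir_deriv_mult dir_deriv_const smooth_differentiable \<phi> q smooth_cmult smooth_const)
    \<comment> \<open>Harmonicity enters as the fact that \<open>zc s \<i>\<close> has square -1:
      the terms with second derivatives cancel.\<close>
    have "zc s \<i> * dir_deriv \<i> q z = - dir_deriv 1 q z"
    proof -
      have "zc s \<i> * (x * zc s \<i>) = - x" for x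
      proof -
        have "zc s \<i> * (x * zc s \<i>) = (zc s \<i> * zc s \<i>) * x" by (simp only: mult_ac)
        then show ?thesis by (simp add: zc_ii)
      qed
      then show ?thesis unfolding q_def[abs_def] dir_deriv_zc_power by simp
    qed
    then have "c * zc s \<i> * dir_deriv \<i> q z = - (c * dir_deriv 1 q z)" by (simp add: mult.assoc)
    then have 3: "\<phi> z * (c * zc s \<i> * dir_deriv \<i> q z) = - (\<phi> z * (c * dir_deriv 1 q z))" by simp
    have 4: "grad (harm_mode n) z = (c * q z, c * q z * zc s \<i>)"
      unfolding grad_harm nm by (simp only: c_def q_def s_def m_def)
    show ?thesis unfolding 1 2 3 4 by (simp add: dot_def grad_def)
  qed
  then have "(LINT z|disk. dot (grad \<phi> z) (grad (harm_mode n) z)) = (LINT z|disk. dir_deriv 1 F1 z + dir_deriv \<i> F2 z)"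
    by simp
  also have "\<dots> = (LINT z|disk. dir_deriv 1 F1 z) + (LINT z|disk. dir_deriv \<i> F2 z)"
  proof (rule Bochner_Integration.integral_add)
    have "integrable disk (\<lambda>z. 1 * dir_deriv 1 F1 z)" "integrable disk (\<lambda>z. 1 * dir_deriv \<i> F2 z)"
      by (intro LINT_times L2s_smooth smooth_dirs F smooth_const)+
    then show "integrable disk (dir_deriv 1 F1)" "integrable disk (dir_deriv \<i> F2)" by simp_all
  qed
  also have "\<dots> = (LINT t|circ. F1 (cis t) * cos t) + (LINT t|circ. F2 (cis t) * sin t)"
    by (simp only: divergence_disk_1[OF F(1)] divergence_disk_ii[OF F(2)])
  also have "\<dots> = (LINT t|circ. F1 (cis t) * cos t + F2 (cis t) * sin t)"
    by (intro Bochner_Integration.integral_add[symmetric] integrable_circ_continuous continuous_intros continuous_cis_comp F)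
  also have "\<dots> = (LINT t|circ. c * (\<phi> (cis t) * fmode n t))"
  proof (rule Bochner_Integration.integral_cong[OF refl])
    fix t
    have "cis t = of_real (cos t) + \<i> * of_real (sin t)" by (simp add: complex_eq_iff)
    then have "zc s (cis t) = zc s (of_real (cos t) + \<i> * of_real (sin t))" by (rule arg_cong)
    also have "\<dots> = cos t + zc s \<i> * sin t" by (simp only: zc_add zc_mult zc_of_real)
    \<comment> \<open>The two components of the gradient combine with the normal (cos t, sin t) to
      one more factor \<open>zc s (cis t)\<close>, which raises the power m - 1 to m.\<close>
    finally have "fmode n t = q (cis t) * (cos t + zc s \<i> * sin t)"
      using m unfolding harm_cis[symmetric] harm_mode_def q_def by (simp add: s_def m_def power_eq_if mult.commute)
    then show "F1 (cis t) * cos t + F2 (cis t) * sin t = c * (\<phi> (cis t) * fmode n t)"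
      by (simp add: F1_def F2_def algebra_simps)
  qed
  also have "\<dots> = c * (LINT t|circ. \<phi> (cis t) * fmode n t)" by simp
  finally show ?thesis by (simp add: c_def nm)
qed

section \<open>Trace and Friedrichs inequalities, closability of the gradient\<close>

lemma L2n_circ_smooth_sq:
  assumes "smooth v"
  shows "((\<lambda>n. 2 * pi * (cmod (fc (\<lambda>t. v (cis t)) n))\<^sup>2) has_sum (L2n circ (\<lambda>t. v (cis t)))\<^sup>2) UNIV"
  using has_sum_cmult_right[OF Parseval_test_fun[OF test_fun_cis_comp[OF assms]], of "2 * pi"]
  by (simp add: L2n_sq)

lemma LINT_fmode_fc: "(LINT t|circ. h t * fmode n t) = 2 * pi * fc h (- n)"
  by (simp add: fc_def)

lemma of_real_abs_of_int: "complex_of_real \<bar>real_of_int n\<bar> = of_int \<bar>n\<bar>"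
  by (metis of_int_abs of_real_of_int_eq)

text \<open>Finite sums are smooth on the whole plane, so no question of convergence arises before
  limits are taken in the mean square.\<close>

definition harm_sum :: "(int \<Rightarrow> complex) \<Rightarrow> int set \<Rightarrow> complex \<Rightarrow> complex" where
  "harm_sum a A z = (\<Sum>n\<in>A. a n * harm_mode n z)"

lemma smooth_harm_sum: "smooth (harm_sum a A)"
  unfolding harm_sum_def[abs_def] by (intro smooth_sum smooth_cmult smooth_harm)

lemma dot_cmult_right: "dot b (c * fst a, c * snd a) = c * dot b a"
  by (simp add: dot_def algebra_simps)

lemma dot_sum_right: "dot b (\<Sum>i\<in>I. a i) = (\<Sum>i\<in>I. dot b (a i))"
  by (induction I rule: infinite_finite_induct) (simp_all add: dot_add_right, simp_all add: dot_def)

lemma dot_grad_harm_sum: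
  "dot b (grad (harm_sum a A) z) = (\<Sum>n\<in>A. a n * dot b (grad (harm_mode n) z))"
  unfolding harm_sum_def[abs_def]
  by (subst grad_sum) (auto intro: smooth_cmult smooth_harm simp: dot_sum_right grad_cmult smooth_harm dot_cmult_right)

lemma Green_harm_sum:
  assumes "smooth \<phi>" "finite A" "0 \<notin> A"
  shows "(LINT z|disk. dot (grad \<phi> z) (grad (harm_sum a A) z)) =
    2 * pi * (\<Sum>n\<in>A. a n * of_int \<bar>n\<bar> * fc (\<lambda>t. \<phi> (cis t)) (- n))"
proof -
  have "(LINT z|disk. dot (grad \<phi> z) (grad (harm_sum a A) z)) =
     (\<Sum>n\<in>A. LINT z|disk. a n * dot (grad \<phi> z) (grad (harm_mode n) z))"
    unfolding dot_grad_harm_sum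
    by (intro Bochner_Integration.integral_sum integrable_mult_right LINT_dot1 L2s_grad assms smooth_harm)
  also have "\<dots> = (\<Sum>n\<in>A. a n * (of_int \<bar>n\<bar> * (2 * pi * fc (\<lambda>t. \<phi> (cis t)) (- n))))"
    using assms by (intro sum.cong refl) (subst integral_mult_right_zero, subst Green_harm, auto simp: LINT_fmode_fc)
  finally show ?thesis by (simp add: sum_distrib_left mult_ac)
qed

lemma fc_sum_fmode:
  assumes "finite A"
  shows "fc (\<lambda>t. \<Sum>n\<in>A. a n * fmode n t) m = (if m \<in> A then a m else 0)"
proof -
  have "fc (\<lambda>t. \<Sum>n\<in>A. a n * fmode n t) m = (LINT x|circ. (\<Sum>n\<in>A. a n * (fmode n x * fmode (-m) x))) / (2 * pi)"
    unfolding fc_def by (simp add: sum_distrib_right mult.assoc)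
  also have "(LINT x|circ. (\<Sum>n\<in>A. a n * (fmode n x * fmode (-m) x))) = (\<Sum>n\<in>A. LINT x|circ. a n * (fmode n x * fmode (-m) x))"
    by (intro Bochner_Integration.integral_sum integrable_circ_continuous continuous_intros continuous_fmode)
  also have "\<dots> = (\<Sum>n\<in>A. if n = m then 2 * pi * a n else 0)"
    by (intro sum.cong refl) (simp add: LINT_circ_fmode_mult)
  also have "\<dots> = (if m \<in> A then 2 * pi * a m else 0)" using assms by (simp add: sum.delta')
  finally show ?thesis by simp
qed

lemma harm_sum_cis: "harm_sum a A (cis t) = (\<Sum>n\<in>A. a n * fmode n t)"
  by (simp add: harm_sum_def harm_cis)

lemma cnj_harm_sum: "finite A \<Longrightarrow> cnj (harm_sum a A z) = harm_sum (\<lambda>n. cnj (a (- n))) (uminus ` A) z"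
  by (simp add: harm_sum_def cnj_harm sum.reindex)

text \<open>The conjugate of a harmonic sum is a harmonic sum with reflected frequencies, so the
  Hermitian pairing reduces to the bilinear Green formula.\<close>

lemma Green_cnj_harm_sum:
  assumes "smooth \<phi>" "finite A" "0 \<notin> A"
  shows "(LINT z|disk. dot (grad \<phi> z) (cnjp (grad (harm_sum a A) z))) =
    2 * pi * (\<Sum>n\<in>A. cnj (a n) * of_int \<bar>n\<bar> * fc (\<lambda>t. \<phi> (cis t)) n)"
proof -
  have "cnjp (grad (harm_sum a A) z) = grad (harm_sum (\<lambda>n. cnj (a (- n))) (uminus ` A)) z" for z
    using grad_cnj[OF smooth_harm_sum, of a A z] cnj_harm_sum[OF assms(2), of a] by simp
  then show ?thesis
    using Green_harm_sum[OF assms(1), of "uminus ` A" "\<lambda>n. cnj (a (- n))"] assms(2,3)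
    by (simp add: sum.reindex image_iff)
qed

lemma L2n_grad_harm_sum:
  assumes "finite A" "0 \<notin> A"
  shows "(L2n disk (grad (harm_sum a A)))\<^sup>2 = 2 * pi * (\<Sum>n\<in>A. of_int \<bar>n\<bar> * (cmod (a n))\<^sup>2)"
proof -
  have "complex_of_real ((L2n disk (grad (harm_sum a A)))\<^sup>2) =
     2 * pi * (\<Sum>n\<in>A. cnj (a n) * of_int \<bar>n\<bar> * fc (\<lambda>t. harm_sum a A (cis t)) n)"
    unfolding LINT_dot_cnjp[symmetric] by (rule Green_cnj_harm_sum[OF smooth_harm_sum assms])
  also have "\<dots> = 2 * pi * (\<Sum>n\<in>A. cnj (a n) * of_int \<bar>n\<bar> * a n)"
    by (simp add: harm_sum_cis fc_sum_fmode[OF assms(1)])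
  also have "\<dots> = complex_of_real (2 * pi * (\<Sum>n\<in>A. of_int \<bar>n\<bar> * (cmod (a n))\<^sup>2))"
    by (simp add: mult_ac complex_norm_square of_real_abs_of_int flip: of_real_power)
  finally show ?thesis by (simp only: of_real_eq_iff)
qed

text \<open>Harmonic extension minimizes the energy. For \<open>p\<close>, built from the
  coefficients of the trace of \<open>v\<close> in \<open>A\<close>, the pairing of grad v with the
  conjugate of grad p equals the energy of \<open>p\<close>, and the Cauchy-Schwarz inequality does
  the rest.\<close>

lemma Dirichlet_principle:
  assumes v: "smooth v" and A: "finite A" "0 \<notin> A"
  shows "2 * pi * (\<Sum>n\<in>A. of_int \<bar>n\<bar> * (cmod (fc (\<lambda>t. v (cis t)) n))\<^sup>2) \<le> (L2n disk (grad v))\<^sup>2"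
proof -
  let ?a = "fc (\<lambda>t. v (cis t))"
  define p where "p = harm_sum ?a A"
  define S where "S = 2 * pi * (\<Sum>n\<in>A. of_int \<bar>n\<bar> * (cmod (?a n))\<^sup>2)"
  have p: "smooth p" unfolding p_def by (rule smooth_harm_sum)
  have Sp: "S = (L2n disk (grad p))\<^sup>2" unfolding p_def L2n_grad_harm_sum[OF A] S_def ..
  have "(LINT z|disk. dot (grad v z) (cnjp (grad p z))) = complex_of_real S"
    unfolding p_def Green_cnj_harm_sum[OF v A] S_def
    by (simp add: mult_ac complex_norm_square of_real_abs_of_int flip: of_real_power)
  moreover have "(\<lambda>z. cnjp (grad p z)) \<in> L2s disk"
  proof -
    have "grad (\<lambda>z. cnj (p z)) = (\<lambda>z. cnjp (grad p z))" by (rule ext) (rule grad_cnj[OF p])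
    then show ?thesis using L2s_grad[OF smooth_cnj[OF p]] by simp
  qed
  ultimately have "\<bar>S\<bar> \<le> L2n disk (grad v) * L2n disk (grad p)"
    using LINT_dot1(2)[OF L2s_grad[OF v], of "\<lambda>z. cnjp (grad p z)"] by (simp add: L2n_cnjp)
  then have *: "L2n disk (grad p) * L2n disk (grad p) \<le> L2n disk (grad v) * L2n disk (grad p)"
    by (simp add: Sp power2_eq_square)
  have "L2n disk (grad p) \<le> L2n disk (grad v)"
  proof (cases "L2n disk (grad p) = 0")
    case False
    then have "L2n disk (grad p) > 0" using L2n_nonneg[of disk "grad p"] by linarith
    then show ?thesis using * by simp
  qed simp
  then show ?thesis unfolding S_def[symmetric] Sp by (simp add: power_mono)
qed

text \<open>By Parseval's identity the squared left side is a sum over frequencies. Without the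
  frequency 0 its weights 1 are at most |n|, and the finite sums are then bounded by the Dirichlet
  principle.\<close>

lemma trace_inequality:
  assumes v: "smooth v" and mean: "fc (\<lambda>t. v (cis t)) 0 = 0"
  shows "L2n circ (\<lambda>t. v (cis t)) \<le> L2n disk (grad v)"
proof -
  let ?a = "fc (\<lambda>t. v (cis t))"
  have "(L2n circ (\<lambda>t. v (cis t)))\<^sup>2 \<le> (L2n disk (grad v))\<^sup>2"
  proof (rule has_sum_le_finite_sums[OF L2n_circ_smooth_sq[OF v]])
    fix F :: "int set" assume F: "finite F"
    have "(\<Sum>n\<in>F. 2 * pi * (cmod (?a n))\<^sup>2) = (\<Sum>n\<in>F - {0}. 2 * pi * (cmod (?a n))\<^sup>2)"
      using F mean by (intro sum.mono_neutral_right) auto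
    also have "\<dots> \<le> (\<Sum>n\<in>F - {0}. 2 * pi * (of_int \<bar>n\<bar> * (cmod (?a n))\<^sup>2))"
    proof (intro sum_mono mult_left_mono)
      fix n assume "n \<in> F - {0}"
      then have "1 \<le> real_of_int \<bar>n\<bar>" by auto
      then show "(cmod (?a n))\<^sup>2 \<le> of_int \<bar>n\<bar> * (cmod (?a n))\<^sup>2"
        using mult_right_mono[of 1 "real_of_int \<bar>n\<bar>" "(cmod (?a n))\<^sup>2"] by simp
    qed simp
    also have "\<dots> = 2 * pi * (\<Sum>n\<in>F - {0}. of_int \<bar>n\<bar> * (cmod (?a n))\<^sup>2)" by (simp add: sum_distrib_left)
    also have "\<dots> \<le> (L2n disk (grad v))\<^sup>2" by (rule Dirichlet_principle[OF v]) (use F in auto)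
    finally show "(\<Sum>n\<in>F. 2 * pi * (cmod (?a n))\<^sup>2) \<le> (L2n disk (grad v))\<^sup>2" .
  qed
  then show ?thesis by (rule power2_le_imp_le) simp
qed

lemma LINT_circ_add_divergence:
  fixes F1 F2 :: "complex \<Rightarrow> complex"
  assumes F: "smooth F1" "smooth F2"
  shows "(LINT z|disk. dir_deriv 1 F1 z + dir_deriv \<i> F2 z) = (LINT t|circ. F1 (cis t) * cos t + F2 (cis t) * sin t)"
    "integrable disk (\<lambda>z. dir_deriv 1 F1 z + dir_deriv \<i> F2 z)"
proof -
  have "integrable disk (\<lambda>z. 1 * dir_deriv 1 F1 z)" "integrable disk (\<lambda>z. 1 * dir_deriv \<i> F2 z)"
    by (intro LINT_times L2s_smooth smooth_dirs F smooth_const)+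
  then have i: "integrable disk (dir_deriv 1 F1)" "integrable disk (dir_deriv \<i> F2)" by simp_all
  then show "integrable disk (\<lambda>z. dir_deriv 1 F1 z + dir_deriv \<i> F2 z)" by simp
  have "(LINT z|disk. dir_deriv 1 F1 z + dir_deriv \<i> F2 z) = (LINT z|disk. dir_deriv 1 F1 z) + (LINT z|disk. dir_deriv \<i> F2 z)"
    by (rule Bochner_Integration.integral_add[OF i])
  also have "\<dots> = (LINT t|circ. F1 (cis t) * cos t) + (LINT t|circ. F2 (cis t) * sin t)"
    by (simp only: divergence_disk_1[OF F(1)] divergence_disk_ii[OF F(2)])
  also have "\<dots> = (LINT t|circ. F1 (cis t) * cos t + F2 (cis t) * sin t)"
    by (intro Bochner_Integration.integral_add[symmetric] integrable_circ_continuous continuous_intros continuous_cis_comp F)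
  finally show "(LINT z|disk. dir_deriv 1 F1 z + dir_deriv \<i> F2 z) = (LINT t|circ. F1 (cis t) * cos t + F2 (cis t) * sin t)" .
qed

text \<open>The divergence theorem for \<open>z |v|\<^sup>2\<close>.\<close>

lemma Friedrichs_inequality:
  assumes v: "smooth v"
  shows "(L2n disk v)\<^sup>2 \<le> (L2n circ (\<lambda>t. v (cis t)))\<^sup>2 + (L2n disk (grad v))\<^sup>2"
proof -
  define X where "X z = complex_of_real (Re z)" for z
  define Y where "Y z = complex_of_real (Im z)" for z
  have blX: "bounded_linear X" and blY: "bounded_linear Y" unfolding X_def[abs_def] Y_def[abs_def]
    by (intro bounded_linear_compose[OF bounded_linear_of_real] bounded_linear_Re bounded_linear_Im)+
  define w where "w z = v z * cnj (v z)" for z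
  have w: "smooth w" unfolding w_def[abs_def] by (intro smooth_mult smooth_cnj v)
  have sX: "smooth X" and sY: "smooth Y" by (intro smooth_linear blX blY)+
  have F: "smooth (\<lambda>z. X z * w z)" "smooth (\<lambda>z. Y z * w z)" by (intro smooth_mult sX sY w)+
  have dw: "dir_deriv b w z = v z * cnj (dir_deriv b v z) + dir_deriv b v z * cnj (v z)" for b z
    unfolding w_def[abs_def] by (simp add: dir_deriv_mult dir_deriv_cnj smooth_differentiable v smooth_cnj)
  have 1: "dir_deriv 1 (\<lambda>z. X z * w z) z = X z * dir_deriv 1 w z + w z" for z
    by (simp add: dir_deriv_mult smooth_differentiable sX w dir_deriv_linear[OF blX]) (simp add: X_def)
  have 2: "dir_deriv \<i> (\<lambda>z. Y z * w z) z = Y z * dir_deriv \<i> w z + w z" for z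
    by (simp add: dir_deriv_mult smooth_differentiable sY w dir_deriv_linear[OF blY]) (simp add: Y_def)
  let ?D = "\<lambda>z. dir_deriv 1 (\<lambda>z. X z * w z) z + dir_deriv \<i> (\<lambda>z. Y z * w z) z"
  \<comment> \<open>The divergence is 2 |v|^2 plus cross terms, which Young's inequality bounds by
    |v|^2 + |grad v|^2 because |z| < 1; one |v|^2 survives.\<close>
  have lower: "(cmod (v z))\<^sup>2 - (norm (grad v z))\<^sup>2 \<le> Re (?D z)" if z: "z \<in> ball 0 1" for z
  proof -
    have "?D z = 2 * w z + (v z * cnj (X z * dir_deriv 1 v z + Y z * dir_deriv \<i> v z) + cnj (v z) * (X z * dir_deriv 1 v z + Y z * dir_deriv \<i> v z))"
      unfolding 1 2 dw by (simp add: X_def Y_def algebra_simps)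
    moreover define d where "d = dot (X z, Y z) (grad v z)"
    moreover have "X z * dir_deriv 1 v z + Y z * dir_deriv \<i> v z = d" by (simp add: d_def dot_def grad_def)
    ultimately have D: "?D z = 2 * w z + (v z * cnj d + cnj (v z) * d)" by simp
    have "norm (X z, Y z) \<le> 1" using z by (simp add: norm_Pair X_def Y_def cmod_def)
    then have "cmod d \<le> 1 * norm (grad v z)"
      unfolding d_def by (intro order_trans[OF norm_dot_le] mult_right_mono) auto
    then have d: "cmod d \<le> norm (grad v z)" by simp
    have "cmod (v z * cnj d + cnj (v z) * d) \<le> 2 * (cmod (v z) * cmod d)"
      by (rule order_trans[OF norm_triangle_ineq]) (simp add: norm_mult)
    also have "\<dots> \<le> 2 * cmod (v z) * norm (grad v z)" using d by (simp add: mult_left_mono)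
    also have "\<dots> \<le> (cmod (v z))\<^sup>2 + (norm (grad v z))\<^sup>2" by (rule sum_squares_bound)
    finally have "- Re (v z * cnj d + cnj (v z) * d) \<le> (cmod (v z))\<^sup>2 + (norm (grad v z))\<^sup>2"
      using abs_Re_le_cmod[of "v z * cnj d + cnj (v z) * d"] by linarith
    moreover have "Re (w z) = (cmod (v z))\<^sup>2" by (simp add: w_def complex_norm_square[symmetric] flip: of_real_power)
    ultimately show ?thesis unfolding D by simp
  qed
  have i: "integrable disk (\<lambda>z. (cmod (v z))\<^sup>2)" "integrable disk (\<lambda>z. (norm (grad v z))\<^sup>2)"
    by (intro L2s_integrable L2s_smooth L2s_grad v)+
  have "(L2n disk v)\<^sup>2 - (L2n disk (grad v))\<^sup>2 = (LINT z|disk. (cmod (v z))\<^sup>2 - (norm (grad v z))\<^sup>2)"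
    using i by (simp add: L2n_sq)
  also have "\<dots> \<le> (LINT z|disk. Re (?D z))"
  proof (rule integral_mono)
    show "integrable disk (\<lambda>z. Re (?D z))" by (rule integrable_Re[OF LINT_circ_add_divergence(2)[OF F]])
    show "integrable disk (\<lambda>z. (cmod (v z))\<^sup>2 - (norm (grad v z))\<^sup>2)" using i by simp
    show "(cmod (v z))\<^sup>2 - (norm (grad v z))\<^sup>2 \<le> Re (?D z)" if "z \<in> space disk" for z
      using that by (intro lower) (simp add: space_restrict_space)
  qed
  also have "\<dots> = Re (LINT z|disk. ?D z)" by (rule integral_Re[OF LINT_circ_add_divergence(2)[OF F]])
  also have "(LINT z|disk. ?D z) = (LINT t|circ. complex_of_real ((cmod (v (cis t)))\<^sup>2))"
    unfolding LINT_circ_add_divergence(1)[OF F]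
  proof (rule Bochner_Integration.integral_cong[OF refl])
    fix t
    have "X (cis t) * w (cis t) * cos t + Y (cis t) * w (cis t) * sin t = w (cis t) * complex_of_real ((cos t)\<^sup>2 + (sin t)\<^sup>2)"
      unfolding X_def Y_def cis.sel of_real_add of_real_power power2_eq_square by (simp only: algebra_simps of_real_mult)
    also have "\<dots> = w (cis t)" by simp
    also have "\<dots> = complex_of_real ((cmod (v (cis t)))\<^sup>2)" by (simp only: w_def complex_norm_square)
    finally show "X (cis t) * w (cis t) * cos t + Y (cis t) * w (cis t) * sin t = complex_of_real ((cmod (v (cis t)))\<^sup>2)" .
  qed
  also have "Re (LINT t|circ. complex_of_real ((cmod (v (cis t)))\<^sup>2)) = (L2n circ (\<lambda>t. v (cis t)))\<^sup>2"
    unfolding L2n_sq integral_complex_of_real by simp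
  finally show ?thesis by simp
qed

text \<open>The natural test function, the conjugate of G divided by 1 + |G|, is bounded but only
  measurable. Continuous functions approximate it almost everywhere, and dominated convergence
  leaves the integral of |G|^2 / (1 + |G|), which must vanish.\<close>

lemma AE_zero_test_continuous:
  fixes G :: "complex \<Rightarrow> complex"
  assumes G: "integrable disk G"
    and orth: "\<And>\<phi> :: complex \<Rightarrow> complex. continuous_on UNIV \<phi> \<Longrightarrow> (LINT z|disk. G z * \<phi> z) = 0"
  shows "AE z in disk. G z = 0"
proof -
  have Gm: "G \<in> borel_measurable disk" using G by simp
  define b where "b z = cnj (G z) / (1 + cmod (G z))" for z
  have nz: "1 + complex_of_real (cmod x) \<noteq> 0" for x
  proof -
    have "complex_of_real (1 + cmod x) \<noteq> 0" unfolding of_real_eq_0_iff using norm_ge_zero[of x] by linarith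
    then show ?thesis by simp
  qed
  have "(\<lambda>x. cnj x / (1 + cmod x)) \<in> borel_measurable borel"
    by (intro borel_measurable_continuous_onI continuous_intros) (use nz in auto)
  from measurable_compose[OF Gm this] have bm: "b \<in> borel_measurable disk" by (simp add: b_def[abs_def])
  then have "b measurable_on ball 0 1"
    using measurable_on_iff_borel_measurable[OF sets_ball_lebesgue] by blast
  then obtain S h where S: "negligible S" and hc: "\<And>n::nat. continuous_on UNIV (h n)"
    and hl: "\<And>z. z \<notin> S \<Longrightarrow> (\<lambda>n. h n z) \<longlonglongrightarrow> (if z \<in> ball 0 1 then b z else 0)"
    unfolding measurable_on_def by blast
  \<comment> \<open>Clipping to modulus at most 1 provides the dominating function |G|; it does not
    change the limit because \<open>b\<close> has modulus at most 1.\<close>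
  define k where "k n z = h n z / of_real (max 1 (cmod (h n z)))" for n z
  have kc: "continuous_on UNIV (k n)" for n unfolding k_def
    by (intro continuous_intros hc) (auto simp: max_def)
  have k1: "cmod (k n z) \<le> 1" for n z
    by (auto simp: k_def norm_divide divide_le_eq_1 max_def)
  have b1: "cmod (b z) \<le> 1" for z
  proof -
    have "1 + complex_of_real (cmod (G z)) = of_real (1 + cmod (G z))" by simp
    then have "cmod (1 + complex_of_real (cmod (G z))) = 1 + cmod (G z)"
      by (simp only: norm_of_real) simp
    then show ?thesis by (simp add: b_def norm_divide divide_le_eq_1 add_pos_nonneg)
  qed
  have kl: "(\<lambda>n. k n z) \<longlonglongrightarrow> b z" if "z \<notin> S" "z \<in> ball 0 1" for z
  proof -
    have "(\<lambda>n. h n z / of_real (max 1 (cmod (h n z)))) \<longlonglongrightarrow> b z / of_real (max 1 (cmod (b z)))"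
      using hl[OF that(1)] that(2) by (intro tendsto_intros) (auto simp: max_def)
    moreover have "max 1 (cmod (b z)) = 1" using b1[of z] by (rule max_absorb1)
    ultimately show ?thesis by (simp only: k_def of_real_1 div_by_1)
  qed
  have AES: "AE z in disk. z \<notin> S"
    using S by (auto simp: AE_restrict_space_iff negligible_iff_null_sets intro: AE_not_in AE_mp)
  have "(\<lambda>n. LINT z|disk. G z * k n z) \<longlonglongrightarrow> (LINT z|disk. G z * b z)"
  proof (rule integral_dominated_convergence[where w="\<lambda>z. cmod (G z)"])
    show "(\<lambda>z. G z * b z) \<in> borel_measurable disk" using Gm bm by simp
    show "(\<lambda>z. G z * k n z) \<in> borel_measurable disk" for n
      using Gm measurable_disk_continuous[OF kc] by simp
    show "integrable disk (\<lambda>z. cmod (G z))" using G by simp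
    show "AE z in disk. (\<lambda>n. G z * k n z) \<longlonglongrightarrow> G z * b z"
      using AES AE_space by eventually_elim (auto intro!: tendsto_intros kl simp: space_restrict_space)
    show "AE z in disk. cmod (G z * k n z) \<le> cmod (G z)" for n
      using k1 by (auto simp: norm_mult mult_left_le)
  qed
  then have 0: "(LINT z|disk. G z * b z) = 0" using orth[OF kc] by (simp add: LIMSEQ_const_iff)
  have Gb: "G z * b z = complex_of_real ((cmod (G z))\<^sup>2 / (1 + cmod (G z)))" for z
    by (simp add: b_def complex_norm_square[symmetric] flip: of_real_power of_real_add)
  have "(LINT z|disk. (cmod (G z))\<^sup>2 / (1 + cmod (G z))) = 0"
    using 0 unfolding Gb integral_complex_of_real by simp
  moreover have "integrable disk (\<lambda>z. (cmod (G z))\<^sup>2 / (1 + cmod (G z)))"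
  proof (rule Bochner_Integration.integrable_bound[OF integrable_norm[OF G]])
    show "(\<lambda>z. (cmod (G z))\<^sup>2 / (1 + cmod (G z))) \<in> borel_measurable disk" using Gm by measurable
    have "(cmod (G z))\<^sup>2 / (1 + cmod (G z)) \<le> cmod (G z)" for z
      by (simp add: divide_le_eq power2_eq_square algebra_simps add_pos_nonneg)
    then show "AE z in disk. norm ((cmod (G z))\<^sup>2 / (1 + cmod (G z))) \<le> norm (cmod (G z))" by simp
  qed
  ultimately have "AE z in disk. (cmod (G z))\<^sup>2 / (1 + cmod (G z)) = 0"
    by (subst (asm) integral_nonneg_eq_0_iff_AE) auto
  then show ?thesis
  proof eventually_elim
    case (elim z)
    then show ?case using norm_ge_zero[of "G z"] by (auto simp: add_eq_0_iff)
  qed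
qed

text \<open>Tested against a function vanishing on the circle, integration by parts has no boundary term.\<close>

lemma gradient_closable:
  fixes g :: "complex \<Rightarrow> complex"
  assumes v: "\<And>k. smooth (v k)" and v0: "(\<lambda>k. L2n disk (v k)) \<longlonglongrightarrow> 0"
    and g: "g \<in> L2s disk" and vg: "(\<lambda>k. L2n disk (\<lambda>z. dir_deriv b (v k) z - g z)) \<longlonglongrightarrow> 0"
    and b: "b = 1 \<or> b = \<i>"
  shows "AE z in disk. g z = 0"
proof -
  have bB: "b \<in> Basis" using b by (auto simp: Basis_complex_def)
  \<comment> \<open>Besides vanishing on the circle, \<open>w\<close> is positive in the open disk,
    so that \<open>g\<close> can be recovered from its product with \<open>w\<close> at the
    end.\<close>
  define w where "w z = 1 - z * cnj z" for z :: complex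
  have w: "smooth w" unfolding w_def[abs_def]
    by (intro smooth_diff smooth_const smooth_mult smooth_ident smooth_cnj)
  have div0: "(LINT z|disk. dir_deriv b F z) = 0" if F: "smooth F" and F0: "\<And>t. F (cis t) = 0" for F :: "complex \<Rightarrow> complex"
    using b divergence_disk_1[OF F] divergence_disk_ii[OF F] F0 by auto
  have orth_smooth: "(LINT z|disk. g z * (w z * \<phi> z)) = 0" if \<phi>: "smooth \<phi>" for \<phi>
  proof -
    define p where "p z = w z * \<phi> z" for z
    have p: "smooth p" unfolding p_def[abs_def] by (intro smooth_mult w \<phi>)
    have dv: "smooth (dir_deriv b (v k))" for k by (intro smooth_dir_deriv v bB)
    have dp: "smooth (dir_deriv b p)" by (intro smooth_dir_deriv p bB)
    have "(LINT z|disk. dir_deriv b (v k) z * p z) = - (LINT z|disk. v k z * dir_deriv b p z)" for k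
    proof -
      have "0 = (LINT z|disk. dir_deriv b (\<lambda>z. v k z * p z) z)"
        by (rule div0[symmetric], intro smooth_mult v p) (simp add: p_def w_def cis_cnj cis_mult)
      also have "\<dots> = (LINT z|disk. v k z * dir_deriv b p z + dir_deriv b (v k) z * p z)"
        by (simp add: dir_deriv_mult smooth_differentiable v p)
      also have "\<dots> = (LINT z|disk. v k z * dir_deriv b p z) + (LINT z|disk. dir_deriv b (v k) z * p z)"
        by (intro Bochner_Integration.integral_add LINT_times L2s_smooth v p dv dp)
      finally show ?thesis by (simp add: eq_neg_iff_add_eq_0 add.commute)
    qed
    moreover have "(\<lambda>k. LINT z|disk. v k z * dir_deriv b p z) \<longlonglongrightarrow> 0"
    proof (rule Lim_null_comparison[OF always_eventually])
      show "\<forall>k. cmod (LINT z|disk. v k z * dir_deriv b p z) \<le> L2n disk (v k) * L2n disk (dir_deriv b p)"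
        by (intro allI LINT_times L2s_smooth v dp)
      show "(\<lambda>k. L2n disk (v k) * L2n disk (dir_deriv b p)) \<longlonglongrightarrow> 0"
        using tendsto_mult_right[OF v0] by simp
    qed
    ultimately have l1: "(\<lambda>k. LINT z|disk. dir_deriv b (v k) z * p z) \<longlonglongrightarrow> 0"
      using tendsto_minus by fastforce
    have "(\<lambda>k. (LINT z|disk. dir_deriv b (v k) z * p z) - (LINT z|disk. g z * p z)) \<longlonglongrightarrow> 0"
    proof (rule Lim_null_comparison[OF always_eventually])
      show "\<forall>k. cmod ((LINT z|disk. dir_deriv b (v k) z * p z) - (LINT z|disk. g z * p z)) \<le>
         L2n disk (\<lambda>z. dir_deriv b (v k) z - g z) * L2n disk p"
      proof
        fix k
        have "(LINT z|disk. dir_deriv b (v k) z * p z) - (LINT z|disk. g z * p z) = (LINT z|disk. (dir_deriv b (v k) z - g z) * p z)"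
          using LINT_times(1)[OF L2s_smooth[OF dv] L2s_smooth[OF p]] LINT_times(1)[OF g L2s_smooth[OF p]]
          by (simp add: left_diff_distrib)
        then show "cmod ((LINT z|disk. dir_deriv b (v k) z * p z) - (LINT z|disk. g z * p z)) \<le>
            L2n disk (\<lambda>z. dir_deriv b (v k) z - g z) * L2n disk p"
          using LINT_times(2)[OF L2s_diff[OF L2s_smooth[OF dv] g] L2s_smooth[OF p]] by simp
      qed
      show "(\<lambda>k. L2n disk (\<lambda>z. dir_deriv b (v k) z - g z) * L2n disk p) \<longlonglongrightarrow> 0"
        using tendsto_mult_right[OF vg] by simp
    qed
    from tendsto_diff[OF l1 this] have "(LINT z|disk. g z * p z) = 0" by (simp add: LIMSEQ_const_iff)
    then show ?thesis by (simp add: p_def)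
  qed
  define G where "G z = g z * w z" for z
  have G: "integrable disk G" unfolding G_def by (intro LINT_times g L2s_smooth w)
  have "AE z in disk. G z = 0"
  proof (rule AE_zero_test_continuous[OF G])
    fix \<phi> :: "complex \<Rightarrow> complex" assume \<phi>: "continuous_on UNIV \<phi>"
    define A where "A = (LINT z|disk. cmod (G z))"
    have A0: "A \<ge> 0" by (simp add: A_def)
    have "cmod (LINT z|disk. G z * \<phi> z) \<le> 0 + e" if e: "e > 0" for e
    proof -
      have e': "e / (A + 1) > 0" using e A0 by simp
      have "continuous_on (cball 0 1) \<phi>" using \<phi> continuous_on_subset by blast
      \<comment> \<open>Orthogonality is known for smooth test functions only; polynomials, which
        are smooth, extend it to continuous ones by uniform approximation on the closed
        disk.\<close>
      from Stone_Weierstrass_polynomial_function[OF compact_cball this e']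
      obtain q where q: "polynomial_function q" "\<forall>z\<in>cball 0 1. cmod (\<phi> z - q z) < e / (A + 1)" by blast
      have "real_polynomial_function (Re \<circ> q)" "real_polynomial_function (Im \<circ> q)"
        using q(1) bounded_linear_Re bounded_linear_Im unfolding polynomial_function_def by auto
      from this[THEN smooth_real_polynomial]
      have "smooth (\<lambda>z. complex_of_real (Re (q z)) + \<i> * complex_of_real (Im (q z)))"
        by (intro smooth_add smooth_cmult) (simp_all add: o_def)
      then have sq: "smooth q" by (simp flip: complex_eq)
      have i: "integrable disk (\<lambda>z. G z * q z)"
        using LINT_times(1)[OF g L2s_smooth[OF smooth_mult[OF w sq]]] by (simp add: G_def mult.assoc)
      obtain B where B: "B \<ge> 0" "\<And>z. z \<in> ball 0 1 \<Longrightarrow> cmod (\<phi> z) \<le> B" by (rule continuous_disk_bounded[OF \<phi>]) blast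
      have i2: "integrable disk (\<lambda>z. G z * \<phi> z)"
      proof (rule Bochner_Integration.integrable_bound[where f="\<lambda>z. B * cmod (G z)"])
        show "integrable disk (\<lambda>z. B * cmod (G z))" using G by simp
        show "(\<lambda>z. G z * \<phi> z) \<in> borel_measurable disk" using G measurable_disk_continuous[OF \<phi>] by simp
        show "AE z in disk. cmod (G z * \<phi> z) \<le> norm (B * cmod (G z))"
        proof (rule AE_I2)
          fix z assume "z \<in> space disk"
          then have "cmod (\<phi> z) \<le> B" using B(2)[of z] by (simp add: space_restrict_space)
          from mult_right_mono[OF this norm_ge_zero[of "G z"]] B(1)
          show "cmod (G z * \<phi> z) \<le> norm (B * cmod (G z))" by (simp add: norm_mult mult.commute)
        qed
      qed
      have "(LINT z|disk. G z * q z) = 0"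
        using orth_smooth[OF sq] by (simp add: G_def mult.assoc)
      then have "(LINT z|disk. G z * \<phi> z) = (LINT z|disk. G z * (\<phi> z - q z))"
        using i i2 by (simp add: right_diff_distrib)
      also have "cmod \<dots> \<le> (LINT z|disk. e / (A + 1) * cmod (G z))"
      proof (rule LINT_norm_bound)
        show "integrable disk (\<lambda>z. e / (A + 1) * cmod (G z))" using G by simp
        show "AE z in disk. cmod (G z * (\<phi> z - q z)) \<le> e / (A + 1) * cmod (G z)"
        proof (rule AE_I2)
          fix z assume "z \<in> space disk"
          then have "cmod (\<phi> z - q z) \<le> e / (A + 1)" using q(2) by (simp add: space_restrict_space less_imp_le)
          from mult_right_mono[OF this norm_ge_zero[of "G z"]]
          show "cmod (G z * (\<phi> z - q z)) \<le> e / (A + 1) * cmod (G z)"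
            by (simp only: norm_mult mult.commute[of "cmod (G z)"])
        qed
      qed
      also have "\<dots> = e * (A / (A + 1))" by (simp add: A_def)
      also have "\<dots> \<le> e" using e A0 by (simp add: field_simps)
      finally show ?thesis by simp
    qed
    then have "cmod (LINT z|disk. G z * \<phi> z) \<le> 0" by (rule field_le_epsilon)
    then show "(LINT z|disk. G z * \<phi> z) = 0" by simp
  qed
  then show ?thesis
    using AE_space
  proof eventually_elim
    case (elim z)
    have "w z = complex_of_real (1 - (cmod z)\<^sup>2)" by (simp add: w_def complex_norm_square flip: of_real_power)
    moreover have "(cmod z)\<^sup>2 < 1" using elim by (simp add: space_restrict_space abs_square_less_1)
    ultimately have "w z \<noteq> 0" by (simp only: of_real_eq_0_iff)
    then show ?case using elim by (simp add: G_def)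
  qed
qed

section \<open>The variational problem\<close>

text \<open>Pairs carry the structure of a real vector space; complex factors act on them through
  \<open>scl\<close>.\<close>

definition scl :: "complex \<Rightarrow> complex \<times> complex \<Rightarrow> complex \<times> complex" where
  "scl c a = (c * fst a, c * snd a)"

lemma norm_scl: "norm (scl c a) = cmod c * norm a"
  by (cases a) (simp add: scl_def norm_Pair norm_mult power_mult_distrib real_sqrt_mult flip: distrib_left)

lemma dot_scl_left: "dot (scl c a) b = c * dot a b" by (simp add: dot_def scl_def algebra_simps)
lemma dot_scl_right: "dot b (scl c a) = c * dot b a" by (simp add: dot_def scl_def algebra_simps)
lemma scl_cnjp: "cnjp (scl c a) = scl (cnj c) (cnjp a)" by (simp add: cnjp_def scl_def)
lemma cnjp_cnjp [simp]: "cnjp (cnjp a) = a" by (simp add: cnjp_def)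

lemma measurable_scl [measurable]:
  assumes "b \<in> borel_measurable N" "U \<in> borel_measurable N"
  shows "(\<lambda>x. scl (b x) (U x)) \<in> borel_measurable N"
  unfolding scl_def
  by (intro borel_measurable_Pair borel_measurable_times assms
    measurable_compose[OF _ borel_measurable_continuous_onI[OF continuous_on_fst[OF continuous_on_id]]]
    measurable_compose[OF _ borel_measurable_continuous_onI[OF continuous_on_snd[OF continuous_on_id]]])

lemma L2s_scl:
  assumes "b \<in> borel_measurable N" "AE x in N. cmod (b x) \<le> B" "U \<in> L2s N"
  shows "(\<lambda>x. scl (b x) (U x)) \<in> L2s N"
    "B \<ge> 0 \<Longrightarrow> L2n N (\<lambda>x. scl (b x) (U x)) \<le> B * L2n N U"
proof -
  have le: "AE x in N. norm (scl (b x) (U x)) \<le> B * norm (U x)"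
    using assms(2) by eventually_elim (simp add: norm_scl mult_right_mono)
  have m: "(\<lambda>x. scl (b x) (U x)) \<in> borel_measurable N"
    by (intro measurable_scl assms L2s_measurable)
  show "(\<lambda>x. scl (b x) (U x)) \<in> L2s N" by (rule L2s_bound[OF assms(3) m le])
  show "B \<ge> 0 \<Longrightarrow> L2n N (\<lambda>x. scl (b x) (U x)) \<le> B * L2n N U"
    by (rule L2n_bound[OF assms(3) m le])
qed

lemma L2s_scl_const: "U \<in> L2s N \<Longrightarrow> (\<lambda>x. scl c (U x)) \<in> L2s N"
  by (rule L2s_scl(1)[where B="cmod c"]) auto

lemma L2n_scl_const: "L2n N (\<lambda>x. scl c (U x)) = cmod c * L2n N U"
  by (simp add: L2n_def norm_scl power_mult_distrib real_sqrt_mult)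

lemma L2s_cnjp:
  assumes "U \<in> L2s N"
  shows "(\<lambda>x. cnjp (U x)) \<in> L2s N"
proof -
  have "(\<lambda>a. cnjp a) \<in> borel_measurable borel"
    unfolding cnjp_def by (intro borel_measurable_continuous_onI continuous_intros)
  from measurable_compose[OF L2s_measurable[OF assms] this] show ?thesis
    using assms by (simp add: L2s_def)
qed

lemma norm_diff_sq: "(norm (a - b))\<^sup>2 = (norm a)\<^sup>2 - 2 * Re (dot a (cnjp b)) + (norm b)\<^sup>2"
proof -
  have "complex_of_real ((norm (a - b))\<^sup>2) = dot (a - b) (cnjp (a - b))" by (rule dot_cnjp[symmetric])
  also have "\<dots> = dot a (cnjp a) - (dot a (cnjp b) + cnj (dot a (cnjp b))) + dot b (cnjp b)"
    by (simp add: dot_def cnjp_def algebra_simps)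
  also have "\<dots> = complex_of_real ((norm a)\<^sup>2 - 2 * Re (dot a (cnjp b)) + (norm b)\<^sup>2)"
    unfolding dot_cnjp complex_add_cnj by simp
  finally show ?thesis by (simp only: of_real_eq_iff)
qed

lemma L2n_diff_sq:
  assumes "U \<in> L2s N" "V \<in> L2s N"
  shows "(L2n N (\<lambda>x. U x - V x))\<^sup>2 = (L2n N U)\<^sup>2 - 2 * Re (LINT x|N. dot (U x) (cnjp (V x))) + (L2n N V)\<^sup>2"
proof -
  have i: "integrable N (\<lambda>x. dot (U x) (cnjp (V x)))" by (rule LINT_dot1(1)[OF assms(1) L2s_cnjp[OF assms(2)]])
  have "(L2n N (\<lambda>x. U x - V x))\<^sup>2 = (LINT x|N. (norm (U x))\<^sup>2 - 2 * Re (dot (U x) (cnjp (V x))) + (norm (V x))\<^sup>2)"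
    unfolding L2n_sq norm_diff_sq ..
  also have "\<dots> = (L2n N U)\<^sup>2 - 2 * (LINT x|N. Re (dot (U x) (cnjp (V x)))) + (L2n N V)\<^sup>2"
    using integrable_Re[OF i] L2s_integrable[OF assms(1)] L2s_integrable[OF assms(2)]
    by (simp add: L2n_sq)
  finally show ?thesis by (simp add: integral_Re[OF i])
qed

text \<open>A near-minimizer of \<open>\<parallel>F - grad v\<parallel>\<close> is nearly an orthogonal projection.\<close>

lemma approx_projection:
  assumes F: "F \<in> L2s disk" and e: "e > 0"
  shows "\<exists>v. smooth v \<and> (\<forall>\<phi>. smooth \<phi> \<longrightarrow>
    cmod (LINT z|disk. dot (F z - grad v z) (grad \<phi> z)) \<le> e * L2n disk (grad \<phi>))"
proof -
  define X where "X = (\<lambda>v. (L2n disk (\<lambda>z. F z - grad v z))\<^sup>2) ` {v. smooth v}"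
  have X: "X \<noteq> {}" "bdd_below X" unfolding X_def
    by (auto intro!: exI[of _ "\<lambda>_. 0"] smooth_const bdd_belowI[of _ 0])
  have "Inf X < Inf X + e\<^sup>2" using e by simp
  then obtain v where v: "smooth v" and near: "(L2n disk (\<lambda>z. F z - grad v z))\<^sup>2 < Inf X + e\<^sup>2"
    unfolding cInf_less_iff[OF X] by (auto simp: X_def)
  define G where "G z = F z - grad v z" for z
  have G: "G \<in> L2s disk" unfolding G_def[abs_def] by (intro L2s_diff F L2s_grad v)
  have "cmod (LINT z|disk. dot (G z) (grad \<phi> z)) \<le> e * L2n disk (grad \<phi>)" if \<phi>: "smooth \<phi>" for \<phi>
  proof -
    define I where "I = (LINT z|disk. dot (G z) (grad \<phi> z))"
    define n where "n = L2n disk (grad \<phi>)"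
    have key: "2 * t * cmod I \<le> e\<^sup>2 + t\<^sup>2 * n\<^sup>2" for t
    proof -
      \<comment> \<open>The phase \<open>u\<close> makes the cross term real and of the size of
        \<open>cmod I\<close>. Since the pairing is bilinear, the perturbation is built from the
        conjugate of \<phi>.\<close>
      define u where "u = (if I = 0 then 1 else I / of_real (cmod I))"
      have u: "cmod u = 1" "cnj u * I = cmod I"
      proof -
        show "cmod u = 1" by (simp add: u_def norm_divide)
        have "cnj I * I = of_real (cmod I) * of_real (cmod I)"
          using complex_norm_square[of I] by (simp add: mult.commute power2_eq_square)
        then show "cnj u * I = cmod I" by (simp add: u_def)
      qed
      define c where "c = of_real t * u"
      define \<psi> where "\<psi> z = c * cnj (\<phi> z)" for z
      have \<psi>: "smooth \<psi>" unfolding \<psi>_def[abs_def] by (intro smooth_cmult smooth_cnj \<phi>)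
      have g\<psi>: "grad \<psi> z = scl c (cnjp (grad \<phi> z))" for z
        unfolding \<psi>_def[abs_def] by (simp add: grad_cmult smooth_cnj \<phi> grad_cnj scl_def)
      have vs: "smooth (\<lambda>z. v z + \<psi> z)" by (intro smooth_add v \<psi>)
      have "Inf X \<le> (L2n disk (\<lambda>z. F z - grad (\<lambda>z. v z + \<psi> z) z))\<^sup>2"
        by (rule cInf_lower[OF _ X(2)]) (use vs in \<open>auto simp: X_def\<close>)
      also have "(\<lambda>z. F z - grad (\<lambda>z. v z + \<psi> z) z) = (\<lambda>z. G z - grad \<psi> z)"
        by (auto simp: grad_add v \<psi> G_def)
      also have "(L2n disk (\<lambda>z. G z - grad \<psi> z))\<^sup>2 =
        (L2n disk G)\<^sup>2 - 2 * Re (LINT z|disk. dot (G z) (cnjp (grad \<psi> z))) + (L2n disk (grad \<psi>))\<^sup>2"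
        by (rule L2n_diff_sq[OF G L2s_grad[OF \<psi>]])
      also have "(LINT z|disk. dot (G z) (cnjp (grad \<psi> z))) = of_real t * cmod I"
        by (simp add: g\<psi> scl_cnjp dot_scl_right I_def[symmetric] c_def mult.assoc u(2))
      also have "L2n disk (grad \<psi>) = \<bar>t\<bar> * n"
      proof -
        have "grad \<psi> = (\<lambda>z. scl c (cnjp (grad \<phi> z)))" using g\<psi> by blast
        then show ?thesis by (simp add: L2n_scl_const L2n_cnjp c_def norm_mult u(1) n_def)
      qed
      also have "(L2n disk G)\<^sup>2 < Inf X + e\<^sup>2" using near by (simp add: G_def[abs_def])
      finally show ?thesis by (simp add: power_mult_distrib)
    qed
    show ?thesis
    proof (cases "n = 0")
      case True
      have "cmod I \<le> L2n disk G * n" unfolding I_def n_def by (rule LINT_dot1(2)[OF G L2s_grad[OF \<phi>]])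
      then show ?thesis using True by (simp add: I_def[symmetric] n_def[symmetric])
    next
      case False
      then have n: "n > 0" using L2n_nonneg[of disk "grad \<phi>"] unfolding n_def by linarith
      \<comment> \<open>The value t = e / n balances the two terms on the right of
        \<open>key\<close>.\<close>
      have "2 * (e / n) * cmod I \<le> e\<^sup>2 + (e / n)\<^sup>2 * n\<^sup>2" by (rule key)
      also have "\<dots> = 2 * e * e" using n by (simp add: power_divide power2_eq_square)
      finally have "2 * e * cmod I \<le> 2 * e * (e * n)" using n by (simp add: divide_le_eq mult.assoc)
      then show ?thesis using e by (simp add: I_def[symmetric] n_def[symmetric])
    qed
  qed
  then show ?thesis using v by (auto simp: G_def)
qed

text \<open>This part of the theory is independent of the support of \<open>\<sigma> - 1\<close>,
  and the coefficient 1 is interpreted in it below as \<open>one\<close>. The imaginary part of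
  \<sigma> is controlled through the bound \<open>B\<close> on the modulus.\<close>

locale conductivity =
  fixes \<sigma> :: "complex \<Rightarrow> complex" and lo B :: real
  assumes measurable_\<sigma>: "\<sigma> \<in> borel_measurable disk"
    and bounded_\<sigma>: "AE z in disk. cmod (\<sigma> z) \<le> B"
    and lo_pos: "lo > 0" and lo_le: "AE z in disk. lo \<le> Re (\<sigma> z)" and B_pos: "B \<ge> lo"
begin

definition form :: "(complex \<Rightarrow> complex \<times> complex) \<Rightarrow> (complex \<Rightarrow> complex \<times> complex) \<Rightarrow> complex" where
  "form U V = (LINT z|disk. \<sigma> z * dot (U z) (V z))"

lemma form_integrable: "U \<in> L2s disk \<Longrightarrow> V \<in> L2s disk \<Longrightarrow> integrable disk (\<lambda>z. \<sigma> z * dot (U z) (V z))"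
  by (rule LINT_dot(1)[OF _ _ measurable_\<sigma> bounded_\<sigma>])

lemma form_bound: "U \<in> L2s disk \<Longrightarrow> V \<in> L2s disk \<Longrightarrow> cmod (form U V) \<le> B * L2n disk U * L2n disk V"
  unfolding form_def using lo_pos B_pos by (intro LINT_dot(2)[OF _ _ measurable_\<sigma> bounded_\<sigma>]) auto

lemma form_diff_left:
  "U \<in> L2s disk \<Longrightarrow> U' \<in> L2s disk \<Longrightarrow> V \<in> L2s disk \<Longrightarrow> form (\<lambda>z. U z - U' z) V = form U V - form U' V"
  unfolding form_def dot_diff_left right_diff_distrib by (intro Bochner_Integration.integral_diff form_integrable)

lemma form_diff_right:
  "U \<in> L2s disk \<Longrightarrow> U' \<in> L2s disk \<Longrightarrow> V \<in> L2s disk \<Longrightarrow> form V (\<lambda>z. U z - U' z) = form V U - form V U'"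
  unfolding form_def dot_diff_right right_diff_distrib by (intro Bochner_Integration.integral_diff form_integrable)

lemma form_coercive:
  assumes U: "U \<in> L2s disk"
  shows "lo * (L2n disk U)\<^sup>2 \<le> cmod (form U (\<lambda>z. cnjp (U z)))"
proof -
  have i: "integrable disk (\<lambda>z. \<sigma> z * dot (U z) (cnjp (U z)))" by (rule form_integrable[OF U L2s_cnjp[OF U]])
  have "lo * (L2n disk U)\<^sup>2 = (LINT z|disk. lo * (norm (U z))\<^sup>2)" by (simp add: L2n_sq)
  also have "\<dots> \<le> (LINT z|disk. Re (\<sigma> z * dot (U z) (cnjp (U z))))"
  proof (rule integral_mono_AE)
    show "integrable disk (\<lambda>z. lo * (norm (U z))\<^sup>2)" using L2s_integrable[OF U] by simp
    show "integrable disk (\<lambda>z. Re (\<sigma> z * dot (U z) (cnjp (U z))))" by (rule integrable_Re[OF i])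
    show "AE z in disk. lo * (norm (U z))\<^sup>2 \<le> Re (\<sigma> z * dot (U z) (cnjp (U z)))"
      using lo_le by eventually_elim (simp add: dot_cnjp mult_right_mono flip: of_real_power)
  qed
  also have "\<dots> = Re (form U (\<lambda>z. cnjp (U z)))" unfolding form_def by (rule integral_Re[OF i])
  also have "\<dots> \<le> cmod (form U (\<lambda>z. cnjp (U z)))" by (rule complex_Re_le_cmod)
  finally show ?thesis .
qed

text \<open>The values of \<open>\<sigma>\<close> lie in a disk around \<open>\<lambda>\<close> of radius \<open>q \<lambda>\<close> with \<open>q < 1\<close>.  One
  projection step with the constant conductivity \<open>\<lambda>\<close> therefore multiplies the dual norm of the
  residual by \<open>q\<close>, so that the infimum of these norms is zero.\<close>

lemma sigma_contraction:
  obtains l q where "l > 0" "0 \<le> q" "q < 1" "AE z in disk. cmod (\<sigma> z - of_real l) \<le> l * q"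
proof -
  \<comment> \<open>With this choice B^2 = l lo, so |\<sigma> - l|^2 is at most B^2 - 2 l lo + l^2 =
    l^2 - l lo, which is (l q)^2 for the \<open>q\<close> chosen next. The assumption
    \<open>B \<ge> lo\<close> makes the radicand nonnegative.\<close>
  define l where "l = B\<^sup>2 / lo"
  define q where "q = sqrt (1 - lo / l)"
  have Bp: "B > 0" using lo_pos B_pos by linarith
  have l: "l > 0" using lo_pos Bp by (simp add: l_def)
  have "lo / l = (lo / B)\<^sup>2" using lo_pos Bp by (simp add: l_def power2_eq_square)
  moreover have "lo / B \<le> 1" using B_pos Bp by simp
  ultimately have ll: "lo / l \<le> 1" using lo_pos Bp by (simp add: power_le_one)
  have lp: "0 < lo / l" using lo_pos l by simp
  have q: "0 \<le> q" "q < 1" using ll lp by (auto simp: q_def)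
  have q2: "q\<^sup>2 = 1 - lo / l" using ll by (simp add: q_def)
  have "AE z in disk. cmod (\<sigma> z - of_real l) \<le> l * q"
    using bounded_\<sigma> lo_le
  proof eventually_elim
    case (elim z)
    have "(cmod (\<sigma> z - of_real l))\<^sup>2 = (cmod (\<sigma> z))\<^sup>2 - 2 * l * Re (\<sigma> z) + l\<^sup>2"
      by (simp add: cmod_power2 power2_diff)
    also have "\<dots> \<le> B\<^sup>2 - 2 * l * lo + l\<^sup>2"
      using elim l by (intro add_right_mono diff_mono power_mono mult_left_mono) auto
    also have "\<dots> = l\<^sup>2 - l * lo" using lo_pos by (simp add: l_def)
    also have "\<dots> = (l * q)\<^sup>2" unfolding power_mult_distrib q2 using l by (simp add: power2_eq_square field_simps)
    finally show ?case by (rule power2_le_imp_le) (use l q in simp)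
  qed
  then show thesis using that l q by blast
qed

text \<open>A bound for the dual norm of the residual, tested on gradients of smooth functions; in
  this form no dual space has to be introduced.\<close>

definition residual_le :: "(complex \<Rightarrow> complex \<times> complex) \<Rightarrow> (complex \<Rightarrow> complex) \<Rightarrow> real \<Rightarrow> bool" where
  "residual_le F v r \<longleftrightarrow> (\<forall>\<phi>. smooth \<phi> \<longrightarrow>
    cmod ((LINT z|disk. dot (F z) (grad \<phi> z)) - form (grad v) (grad \<phi>)) \<le> r * L2n disk (grad \<phi>))"

text \<open>Let H be the residual field divided by \<open>l\<close> and grad \<psi> its approximate
  projection. The new residual is \<open>l\<close> times the pairing with H - grad \<psi>, which is
  small, minus the pairing with (\<sigma> - l) grad \<psi>. As grad \<psi> has norm at most r / l up
  to the projection error, the latter contributes at most q r up to an error.\<close>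

lemma residual_step:
  assumes F: "F \<in> L2s disk" and v: "smooth v" and r: "residual_le F v r"
    and l: "l > 0" and q: "0 \<le> q" and contr: "AE z in disk. cmod (\<sigma> z - of_real l) \<le> l * q" and e: "e > 0"
  shows "\<exists>w. smooth w \<and> residual_le F w (q * r + e)"
proof -
  \<comment> \<open>The projection error enters twice, as l e' and as l q e'; this value makes the
    sum equal to \<open>e\<close>.\<close>
  define e' where "e' = e / (l * (1 + q))"
  have e': "e' > 0" using e l q by (simp add: e'_def)
  define G where "G z = F z - scl (\<sigma> z) (grad v z)" for z
  have G: "G \<in> L2s disk" unfolding G_def[abs_def]
    by (intro L2s_diff F L2s_scl(1)[OF measurable_\<sigma> bounded_\<sigma>] L2s_grad v)
  have GI: "(LINT z|disk. dot (G z) (grad \<phi> z)) = (LINT z|disk. dot (F z) (grad \<phi> z)) - form (grad v) (grad \<phi>)"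
    if "smooth \<phi>" for \<phi>
    unfolding G_def dot_diff_left dot_scl_left form_def
    by (intro Bochner_Integration.integral_diff LINT_dot1(1) F L2s_grad form_integrable v that)
  define H where "H z = scl (1 / of_real l) (G z)" for z
  have H: "H \<in> L2s disk" unfolding H_def[abs_def] by (rule L2s_scl_const[OF G])
  obtain \<psi> where \<psi>: "smooth \<psi>" and pr: "\<And>\<phi>. smooth \<phi> \<Longrightarrow>
      cmod (LINT z|disk. dot (H z - grad \<psi> z) (grad \<phi> z)) \<le> e' * L2n disk (grad \<phi>)"
    using approx_projection[OF H e'] by blast
  have r': "cmod (LINT z|disk. dot (G z) (grad \<phi> z)) \<le> r * L2n disk (grad \<phi>)" if "smooth \<phi>" for \<phi>
    using r that unfolding residual_le_def GI[OF that] by blast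
  define P where "P = L2n disk (grad \<psi>)"
  have P: "P \<le> r / l + e' \<or> P = 0"
  proof -
    \<comment> \<open>Testing with the conjugate of \<psi> turns the pairing with grad \<psi> into
      the square of \<open>P\<close>.\<close>
    define \<eta> where "\<eta> z = cnj (\<psi> z)" for z
    have \<eta>: "smooth \<eta>" unfolding \<eta>_def[abs_def] by (rule smooth_cnj[OF \<psi>])
    have g\<eta>: "grad \<eta> z = cnjp (grad \<psi> z)" for z unfolding \<eta>_def[abs_def] by (rule grad_cnj[OF \<psi>])
    have n\<eta>: "L2n disk (grad \<eta>) = P" by (simp add: P_def L2n_def g\<eta>)
    have "complex_of_real (P\<^sup>2) = (LINT z|disk. dot (grad \<psi> z) (grad \<eta> z))"
      unfolding P_def g\<eta> by (rule LINT_dot_cnjp[symmetric])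
    also have "\<dots> = (LINT z|disk. dot (H z) (grad \<eta> z)) - (LINT z|disk. dot (H z - grad \<psi> z) (grad \<eta> z))"
      using LINT_dot1(1)[OF H L2s_grad[OF \<eta>]] LINT_dot1(1)[OF L2s_grad[OF \<psi>] L2s_grad[OF \<eta>]]
      by (simp add: dot_diff_left)
    also have "(LINT z|disk. dot (H z) (grad \<eta> z)) = (1 / of_real l) * (LINT z|disk. dot (G z) (grad \<eta> z))"
      unfolding H_def dot_scl_left by simp
    finally have "P\<^sup>2 = cmod ((1 / of_real l) * (LINT z|disk. dot (G z) (grad \<eta> z)) - (LINT z|disk. dot (H z - grad \<psi> z) (grad \<eta> z)))"
      by (metis norm_of_real abs_of_nonneg zero_le_power2)
    also have "\<dots> \<le> (1 / l) * cmod (LINT z|disk. dot (G z) (grad \<eta> z)) + cmod (LINT z|disk. dot (H z - grad \<psi> z) (grad \<eta> z))"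
      by (rule order_trans[OF norm_triangle_ineq4]) (use l in \<open>simp add: norm_mult norm_divide\<close>)
    also have "\<dots> \<le> (1 / l) * (r * P) + e' * P"
      using r'[OF \<eta>] pr[OF \<eta>] l unfolding n\<eta> by (intro add_mono mult_left_mono) auto
    finally have "P * P \<le> (r / l + e') * P" by (simp add: power2_eq_square algebra_simps)
    then show ?thesis using L2n_nonneg[of disk "grad \<psi>"] by (auto simp: P_def[symmetric])
  qed
  define w where "w z = v z + \<psi> z" for z
  have w: "smooth w" unfolding w_def[abs_def] by (intro smooth_add v \<psi>)
  have "residual_le F w (q * r + e)"
    unfolding residual_le_def
  proof (intro allI impI)
    fix \<phi> :: "complex \<Rightarrow> complex" assume \<phi>: "smooth \<phi>"
    define N where "N = L2n disk (grad \<phi>)"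
    have r0: "r * N \<ge> 0" using r'[OF \<phi>] norm_ge_zero unfolding N_def by (rule order_trans[rotated])
    have gw: "grad w z = grad v z + grad \<psi> z" for z unfolding w_def[abs_def] by (rule grad_add[OF v \<psi>])
    have "(LINT z|disk. dot (F z) (grad \<phi> z)) - form (grad w) (grad \<phi>) =
      (LINT z|disk. dot (F z) (grad \<phi> z)) - form (grad v) (grad \<phi>) - form (grad \<psi>) (grad \<phi>)"
      unfolding form_def gw dot_add_right dot_add_left distrib_left
      using form_integrable[OF L2s_grad[OF v] L2s_grad[OF \<phi>]] form_integrable[OF L2s_grad[OF \<psi>] L2s_grad[OF \<phi>]]
      by simp
    also have "\<dots> = of_real l * (LINT z|disk. dot (H z - grad \<psi> z) (grad \<phi> z))
        - (LINT z|disk. (\<sigma> z - of_real l) * dot (grad \<psi> z) (grad \<phi> z))"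
    proof -
      have i: "integrable disk (\<lambda>z. dot (G z) (grad \<phi> z))" "integrable disk (\<lambda>z. dot (grad \<psi> z) (grad \<phi> z))"
        by (intro LINT_dot1(1) G L2s_grad \<psi> \<phi>)+
      have "of_real l * (LINT z|disk. dot (H z - grad \<psi> z) (grad \<phi> z)) =
         (LINT z|disk. dot (G z) (grad \<phi> z)) - of_real l * (LINT z|disk. dot (grad \<psi> z) (grad \<phi> z))"
        unfolding H_def dot_diff_left dot_scl_left using i l by (simp add: right_diff_distrib)
      moreover have "(LINT z|disk. (\<sigma> z - of_real l) * dot (grad \<psi> z) (grad \<phi> z)) =
         form (grad \<psi>) (grad \<phi>) - of_real l * (LINT z|disk. dot (grad \<psi> z) (grad \<phi> z))"
        unfolding form_def left_diff_distrib using i form_integrable[OF L2s_grad[OF \<psi>] L2s_grad[OF \<phi>]] by simp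
      ultimately show ?thesis unfolding GI[OF \<phi>] by simp
    qed
    also have "cmod \<dots> \<le> l * (e' * N) + l * q * P * N"
    proof (rule order_trans[OF norm_triangle_ineq4 add_mono])
      show "cmod (of_real l * (LINT z|disk. dot (H z - grad \<psi> z) (grad \<phi> z))) \<le> l * (e' * N)"
        using pr[OF \<phi>] l by (simp add: norm_mult N_def)
      show "cmod (LINT z|disk. (\<sigma> z - of_real l) * dot (grad \<psi> z) (grad \<phi> z)) \<le> l * q * P * N"
        unfolding P_def N_def
        by (rule LINT_dot(2)[OF L2s_grad[OF \<psi>] L2s_grad[OF \<phi>] _ contr])
           (use measurable_\<sigma> l q in auto)
    qed
    also have "\<dots> \<le> l * (e' * N) + (q * (r * N) + l * q * (e' * N))"
    proof -
      have "l * q * P * N \<le> q * (r * N) + l * q * (e' * N)"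
        using P
      proof
        assume "P \<le> r / l + e'"
        then have "(l * q * N) * P \<le> (l * q * N) * (r / l + e')"
          using l q by (intro mult_left_mono) (auto simp: N_def)
        also have "\<dots> = q * (r * N) + l * q * (e' * N)" using l by (simp add: field_simps)
        finally show ?thesis by (simp add: mult_ac)
      next
        assume "P = 0"
        then show ?thesis using r0 q l e' by (simp add: N_def)
      qed
      then show ?thesis by simp
    qed
    also have "\<dots> = (q * r + e) * N"
    proof -
      have "l * (1 + q) > 0" using l q by (simp add: add_pos_nonneg)
      then have "l * (1 + q) \<noteq> 0" by linarith
      then have "e = l * (1 + q) * e'" unfolding e'_def by (metis nonzero_mult_div_cancel_left times_divide_eq_right)
      then have "e = l * e' + l * q * e'" by (simp add: algebra_simps)
      then show ?thesis by (simp add: algebra_simps)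
    qed
    finally show "cmod ((LINT z|disk. dot (F z) (grad \<phi> z)) - form (grad w) (grad \<phi>)) \<le> (q * r + e) * L2n disk (grad \<phi>)"
      by (simp add: N_def)
  qed
  then show ?thesis using w by blast
qed

lemma residual_small:
  assumes F: "F \<in> L2s disk" and e: "e > 0"
  shows "\<exists>v. smooth v \<and> residual_le F v e"
proof -
  obtain l q where lq: "l > 0" "0 \<le> q" "q < 1" "AE z in disk. cmod (\<sigma> z - of_real l) \<le> l * q"
    by (rule sigma_contraction)
  define R where "R = {r. r \<ge> 0 \<and> (\<exists>v. smooth v \<and> residual_le F v r)}"
  have "residual_le F (\<lambda>_. 0) (L2n disk F)"
    unfolding residual_le_def form_def grad_const using LINT_dot1(2)[OF F L2s_grad] by simp
  then have R: "R \<noteq> {}" "bdd_below R" unfolding R_def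
    by (auto intro!: exI[of _ "L2n disk F"] exI[of _ "\<lambda>_. 0"] smooth_const bdd_belowI[of _ 0])
  have R0: "Inf R \<ge> 0" using R(1) by (intro cInf_greatest) (auto simp: R_def)
  have "Inf R < e"
  proof (rule ccontr)
    assume "\<not> Inf R < e"
    then have Rp: "Inf R > 0" using e by linarith
    \<comment> \<open>From a value within \<open>d\<close> of the infimum, one step with error
      \<open>d\<close> leads to at most q Inf R + 2 d, and 2 d is only half of (1 - q) Inf
      R.\<close>
    define d where "d = (1 - q) * Inf R / 4"
    have d: "d > 0" using lq Rp by (simp add: d_def)
    have "Inf R < Inf R + d" using d by simp
    then obtain r v where r: "r \<ge> 0" "r < Inf R + d" "smooth v" "residual_le F v r"
      unfolding cInf_less_iff[OF R] by (auto simp: R_def)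
    obtain w where "smooth w" "residual_le F w (q * r + d)"
      using residual_step[OF F r(3,4) lq(1,2,4) d] by blast
    then have "q * r + d \<in> R" using r lq d by (auto simp: R_def)
    then have "Inf R \<le> q * r + d" by (rule cInf_lower[OF _ R(2)])
    also have "\<dots> \<le> q * (Inf R + d) + d" using r lq by (simp add: mult_left_mono)
    also have "\<dots> \<le> q * Inf R + 2 * d" using lq d mult_left_le_one_le[of d q] by (simp add: distrib_left)
    finally have "(1 - q) * Inf R \<le> 2 * d" by (simp add: algebra_simps)
    then show False using lq Rp by (simp add: d_def)
  qed
  then obtain r v where "r \<ge> 0" "r < e" "smooth v" "residual_le F v r"
    unfolding cInf_less_iff[OF R] by (auto simp: R_def)
  then have "smooth v \<and> residual_le F v e"
    unfolding residual_le_def by (meson L2n_nonneg less_imp_le mult_right_mono order_trans)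
  then show ?thesis by blast
qed

end

section \<open>The Neumann-to-Dirichlet map\<close>

lemma L2s_circ_integrable:
  assumes "h \<in> L2s circ" shows "integrable circ (h :: real \<Rightarrow> complex)"
  using LINT_times(1)[OF assms L2s_circ_continuous[OF continuous_on_const[of _ "1::complex"]]] by simp

lemma fc_bound_L2:
  assumes "h \<in> L2s circ"
  shows "cmod (fc h n) \<le> L2n circ (fmode (- n)) / (2 * pi) * L2n circ h"
  using LINT_times(2)[OF assms L2s_circ_continuous[OF continuous_fmode], of "- n"]
  by (simp add: fc_def norm_divide divide_right_mono mult.commute)

lemma fc_tendsto_L2:
  assumes h: "h \<in> L2s circ" and v: "\<And>k. v k \<in> L2s circ" and lim: "(\<lambda>k. L2n circ (\<lambda>x. v k x - h x)) \<longlonglongrightarrow> 0"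
  shows "(\<lambda>k. fc (v k) n) \<longlonglongrightarrow> fc h n"
proof (rule LIM_zero_cancel, rule Lim_null_comparison[OF always_eventually])
  show "\<forall>k. norm (fc (v k) n - fc h n) \<le> L2n circ (fmode (- n)) / (2 * pi) * L2n circ (\<lambda>x. v k x - h x)"
    using fc_bound_L2[OF L2s_diff[OF v h]] by (simp add: fc_diff L2s_circ_integrable v h)
  show "(\<lambda>k. L2n circ (fmode (- n)) / (2 * pi) * L2n circ (\<lambda>x. v k x - h x)) \<longlonglongrightarrow> 0"
    using tendsto_mult_left[OF lim] by simp
qed

text \<open>Only gradients are required to converge, since the Neumann problem determines solutions
  up to constants. Convergence of the functions themselves follows by \<open>trace_limit\<close> and
  \<open>disk_limit\<close> once the means on the circle are fixed.\<close>

definition conv_grad :: "(nat \<Rightarrow> complex \<Rightarrow> complex) \<Rightarrow> (complex \<Rightarrow> complex \<times> complex) \<Rightarrow> bool" where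
  "conv_grad v U \<longleftrightarrow> (\<forall>k. smooth (v k)) \<and> U \<in> L2s disk \<and> (\<lambda>k. L2n disk (\<lambda>z. grad (v k) z - U z)) \<longlonglongrightarrow> 0"

lemma conv_gradD:
  assumes "conv_grad v U"
  shows "smooth (v k)" "U \<in> L2s disk" "(\<lambda>k. L2n disk (\<lambda>z. grad (v k) z - U z)) \<longlonglongrightarrow> 0"
  using assms by (auto simp: conv_grad_def)

lemma conv_grad_const: "smooth v \<Longrightarrow> conv_grad (\<lambda>_. v) (grad v)"
  by (simp add: conv_grad_def L2s_grad L2n_def)

lemma tendsto_LINT_dot:
  assumes v: "conv_grad v U" and V: "V \<in> L2s disk" and b: "b \<in> borel_measurable disk"
    "AE z in disk. cmod (b z) \<le> C"
    "C \<ge> 0"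
  shows "(\<lambda>k. LINT z|disk. b z * dot (grad (v k) z) (V z)) \<longlonglongrightarrow> (LINT z|disk. b z * dot (U z) (V z))"
proof (rule LIM_zero_cancel, rule Lim_null_comparison[OF always_eventually])
  note D = conv_gradD[OF v]
  have eq: "(LINT z|disk. b z * dot (grad (v k) z) (V z)) - (LINT z|disk. b z * dot (U z) (V z)) =
    (LINT z|disk. b z * dot (grad (v k) z - U z) (V z))" for k
    using LINT_dot(1)[OF L2s_grad[OF D(1)] V b(1,2)] LINT_dot(1)[OF D(2) V b(1,2)]
    by (simp add: dot_diff_left right_diff_distrib)
  show "\<forall>k. norm ((LINT z|disk. b z * dot (grad (v k) z) (V z)) - (LINT z|disk. b z * dot (U z) (V z)))
      \<le> C * L2n disk (\<lambda>z. grad (v k) z - U z) * L2n disk V"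
    unfolding eq by (intro allI LINT_dot(2) L2s_diff L2s_grad D V b)
  show "(\<lambda>k. C * L2n disk (\<lambda>z. grad (v k) z - U z) * L2n disk V) \<longlonglongrightarrow> 0"
    using tendsto_mult_right[OF tendsto_mult_left[OF D(3)]] by simp
qed

lemma tendsto_LINT_dot1:
  assumes v: "conv_grad v U" and V: "V \<in> L2s disk"
  shows "(\<lambda>k. LINT z|disk. dot (grad (v k) z) (V z)) \<longlonglongrightarrow> (LINT z|disk. dot (U z) (V z))"
  using tendsto_LINT_dot[OF assms, of "\<lambda>_. 1" 1] by simp

lemma conv_grad_diff:
  assumes "conv_grad v U" "conv_grad w V"
  shows "conv_grad (\<lambda>k z. v k z - w k z) (\<lambda>z. U z - V z)"
proof -
  note D = conv_gradD[OF assms(1)] conv_gradD[OF assms(2)]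
  have "(\<lambda>k. L2n disk (\<lambda>z. grad (\<lambda>z. v k z - w k z) z - (U z - V z))) \<longlonglongrightarrow> 0"
  proof (rule Lim_null_comparison[OF always_eventually])
    show "\<forall>k. norm (L2n disk (\<lambda>z. grad (\<lambda>z. v k z - w k z) z - (U z - V z))) \<le>
        L2n disk (\<lambda>z. grad (v k) z - U z) + L2n disk (\<lambda>z. grad (w k) z - V z)"
    proof
      fix k
      have "(\<lambda>z. grad (\<lambda>z. v k z - w k z) z - (U z - V z)) = (\<lambda>z. (grad (v k) z - U z) - (grad (w k) z - V z))"
        by (auto simp: grad_diff D)
      then show "norm (L2n disk (\<lambda>z. grad (\<lambda>z. v k z - w k z) z - (U z - V z))) \<le>
        L2n disk (\<lambda>z. grad (v k) z - U z) + L2n disk (\<lambda>z. grad (w k) z - V z)"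
        using L2n_diff_le[OF L2s_diff[OF L2s_grad[OF D(1)] D(2)] L2s_diff[OF L2s_grad[OF D(4)] D(5)], of k k] by simp
    qed
    show "(\<lambda>k. L2n disk (\<lambda>z. grad (v k) z - U z) + L2n disk (\<lambda>z. grad (w k) z - V z)) \<longlonglongrightarrow> 0"
      using tendsto_add[OF D(3) D(6)] by simp
  qed
  then show ?thesis using D by (auto simp: conv_grad_def intro!: smooth_diff L2s_diff)
qed

lemma conv_grad_cmult:
  assumes "conv_grad v U"
  shows "conv_grad (\<lambda>k z. c * v k z) (\<lambda>z. scl c (U z))"
proof -
  note D = conv_gradD[OF assms(1)]
  have "grad (\<lambda>z. c * v k z) z - scl c (U z) = scl c (grad (v k) z - U z)" for k z
    by (simp add: grad_cmult D scl_def right_diff_distrib prod_eq_iff)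
  then have "(\<lambda>k. L2n disk (\<lambda>z. grad (\<lambda>z. c * v k z) z - scl c (U z))) \<longlonglongrightarrow> 0"
    using tendsto_mult_left[OF D(3), of "cmod c"] by (simp add: L2n_scl_const)
  then show ?thesis using D by (auto simp: conv_grad_def intro!: smooth_cmult L2s_scl_const)
qed

lemma conv_grad_complete:
  assumes v: "\<And>k. smooth (v k)"
    and cauchy: "\<And>e. e > 0 \<Longrightarrow> \<exists>K. \<forall>j\<ge>K. \<forall>k\<ge>K. L2n disk (grad (\<lambda>z. v j z - v k z)) < e"
  shows "\<exists>U. conv_grad v U"
proof -
  have "grad (\<lambda>z. v j z - v k z) = (\<lambda>z. grad (v j) z - grad (v k) z)" for j k
    by (auto simp: grad_diff v)
  then show ?thesis
    using L2_complete[of "\<lambda>k. grad (v k)", OF L2s_grad[OF v]] cauchy v unfolding conv_grad_def by auto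
qed

lemma conv_grad_cauchy:
  assumes v: "conv_grad v U" and e: "e > 0"
  shows "\<exists>K. \<forall>j\<ge>K. \<forall>k\<ge>K. L2n disk (grad (\<lambda>z. v j z - v k z)) < e"
proof -
  note D = conv_gradD[OF v]
  obtain K where K: "\<And>k. k \<ge> K \<Longrightarrow> L2n disk (\<lambda>z. grad (v k) z - U z) < e / 2"
    using LIMSEQ_D[OF D(3), of "e/2"] e by auto
  have "L2n disk (grad (\<lambda>z. v j z - v k z)) < e" if "j \<ge> K" "k \<ge> K" for j k
  proof -
    have "grad (\<lambda>z. v j z - v k z) = (\<lambda>z. grad (v j) z - grad (v k) z)" by (auto simp: grad_diff D)
    then show ?thesis
      using L2n_triangle_diff[OF L2s_grad[OF D(1)] D(2) L2s_grad[OF D(1)], of j k] K[OF that(1)] K[OF that(2)]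
        L2n_minus_commute[of disk U "grad (v k)"] by simp
  qed
  then show ?thesis by blast
qed

lemma fc_sub_const:
  assumes "smooth v"
  shows "fc (\<lambda>t. v (cis t) - c) 0 = fc (\<lambda>t. v (cis t)) 0 - c"
proof -
  have "fc (\<lambda>t. c) 0 = c" using fc_sum_fmode[of "{0}" "\<lambda>_. c" 0] by simp
  then show ?thesis
    by (subst fc_diff) (auto intro: integrable_circ_continuous continuous_cis_comp assms)
qed

text \<open>The trace inequality applies to differences because all means vanish, so Cauchy
  gradients force Cauchy traces.\<close>

lemma trace_limit:
  assumes v: "conv_grad v U" and mean: "\<And>k. fc (\<lambda>t. v k (cis t)) 0 = 0"
  shows "\<exists>h\<in>L2s circ. (\<lambda>k. L2n circ (\<lambda>t. v k (cis t) - h t)) \<longlonglongrightarrow> 0"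
proof (rule L2_complete)
  note D = conv_gradD[OF v]
  show "(\<lambda>t. v k (cis t)) \<in> L2s circ" for k by (intro L2s_circ_continuous continuous_cis_comp D)
  fix e :: real assume "e > 0"
  from conv_grad_cauchy[OF v this] obtain K where
    K: "\<And>j k. j \<ge> K \<Longrightarrow> k \<ge> K \<Longrightarrow> L2n disk (grad (\<lambda>z. v j z - v k z)) < e" by blast
  have "L2n circ (\<lambda>t. v j (cis t) - v k (cis t)) \<le> L2n disk (grad (\<lambda>z. v j z - v k z))" for j k
    using trace_inequality[OF smooth_diff[OF D(1) D(1)], of j k]
    by (simp add: fc_diff integrable_circ_continuous continuous_cis_comp D mean)
  then show "\<exists>K. \<forall>j\<ge>K. \<forall>k\<ge>K. L2n circ (\<lambda>t. v j (cis t) - v k (cis t)) < e"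
    using K order_le_less_trans by blast
qed

text \<open>Friedrichs' inequality controls the functions in the disk by their traces and gradients,
  both of which are Cauchy.\<close>

lemma disk_limit:
  assumes v: "conv_grad v U" and h: "h \<in> L2s circ" "(\<lambda>k. L2n circ (\<lambda>t. v k (cis t) - h t)) \<longlonglongrightarrow> 0"
  shows "\<exists>u\<in>L2s disk. (\<lambda>k. L2n disk (\<lambda>z. v k z - u z)) \<longlonglongrightarrow> 0"
proof (rule L2_complete)
  note D = conv_gradD[OF v]
  have vc: "(\<lambda>t. v k (cis t)) \<in> L2s circ" for k by (intro L2s_circ_continuous continuous_cis_comp D)
  show "v k \<in> L2s disk" for k by (intro L2s_smooth D)
  fix e :: real assume e: "e > 0"
  then have "e / 3 > 0" by simp
  from conv_grad_cauchy[OF v this] obtain K where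
    K: "\<And>j k. j \<ge> K \<Longrightarrow> k \<ge> K \<Longrightarrow> L2n disk (grad (\<lambda>z. v j z - v k z)) < e / 3" by blast
  obtain K' where K': "\<And>k. k \<ge> K' \<Longrightarrow> L2n circ (\<lambda>t. v k (cis t) - h t) < e / 3"
    using LIMSEQ_D[OF h(2), of "e/3"] e by auto
  have "L2n disk (\<lambda>z. v j z - v k z) < e" if jk: "j \<ge> max K K'" "k \<ge> max K K'" for j k
  proof -
    let ?w = "\<lambda>z. v j z - v k z"
    have w: "smooth ?w" by (intro smooth_diff D)
    have "(L2n disk ?w)\<^sup>2 \<le> (L2n circ (\<lambda>t. ?w (cis t)))\<^sup>2 + (L2n disk (grad ?w))\<^sup>2"
      by (rule Friedrichs_inequality[OF w])
    also have "\<dots> \<le> (L2n circ (\<lambda>t. ?w (cis t)) + L2n disk (grad ?w))\<^sup>2"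
      by (simp add: power2_sum)
    finally have "L2n disk ?w \<le> L2n circ (\<lambda>t. ?w (cis t)) + L2n disk (grad ?w)"
      by (rule power2_le_imp_le) simp
    also have "L2n circ (\<lambda>t. ?w (cis t)) \<le> L2n circ (\<lambda>t. v j (cis t) - h t) + L2n circ (\<lambda>t. h t - v k (cis t))"
      by (rule L2n_triangle_diff[OF vc h(1) vc])
    also have "L2n circ (\<lambda>t. h t - v k (cis t)) = L2n circ (\<lambda>t. v k (cis t) - h t)" by (rule L2n_minus_commute)
    finally show ?thesis using K[of j k] K'[of j] K'[of k] jk by simp
  qed
  then show "\<exists>K. \<forall>j\<ge>K. \<forall>k\<ge>K. L2n disk (\<lambda>z. v j z - v k z) < e" by blast
qed

lemma L2n_fst_le:
  fixes U :: "'a \<Rightarrow> 'b::euclidean_space \<times> 'c::euclidean_space"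
  assumes "U \<in> L2s N"
  shows "(\<lambda>x. fst (U x)) \<in> L2s N"
    "(\<lambda>x. snd (U x)) \<in> L2s N"
    "L2n N (\<lambda>x. fst (U x)) \<le> L2n N U"
    "L2n N (\<lambda>x. snd (U x)) \<le> L2n N U"
proof -
  have m: "(\<lambda>x. fst (U x)) \<in> borel_measurable N" "(\<lambda>x. snd (U x)) \<in> borel_measurable N"
    by (intro measurable_compose[OF L2s_measurable[OF assms]] borel_measurable_continuous_onI continuous_intros)+
  have l: "AE x in N. norm (fst (U x)) \<le> 1 * norm (U x)" "AE x in N. norm (snd (U x)) \<le> 1 * norm (U x)"
  proof -
    have "norm (fst p) \<le> norm p" "norm (snd p) \<le> norm p" for p :: "'b \<times> 'c"
      by (cases p; simp add: norm_fst_le norm_snd_le)+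
    then show "AE x in N. norm (fst (U x)) \<le> 1 * norm (U x)" "AE x in N. norm (snd (U x)) \<le> 1 * norm (U x)"
      by simp_all
  qed
  show "(\<lambda>x. fst (U x)) \<in> L2s N" "(\<lambda>x. snd (U x)) \<in> L2s N"
    using L2s_bound[OF assms m(1) l(1)] L2s_bound[OF assms m(2) l(2)] .
  show "L2n N (\<lambda>x. fst (U x)) \<le> L2n N U" "L2n N (\<lambda>x. snd (U x)) \<le> L2n N U"
    using L2n_bound[OF assms m(1) l(1)] L2n_bound[OF assms m(2) l(2)] by auto
qed

lemma L2_Pair:
  fixes f :: "'a \<Rightarrow> 'b::euclidean_space" and g :: "'a \<Rightarrow> 'c::euclidean_space"
  assumes "f \<in> L2s N" "g \<in> L2s N"
  shows "(\<lambda>x. (f x, g x)) \<in> L2s N" "L2n N (\<lambda>x. (f x, g x)) \<le> L2n N f + L2n N g"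
proof -
  have 1: "(\<lambda>x. (f x, 0 :: 'c)) \<in> L2s N" and 2: "(\<lambda>x. (0 :: 'b, g x)) \<in> L2s N"
    using assms by (auto simp: L2s_def norm_Pair intro!: borel_measurable_Pair)
  show "(\<lambda>x. (f x, g x)) \<in> L2s N" using L2s_add[OF 1 2] by simp
  have "L2n N (\<lambda>x. (f x, 0 :: 'c)) = L2n N f" "L2n N (\<lambda>x. (0 :: 'b, g x)) = L2n N g"
    by (simp_all add: L2n_def norm_Pair)
  then show "L2n N (\<lambda>x. (f x, g x)) \<le> L2n N f + L2n N g" using L2n_triangle[OF 1 2] by simp
qed

text \<open>Passes from the two partial derivatives of the definition to one pair-valued field, the
  form in which all estimates are made.\<close>

lemma H1_approx_iff:
  "H1_approx v u ux uy \<longleftrightarrow> conv_grad v (\<lambda>z. (ux z, uy z)) \<and> L2_conv disk v u"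
proof
  assume A: "H1_approx v u ux uy"
  then have s: "\<And>k. smooth (v k)" and l: "L2_conv disk v u"
    and x: "ux \<in> L2s disk" "(\<lambda>k. L2n disk (\<lambda>z. dir_deriv 1 (v k) z - ux z)) \<longlonglongrightarrow> 0"
    and y: "uy \<in> L2s disk" "(\<lambda>k. L2n disk (\<lambda>z. dir_deriv \<i> (v k) z - uy z)) \<longlonglongrightarrow> 0"
    by (auto simp: H1_approx_def L2_conv_iff)
  have "(\<lambda>k. L2n disk (\<lambda>z. grad (v k) z - (ux z, uy z))) \<longlonglongrightarrow> 0"
  proof (rule Lim_null_comparison[OF always_eventually])
    show "\<forall>k. norm (L2n disk (\<lambda>z. grad (v k) z - (ux z, uy z))) \<le>
      L2n disk (\<lambda>z. dir_deriv 1 (v k) z - ux z) + L2n disk (\<lambda>z. dir_deriv \<i> (v k) z - uy z)"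
      using L2_Pair(2)[OF L2s_diff[OF L2s_smooth[OF smooth_dirs(1)[OF s]] x(1)] L2s_diff[OF L2s_smooth[OF smooth_dirs(2)[OF s]] y(1)]]
      by (simp add: grad_def)
    show "(\<lambda>k. L2n disk (\<lambda>z. dir_deriv 1 (v k) z - ux z) + L2n disk (\<lambda>z. dir_deriv \<i> (v k) z - uy z)) \<longlonglongrightarrow> 0"
      using tendsto_add[OF x(2) y(2)] by simp
  qed
  then show "conv_grad v (\<lambda>z. (ux z, uy z)) \<and> L2_conv disk v u"
    using s l L2_Pair(1)[OF x(1) y(1)] by (auto simp: conv_grad_def)
next
  assume A: "conv_grad v (\<lambda>z. (ux z, uy z)) \<and> L2_conv disk v u"
  then have c: "conv_grad v (\<lambda>z. (ux z, uy z))" ..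
  note D = conv_gradD[OF c]
  have xy: "ux \<in> L2s disk" "uy \<in> L2s disk" using L2n_fst_le(1,2)[OF D(2)] by auto
  have le: "L2n disk (\<lambda>z. dir_deriv 1 (v k) z - ux z) \<le> L2n disk (\<lambda>z. grad (v k) z - (ux z, uy z))"
    "L2n disk (\<lambda>z. dir_deriv \<i> (v k) z - uy z) \<le> L2n disk (\<lambda>z. grad (v k) z - (ux z, uy z))" for k
    using L2n_fst_le(3,4)[OF L2s_diff[OF L2s_grad[OF D(1)] D(2)], of k] by (auto simp: grad_def)
  have "(\<lambda>k. L2n disk (\<lambda>z. dir_deriv 1 (v k) z - ux z)) \<longlonglongrightarrow> 0"
    by (rule Lim_null_comparison[OF always_eventually D(3)]) (use le in auto)
  moreover have "(\<lambda>k. L2n disk (\<lambda>z. dir_deriv \<i> (v k) z - uy z)) \<longlonglongrightarrow> 0"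
    by (rule Lim_null_comparison[OF always_eventually D(3)]) (use le in auto)
  ultimately show "H1_approx v u ux uy"
    using A D xy by (auto simp: H1_approx_def L2_conv_iff intro: L2s_smooth smooth_dirs)
qed

section \<open>Exact weak solutions and the value of the Neumann-to-Dirichlet map\<close>

context conductivity
begin

lemma tendsto_form:
  assumes "conv_grad v U" "V \<in> L2s disk"
  shows "(\<lambda>k. form (grad (v k)) V) \<longlonglongrightarrow> form U V"
  unfolding form_def using lo_pos B_pos
  by (intro tendsto_LINT_dot[OF assms measurable_\<sigma> bounded_\<sigma>]) simp

text \<open>The field \<open>U\<close> need not be the gradient of a smooth function and cannot be
  inserted directly. Conjugates of the approximants are inserted instead, and coercivity is used in
  the limit. The case c = 0 yields uniqueness, other values of \<open>c\<close> yield stability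
  estimates.\<close>

lemma coercive_limit:
  assumes v: "conv_grad v U" and c: "\<And>\<phi>. smooth \<phi> \<Longrightarrow> cmod (form U (grad \<phi>)) \<le> c * L2n disk (grad \<phi>)" "c \<ge> 0"
  shows "lo * L2n disk U \<le> c"
proof -
  note D = conv_gradD[OF v]
  have gc: "grad (\<lambda>z. cnj (v k z)) = (\<lambda>z. cnjp (grad (v k) z))" for k by (rule ext) (rule grad_cnj[OF D(1)])
  have "(\<lambda>k. cmod (form U (\<lambda>z. cnjp (grad (v k) z)))) \<longlonglongrightarrow> cmod (form U (\<lambda>z. cnjp (U z)))"
  proof (rule tendsto_norm, rule LIM_zero_cancel, rule Lim_null_comparison[OF always_eventually])
    show "\<forall>k. norm (form U (\<lambda>z. cnjp (grad (v k) z)) - form U (\<lambda>z. cnjp (U z))) \<le> B * L2n disk U * L2n disk (\<lambda>z. grad (v k) z - U z)"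
    proof
      fix k
      have c1: "(\<lambda>z. cnjp (grad (v k) z)) \<in> L2s disk" "(\<lambda>z. cnjp (U z)) \<in> L2s disk"
        by (intro L2s_cnjp L2s_grad D)+
      have "L2n disk (\<lambda>z. cnjp (grad (v k) z) - cnjp (U z)) = L2n disk (\<lambda>z. cnjp (grad (v k) z - U z))"
        by (simp add: cnjp_def)
      also have "\<dots> = L2n disk (\<lambda>z. grad (v k) z - U z)" by (rule L2n_cnjp)
      finally show "norm (form U (\<lambda>z. cnjp (grad (v k) z)) - form U (\<lambda>z. cnjp (U z))) \<le> B * L2n disk U * L2n disk (\<lambda>z. grad (v k) z - U z)"
        using form_bound[OF D(2) L2s_diff[OF c1]] form_diff_right[OF c1 D(2)] by simp
    qed
    show "(\<lambda>k. B * L2n disk U * L2n disk (\<lambda>z. grad (v k) z - U z)) \<longlonglongrightarrow> 0"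
      using tendsto_mult_left[OF D(3)] by simp
  qed
  moreover have "(\<lambda>k. c * L2n disk (grad (v k))) \<longlonglongrightarrow> c * L2n disk U"
    by (intro tendsto_intros L2n_tendsto D L2s_grad)
  moreover have "cmod (form U (\<lambda>z. cnjp (grad (v k) z))) \<le> c * L2n disk (grad (v k))" for k
    using c(1)[OF smooth_cnj[OF D(1)], of k] unfolding gc by (simp add: L2n_cnjp)
  ultimately have "cmod (form U (\<lambda>z. cnjp (U z))) \<le> c * L2n disk U"
    by (intro LIMSEQ_le) auto
  then have *: "(lo * L2n disk U) * L2n disk U \<le> c * L2n disk U"
    using form_coercive[OF D(2)] by (simp add: power2_eq_square mult.assoc)
  show ?thesis
  proof (cases "L2n disk U = 0")
    case False
    then have "L2n disk U > 0" using L2n_nonneg[of disk U] by linarith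
    then show ?thesis using * by (simp only: mult_le_cancel_right_pos)
  qed (use c in simp)
qed

text \<open>Approximate solutions with residuals 1 / (k + 1) have Cauchy gradients by
  \<open>coercive_limit\<close>, applied to the difference of two of them; the limit has residual
  zero.\<close>

lemma solve_field:
  assumes F: "F \<in> L2s disk"
  shows "\<exists>v U. conv_grad v U \<and> (\<forall>\<phi>. smooth \<phi> \<longrightarrow> form U (grad \<phi>) = (LINT z|disk. dot (F z) (grad \<phi> z)))"
proof -
  have "\<exists>v. smooth v \<and> residual_le F v (1 / (real k + 1))" for k
    by (rule residual_small[OF F]) simp
  then obtain v where v: "\<And>k. smooth (v k)" and r: "\<And>k. residual_le F (v k) (1 / (real k + 1))" by metis
  have cauchy: "lo * L2n disk (grad (\<lambda>z. v j z - v k z)) \<le> 1 / (real j + 1) + 1 / (real k + 1)" for j k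
  proof (rule coercive_limit[OF conv_grad_const])
    show "smooth (\<lambda>z. v j z - v k z)" by (intro smooth_diff v)
    fix \<phi> :: "complex \<Rightarrow> complex" assume \<phi>: "smooth \<phi>"
    let ?I = "LINT z|disk. dot (F z) (grad \<phi> z)"
    have eq: "form (grad (\<lambda>z. v j z - v k z)) (grad \<phi>) = form (grad (v j)) (grad \<phi>) - form (grad (v k)) (grad \<phi>)"
      using form_diff_left[OF L2s_grad[OF v] L2s_grad[OF v] L2s_grad[OF \<phi>], of j k] by (simp add: grad_diff v form_def)
    have "cmod ((?I - form (grad (v k)) (grad \<phi>)) - (?I - form (grad (v j)) (grad \<phi>))) \<le> 1 / (real k + 1) * L2n disk (grad \<phi>) + 1 / (real j + 1) * L2n disk (grad \<phi>)"
      using r[of j] r[of k] \<phi> unfolding residual_le_def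
      by (intro order_trans[OF norm_triangle_ineq4 add_mono]) auto
    then show "cmod (form (grad (\<lambda>z. v j z - v k z)) (grad \<phi>)) \<le> (1 / (real j + 1) + 1 / (real k + 1)) * L2n disk (grad \<phi>)"
      unfolding eq distrib_right by simp
  qed simp
  have "\<exists>U. conv_grad v U"
  proof (rule conv_grad_complete[OF v])
    fix e :: real assume e: "e > 0"
    have "(\<lambda>k. 1 / (real k + 1)) \<longlonglongrightarrow> 0" using LIMSEQ_inverse_real_of_nat by (simp add: inverse_eq_divide add.commute)
    then obtain K where K: "\<And>k. k \<ge> K \<Longrightarrow> 1 / (real k + 1) < lo * e / 2"
      using LIMSEQ_D[of _ 0 "lo * e / 2"] e lo_pos by fastforce
    have "L2n disk (grad (\<lambda>z. v j z - v k z)) < e" if "j \<ge> K" "k \<ge> K" for j k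
    proof -
      have "lo * L2n disk (grad (\<lambda>z. v j z - v k z)) < lo * e"
        using cauchy[of j k] K[OF that(1)] K[OF that(2)] by linarith
      then show ?thesis using lo_pos by simp
    qed
    then show "\<exists>K. \<forall>j\<ge>K. \<forall>k\<ge>K. L2n disk (grad (\<lambda>z. v j z - v k z)) < e" by blast
  qed
  then obtain U where U: "conv_grad v U" by blast
  have "form U (grad \<phi>) = (LINT z|disk. dot (F z) (grad \<phi> z))" if \<phi>: "smooth \<phi>" for \<phi>
  proof -
    let ?I = "LINT z|disk. dot (F z) (grad \<phi> z)"
    have "(\<lambda>k. ?I - form (grad (v k)) (grad \<phi>)) \<longlonglongrightarrow> 0"
    proof (rule Lim_null_comparison[OF always_eventually])
      show "\<forall>k. norm (?I - form (grad (v k)) (grad \<phi>)) \<le> 1 / (real k + 1) * L2n disk (grad \<phi>)"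
        using r \<phi> unfolding residual_le_def by blast
      show "(\<lambda>k. 1 / (real k + 1) * L2n disk (grad \<phi>)) \<longlonglongrightarrow> 0"
        using tendsto_mult_right[OF LIMSEQ_inverse_real_of_nat, of "L2n disk (grad \<phi>)"] by (simp add: inverse_eq_divide add.commute)
    qed
    moreover have "(\<lambda>k. ?I - form (grad (v k)) (grad \<phi>)) \<longlonglongrightarrow> ?I - form U (grad \<phi>)"
      by (intro tendsto_intros tendsto_form U L2s_grad \<phi>)
    ultimately show ?thesis using LIMSEQ_unique by fastforce
  qed
  then show ?thesis using U by blast
qed

text \<open>Approximants, weak gradient and trace of mean zero all belong to one and the same
  sequence, which the separate existential quantifiers behind \<open>ND_map\<close> do not
  provide.\<close>

definition nd_sol :: "pdist \<Rightarrow> (nat \<Rightarrow> complex \<Rightarrow> complex) \<Rightarrow> (complex \<Rightarrow> complex \<times> complex) \<Rightarrow> (real \<Rightarrow> complex) \<Rightarrow> bool" where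
  "nd_sol f v U h \<longleftrightarrow> conv_grad v U \<and> (\<forall>\<phi>. smooth \<phi> \<longrightarrow> form U (grad \<phi>) = f (\<lambda>t. \<phi> (cis t))) \<and>
     h \<in> L2s circ \<and> (\<lambda>k. L2n circ (\<lambda>t. v k (cis t) - h t)) \<longlonglongrightarrow> 0 \<and> fc h 0 = 0"

lemma nd_sol_exists:
  assumes F: "F \<in> L2s disk" "\<And>\<phi>. smooth \<phi> \<Longrightarrow> (LINT z|disk. dot (F z) (grad \<phi> z)) = f (\<lambda>t. \<phi> (cis t))"
  shows "\<exists>v U h. nd_sol f v U h"
proof -
  obtain w U where w: "conv_grad w U" and sol: "\<And>\<phi>. smooth \<phi> \<Longrightarrow> form U (grad \<phi>) = (LINT z|disk. dot (F z) (grad \<phi> z))"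
    using solve_field[OF F(1)] by blast
  note D = conv_gradD[OF w]
  \<comment> \<open>Subtracting the mean over the circle leaves the gradients unchanged and makes
    the trace inequality applicable.\<close>
  define v where "v k z = w k z - fc (\<lambda>t. w k (cis t)) 0" for k z
  have sv: "smooth (v k)" for k unfolding v_def[abs_def] by (intro smooth_diff D smooth_const)
  have "grad (v k) z = grad (w k) z" for k z
    unfolding v_def[abs_def] by (simp add: grad_diff D smooth_const grad_const)
  then have v: "conv_grad v U" using w sv by (simp add: conv_grad_def)
  have mean: "fc (\<lambda>t. v k (cis t)) 0 = 0" for k by (simp add: v_def fc_sub_const[OF D(1)])
  obtain h where h: "h \<in> L2s circ" "(\<lambda>k. L2n circ (\<lambda>t. v k (cis t) - h t)) \<longlonglongrightarrow> 0"
    using trace_limit[OF v mean] by blast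
  have "(\<lambda>k. fc (\<lambda>t. v k (cis t)) 0) \<longlonglongrightarrow> fc h 0"
    by (rule fc_tendsto_L2[OF h(1) _ h(2)]) (intro L2s_circ_continuous continuous_cis_comp sv)
  then have "fc h 0 = 0" by (simp add: mean LIMSEQ_const_iff)
  then have "nd_sol f v U h" unfolding nd_sol_def using v sol F(2) h by simp
  then show ?thesis by blast
qed

text \<open>For uniqueness, a competing trace may come from a sequence other than the one that gives
  the weak gradient. Coercivity identifies the weak gradients of the two solutions, and closability
  identifies the gradient along the trace sequence. So the two traces differ by a constant, which is
  zero by the mean condition.\<close>

lemma nd_sol_ND_map:
  assumes s: "nd_sol f v U h"
  shows "ND_map \<sigma> f = dist_of h"
  unfolding ND_map_def
proof (rule the_equality)
  have v: "conv_grad v U" and sol: "\<And>\<phi>. smooth \<phi> \<Longrightarrow> form U (grad \<phi>) = f (\<lambda>t. \<phi> (cis t))"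
    and h: "h \<in> L2s circ" "(\<lambda>k. L2n circ (\<lambda>t. v k (cis t) - h t)) \<longlonglongrightarrow> 0" "fc h 0 = 0"
    using s by (auto simp: nd_sol_def)
  note D = conv_gradD[OF v]
  have form_eq: "form (\<lambda>z. (ux z, uy z)) (grad w) = (LINT z|disk. \<sigma> z * (ux z * dir_deriv 1 w z + uy z * dir_deriv \<i> w z))" for ux uy w
    by (simp add: form_def dot_def grad_def)
  show "fcoeff (dist_of h) 0 = 0 \<and> (\<exists>u h'. neumann_solution \<sigma> f u \<and> H1_trace u h' \<and> dist_of h = dist_of h')"
  proof -
    obtain u where u: "u \<in> L2s disk" "(\<lambda>k. L2n disk (\<lambda>z. v k z - u z)) \<longlonglongrightarrow> 0"
      using disk_limit[OF v h(1,2)] by blast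
    have H: "H1_approx v u (\<lambda>z. fst (U z)) (\<lambda>z. snd (U z))"
      using v u D by (auto simp: H1_approx_iff L2_conv_iff intro: L2s_smooth)
    have "form (\<lambda>z. (fst (U z), snd (U z))) (grad w) = f (\<lambda>t. w (cis t))" if "smooth w" for w
      using sol[OF that] by simp
    then have "neumann_solution \<sigma> f u"
      unfolding neumann_solution_def H1_gradient_def form_eq using H by blast
    moreover have "L2_conv circ (\<lambda>k t. v k (cis t)) h"
      using h D by (auto simp: L2_conv_iff intro: L2s_circ_continuous continuous_cis_comp)
    then have "H1_trace u h" unfolding H1_trace_def using H by blast
    ultimately show ?thesis using h(3) by (auto simp: fcoeff_dist_of)
  qed
  fix g assume g: "fcoeff g 0 = 0 \<and> (\<exists>u h. neumann_solution \<sigma> f u \<and> H1_trace u h \<and> g = dist_of h)"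
  then obtain u h' where ns: "neumann_solution \<sigma> f u" and tr: "H1_trace u h'" and gh: "g = dist_of h'" by blast
  have h'0: "fc h' 0 = 0" using g gh by (simp add: fcoeff_dist_of)
  obtain v' ux uy where v': "H1_approx v' u ux uy"
    and sol': "\<And>w. smooth w \<Longrightarrow> form (\<lambda>z. (ux z, uy z)) (grad w) = f (\<lambda>t. w (cis t))"
    using ns unfolding neumann_solution_def H1_gradient_def form_eq by blast
  obtain V Vx Vy where V: "H1_approx V u Vx Vy" and Vh: "L2_conv circ (\<lambda>k t. V k (cis t)) h'"
    using tr unfolding H1_trace_def by blast
  define U' where "U' z = (ux z, uy z)" for z
  define W where "W z = (Vx z, Vy z)" for z
  have cv': "conv_grad v' U'" and cV: "conv_grad V W" and lv': "L2_conv disk v' u" and lV: "L2_conv disk V u"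
    using v' V unfolding H1_approx_iff U'_def[abs_def] W_def[abs_def] by auto
  note D' = conv_gradD[OF cv'] and DV = conv_gradD[OF cV]
  have UU': "L2n disk (\<lambda>z. U' z - U z) = 0"
  proof -
    have "lo * L2n disk (\<lambda>z. U' z - U z) \<le> 0"
    proof (rule coercive_limit[OF conv_grad_diff[OF cv' v]])
      fix \<phi> :: "complex \<Rightarrow> complex" assume \<phi>: "smooth \<phi>"
      show "cmod (form (\<lambda>z. U' z - U z) (grad \<phi>)) \<le> 0 * L2n disk (grad \<phi>)"
        using form_diff_left[OF D'(2) D(2) L2s_grad[OF \<phi>]] sol[OF \<phi>] sol'[OF \<phi>] by (simp add: U'_def[abs_def])
    qed simp
    then show ?thesis using lo_pos L2n_nonneg[of disk "\<lambda>z. U' z - U z"] by (simp add: mult_le_0_iff)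
  qed
  \<comment> \<open>Both sequences converge to the same \<open>u\<close>, so their difference tends
    to zero while its gradients converge; closability makes the limit of the gradients
    vanish.\<close>
  have WU': "AE z in disk. W z - U' z = 0"
  proof -
    let ?d = "\<lambda>k z. V k z - v' k z"
    have sd: "smooth (?d k)" for k by (intro smooth_diff DV D')
    have u: "u \<in> L2s disk" using lv' by (simp add: L2_conv_iff)
    have d0: "(\<lambda>k. L2n disk (?d k)) \<longlonglongrightarrow> 0"
    proof (rule Lim_null_comparison[OF always_eventually])
      show "\<forall>k. norm (L2n disk (?d k)) \<le> L2n disk (\<lambda>z. V k z - u z) + L2n disk (\<lambda>z. v' k z - u z)"
        using L2n_triangle_diff[OF L2s_smooth[OF DV(1)] u L2s_smooth[OF D'(1)]] L2n_minus_commute[of disk u] by simp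
      show "(\<lambda>k. L2n disk (\<lambda>z. V k z - u z) + L2n disk (\<lambda>z. v' k z - u z)) \<longlonglongrightarrow> 0"
      proof -
        have "(\<lambda>k. L2n disk (\<lambda>z. V k z - u z)) \<longlonglongrightarrow> 0" "(\<lambda>k. L2n disk (\<lambda>z. v' k z - u z)) \<longlonglongrightarrow> 0"
          using lv' lV by (auto simp: L2_conv_iff)
        from tendsto_add[OF this] show ?thesis by simp
      qed
    qed
    have c: "conv_grad ?d (\<lambda>z. W z - U' z)" by (rule conv_grad_diff[OF cV cv'])
    have "H1_approx ?d (\<lambda>_. 0) (\<lambda>z. fst (W z - U' z)) (\<lambda>z. snd (W z - U' z))"
      unfolding H1_approx_iff L2_conv_iff prod.collapse using c d0 sd by (simp add: L2s_smooth)
    then have l: "(\<lambda>z. fst (W z - U' z)) \<in> L2s disk" "(\<lambda>z. snd (W z - U' z)) \<in> L2s disk"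
      "(\<lambda>k. L2n disk (\<lambda>z. dir_deriv 1 (?d k) z - fst (W z - U' z))) \<longlonglongrightarrow> 0"
      "(\<lambda>k. L2n disk (\<lambda>z. dir_deriv \<i> (?d k) z - snd (W z - U' z))) \<longlonglongrightarrow> 0"
      unfolding H1_approx_def L2_conv_iff by blast+
    have "AE z in disk. fst (W z - U' z) = 0" by (rule gradient_closable[OF sd d0 l(1) l(3)]) simp
    moreover have "AE z in disk. snd (W z - U' z) = 0" by (rule gradient_closable[OF sd d0 l(2) l(4)]) simp
    ultimately show ?thesis by eventually_elim (simp add: prod_eq_iff)
  qed
  have WU: "L2n disk (\<lambda>z. W z - U z) = 0"
  proof -
    have "L2n disk (\<lambda>z. W z - U' z) = 0" using L2n_eq_0_iff[OF L2s_diff[OF DV(2) D'(2)]] WU' by blast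
    then show ?thesis
      using L2n_triangle_diff[OF DV(2) D'(2) D(2)] UU' L2n_nonneg[of disk "\<lambda>z. W z - U z"] by linarith
  qed
  let ?d = "\<lambda>k z. V k z - v k z"
  have sd: "smooth (?d k)" for k by (intro smooth_diff DV D)
  have cd: "(\<lambda>t. ?d k (cis t)) \<in> L2s circ" for k using continuous_cis_comp[OF sd] by (intro L2s_circ_continuous) auto
  have h': "h' \<in> L2s circ" "(\<lambda>k. L2n circ (\<lambda>t. V k (cis t) - h' t)) \<longlonglongrightarrow> 0"
    using Vh by (auto simp: L2_conv_iff)
  have hh: "(\<lambda>t. h' t - h t) \<in> L2s circ" by (rule L2s_diff[OF h'(1) h(1)])
  have vc: "(\<lambda>t. v k (cis t)) \<in> L2s circ" "(\<lambda>t. V k (cis t)) \<in> L2s circ" for k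
    by (intro L2s_circ_continuous continuous_cis_comp D DV)+
  have dh: "(\<lambda>k. L2n circ (\<lambda>t. ?d k (cis t) - (h' t - h t))) \<longlonglongrightarrow> 0"
  proof (rule Lim_null_comparison[OF always_eventually])
    show "\<forall>k. norm (L2n circ (\<lambda>t. ?d k (cis t) - (h' t - h t))) \<le> L2n circ (\<lambda>t. V k (cis t) - h' t) + L2n circ (\<lambda>t. v k (cis t) - h t)"
      using L2n_diff_le[OF L2s_diff[OF vc(2) h'(1)] L2s_diff[OF vc(1) h(1)]] by (simp add: algebra_simps)
    show "(\<lambda>k. L2n circ (\<lambda>t. V k (cis t) - h' t) + L2n circ (\<lambda>t. v k (cis t) - h t)) \<longlonglongrightarrow> 0"
      using tendsto_add[OF h'(2) h(2)] by simp
  qed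
  \<comment> \<open>The difference \<open>?d k\<close> need not have mean zero on the circle. Its
    mean is removed before the trace inequality is applied and is added back as a null
    sequence.\<close>
  define m where "m k = fc (\<lambda>t. ?d k (cis t)) 0" for k
  have "fc (\<lambda>t. h' t - h t) 0 = 0" by (simp add: fc_diff L2s_circ_integrable h h' h'0)
  then have m0: "m \<longlonglongrightarrow> 0" using fc_tendsto_L2[OF hh cd dh, of 0] by (simp add: m_def[abs_def])
  have gd0: "(\<lambda>k. L2n disk (grad (?d k))) \<longlonglongrightarrow> 0"
  proof -
    have c: "conv_grad ?d (\<lambda>z. W z - U z)" by (rule conv_grad_diff[OF cV v])
    have "(\<lambda>k. L2n disk (grad (?d k))) \<longlonglongrightarrow> L2n disk (\<lambda>z. W z - U z)"
      by (rule L2n_tendsto[OF conv_gradD(2)[OF c] L2s_grad[OF sd] conv_gradD(3)[OF c]])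
    then show ?thesis by (simp add: WU)
  qed
  have tr_le: "L2n circ (\<lambda>t. ?d k (cis t) - m k) \<le> L2n disk (grad (?d k))" for k
  proof -
    have "grad (\<lambda>z. ?d k z - m k) = grad (?d k)"
      by (rule ext) (simp only: grad_diff[OF sd smooth_const] grad_const diff_zero)
    then show ?thesis
      using trace_inequality[OF smooth_diff[OF sd smooth_const], of k "m k"] fc_sub_const[OF sd, of k "m k"]
      by (simp add: m_def)
  qed
  have cm: "(\<lambda>t. m k) \<in> L2s circ" for k by (intro L2s_circ_continuous continuous_intros)
  have "L2n circ (\<lambda>t. h' t - h t) \<le> L2n circ (\<lambda>t. ?d k (cis t) - (h' t - h t)) + (L2n disk (grad (?d k)) + cmod (m k) * L2n circ (\<lambda>_. 1::complex))" for k
  proof -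
    have "L2n circ (\<lambda>t. h' t - h t) \<le> L2n circ (\<lambda>t. (h' t - h t) - ?d k (cis t)) + L2n circ (\<lambda>t. ?d k (cis t))"
      by (rule L2n_le_add_diff[OF hh cd])
    moreover have "L2n circ (\<lambda>t. ?d k (cis t)) \<le> L2n circ (\<lambda>t. ?d k (cis t) - m k) + L2n circ (\<lambda>t. m k)"
      by (rule L2n_le_add_diff[OF cd cm])
    moreover have "L2n circ (\<lambda>t. m k) = cmod (m k) * L2n circ (\<lambda>_. 1::complex)"
      using L2n_cmult[of circ "m k" "\<lambda>_. 1"] by simp
    ultimately show ?thesis
      using tr_le[of k] L2n_minus_commute[of circ "\<lambda>t. h' t - h t" "\<lambda>t. ?d k (cis t)"] by linarith
  qed
  moreover have "(\<lambda>k. L2n circ (\<lambda>t. ?d k (cis t) - (h' t - h t)) + (L2n disk (grad (?d k)) + cmod (m k) * L2n circ (\<lambda>_. 1::complex))) \<longlonglongrightarrow> 0 + (0 + cmod 0 * L2n circ (\<lambda>_. 1::complex))"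
    by (intro tendsto_add dh gd0 tendsto_mult_right tendsto_norm m0)
  ultimately have "L2n circ (\<lambda>t. h' t - h t) \<le> 0 + (0 + cmod 0 * L2n circ (\<lambda>_. 1::complex))"
    by (intro LIMSEQ_le[OF tendsto_const]) auto
  then have hh0: "L2n circ (\<lambda>t. h' t - h t) = 0" using L2n_nonneg[of circ "\<lambda>t. h' t - h t"] by simp
  show "g = dist_of h"
    unfolding gh
  proof (rule dist_eqI)
    show "fcoeff (dist_of h') n = fcoeff (dist_of h) n" for n
      using fc_bound_L2[OF hh, of n] hh0 by (simp add: fcoeff_dist_of fc_diff L2s_circ_integrable h h')
  qed (intro dist_of_distribution L2s_circ_integrable h h')+
qed

end

section \<open>Sobolev norms and truncation\<close>

abbreviation wt :: "int \<Rightarrow> real" where "wt n \<equiv> real_of_int (max 1 \<bar>n\<bar>)"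

lemma sob_term_nonneg: "0 \<le> sob_term s g n"
  by (simp add: sob_term_def)

lemma sob_norm_nonneg: "0 \<le> sob_norm s g"
  unfolding sob_norm_def by (intro real_sqrt_ge_zero mult_nonneg_nonneg infsum_nonneg sob_term_nonneg) auto

lemma sob_norm_sq: "(sob_norm s g)\<^sup>2 = 2 * pi * (\<Sum>\<^sub>\<infinity>n. sob_term s g n)"
  unfolding sob_norm_def by (intro real_sqrt_pow2 mult_nonneg_nonneg infsum_nonneg sob_term_nonneg) auto

lemma fcoeff_le_sob_norm:
  assumes "g \<in> sob t"
  shows "cmod (fcoeff g n) \<le> sob_norm t g * wt n powr - t"
proof -
  have s: "sob_term t g summable_on UNIV" using assms by (simp add: sob_def)
  have "sob_term t g n = (\<Sum>\<^sub>\<infinity>k\<in>{n}. sob_term t g k)" by simp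
  also have "\<dots> \<le> (\<Sum>\<^sub>\<infinity>k. sob_term t g k)"
    by (rule infsum_mono_neutral) (use s in \<open>auto simp: sob_term_nonneg\<close>)
  also have "\<dots> \<le> 2 * pi * (\<Sum>\<^sub>\<infinity>k. sob_term t g k)"
    using pi_ge_two infsum_nonneg[of UNIV "sob_term t g"] sob_term_nonneg[of t g]
    by (intro mult_right_mono[of 1 "2 * pi", simplified]) auto
  finally have "sob_term t g n \<le> (sob_norm t g)\<^sup>2" by (simp add: sob_norm_sq)
  moreover have "sob_term t g n = (wt n powr t * cmod (fcoeff g n))\<^sup>2"
    by (simp add: sob_term_def power_mult_distrib powr_power mult.commute)
  ultimately have "wt n powr t * cmod (fcoeff g n) \<le> sob_norm t g"
    using power2_le_imp_le sob_norm_nonneg by metis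
  then have "wt n powr - t * (wt n powr t * cmod (fcoeff g n)) \<le> wt n powr - t * sob_norm t g"
    by (intro mult_left_mono) auto
  moreover have "wt n powr - t * (wt n powr t * cmod (fcoeff g n)) = cmod (fcoeff g n)"
    by (simp add: mult.assoc[symmetric] powr_add[symmetric])
  ultimately show ?thesis by (simp only: mult.commute[of "sob_norm t g"])
qed

definition zeta2 :: real where "zeta2 = (\<Sum>\<^sub>\<infinity>n. wt n powr - 2)"

lemma zeta2_nonneg: "0 \<le> zeta2"
  unfolding zeta2_def by (intro infsum_nonneg) auto

text \<open>One additional power of the weight leaves squared terms of the order
  \<open>wt n powr - 2\<close>, whose sum is \<open>zeta2\<close>. Giving away a full order is
  affordable because the images considered below are smooth.\<close>

lemma sob_of_decay:
  assumes g: "g \<in> distributions" and le: "\<And>n. cmod (fcoeff g n) \<le> C * wt n powr - (t + 1)"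
  shows "g \<in> sob t" "sob_norm t g \<le> C * sqrt (2 * pi * zeta2)"
proof -
  have C: "C \<ge> 0" using order_trans[OF norm_ge_zero le[of 0]] by simp
  have S: "(\<lambda>n. C\<^sup>2 * wt n powr - 2) summable_on UNIV"
    by (intro summable_on_cmult_right summable_on_int_inverse) simp
  have le2: "sob_term t g n \<le> C\<^sup>2 * wt n powr - 2" for n
  proof -
    have "sob_term t g n \<le> wt n powr (2 * t) * (C * wt n powr - (t + 1))\<^sup>2"
      unfolding sob_term_def by (intro mult_left_mono power_mono le) auto
    also have "\<dots> = C\<^sup>2 * (wt n powr (2 * t) * (wt n powr - (t + 1) * wt n powr - (t + 1)))"
      by (simp add: power_mult_distrib power2_eq_square)
    also have "\<dots> = C\<^sup>2 * wt n powr - 2" by (simp add: powr_add[symmetric])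
    finally show ?thesis .
  qed
  have s: "sob_term t g summable_on UNIV"
    by (rule summable_on_comparison_test[OF S]) (auto simp: le2 sob_term_nonneg)
  then show "g \<in> sob t" using g by (simp add: sob_def)
  have "(\<Sum>\<^sub>\<infinity>n. sob_term t g n) \<le> (\<Sum>\<^sub>\<infinity>n. C\<^sup>2 * wt n powr - 2)"
    by (intro infsum_mono s S le2)
  also have "\<dots> = C\<^sup>2 * zeta2" unfolding zeta2_def by (rule infsum_cmult_right) (auto intro: summable_on_int_inverse)
  finally have "(sob_norm t g)\<^sup>2 \<le> 2 * pi * (C\<^sup>2 * zeta2)" by (simp add: sob_norm_sq)
  also have "\<dots> = (C * sqrt (2 * pi * zeta2))\<^sup>2" using zeta2_nonneg by (simp add: power_mult_distrib)
  finally show "sob_norm t g \<le> C * sqrt (2 * pi * zeta2)"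
    by (rule power2_le_imp_le) (use C zeta2_nonneg in simp)
qed

lemma sob_distribution: "g \<in> sob t \<Longrightarrow> g \<in> distributions" by (simp add: sob_def)
lemma sob_diamond_sob: "g \<in> sob_diamond t \<Longrightarrow> g \<in> sob t" by (simp add: sob_diamond_def)
lemma sob_diamond_0: "g \<in> sob_diamond t \<Longrightarrow> fcoeff g 0 = 0" by (simp add: sob_diamond_def)

text \<open>Truncations of a datum without mean lie in every \<open>sob_diamond t\<close> and
  approximate it in the norm of its own order; they carry identities from order -1/2 to all
  orders.\<close>

definition trunc :: "pdist \<Rightarrow> int set \<Rightarrow> pdist" where
  "trunc f A = (\<lambda>\<phi>. \<Sum>m\<in>A. fcoeff f m * dist_of (fmode m) \<phi>)"

lemma fmode_dist: "dist_of (fmode m) \<in> distributions"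
  by (intro dist_of_distribution integrable_circ_continuous continuous_fmode)

lemma fcoeff_fmode: "fcoeff (dist_of (fmode m)) n = (if n = m then 1 else 0)"
  by (auto simp: fcoeff_dist_of fc_fmode)

lemma zero_dist: "(\<lambda>_. 0) \<in> distributions"
proof -
  have "dist_of (\<lambda>_. 0) = (\<lambda>_. 0)" by (auto simp: dist_of_def)
  then show ?thesis using dist_of_distribution[of "\<lambda>_. 0"] by simp
qed

lemma trunc_dist: "finite A \<Longrightarrow> trunc f A \<in> distributions"
proof (induction A rule: finite_induct)
  case (insert a A)
  have "trunc f (insert a A) = (\<lambda>\<phi>. trunc f A \<phi> + fcoeff f a * dist_of (fmode a) \<phi>)"
    using insert by (auto simp: trunc_def)
  then show ?case using dist_add_cmult[OF insert.IH fmode_dist] by simp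
qed (simp add: trunc_def zero_dist)

lemma fcoeff_trunc:
  assumes "finite A" shows "fcoeff (trunc f A) n = (if n \<in> A then fcoeff f n else 0)"
proof -
  have "fcoeff (trunc f A) n = (\<Sum>m\<in>A. fcoeff f m * fcoeff (dist_of (fmode m)) n)"
    by (simp add: fcoeff_def trunc_def sum_divide_distrib)
  also have "\<dots> = (\<Sum>m\<in>A. if n = m then fcoeff f m else 0)"
    by (intro sum.cong refl) (simp add: fcoeff_fmode)
  finally show ?thesis using assms by (simp add: sum.delta)
qed

lemma sob_finite_support:
  assumes "g \<in> distributions" "finite A" "\<And>n. n \<notin> A \<Longrightarrow> fcoeff g n = 0"
  shows "g \<in> sob t"
proof -
  have "sob_term t g summable_on A" using assms(2) by simp
  moreover have "sob_term t g summable_on UNIV \<longleftrightarrow> sob_term t g summable_on A"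
    by (rule summable_on_cong_neutral) (use assms(3) in \<open>auto simp: sob_term_def\<close>)
  ultimately show ?thesis using assms(1) by (simp add: sob_def)
qed

lemma fmode_sob_diamond: "m \<noteq> 0 \<Longrightarrow> dist_of (fmode m) \<in> sob_diamond t"
  unfolding sob_diamond_def
  by (auto simp: fcoeff_fmode intro!: sob_finite_support[of _ "{m}"] fmode_dist split: if_splits)

lemma trunc_sob_diamond: "finite A \<Longrightarrow> fcoeff f 0 = 0 \<Longrightarrow> trunc f A \<in> sob_diamond t"
  unfolding sob_diamond_def
  by (auto simp: fcoeff_trunc intro!: sob_finite_support[of _ A] trunc_dist)

lemma sob_diamond_diff:
  assumes "f \<in> sob_diamond t" "g \<in> sob_diamond t"
  shows "f - g \<in> sob_diamond t"
proof -
  have s: "sob_term t f summable_on UNIV" "sob_term t g summable_on UNIV"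
    using assms by (auto simp: sob_diamond_def sob_def)
  have le: "sob_term t (f - g) n \<le> 2 * sob_term t f n + 2 * sob_term t g n" for n
  proof -
    have "(cmod (fcoeff f n - fcoeff g n))\<^sup>2 \<le> (cmod (fcoeff f n) + cmod (fcoeff g n))\<^sup>2"
      by (intro power_mono norm_triangle_ineq4) simp
    also have "\<dots> \<le> 2 * (cmod (fcoeff f n))\<^sup>2 + 2 * (cmod (fcoeff g n))\<^sup>2"
      using sum_squares_bound[of "cmod (fcoeff f n)" "cmod (fcoeff g n)"] by (simp add: power2_sum)
    finally have "wt n powr (2 * t) * (cmod (fcoeff f n - fcoeff g n))\<^sup>2 \<le>
       wt n powr (2 * t) * (2 * (cmod (fcoeff f n))\<^sup>2 + 2 * (cmod (fcoeff g n))\<^sup>2)"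
      by (intro mult_left_mono) auto
    then show ?thesis by (simp add: sob_term_def fcoeff_diff algebra_simps)
  qed
  have "sob_term t (f - g) summable_on UNIV"
    by (rule summable_on_comparison_test[of "\<lambda>n. 2 * sob_term t f n + 2 * sob_term t g n"])
       (use s le in \<open>auto simp: sob_term_nonneg intro!: summable_on_add summable_on_cmult_right\<close>)
  then show ?thesis using assms
    by (auto simp: sob_diamond_def sob_def fcoeff_diff intro: dist_diff)
qed

lemma sob_norm_trunc_tendsto:
  assumes f: "f \<in> sob_diamond t"
  shows "((\<lambda>A. sob_norm t (f - trunc f A)) \<longlongrightarrow> 0) (finite_subsets_at_top UNIV)"
proof -
  have s: "sob_term t f summable_on UNIV" using f by (simp add: sob_diamond_def sob_def)
  have "((\<lambda>A. (\<Sum>\<^sub>\<infinity>n. sob_term t f n) - sum (sob_term t f) A) \<longlongrightarrow> (\<Sum>\<^sub>\<infinity>n. sob_term t f n) - (\<Sum>\<^sub>\<infinity>n. sob_term t f n)) (finite_subsets_at_top UNIV)"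
    using has_sum_infsum[OF s] unfolding has_sum_def by (intro tendsto_diff tendsto_const)
  then have "((\<lambda>A. sqrt (2 * pi * ((\<Sum>\<^sub>\<infinity>n. sob_term t f n) - sum (sob_term t f) A))) \<longlongrightarrow> sqrt (2 * pi * 0)) (finite_subsets_at_top UNIV)"
    by (intro tendsto_real_sqrt tendsto_mult_left) simp
  moreover have "\<forall>\<^sub>F A in finite_subsets_at_top UNIV. sqrt (2 * pi * ((\<Sum>\<^sub>\<infinity>n. sob_term t f n) - sum (sob_term t f) A)) = sob_norm t (f - trunc f A)"
  proof -
    have "sqrt (2 * pi * ((\<Sum>\<^sub>\<infinity>n. sob_term t f n) - sum (sob_term t f) A)) = sob_norm t (f - trunc f A)" if A: "finite A" for A
    proof -
      have "(\<Sum>\<^sub>\<infinity>n. sob_term t (f - trunc f A) n) = (\<Sum>\<^sub>\<infinity>n\<in>UNIV - A. sob_term t f n)"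
        by (rule infsum_cong_neutral) (auto simp: sob_term_def fcoeff_diff fcoeff_trunc[OF A])
      also have "\<dots> = (\<Sum>\<^sub>\<infinity>n. sob_term t f n) - (\<Sum>\<^sub>\<infinity>n\<in>A. sob_term t f n)"
        by (rule infsum_Diff[OF s]) (use A in auto)
      finally show ?thesis using A by (simp add: sob_norm_def)
    qed
    moreover have "\<forall>\<^sub>F A in finite_subsets_at_top (UNIV::int set). finite A"
      by (simp add: eventually_finite_subsets_at_top) auto
    ultimately show ?thesis by (simp add: eventually_mono)
  qed
  ultimately show ?thesis by (simp add: tendsto_cong)
qed

text \<open>Infinite sums over the integers are limits along finite subsets, whereas the
  approximants in \<open>conv_grad\<close> are sequences; symmetric intervals are cofinal among the
  finite sets.\<close>

lemma has_sum_symmetric: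
  fixes f :: "int \<Rightarrow> 'b::{topological_comm_monoid_add,t2_space}"
  assumes "(f has_sum s) UNIV"
  shows "(\<lambda>N. \<Sum>n\<in>{- int N..int N}. f n) \<longlonglongrightarrow> s"
proof -
  have "filterlim (\<lambda>N. {- int N..int N}) (finite_subsets_at_top UNIV) sequentially"
    unfolding filterlim_finite_subsets_at_top
  proof (intro allI impI)
    fix X :: "int set" assume X: "finite X \<and> X \<subseteq> UNIV"
    define K where "K = nat (Max (insert 0 (abs ` X)))"
    have "X \<subseteq> {- int N..int N}" if "N \<ge> K" for N
    proof
      fix x assume "x \<in> X"
      then have "\<bar>x\<bar> \<le> Max (insert 0 (abs ` X))" using X by (intro Max_ge) auto
      then show "x \<in> {- int N..int N}" using that unfolding K_def by auto
    qed
    then show "\<forall>\<^sub>F N in sequentially. finite {- int N..int N} \<and> X \<subseteq> {- int N..int N} \<and> {- int N..int N} \<subseteq> UNIV"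
      by (auto simp: eventually_sequentially)
  qed
  from filterlim_compose[OF assms[unfolded has_sum_def] this] show ?thesis by simp
qed

text \<open>The weak gradient of the harmonic function with Neumann data \<open>f\<close>.\<close>

lemma harmonic_field_exists:
  assumes f: "f \<in> sob_diamond (-1/2)"
  obtains F where "F \<in> L2s disk" "\<And>\<phi>. smooth \<phi> \<Longrightarrow> (LINT z|disk. dot (F z) (grad \<phi> z)) = f (\<lambda>t. \<phi> (cis t))"
    "L2n disk F \<le> sob_norm (-1/2) f"
proof -
  have fd: "f \<in> distributions" and s: "sob_term (-1/2) f summable_on UNIV" and f0: "fcoeff f 0 = 0"
    using f by (auto simp: sob_diamond_def sob_def)
  \<comment> \<open>Since the normal derivative of \<open>harm_mode n\<close> on the circle is |n|
    times the mode, these are the coefficients of the harmonic function with Neumann data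
    \<open>f\<close>. Its energy then carries the weight 1 / |n|, which is that of the norm of order
    -1/2.\<close>
  define a where "a n = fcoeff f n / of_int \<bar>n\<bar>" for n
  define I where "I N = {- int N..int N}" for N
  define v where "v N = harm_sum a (I N - {0})" for N
  define S where "S N = (\<Sum>n\<in>I N. sob_term (-1/2) f n)" for N
  have sv: "smooth (v N)" for N unfolding v_def by (rule smooth_harm_sum)
  have energy: "of_int \<bar>n\<bar> * (cmod (a n))\<^sup>2 = sob_term (-1/2) f n" if "n \<noteq> 0" for n
  proof -
    have "max 1 \<bar>n\<bar> = \<bar>n\<bar>" using that by simp
    then show ?thesis using that unfolding sob_term_def a_def
      by (simp add: norm_divide powr_minus power2_eq_square field_simps)
  qed
  have norm_sq: "(L2n disk (grad (harm_sum a A)))\<^sup>2 = 2 * pi * (\<Sum>n\<in>A. sob_term (-1/2) f n)" if "finite A" "0 \<notin> A" for A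
    unfolding L2n_grad_harm_sum[OF that] by (rule arg_cong[where f="(*) (2 * pi)"], rule sum.cong[OF refl], rule energy) (use that in auto)
  have S0: "S N = (\<Sum>n\<in>I N - {0}. sob_term (-1/2) f n)" for N
    unfolding S_def by (intro sum.mono_neutral_right) (auto simp: I_def sob_term_def f0)
  have Slim: "S \<longlonglongrightarrow> (\<Sum>\<^sub>\<infinity>n. sob_term (-1/2) f n)"
    unfolding S_def[abs_def] I_def by (rule has_sum_symmetric[OF has_sum_infsum[OF s]])
  have diff: "(L2n disk (grad (\<lambda>z. v j z - v k z)))\<^sup>2 = 2 * pi * (S j - S k)" if "k \<le> j" for j k
  proof -
    have sub: "I k - {0} \<subseteq> I j - {0}" using that by (auto simp: I_def)
    have "(\<lambda>z. v j z - v k z) = harm_sum a ((I j - {0}) - (I k - {0}))"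
      unfolding v_def harm_sum_def[abs_def] by (rule ext, rule sum_diff[OF _ sub, symmetric]) (simp add: I_def)
    then have "(L2n disk (grad (\<lambda>z. v j z - v k z)))\<^sup>2 = 2 * pi * (\<Sum>n\<in>(I j - {0}) - (I k - {0}). sob_term (-1/2) f n)"
      by (simp only:) (rule norm_sq, auto simp: I_def)
    also have "(\<Sum>n\<in>(I j - {0}) - (I k - {0}). sob_term (-1/2) f n) = S j - S k"
      unfolding S0 by (rule sum_diff[OF _ sub]) (simp add: I_def)
    finally show ?thesis .
  qed
  have sym: "L2n disk (grad (\<lambda>z. v j z - v k z)) = L2n disk (grad (\<lambda>z. v k z - v j z))" for j k
  proof -
    have "grad (\<lambda>z. v j z - v k z) = (\<lambda>z. grad (v j) z - grad (v k) z)" for j k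
      by (rule ext) (rule grad_diff[OF sv sv])
    then show ?thesis using L2n_minus_commute[of disk "grad (v j)" "grad (v k)"] by (simp only:)
  qed
  have "\<exists>F. conv_grad v F"
  proof (rule conv_grad_complete[OF sv])
    fix e :: real assume e: "e > 0"
    have "Cauchy S" using Slim by (rule LIMSEQ_imp_Cauchy)
    moreover have "e\<^sup>2 / (2 * pi) > 0" using e by simp
    ultimately obtain K where K: "\<And>j k. j \<ge> K \<Longrightarrow> k \<ge> K \<Longrightarrow> \<bar>S j - S k\<bar> < e\<^sup>2 / (2 * pi)"
      unfolding Cauchy_def dist_real_def by metis
    have *: "L2n disk (grad (\<lambda>z. v j z - v k z)) < e" if "j \<ge> K" "k \<ge> K" "k \<le> j" for j k
    proof -
      have "S j - S k < e\<^sup>2 / (2 * pi)" using K[OF that(1,2)] by linarith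
      then have "2 * pi * (S j - S k) < e\<^sup>2" by (simp add: field_simps)
      then have "(L2n disk (grad (\<lambda>z. v j z - v k z)))\<^sup>2 < e\<^sup>2" by (simp only: diff[OF that(3)])
      then show ?thesis by (rule power2_less_imp_less) (use e in simp)
    qed
    have "L2n disk (grad (\<lambda>z. v j z - v k z)) < e" if "j \<ge> K" "k \<ge> K" for j k
      using *[OF that] *[OF that(2,1)] sym[of j k] by (cases "k \<le> j") auto
    then show "\<exists>K. \<forall>j\<ge>K. \<forall>k\<ge>K. L2n disk (grad (\<lambda>z. v j z - v k z)) < e" by blast
  qed
  then obtain F where F: "conv_grad v F" by blast
  note D = conv_gradD[OF F]
  have weak: "(LINT z|disk. dot (F z) (grad \<phi> z)) = f (\<lambda>t. \<phi> (cis t))" if \<phi>: "smooth \<phi>" for \<phi>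
  proof -
    let ?\<psi> = "\<lambda>t. \<phi> (cis t)"
    have "(LINT z|disk. dot (grad (v N) z) (grad \<phi> z)) = (\<Sum>n\<in>I N. fc ?\<psi> n * f (fmode n))" for N
    proof -
      have "(LINT z|disk. dot (grad (v N) z) (grad \<phi> z)) = (LINT z|disk. dot (grad \<phi> z) (grad (v N) z))"
        by (simp add: dot_commute)
      also have "\<dots> = 2 * pi * (\<Sum>n\<in>I N - {0}. a n * of_int \<bar>n\<bar> * fc ?\<psi> (- n))"
        unfolding v_def by (rule Green_harm_sum[OF \<phi>]) (auto simp: I_def)
      also have "(\<Sum>n\<in>I N - {0}. a n * of_int \<bar>n\<bar> * fc ?\<psi> (- n)) = (\<Sum>n\<in>I N. fcoeff f n * fc ?\<psi> (- n))"
        by (rule sum.mono_neutral_cong_left) (auto simp: I_def a_def f0)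
      also have "\<dots> = (\<Sum>n\<in>I N. fcoeff f (- n) * fc ?\<psi> n)"
        by (rule sum.reindex_bij_witness[of _ uminus uminus]) (auto simp: I_def)
      finally show ?thesis by (simp add: sum_distrib_left dist_fmode[of f] mult_ac)
    qed
    moreover have "(\<lambda>N. \<Sum>n\<in>I N. fc ?\<psi> n * f (fmode n)) \<longlonglongrightarrow> f ?\<psi>"
      unfolding I_def by (intro has_sum_symmetric dist_has_sum fd test_fun_cis_comp \<phi>)
    moreover have "(\<lambda>N. LINT z|disk. dot (grad (v N) z) (grad \<phi> z)) \<longlonglongrightarrow> (LINT z|disk. dot (F z) (grad \<phi> z))"
      by (intro tendsto_LINT_dot1 F L2s_grad \<phi>)
    ultimately show ?thesis using LIMSEQ_unique by fastforce
  qed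
  have "(\<lambda>N. (L2n disk (grad (v N)))\<^sup>2) \<longlonglongrightarrow> (L2n disk F)\<^sup>2"
    by (intro tendsto_power L2n_tendsto D L2s_grad)
  moreover have "(L2n disk (grad (v N)))\<^sup>2 = 2 * pi * S N" for N
    unfolding v_def S0 by (rule norm_sq) (auto simp: I_def)
  moreover have "(\<lambda>N. 2 * pi * S N) \<longlonglongrightarrow> (sob_norm (-1/2) f)\<^sup>2"
    unfolding sob_norm_sq by (intro tendsto_mult_left Slim)
  ultimately have "(L2n disk F)\<^sup>2 = (sob_norm (-1/2) f)\<^sup>2" using LIMSEQ_unique by fastforce
  then have "L2n disk F \<le> sob_norm (-1/2) f" by (simp add: power2_le_imp_le sob_norm_nonneg)
  then show thesis using that[OF D(2) weak] by blast
qed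

section \<open>The matrix of the relative Neumann-to-Dirichlet map\<close>

text \<open>Complex-valued so that it can be a factor in \<open>scl\<close>. It is applied with a
  radius outside which \<sigma> = 1.\<close>

definition radial_cut :: "real \<Rightarrow> complex \<Rightarrow> complex" where
  "radial_cut R z = (if cmod z \<le> R then 1 else 0)"

lemma measurable_cut: "radial_cut R \<in> borel_measurable disk"
proof -
  have a: "(indicator (cball 0 R) :: complex \<Rightarrow> real) \<in> borel_measurable borel"
    by (rule borel_measurable_indicator) simp
  have b: "complex_of_real \<in> borel_measurable borel"
    by (intro borel_measurable_continuous_onI continuous_intros)
  have "radial_cut R = (\<lambda>z. complex_of_real (indicator (cball 0 R) z))" by (auto simp: radial_cut_def indicator_def)
  then have "radial_cut R \<in> borel_measurable borel" using measurable_compose[OF a b] by (simp only:)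
  then show ?thesis by (intro measurable_restrict_space1 measurable_completion) simp
qed

lemma cut_le: "AE z in N. cmod (radial_cut R z) \<le> 1" by (simp add: radial_cut_def)

lemma L2s_cut: "U \<in> L2s disk \<Longrightarrow> (\<lambda>z. scl (radial_cut R z) (U z)) \<in> L2s disk"
  and L2n_cut_le: "U \<in> L2s disk \<Longrightarrow> L2n disk (\<lambda>z. scl (radial_cut R z) (U z)) \<le> L2n disk U"
  using L2s_scl[OF measurable_cut cut_le] by fastforce+

lemma norm_grad_harm: "norm (grad (harm_mode n) z) = sqrt 2 * (\<bar>of_int n\<bar> * cmod z ^ (nat \<bar>n\<bar> - 1))"
proof -
  have "cmod (zc s \<i>) = 1" for s by simp
  then have "norm (grad (harm_mode n) z) = sqrt ((\<bar>of_int n\<bar> * cmod z ^ (nat \<bar>n\<bar> - 1))\<^sup>2 + (\<bar>of_int n\<bar> * cmod z ^ (nat \<bar>n\<bar> - 1))\<^sup>2)"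
    by (simp only: grad_harm norm_Pair norm_mult norm_power norm_zc norm_of_int norm_ii mult_1_right abs_abs of_int_abs)
  then show ?thesis by (simp add: real_sqrt_mult flip: mult_2)
qed

text \<open>The gradient of \<open>harm_mode n\<close> has norm sqrt 2 |n| times |z| to the power
  |n| - 1. This is the source of all exponential decay below.\<close>

lemma L2n_cut_grad_harm:
  assumes R: "0 < R"
  shows "L2n disk (\<lambda>z. scl (radial_cut R z) (grad (harm_mode n) z)) \<le> sqrt 2 * (\<bar>of_int n\<bar> * R ^ (nat \<bar>n\<bar> - 1)) * L2n disk (\<lambda>_. 1 :: complex)"
proof (rule L2n_bound)
  show "(\<lambda>_. 1 :: complex) \<in> L2s disk" by (intro L2s_disk_continuous continuous_intros)
  show "(\<lambda>z. scl (radial_cut R z) (grad (harm_mode n) z)) \<in> borel_measurable disk"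
    by (intro L2s_measurable L2s_cut L2s_grad smooth_harm)
  have "norm (scl (radial_cut R z) (grad (harm_mode n) z)) \<le> sqrt 2 * (\<bar>of_int n\<bar> * R ^ (nat \<bar>n\<bar> - 1))" for z
    using R by (auto simp: norm_scl radial_cut_def norm_grad_harm intro!: mult_left_mono power_mono)
  then show "AE z in disk. norm (scl (radial_cut R z) (grad (harm_mode n) z)) \<le> sqrt 2 * (\<bar>of_int n\<bar> * R ^ (nat \<bar>n\<bar> - 1)) * norm (1 :: complex)"
    by simp
qed (use R in simp)

text \<open>Green's formula survives the passage to the limit, so Fourier coefficients of the trace
  can be read off the weak gradient.\<close>

lemma weak_grad_harm:
  assumes v: "conv_grad v U" and h: "h \<in> L2s circ" "(\<lambda>k. L2n circ (\<lambda>t. v k (cis t) - h t)) \<longlonglongrightarrow> 0" and n: "n \<noteq> 0"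
  shows "(LINT z|disk. dot (U z) (grad (harm_mode n) z)) = 2 * pi * of_int \<bar>n\<bar> * fc h (- n)"
proof -
  note D = conv_gradD[OF v]
  have "(\<lambda>k. LINT z|disk. dot (grad (v k) z) (grad (harm_mode n) z)) \<longlonglongrightarrow> (LINT z|disk. dot (U z) (grad (harm_mode n) z))"
    by (intro tendsto_LINT_dot1 v L2s_grad smooth_harm)
  moreover have "(LINT z|disk. dot (grad (v k) z) (grad (harm_mode n) z)) = 2 * pi * of_int \<bar>n\<bar> * fc (\<lambda>t. v k (cis t)) (- n)" for k
    unfolding Green_harm[OF D(1) n] LINT_fmode_fc by (simp add: mult_ac of_real_abs_of_int)
  moreover have "(\<lambda>k. 2 * pi * of_int \<bar>n\<bar> * fc (\<lambda>t. v k (cis t)) (- n)) \<longlonglongrightarrow> 2 * pi * of_int \<bar>n\<bar> * fc h (- n)"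
    by (intro tendsto_mult_left fc_tendsto_L2[OF h(1) _ h(2)] L2s_circ_continuous continuous_cis_comp D)
  ultimately show ?thesis using LIMSEQ_unique by fastforce
qed

text \<open>With this instance the reference map \<open>ND_map (\<lambda>_. 1)\<close> is covered by
  the same existence and uniqueness results.\<close>

interpretation one: conductivity "\<lambda>_. 1" 1 1
  by unfold_locales auto

lemma one_form: "one.form U V = (LINT z|disk. dot (U z) (V z))"
  by (simp add: one.form_def)

section \<open>Fourier coefficients of the relative map\<close>

context conductivity
begin

lemma nd_solD:
  assumes "nd_sol f v U h"
  shows "conv_grad v U" "smooth \<phi> \<Longrightarrow> form U (grad \<phi>) = f (\<lambda>t. \<phi> (cis t))" "h \<in> L2s circ"
    "(\<lambda>k. L2n circ (\<lambda>t. v k (cis t) - h t)) \<longlonglongrightarrow> 0" "fc h 0 = 0" "U \<in> L2s disk"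
  using assms by (auto simp: nd_sol_def conv_grad_def)

lemma nd_sol_sob_exists:
  assumes "f \<in> sob_diamond (-1/2)"
  shows "\<exists>v U h. nd_sol f v U h"
proof -
  obtain F where "F \<in> L2s disk" "\<And>\<phi>. smooth \<phi> \<Longrightarrow> (LINT z|disk. dot (F z) (grad \<phi> z)) = f (\<lambda>t. \<phi> (cis t))"
    using harmonic_field_exists[OF assms] by blast
  then show ?thesis by (rule nd_sol_exists)
qed

lemma nd_sol_energy:
  assumes f: "f \<in> sob_diamond (-1/2)" and s: "nd_sol f v U h"
  shows "lo * L2n disk U \<le> sob_norm (-1/2) f"
proof -
  obtain F where F: "F \<in> L2s disk" "\<And>\<phi>. smooth \<phi> \<Longrightarrow> (LINT z|disk. dot (F z) (grad \<phi> z)) = f (\<lambda>t. \<phi> (cis t))"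
    "L2n disk F \<le> sob_norm (-1/2) f" using harmonic_field_exists[OF f] by blast
  show ?thesis
  proof (rule coercive_limit[OF nd_solD(1)[OF s]])
    fix \<phi> :: "complex \<Rightarrow> complex" assume \<phi>: "smooth \<phi>"
    have "cmod (form U (grad \<phi>)) \<le> L2n disk F * L2n disk (grad \<phi>)"
      using LINT_dot1(2)[OF F(1) L2s_grad[OF \<phi>]] by (simp add: nd_solD(2)[OF s \<phi>] F(2)[OF \<phi>])
    also have "\<dots> \<le> sob_norm (-1/2) f * L2n disk (grad \<phi>)" by (intro mult_right_mono F) simp
    finally show "cmod (form U (grad \<phi>)) \<le> sob_norm (-1/2) f * L2n disk (grad \<phi>)" .
  qed (rule sob_norm_nonneg)
qed

text \<open>Since any \<open>nd_sol\<close> determines the value of \<open>ND_map\<close>, its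
  linearity follows from combining solutions.\<close>

lemma nd_sol_diff_cmult:
  assumes "nd_sol f v U h" "nd_sol g v' U' h'"
  shows "nd_sol (\<lambda>\<phi>. f \<phi> - c * g \<phi>) (\<lambda>k z. v k z - c * v' k z) (\<lambda>z. U z - scl c (U' z)) (\<lambda>t. h t - c * h' t)"
  unfolding nd_sol_def
proof (intro conjI allI impI)
  note s = nd_solD[OF assms(1)] nd_solD[OF assms(2)]
  show "conv_grad (\<lambda>k z. v k z - c * v' k z) (\<lambda>z. U z - scl c (U' z))"
    by (intro conv_grad_diff conv_grad_cmult s)
  show "form (\<lambda>z. U z - scl c (U' z)) (grad \<phi>) = f (\<lambda>t. \<phi> (cis t)) - c * g (\<lambda>t. \<phi> (cis t))" if \<phi>: "smooth \<phi>" for \<phi>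
  proof -
    have "form (\<lambda>z. scl c (U' z)) (grad \<phi>) = c * form U' (grad \<phi>)"
      by (simp add: form_def dot_scl_left mult.left_commute)
    then show ?thesis
      using form_diff_left[OF s(6) L2s_scl_const[OF s(12)] L2s_grad[OF \<phi>], of c] s(2)[OF \<phi>] s(8)[OF \<phi>] by simp
  qed
  have ch: "(\<lambda>t. c * h' t) \<in> L2s circ" by (intro L2s_cmult s)
  show "(\<lambda>t. h t - c * h' t) \<in> L2s circ" by (intro L2s_diff ch s)
  have i: "integrable circ h" "integrable circ h'" by (intro L2s_circ_integrable s)+
  have "fc (\<lambda>t. c * h' t) 0 = c * fc h' 0" by (simp add: fc_def mult.assoc)
  then show "fc (\<lambda>t. h t - c * h' t) 0 = 0" using i s(5,11) by (simp add: fc_diff)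
  have vc: "(\<lambda>t. v k (cis t)) \<in> L2s circ" "(\<lambda>t. v' k (cis t)) \<in> L2s circ" for k
    by (intro L2s_circ_continuous continuous_cis_comp conv_gradD[OF s(1)] conv_gradD[OF s(7)])+
  show "(\<lambda>k. L2n circ (\<lambda>t. v k (cis t) - c * v' k (cis t) - (h t - c * h' t))) \<longlonglongrightarrow> 0"
  proof (rule Lim_null_comparison[OF always_eventually])
    show "\<forall>k. norm (L2n circ (\<lambda>t. v k (cis t) - c * v' k (cis t) - (h t - c * h' t))) \<le>
      L2n circ (\<lambda>t. v k (cis t) - h t) + cmod c * L2n circ (\<lambda>t. v' k (cis t) - h' t)"
    proof
      fix k
      have "(\<lambda>t. v k (cis t) - c * v' k (cis t) - (h t - c * h' t)) = (\<lambda>t. (v k (cis t) - h t) - c * (v' k (cis t) - h' t))"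
        by (auto simp: algebra_simps)
      then show "norm (L2n circ (\<lambda>t. v k (cis t) - c * v' k (cis t) - (h t - c * h' t))) \<le>
          L2n circ (\<lambda>t. v k (cis t) - h t) + cmod c * L2n circ (\<lambda>t. v' k (cis t) - h' t)"
        using L2n_diff_le[OF L2s_diff[OF vc(1) s(3)] L2s_cmult[OF L2s_diff[OF vc(2) s(9)]], of k c k] by (simp add: L2n_cmult)
    qed
    show "(\<lambda>k. L2n circ (\<lambda>t. v k (cis t) - h t) + cmod c * L2n circ (\<lambda>t. v' k (cis t) - h' t)) \<longlonglongrightarrow> 0"
      using tendsto_add[OF s(4) tendsto_mult_left[OF s(10), of "cmod c"]] by simp
  qed
qed

definition nd_coeff :: "pdist \<Rightarrow> int \<Rightarrow> complex" where
  "nd_coeff f n = fcoeff (ND_map \<sigma> f) n"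

lemma nd_coeff_eq: "nd_sol f v U h \<Longrightarrow> nd_coeff f n = fc h n"
  by (simp add: nd_coeff_def nd_sol_ND_map fcoeff_dist_of)

lemma nd_map_dist:
  assumes "f \<in> sob_diamond (-1/2)" shows "ND_map \<sigma> f \<in> distributions"
  using nd_sol_sob_exists[OF assms] by (auto simp: nd_sol_ND_map intro!: dist_of_distribution L2s_circ_integrable nd_solD(3))

lemma nd_coeff_0: "f \<in> sob_diamond (-1/2) \<Longrightarrow> nd_coeff f 0 = 0"
  using nd_sol_sob_exists[of f] nd_coeff_eq nd_solD(5) by metis

lemma nd_coeff_diff_cmult:
  assumes "f \<in> sob_diamond (-1/2)" "g \<in> sob_diamond (-1/2)"
  shows "nd_coeff (\<lambda>\<phi>. f \<phi> - c * g \<phi>) n = nd_coeff f n - c * nd_coeff g n"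
proof -
  obtain v U h v' U' h' where s: "nd_sol f v U h" "nd_sol g v' U' h'"
    using nd_sol_sob_exists[OF assms(1)] nd_sol_sob_exists[OF assms(2)] by blast
  have i: "integrable circ h" "integrable circ h'" using s by (auto intro: L2s_circ_integrable nd_solD)
  have "fc (\<lambda>t. c * h' t) n = c * fc h' n" by (simp add: fc_def mult.assoc)
  then show ?thesis
    using i by (simp add: nd_coeff_eq[OF s(1)] nd_coeff_eq[OF s(2)] nd_coeff_eq[OF nd_sol_diff_cmult[OF s]] fc_diff)
qed

definition rel_coeff :: "pdist \<Rightarrow> int \<Rightarrow> complex" where
  "rel_coeff f n = nd_coeff f n - one.nd_coeff f n"

lemma rel_coeff_0: "f \<in> sob_diamond (-1/2) \<Longrightarrow> rel_coeff f 0 = 0"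
  by (simp add: rel_coeff_def nd_coeff_0 one.nd_coeff_0)

lemma rel_coeff_diff_cmult:
  assumes "f \<in> sob_diamond (-1/2)" "g \<in> sob_diamond (-1/2)"
  shows "rel_coeff (\<lambda>\<phi>. f \<phi> - c * g \<phi>) n = rel_coeff f n - c * rel_coeff g n"
  by (simp add: rel_coeff_def nd_coeff_diff_cmult[OF assms] one.nd_coeff_diff_cmult[OF assms] algebra_simps)

lemma sigma_minus_one: "(\<lambda>z. \<sigma> z - 1) \<in> borel_measurable disk" "AE z in disk. cmod (\<sigma> z - 1) \<le> B + 1"
proof -
  show "(\<lambda>z. \<sigma> z - 1) \<in> borel_measurable disk" using measurable_\<sigma> by measurable
  show "AE z in disk. cmod (\<sigma> z - 1) \<le> B + 1"
    using bounded_\<sigma>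
  proof eventually_elim
    case (elim z)
    then show ?case using norm_triangle_ineq4[of "\<sigma> z" 1] by simp
  qed
qed

lemma LINT_sigma_minus_one:
  assumes "U \<in> L2s disk" "V \<in> L2s disk"
  shows "(LINT z|disk. (\<sigma> z - 1) * dot (U z) (V z)) = form U V - (LINT z|disk. dot (U z) (V z))"
  using form_integrable[OF assms] LINT_dot1(1)[OF assms] by (simp add: form_def left_diff_distrib)

lemma rel_coeff_eq:
  assumes f: "f \<in> sob_diamond (-1/2)" and s: "nd_sol f v U h" and n: "n \<noteq> 0"
  shows "2 * pi * of_int \<bar>n\<bar> * rel_coeff f (- n) = - (LINT z|disk. (\<sigma> z - 1) * dot (U z) (grad (harm_mode n) z))"
proof -
  obtain v1 U1 h1 where s1: "one.nd_sol f v1 U1 h1" using one.nd_sol_sob_exists[OF f] by blast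
  note g = L2s_grad[OF smooth_harm]
  have "(LINT z|disk. (\<sigma> z - 1) * dot (U z) (grad (harm_mode n) z)) = f (\<lambda>t. harm_mode n (cis t)) - 2 * pi * of_int \<bar>n\<bar> * fc h (- n)"
    unfolding LINT_sigma_minus_one[OF nd_solD(6)[OF s] g] nd_solD(2)[OF s smooth_harm]
      weak_grad_harm[OF nd_solD(1,3,4)[OF s] n] ..
  moreover have "f (\<lambda>t. harm_mode n (cis t)) = 2 * pi * of_int \<bar>n\<bar> * fc h1 (- n)"
    using one.nd_solD(2)[OF s1 smooth_harm] weak_grad_harm[OF one.nd_solD(1,3,4)[OF s1] n] by (simp add: one_form)
  ultimately show ?thesis
    by (simp add: rel_coeff_def nd_coeff_eq[OF s] one.nd_coeff_eq[OF s1] algebra_simps)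
qed

end

locale localized_conductivity = conductivity +
  fixes R :: real
  assumes R: "0 < R" "R < 1" and one_outside: "AE z in disk. R < cmod z \<longrightarrow> \<sigma> z = 1"
begin

text \<open>Almost everywhere where \<open>\<sigma> - 1\<close> does not vanish the cutoff equals 1,
  so it can be put on both factors, and each of them can then supply decay of its own.\<close>

lemma LINT_sigma_minus_one_le:
  assumes U: "U \<in> L2s disk" and V: "V \<in> L2s disk"
  shows "cmod (LINT z|disk. (\<sigma> z - 1) * dot (U z) (V z)) \<le>
    (B + 1) * L2n disk (\<lambda>z. scl (radial_cut R z) (U z)) * L2n disk (\<lambda>z. scl (radial_cut R z) (V z))"
proof -
  have "(LINT z|disk. (\<sigma> z - 1) * dot (U z) (V z)) = (LINT z|disk. (\<sigma> z - 1) * dot (scl (radial_cut R z) (U z)) (scl (radial_cut R z) (V z)))"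
  proof (rule integral_cong_AE)
    show "(\<lambda>z. (\<sigma> z - 1) * dot (U z) (V z)) \<in> borel_measurable disk"
      by (rule borel_measurable_integrable[OF LINT_dot(1)[OF U V sigma_minus_one]])
    show "(\<lambda>z. (\<sigma> z - 1) * dot (scl (radial_cut R z) (U z)) (scl (radial_cut R z) (V z))) \<in> borel_measurable disk"
      by (rule borel_measurable_integrable[OF LINT_dot(1)[OF L2s_cut[OF U] L2s_cut[OF V] sigma_minus_one]])
    show "AE z in disk. (\<sigma> z - 1) * dot (U z) (V z) = (\<sigma> z - 1) * dot (scl (radial_cut R z) (U z)) (scl (radial_cut R z) (V z))"
      using one_outside by eventually_elim (auto simp: radial_cut_def dot_scl_left dot_scl_right)
  qed
  then show ?thesis
    using LINT_dot(2)[OF L2s_cut[OF U] L2s_cut[OF V] sigma_minus_one] lo_pos B_pos by simp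
qed

text \<open>The factor |n| from the gradient of the test mode cancels the factor |n| in
  \<open>rel_coeff_eq\<close>, so pure exponential decay in n remains; the exponent |n| - 1 is the
  origin of 1 / R. The datum enters through the norm of \<open>U\<close> on the inner disk, which
  \<open>rel_matrix_bound\<close> estimates further.\<close>

lemma rel_coeff_bound:
  assumes f: "f \<in> sob_diamond (-1/2)" and s: "nd_sol f v U h"
  shows "cmod (rel_coeff f n) \<le> (B + 1) * L2n disk (\<lambda>_. 1 :: complex) / R * L2n disk (\<lambda>z. scl (radial_cut R z) (U z)) * R ^ nat \<bar>n\<bar>"
proof (cases "n = 0")
  case True
  then show ?thesis using R lo_pos B_pos by (simp add: rel_coeff_0[OF f])
next
  case False
  define K where "K = (B + 1) * L2n disk (\<lambda>z. scl (radial_cut R z) (U z))"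
  have K: "K \<ge> 0" using lo_pos B_pos by (simp add: K_def)
  define X where "X = of_int \<bar>n\<bar> * cmod (rel_coeff f n)"
  have "2 * pi * X = cmod (2 * pi * of_int \<bar>- n\<bar> * rel_coeff f (- (- n)))"
    by (simp add: norm_mult X_def)
  also have "\<dots> \<le> K * L2n disk (\<lambda>z. scl (radial_cut R z) (grad (harm_mode (- n)) z))"
  proof -
    have "2 * pi * of_int \<bar>- n\<bar> * rel_coeff f (- (- n)) = - (LINT z|disk. (\<sigma> z - 1) * dot (U z) (grad (harm_mode (- n)) z))"
      by (rule rel_coeff_eq[OF f s]) (use False in simp)
    then show ?thesis unfolding K_def
      using LINT_sigma_minus_one_le[OF nd_solD(6)[OF s] L2s_grad[OF smooth_harm], of "- n"] by (simp only: norm_minus_cancel)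
  qed
  also have "\<dots> \<le> K * (sqrt 2 * (\<bar>of_int (- n)\<bar> * R ^ (nat \<bar>- n\<bar> - 1)) * L2n disk (\<lambda>_. 1 :: complex))"
    by (intro mult_left_mono L2n_cut_grad_harm R K)
  also have "\<dots> = of_int \<bar>n\<bar> * (sqrt 2 * (K * R ^ (nat \<bar>n\<bar> - 1) * L2n disk (\<lambda>_. 1 :: complex)))" by simp
  finally have "of_int \<bar>n\<bar> * (2 * pi * cmod (rel_coeff f n)) \<le> of_int \<bar>n\<bar> * (sqrt 2 * (K * R ^ (nat \<bar>n\<bar> - 1) * L2n disk (\<lambda>_. 1 :: complex)))"
    by (simp add: X_def mult_ac)
  then have le: "2 * pi * cmod (rel_coeff f n) \<le> sqrt 2 * (K * R ^ (nat \<bar>n\<bar> - 1) * L2n disk (\<lambda>_. 1 :: complex))"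
    using False by simp
  define Y where "Y = K * (R ^ nat \<bar>n\<bar> / R) * L2n disk (\<lambda>_. 1 :: complex)"
  have "R ^ (nat \<bar>n\<bar> - 1) = R ^ nat \<bar>n\<bar> / R"
    using R False by (simp add: power_diff)
  then have "2 * pi * cmod (rel_coeff f n) \<le> sqrt 2 * Y" using le by (simp add: Y_def)
  also have "\<dots> \<le> 2 * pi * Y"
  proof (rule mult_right_mono)
    have "sqrt 2 \<le> 2" using real_sqrt_le_mono[of 2 4] by simp
    then show "sqrt 2 \<le> 2 * pi" using pi_ge_two by linarith
    show "0 \<le> Y" using K R by (simp add: Y_def)
  qed
  finally have "2 * pi * cmod (rel_coeff f n) \<le> 2 * pi * (K * (R ^ nat \<bar>n\<bar> / R) * L2n disk (\<lambda>_. 1 :: complex))"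
    by (simp only: Y_def)
  then have "cmod (rel_coeff f n) \<le> K * (R ^ nat \<bar>n\<bar> / R) * L2n disk (\<lambda>_. 1 :: complex)"
    by (rule mult_left_le_imp_le) simp
  then show ?thesis by (simp add: K_def mult_ac)
qed

text \<open>Continuity in the datum, which allows the passage from truncations to the full matrix
  series in \<open>rel_coeff_has_sum\<close>.\<close>

lemma rel_coeff_continuous:
  obtains C where "C \<ge> 0" "\<And>f n. f \<in> sob_diamond (-1/2) \<Longrightarrow> cmod (rel_coeff f n) \<le> C * sob_norm (-1/2) f"
proof -
  define A where "A = (B + 1) * L2n disk (\<lambda>_. 1 :: complex) / R"
  have A: "A \<ge> 0" using R lo_pos B_pos by (simp add: A_def)
  have "cmod (rel_coeff f n) \<le> A / lo * sob_norm (-1/2) f" if f: "f \<in> sob_diamond (-1/2)" for f n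
  proof -
    obtain v U h where s: "nd_sol f v U h" using nd_sol_sob_exists[OF f] by blast
    have "cmod (rel_coeff f n) \<le> A * L2n disk (\<lambda>z. scl (radial_cut R z) (U z)) * R ^ nat \<bar>n\<bar>"
      unfolding A_def by (rule rel_coeff_bound[OF f s])
    also have "\<dots> \<le> A * L2n disk U * 1"
      using A R by (intro mult_mono mult_left_mono L2n_cut_le nd_solD(6)[OF s] power_le_one) auto
    also have "\<dots> \<le> A * (sob_norm (-1/2) f / lo) * 1"
      using A lo_pos nd_sol_energy[OF f s] by (intro mult_right_mono mult_left_mono) (auto simp: field_simps)
    finally show ?thesis by simp
  qed
  moreover have "A / lo \<ge> 0" using A lo_pos by simp
  ultimately show thesis using that by blast
qed

text \<open>The column m = 0 is set to zero because the constant mode is no admissible Neumann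
  datum. It only ever multiplies a vanishing coefficient.\<close>

definition rel_matrix :: "int \<Rightarrow> int \<Rightarrow> complex" where
  "rel_matrix n m = (if m = 0 then 0 else rel_coeff (dist_of (fmode m)) n)"

lemma rel_matrix_0: "rel_matrix 0 m = 0"
  by (simp add: rel_matrix_def rel_coeff_0 fmode_sob_diamond)

text \<open>For the datum \<open>fmode m\<close> the harmonic solution u is
  \<open>harm_mode m\<close> divided by |m|. The correction U - grad u solves the problem for
  \<sigma> with source (1 - \<sigma>) grad u, which lives in the disk of radius R, where grad u is
  of the order of R to the power |m| - 1. Hence \<open>U\<close> itself is that small on this
  disk.\<close>

lemma rel_matrix_bound:
  obtains C where "C \<ge> 0" "\<And>n m. cmod (rel_matrix n m) \<le> C * R ^ nat \<bar>n\<bar> * R ^ nat \<bar>m\<bar>"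
proof -
  define A where "A = (B + 1) * L2n disk (\<lambda>_. 1 :: complex) / R"
  have A: "A \<ge> 0" using R lo_pos B_pos by (simp add: A_def)
  \<comment> \<open>The 1 stands for grad u on the inner disk and (B + 1) / lo for the correction;
    the last factor comes from the bound for \<open>cu\<close>.\<close>
  define E where "E = (1 + (B + 1) / lo) * (sqrt 2 * L2n disk (\<lambda>_. 1 :: complex) / R)"
  have E: "E \<ge> 0" using R lo_pos B_pos by (simp add: E_def)
  have "cmod (rel_matrix n m) \<le> (A * E) * R ^ nat \<bar>n\<bar> * R ^ nat \<bar>m\<bar>" for n m
  proof (cases "m = 0")
    case False
    define f where "f = dist_of (fmode m)"
    have f: "f \<in> sob_diamond (-1/2)" unfolding f_def by (rule fmode_sob_diamond[OF False])
    obtain v U h where s: "nd_sol f v U h" using nd_sol_sob_exists[OF f] by blast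
    define u where "u z = (1 / of_int \<bar>m\<bar>) * harm_mode m z" for z
    have u: "smooth u" unfolding u_def[abs_def] by (intro smooth_cmult smooth_harm)
    have gu: "grad u z = scl (1 / of_int \<bar>m\<bar>) (grad (harm_mode m) z)" for z
      unfolding u_def[abs_def] by (subst grad_cmult[OF smooth_harm]) (simp add: scl_def)
    have fu: "(LINT z|disk. dot (grad u z) (grad \<phi> z)) = f (\<lambda>t. \<phi> (cis t))" if \<phi>: "smooth \<phi>" for \<phi>
    proof -
      have "(LINT z|disk. dot (grad u z) (grad \<phi> z)) = (1 / of_int \<bar>m\<bar>) * (LINT z|disk. dot (grad \<phi> z) (grad (harm_mode m) z))"
        unfolding gu dot_scl_left by (simp add: dot_commute)
      also have "\<dots> = (LINT t|circ. \<phi> (cis t) * fmode m t)"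
        unfolding Green_harm[OF \<phi> False] using False by simp
      also have "\<dots> = f (\<lambda>t. \<phi> (cis t))"
        by (simp add: f_def dist_of_def test_fun_cis_comp[OF \<phi>] mult.commute)
      finally show ?thesis .
    qed
    define cu where "cu = L2n disk (\<lambda>z. scl (radial_cut R z) (grad u z))"
    have cu0: "cu \<ge> 0" by (simp add: cu_def)
    have cu: "cu \<le> sqrt 2 * L2n disk (\<lambda>_. 1 :: complex) / R * R ^ nat \<bar>m\<bar>"
    proof -
      have "(\<lambda>z. scl (radial_cut R z) (grad u z)) = (\<lambda>z. scl (1 / of_int \<bar>m\<bar>) (scl (radial_cut R z) (grad (harm_mode m) z)))"
        by (auto simp: gu scl_def mult_ac)
      then have "cu = (1 / of_int \<bar>m\<bar>) * L2n disk (\<lambda>z. scl (radial_cut R z) (grad (harm_mode m) z))"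
        unfolding cu_def by (simp add: L2n_scl_const norm_divide)
      also have "\<dots> \<le> (1 / of_int \<bar>m\<bar>) * (sqrt 2 * (\<bar>of_int m\<bar> * R ^ (nat \<bar>m\<bar> - 1)) * L2n disk (\<lambda>_. 1 :: complex))"
        by (intro mult_left_mono L2n_cut_grad_harm R) simp
      also have "\<dots> = sqrt 2 * R ^ (nat \<bar>m\<bar> - 1) * L2n disk (\<lambda>_. 1 :: complex)" using False by simp
      also have "R ^ (nat \<bar>m\<bar> - 1) = R ^ nat \<bar>m\<bar> / R" using R False by (simp add: power_diff)
      finally show ?thesis by (simp add: mult_ac)
    qed
    have W: "lo * L2n disk (\<lambda>z. U z - grad u z) \<le> (B + 1) * cu"
    proof (rule coercive_limit[OF conv_grad_diff[OF nd_solD(1)[OF s] conv_grad_const[OF u]]])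
      fix \<phi> :: "complex \<Rightarrow> complex" assume \<phi>: "smooth \<phi>"
      have "form (\<lambda>z. U z - grad u z) (grad \<phi>) = - (LINT z|disk. (\<sigma> z - 1) * dot (grad u z) (grad \<phi> z))"
        unfolding LINT_sigma_minus_one[OF L2s_grad[OF u] L2s_grad[OF \<phi>]] fu[OF \<phi>]
        using form_diff_left[OF nd_solD(6)[OF s] L2s_grad[OF u] L2s_grad[OF \<phi>]] nd_solD(2)[OF s \<phi>] by simp
      then have "cmod (form (\<lambda>z. U z - grad u z) (grad \<phi>)) \<le> (B + 1) * cu * L2n disk (\<lambda>z. scl (radial_cut R z) (grad \<phi> z))"
        using LINT_sigma_minus_one_le[OF L2s_grad[OF u] L2s_grad[OF \<phi>]] by (simp add: cu_def)
      also have "\<dots> \<le> (B + 1) * cu * L2n disk (grad \<phi>)"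
        using lo_pos B_pos cu0 by (intro mult_left_mono L2n_cut_le L2s_grad \<phi>) auto
      finally show "cmod (form (\<lambda>z. U z - grad u z) (grad \<phi>)) \<le> (B + 1) * cu * L2n disk (grad \<phi>)" .
    qed (use lo_pos B_pos cu0 in simp)
    have US: "U \<in> L2s disk" by (rule nd_solD(6)[OF s])
    have "L2n disk (\<lambda>z. scl (radial_cut R z) (U z)) \<le> L2n disk (\<lambda>z. scl (radial_cut R z) (U z) - scl (radial_cut R z) (grad u z)) + cu"
      unfolding cu_def by (intro L2n_le_add_diff L2s_cut US L2s_grad u)
    also have "(\<lambda>z. scl (radial_cut R z) (U z) - scl (radial_cut R z) (grad u z)) = (\<lambda>z. scl (radial_cut R z) (U z - grad u z))"
      by (auto simp: scl_def algebra_simps)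
    also have "L2n disk (\<lambda>z. scl (radial_cut R z) (U z - grad u z)) \<le> L2n disk (\<lambda>z. U z - grad u z)"
      by (intro L2n_cut_le L2s_diff US L2s_grad u)
    also have "L2n disk (\<lambda>z. U z - grad u z) \<le> (B + 1) / lo * cu"
      using W lo_pos by (simp add: field_simps)
    finally have "L2n disk (\<lambda>z. scl (radial_cut R z) (U z)) \<le> (1 + (B + 1) / lo) * cu"
      by (simp add: distrib_right)
    also have "\<dots> \<le> (1 + (B + 1) / lo) * (sqrt 2 * L2n disk (\<lambda>_. 1 :: complex) / R * R ^ nat \<bar>m\<bar>)"
      using lo_pos B_pos by (intro mult_left_mono cu) auto
    also have "\<dots> = E * R ^ nat \<bar>m\<bar>" by (simp add: E_def)
    finally have cU: "L2n disk (\<lambda>z. scl (radial_cut R z) (U z)) \<le> E * R ^ nat \<bar>m\<bar>" .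
    have "cmod (rel_matrix n m) \<le> A * L2n disk (\<lambda>z. scl (radial_cut R z) (U z)) * R ^ nat \<bar>n\<bar>"
      using rel_coeff_bound[OF f s, of n] False by (simp add: rel_matrix_def f_def[symmetric] A_def)
    also have "\<dots> \<le> A * (E * R ^ nat \<bar>m\<bar>) * R ^ nat \<bar>n\<bar>"
      using A R by (intro mult_right_mono mult_left_mono cU) auto
    finally show ?thesis by (simp add: mult_ac)
  qed (use A E R in \<open>simp add: rel_matrix_def\<close>)
  then show thesis using that[of "A * E"] A E by simp
qed

lemma rel_coeff_trunc:
  assumes f: "f \<in> sob_diamond (-1/2)" and A: "finite A"
  shows "rel_coeff (trunc f A) n = (\<Sum>m\<in>A. rel_matrix n m * fcoeff f m)"
  using A
proof (induction A rule: finite_induct)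
  case empty
  have z: "(\<lambda>_. 0) \<in> sob_diamond (-1/2)" using trunc_sob_diamond[of "{}" f "-1/2"] f by (simp add: trunc_def sob_diamond_0)
  show ?case using rel_coeff_diff_cmult[OF z z, of 1 n] by (simp add: trunc_def)
next
  case (insert a A)
  have t: "trunc f A \<in> sob_diamond (-1/2)" by (rule trunc_sob_diamond) (use insert f sob_diamond_0 in auto)
  show ?case
  proof (cases "a = 0")
    case True
    then have "trunc f (insert a A) = trunc f A" using insert by (auto simp: trunc_def sob_diamond_0[OF f])
    then show ?thesis using insert True by (simp add: sob_diamond_0[OF f])
  next
    case False
    have "trunc f (insert a A) = (\<lambda>\<phi>. trunc f A \<phi> - (- fcoeff f a) * dist_of (fmode a) \<phi>)"
      using insert by (auto simp: trunc_def)
    then show ?thesis using insert False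
      by (simp only: rel_coeff_diff_cmult[OF t fmode_sob_diamond[OF False]]) (simp add: rel_matrix_def mult.commute)
  qed
qed

lemma rel_coeff_has_sum:
  assumes f: "f \<in> sob_diamond (-1/2)"
  shows "((\<lambda>m. rel_matrix n m * fcoeff f m) has_sum rel_coeff f n) UNIV"
  unfolding has_sum_def
proof (rule LIM_zero_cancel)
  obtain C where C: "C \<ge> 0" "\<And>f n. f \<in> sob_diamond (-1/2) \<Longrightarrow> cmod (rel_coeff f n) \<le> C * sob_norm (-1/2) f"
    by (rule rel_coeff_continuous) blast
  have fin: "\<forall>\<^sub>F A in finite_subsets_at_top (UNIV::int set). finite A"
    by (simp add: eventually_finite_subsets_at_top) auto
  show "((\<lambda>A. (\<Sum>m\<in>A. rel_matrix n m * fcoeff f m) - rel_coeff f n) \<longlongrightarrow> 0) (finite_subsets_at_top UNIV)"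
  proof (rule Lim_null_comparison)
    show "((\<lambda>A. C * sob_norm (-1/2) (f - trunc f A)) \<longlongrightarrow> 0) (finite_subsets_at_top UNIV)"
      using tendsto_mult_left[OF sob_norm_trunc_tendsto[OF f], of C] by simp
    show "\<forall>\<^sub>F A in finite_subsets_at_top UNIV. norm ((\<Sum>m\<in>A. rel_matrix n m * fcoeff f m) - rel_coeff f n) \<le> C * sob_norm (-1/2) (f - trunc f A)"
      using fin
    proof eventually_elim
      case (elim A)
      have t: "trunc f A \<in> sob_diamond (-1/2)" by (rule trunc_sob_diamond) (use elim f sob_diamond_0 in auto)
      have "f - trunc f A = (\<lambda>\<phi>. f \<phi> - 1 * trunc f A \<phi>)" by auto
      then have "rel_coeff (f - trunc f A) n = rel_coeff f n - (\<Sum>m\<in>A. rel_matrix n m * fcoeff f m)"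
        using rel_coeff_diff_cmult[OF f t, of 1 n] by (simp only: rel_coeff_trunc[OF f elim] mult_1)
      then show ?case using C(2)[OF sob_diamond_diff[OF f t], of n] by (simp add: norm_minus_commute)
    qed
  qed
qed

end

section \<open>The relative Neumann-to-Dirichlet map on all Sobolev spaces\<close>

text \<open>Exponential decay in |n| absorbs any power of the weight. This is why one matrix bound
  serves all pairs of Sobolev orders.\<close>

lemma power_decay:
  fixes R p :: real
  assumes R: "0 < R" "R < 1"
  obtains K where "K \<ge> 0" "\<And>n::int. R ^ nat \<bar>n\<bar> \<le> K * wt n powr - p"
proof -
  define j where "j = nat \<lceil>\<bar>p\<bar>\<rceil>"
  have j: "p \<le> real j" unfolding j_def by linarith
  define c where "c = - ln R"
  have c: "c > 0" using R by (simp add: c_def)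
  have Rk: "R ^ k = exp (- (c * real k))" for k
    using R by (simp add: c_def exp_of_nat_mult mult.commute[of _ "real k"])
  have lim: "filterlim (\<lambda>k::nat. c * real k) at_top sequentially"
    by (rule filterlim_tendsto_pos_mult_at_top[OF tendsto_const c filterlim_real_sequentially])
  have "(\<lambda>k. (c * real k) ^ j / exp (c * real k)) \<longlonglongrightarrow> 0"
    by (rule filterlim_compose[OF tendsto_power_div_exp_0 lim])
  then have "Bseq (\<lambda>k. (c * real k) ^ j / exp (c * real k))"
    by (intro convergent_imp_Bseq convergentI)
  then obtain B where B: "B > 0" "\<And>k. norm ((c * real k) ^ j / exp (c * real k)) \<le> B"
    unfolding Bseq_def by blast
  define K where "K = max 1 (B / c ^ j)"
  have "R ^ nat \<bar>n\<bar> \<le> K * wt n powr - p" for n :: int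
  proof (cases "n = 0")
    case False
    define k where "k = nat \<bar>n\<bar>"
    have k: "real k \<ge> 1" "wt n = real k" using False by (auto simp: k_def)
    have "(c * real k) ^ j * R ^ k \<le> B"
      using B(2)[of k] c by (simp add: Rk exp_minus field_simps)
    then have "R ^ k * real k ^ j \<le> B / c ^ j" using c by (simp add: field_simps power_mult_distrib)
    also have "\<dots> \<le> K" by (simp add: K_def)
    finally have *: "R ^ k * real k ^ j \<le> K" .
    have "R ^ k = (R ^ k * real k ^ j) * real k powr - real j"
      using k by (simp add: powr_minus powr_realpow)
    also have "\<dots> \<le> K * real k powr - real j" by (intro mult_right_mono *) simp
    also have "\<dots> \<le> K * real k powr - p" using j k by (intro mult_left_mono powr_mono) (auto simp: K_def)
    finally show ?thesis unfolding k(2) k_def[symmetric] .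
  qed (simp add: K_def)
  then show thesis using that[of K] by (simp add: K_def)
qed

lemma summable_power_weight:
  fixes R t :: real
  assumes "0 < R" "R < 1"
  shows "(\<lambda>n. R ^ nat \<bar>n\<bar> * wt n powr - t) summable_on UNIV"
proof -
  obtain K where K: "K \<ge> 0" "\<And>n::int. R ^ nat \<bar>n\<bar> \<le> K * wt n powr - (2 - t)"
    using power_decay[OF assms] by blast
  have S: "(\<lambda>n. K * wt n powr - 2) summable_on UNIV"
    by (intro summable_on_cmult_right summable_on_int_inverse) simp
  show ?thesis
  proof (rule summable_on_comparison_test[OF S])
    fix n :: int
    have "R ^ nat \<bar>n\<bar> * wt n powr - t \<le> (K * wt n powr - (2 - t)) * wt n powr - t"
      by (intro mult_right_mono K) simp
    also have "\<dots> = K * wt n powr - 2" by (simp add: mult.assoc powr_add[symmetric])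
    finally show "R ^ nat \<bar>n\<bar> * wt n powr - t \<le> K * wt n powr - 2" .
    show "0 \<le> R ^ nat \<bar>n\<bar> * wt n powr - t" using assms by simp
  qed
qed

lemma sob_diamond_add_cmult:
  assumes "f \<in> sob_diamond t" "g \<in> sob_diamond t"
  shows "(\<lambda>\<phi>. f \<phi> + c * g \<phi>) \<in> sob_diamond t"
proof -
  have gd: "g \<in> distributions" and gs: "sob_term t g summable_on UNIV" and g0: "fcoeff g 0 = 0"
    using assms(2) by (auto simp: sob_diamond_def sob_def)
  define h where "h = (\<lambda>\<phi>. 0 + (- c) * g \<phi>)"
  have hd: "h \<in> distributions" unfolding h_def by (rule dist_add_cmult[OF zero_dist gd])
  have hc: "fcoeff h n = - c * fcoeff g n" for n by (simp add: h_def fcoeff_def)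
  have "sob_term t h = (\<lambda>n. (cmod c)\<^sup>2 * sob_term t g n)"
    by (auto simp: sob_term_def hc norm_mult power_mult_distrib)
  then have "h \<in> sob_diamond t"
    using hd gs g0 by (simp add: sob_diamond_def sob_def hc summable_on_cmult_right)
  from sob_diamond_diff[OF assms(1) this] show ?thesis by (simp add: h_def fun_diff_def)
qed

context localized_conductivity
begin

text \<open>The matrix acts on coefficients, so the formula makes sense for data of every order,
  also for those below -1/2. The value elsewhere follows the convention of
  \<open>is_relative_ND\<close>.\<close>

definition rel_op :: "pdist \<Rightarrow> pdist" where
  "rel_op f = (if f \<in> (\<Union>t. sob_diamond t) then dist_of (fser (\<lambda>n. \<Sum>\<^sub>\<infinity>m. rel_matrix n m * fcoeff f m)) else (\<lambda>_. 0))"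

text \<open>The coefficients of \<open>f\<close> grow at most like a power of |m|, which R to the
  power |m| outweighs. The factor in n survives and yields boundedness into every order.\<close>

lemma rel_op_series:
  obtains Z where "\<And>t. Z t \<ge> 0"
    "\<And>t f n. f \<in> sob_diamond t \<Longrightarrow> (\<lambda>m. rel_matrix n m * fcoeff f m) summable_on UNIV"
    "\<And>t f n. f \<in> sob_diamond t \<Longrightarrow> cmod (\<Sum>\<^sub>\<infinity>m. rel_matrix n m * fcoeff f m) \<le> Z t * sob_norm t f * R ^ nat \<bar>n\<bar>"
proof -
  obtain C where C: "C \<ge> 0" "\<And>n m. cmod (rel_matrix n m) \<le> C * R ^ nat \<bar>n\<bar> * R ^ nat \<bar>m\<bar>"
    by (rule rel_matrix_bound) blast
  define Z where "Z t = C * (\<Sum>\<^sub>\<infinity>m. R ^ nat \<bar>m\<bar> * wt m powr - t)" for t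
  have Z: "Z t \<ge> 0" for t unfolding Z_def using C R by (intro mult_nonneg_nonneg infsum_nonneg) auto
  have le: "cmod (rel_matrix n m * fcoeff f m) \<le> (C * R ^ nat \<bar>n\<bar> * sob_norm t f) * (R ^ nat \<bar>m\<bar> * wt m powr - t)"
    if f: "f \<in> sob_diamond t" for t f n m
  proof -
    have "cmod (rel_matrix n m * fcoeff f m) \<le> (C * R ^ nat \<bar>n\<bar> * R ^ nat \<bar>m\<bar>) * (sob_norm t f * wt m powr - t)"
      unfolding norm_mult using C R by (intro mult_mono C fcoeff_le_sob_norm sob_diamond_sob f) auto
    then show ?thesis by (simp add: mult_ac)
  qed
  have S: "(\<lambda>m. (C * R ^ nat \<bar>n\<bar> * sob_norm t f) * (R ^ nat \<bar>m\<bar> * wt m powr - t)) summable_on UNIV" for n t f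
    by (intro summable_on_cmult_right summable_power_weight R)
  have abs: "(\<lambda>m. cmod (rel_matrix n m * fcoeff f m)) summable_on UNIV" if f: "f \<in> sob_diamond t" for t f n
    by (rule summable_on_comparison_test[OF S]) (use le[OF f] in auto)
  have b: "cmod (\<Sum>\<^sub>\<infinity>m. rel_matrix n m * fcoeff f m) \<le> Z t * sob_norm t f * R ^ nat \<bar>n\<bar>" if f: "f \<in> sob_diamond t" for t f n
  proof -
    have "cmod (\<Sum>\<^sub>\<infinity>m. rel_matrix n m * fcoeff f m) \<le> (\<Sum>\<^sub>\<infinity>m. cmod (rel_matrix n m * fcoeff f m))"
      by (rule norm_infsum_bound[OF abs[OF f]])
    also have "\<dots> \<le> (\<Sum>\<^sub>\<infinity>m. (C * R ^ nat \<bar>n\<bar> * sob_norm t f) * (R ^ nat \<bar>m\<bar> * wt m powr - t))"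
      by (intro infsum_mono abs[OF f] S le[OF f])
    also have "\<dots> = (C * R ^ nat \<bar>n\<bar> * sob_norm t f) * (\<Sum>\<^sub>\<infinity>m. R ^ nat \<bar>m\<bar> * wt m powr - t)"
      by (rule infsum_cmult_right) (intro summable_power_weight R)
    also have "\<dots> = Z t * sob_norm t f * R ^ nat \<bar>n\<bar>" by (simp add: Z_def mult_ac)
    finally show ?thesis .
  qed
  show thesis by (rule that[of Z]) (use Z b abs in \<open>auto intro: abs_summable_summable\<close>)
qed

lemma rel_op_props:
  assumes f: "f \<in> sob_diamond t"
  shows "rel_op f \<in> distributions" "fcoeff (rel_op f) n = (\<Sum>\<^sub>\<infinity>m. rel_matrix n m * fcoeff f m)"
    "(\<lambda>m. rel_matrix n m * fcoeff f m) summable_on UNIV"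
proof -
  obtain Z where Z: "\<And>t. Z t \<ge> 0"
    "\<And>t f n. f \<in> sob_diamond t \<Longrightarrow> (\<lambda>m. rel_matrix n m * fcoeff f m) summable_on UNIV"
    "\<And>t f n. f \<in> sob_diamond t \<Longrightarrow> cmod (\<Sum>\<^sub>\<infinity>m. rel_matrix n m * fcoeff f m) \<le> Z t * sob_norm t f * R ^ nat \<bar>n\<bar>"
    by (rule rel_op_series) blast
  have "(\<lambda>n. Z t * sob_norm t f * (R ^ nat \<bar>n\<bar> * wt n powr - 0)) summable_on UNIV"
    by (intro summable_on_cmult_right summable_power_weight R)
  then have "(\<lambda>n. cmod (\<Sum>\<^sub>\<infinity>m. rel_matrix n m * fcoeff f m)) summable_on UNIV"
    by (rule summable_on_comparison_test) (use Z(3)[OF f] in auto)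
  from dist_of_fser(1,2)[OF this] show "rel_op f \<in> distributions"
    "fcoeff (rel_op f) n = (\<Sum>\<^sub>\<infinity>m. rel_matrix n m * fcoeff f m)"
    using f by (auto simp: rel_op_def)
  show "(\<lambda>m. rel_matrix n m * fcoeff f m) summable_on UNIV" by (rule Z(2)[OF f])
qed

lemma rel_op_ND:
  assumes f: "f \<in> sob_diamond (-1/2)"
  shows "rel_op f = ND_map \<sigma> f - ND_map (\<lambda>_. 1) f"
proof (rule dist_eqI)
  show "rel_op f \<in> distributions" by (rule rel_op_props(1)[OF f])
  show "ND_map \<sigma> f - ND_map (\<lambda>_. 1) f \<in> distributions"
    by (intro dist_diff nd_map_dist one.nd_map_dist f)
  fix n
  have "fcoeff (rel_op f) n = rel_coeff f n"
    unfolding rel_op_props(2)[OF f] by (rule infsumI[OF rel_coeff_has_sum[OF f]])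
  then show "fcoeff (rel_op f) n = fcoeff (ND_map \<sigma> f - ND_map (\<lambda>_. 1) f) n"
    by (simp add: rel_coeff_def nd_coeff_def one.nd_coeff_def fcoeff_diff)
qed

lemma rel_op_linear:
  assumes f: "f \<in> sob_diamond t" and g: "g \<in> sob_diamond t"
  shows "rel_op (\<lambda>\<phi>. f \<phi> + c * g \<phi>) = (\<lambda>\<phi>. rel_op f \<phi> + c * rel_op g \<phi>)"
proof (rule dist_eqI)
  note fg = sob_diamond_add_cmult[OF f g, of c]
  show "rel_op (\<lambda>\<phi>. f \<phi> + c * g \<phi>) \<in> distributions" by (rule rel_op_props(1)[OF fg])
  show "(\<lambda>\<phi>. rel_op f \<phi> + c * rel_op g \<phi>) \<in> distributions"
    by (intro dist_add_cmult rel_op_props(1)[OF f] rel_op_props(1)[OF g])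
  fix n
  have "fcoeff (rel_op (\<lambda>\<phi>. f \<phi> + c * g \<phi>)) n = (\<Sum>\<^sub>\<infinity>m. rel_matrix n m * fcoeff f m + c * (rel_matrix n m * fcoeff g m))"
    unfolding rel_op_props(2)[OF fg] fcoeff_add_cmult by (simp add: algebra_simps)
  also have "\<dots> = (\<Sum>\<^sub>\<infinity>m. rel_matrix n m * fcoeff f m) + (\<Sum>\<^sub>\<infinity>m. c * (rel_matrix n m * fcoeff g m))"
    by (intro infsum_add rel_op_props(3)[OF f] summable_on_cmult_right rel_op_props(3)[OF g])
  also have "(\<Sum>\<^sub>\<infinity>m. c * (rel_matrix n m * fcoeff g m)) = c * (\<Sum>\<^sub>\<infinity>m. rel_matrix n m * fcoeff g m)"
    by (rule infsum_cmult_right) (rule rel_op_props(3)[OF g])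
  finally show "fcoeff (rel_op (\<lambda>\<phi>. f \<phi> + c * g \<phi>)) n = fcoeff (\<lambda>\<phi>. rel_op f \<phi> + c * rel_op g \<phi>) n"
    by (simp add: fcoeff_add_cmult rel_op_props(2)[OF f] rel_op_props(2)[OF g])
qed

lemma rel_op_bounded:
  "\<exists>C. \<forall>f\<in>sob_diamond t. rel_op f \<in> sob_diamond r \<and> sob_norm r (rel_op f) \<le> C * sob_norm t f"
proof -
  obtain Z where Z: "\<And>t. Z t \<ge> 0"
    "\<And>t f n. f \<in> sob_diamond t \<Longrightarrow> (\<lambda>m. rel_matrix n m * fcoeff f m) summable_on UNIV"
    "\<And>t f n. f \<in> sob_diamond t \<Longrightarrow> cmod (\<Sum>\<^sub>\<infinity>m. rel_matrix n m * fcoeff f m) \<le> Z t * sob_norm t f * R ^ nat \<bar>n\<bar>"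
    by (rule rel_op_series) blast
  obtain K where K: "K \<ge> 0" "\<And>n::int. R ^ nat \<bar>n\<bar> \<le> K * wt n powr - (r + 1)"
    using power_decay[OF R] by blast
  have "rel_op f \<in> sob_diamond r \<and> sob_norm r (rel_op f) \<le> (Z t * K * sqrt (2 * pi * zeta2)) * sob_norm t f"
    if f: "f \<in> sob_diamond t" for f
  proof -
    have le: "cmod (fcoeff (rel_op f) n) \<le> (Z t * sob_norm t f * K) * wt n powr - (r + 1)" for n
    proof -
      have "cmod (fcoeff (rel_op f) n) \<le> Z t * sob_norm t f * R ^ nat \<bar>n\<bar>"
        unfolding rel_op_props(2)[OF f] by (rule Z(3)[OF f])
      also have "\<dots> \<le> Z t * sob_norm t f * (K * wt n powr - (r + 1))"
        by (intro mult_left_mono K mult_nonneg_nonneg Z sob_norm_nonneg)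
      finally show ?thesis by (simp add: mult.assoc)
    qed
    have "fcoeff (rel_op f) 0 = 0" unfolding rel_op_props(2)[OF f] by (simp add: rel_matrix_0)
    then show ?thesis
      using sob_of_decay[OF rel_op_props(1)[OF f] le] by (simp add: sob_diamond_def mult_ac)
  qed
  then show ?thesis by blast
qed

lemma rel_op_is_relative_ND: "is_relative_ND \<sigma> rel_op"
  unfolding is_relative_ND_def
  using rel_op_ND rel_op_linear rel_op_bounded by (auto simp: rel_op_def)

end

text \<open>Truncations belong to the space of order -1/2, where the map is prescribed, and
  approximate \<open>f\<close> in order t. Boundedness into order 0, an arbitrary choice, makes each
  coefficient of the image a limit of prescribed ones.\<close>

lemma is_relative_ND_unique:
  assumes T: "is_relative_ND \<sigma> T" and T': "is_relative_ND \<sigma> T'"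
  shows "T = T'"
proof
  fix f
  show "T f = T' f"
  proof (cases "f \<in> (\<Union>t. sob_diamond t)")
    case True
    then obtain t where f: "f \<in> sob_diamond t" by blast
    have lim: "((\<lambda>A. fcoeff (S (trunc f A)) n) \<longlongrightarrow> fcoeff (S f) n) (finite_subsets_at_top UNIV)"
      if S: "is_relative_ND \<sigma> S" for S n
    proof -
      obtain C where C: "\<And>f. f \<in> sob_diamond t \<Longrightarrow> S f \<in> sob_diamond 0 \<and> sob_norm 0 (S f) \<le> C * sob_norm t f"
        using S unfolding is_relative_ND_def by metis
      have lin: "S (\<lambda>\<phi>. f \<phi> + c * g \<phi>) = (\<lambda>\<phi>. S f \<phi> + c * S g \<phi>)" if "f \<in> sob_diamond t" "g \<in> sob_diamond t" for f g c
        using S that unfolding is_relative_ND_def by blast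
      have fin: "\<forall>\<^sub>F A in finite_subsets_at_top (UNIV::int set). finite A"
        by (simp add: eventually_finite_subsets_at_top) auto
      show ?thesis
      proof (rule LIM_zero_cancel, rule Lim_null_comparison)
        show "((\<lambda>A. C * sob_norm t (f - trunc f A)) \<longlongrightarrow> 0) (finite_subsets_at_top UNIV)"
          using tendsto_mult_left[OF sob_norm_trunc_tendsto[OF f], of C] by simp
        show "\<forall>\<^sub>F A in finite_subsets_at_top UNIV. norm (fcoeff (S (trunc f A)) n - fcoeff (S f) n) \<le> C * sob_norm t (f - trunc f A)"
          using fin
        proof eventually_elim
          case (elim A)
          have t: "trunc f A \<in> sob_diamond t" by (rule trunc_sob_diamond[OF elim sob_diamond_0[OF f]])
          have d: "f - trunc f A \<in> sob_diamond t" by (rule sob_diamond_diff[OF f t])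
          have "S (f - trunc f A) = (\<lambda>\<phi>. S f \<phi> + (-1) * S (trunc f A) \<phi>)"
            unfolding dist_diff_eq by (rule lin[OF f t])
          then have "fcoeff (S (f - trunc f A)) n = fcoeff (S f) n - fcoeff (S (trunc f A)) n"
            by (simp add: fcoeff_def diff_divide_distrib)
          moreover have "cmod (fcoeff (S (f - trunc f A)) n) \<le> sob_norm 0 (S (f - trunc f A)) * wt n powr - 0"
            using C[OF d] by (intro fcoeff_le_sob_norm sob_diamond_sob) blast
          moreover have "wt n powr - 0 = 1" by (auto simp: max_def)
          moreover have "sob_norm 0 (S (f - trunc f A)) \<le> C * sob_norm t (f - trunc f A)" using C[OF d] by blast
          ultimately show ?case by (simp only: norm_minus_commute[of "fcoeff (S f) n"] mult_1_right)
        qed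
      qed
    qed
    have eq: "T g = T' g" if "g \<in> sob_diamond (-1/2)" for g
      using T T' that unfolding is_relative_ND_def by metis
    have "fcoeff (T f) n = fcoeff (T' f) n" for n
    proof (rule tendsto_unique[OF _ lim[OF T]])
      have fin: "\<forall>\<^sub>F A in finite_subsets_at_top (UNIV::int set). finite A"
        by (simp add: eventually_finite_subsets_at_top) auto
      have "\<forall>\<^sub>F A in finite_subsets_at_top UNIV. fcoeff (T' (trunc f A)) n = fcoeff (T (trunc f A)) n"
        using fin by eventually_elim (simp add: eq trunc_sob_diamond sob_diamond_0[OF f])
      from Lim_transform_eventually[OF lim[OF T'] this]
      show "((\<lambda>A. fcoeff (T (trunc f A)) n) \<longlongrightarrow> fcoeff (T' f) n) (finite_subsets_at_top UNIV)" .
    qed simp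
    moreover have "S f \<in> distributions" if "is_relative_ND \<sigma> S" for S
    proof -
      have "S f \<in> sob_diamond 0" using that f unfolding is_relative_ND_def by blast
      then show ?thesis by (intro sob_distribution sob_diamond_sob)
    qed
    ultimately show ?thesis using dist_eqI T T' by blast
  next
    case False
    then show ?thesis using T T' unfolding is_relative_ND_def by metis
  qed
qed

lemma (in localized_conductivity) Upsilon_is_relative_ND: "is_relative_ND \<sigma> (Upsilon \<sigma>)"
  unfolding Upsilon_def
  by (rule theI[of _ rel_op]) (use rel_op_is_relative_ND is_relative_ND_unique in auto)

text \<open>Each point of the disk outside the essential support has a neighbourhood on which
  \<open>h\<close> vanishes almost everywhere. Uncountably many null sets might add up, so a
  countable subcover is extracted by the Lindelof property.\<close>

lemma ess_support_radius:
  assumes "compact (ess_support h)"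
  obtains R where "0 < R" "R < 1" "AE z in disk. R < cmod z \<longrightarrow> h z = 0"
proof -
  have sub: "ess_support h \<subseteq> ball 0 1" by (auto simp: ess_support_def)
  obtain R where R: "0 < R" "R < 1" "ess_support h \<subseteq> cball 0 R"
  proof (cases "ess_support h = {}")
    case True
    then show ?thesis using that[of "1/2"] by simp
  next
    case False
    obtain a where a: "a \<in> ess_support h" "\<And>z. z \<in> ess_support h \<Longrightarrow> cmod z \<le> cmod a"
      using continuous_attains_sup[OF assms False, of norm] by (auto intro: continuous_intros)
    \<comment> \<open>The maximum with 1/2 keeps the radius positive if the support is just the
      origin.\<close>
    then show ?thesis using that[of "max (1/2) (cmod a)"] sub by fastforce
  qed
  define V where "V = {z \<in> ball 0 1. R < cmod z}"
  have "\<exists>e>0. AE x in disk. x \<in> ball z e \<longrightarrow> h x = 0" if "z \<in> V" for z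
    using that R(3) unfolding V_def ess_support_def by auto
  then obtain e where e: "\<And>z. z \<in> V \<Longrightarrow> e z > 0" "\<And>z. z \<in> V \<Longrightarrow> AE x in disk. x \<in> ball z (e z) \<longrightarrow> h x = 0"
    by metis
  obtain \<F> where F: "\<F> \<subseteq> (\<lambda>z. ball z (e z)) ` V" "countable \<F>" "\<Union>\<F> = \<Union>((\<lambda>z. ball z (e z)) ` V)"
    by (rule Lindelof[of "(\<lambda>z. ball z (e z)) ` V"]) auto
  have "AE x in disk. \<forall>X\<in>\<F>. x \<in> X \<longrightarrow> h x = 0"
    using F(1,2) e(2) by (subst AE_ball_countable) auto
  then have "AE z in disk. R < cmod z \<longrightarrow> h z = 0"
    using AE_space
  proof eventually_elim
    case (elim x)
    show ?case
    proof
      assume "R < cmod x"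
      then have "x \<in> V" using elim(2) by (simp add: V_def space_restrict_space)
      then have "x \<in> \<Union>\<F>" unfolding F(3) using e(1) by force
      then show "h x = 0" using elim(1) by blast
    qed
  qed
  then show thesis using that R by blast
qed

section \<open>Discretization\<close>

text \<open>The mean of the mode j over the nodes, as shown next: the nodes cannot distinguish
  frequencies that are congruent modulo 2 M + 1.\<close>

definition comb :: "nat \<Rightarrow> int \<Rightarrow> complex" where
  "comb M j = (if (2 * int M + 1) dvd j then 1 else 0)"

text \<open>Multiplication by the ratio \<open>w\<close> of consecutive terms shifts the window of
  summation by one, which does not change the sum over a full period. So the sum vanishes unless w =
  1, that is, unless N divides j.\<close>

lemma mean_fmode_node:
  "1 / (2 * of_nat M + 1) * (\<Sum>m\<in>{- int M..int M}. fmode j (node M m)) = comb M j"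
proof -
  define N where "N = 2 * int M + 1"
  have N: "N > 0" by (simp add: N_def)
  define w where "w = cis (2 * pi * of_int j / of_int N)"
  define g where "g m = cis (of_int j * node M m)" for m
  have node: "node M m = 2 * pi * of_int m / of_int N" for m by (simp add: node_def N_def)
  have gS: "g (m + 1) = w * g m" for m
    unfolding g_def w_def node cis_mult by (simp add: field_simps add_divide_distrib)
  have gN: "g (m + N) = g m" for m
  proof -
    have "of_int j * node M (m + N) = of_int j * node M m + 2 * pi * of_int j"
      using N unfolding node by (simp add: field_simps)
    then have "g (m + N) = g m * cis (2 * pi * of_int j)" unfolding g_def by (simp only: cis_mult)
    also have "cis (2 * pi * of_int j) = 1" by simp
    finally show ?thesis by simp
  qed
  have fg: "(\<Sum>m\<in>{- int M..int M}. fmode j (node M m)) = (\<Sum>m\<in>{- int M..int M}. g m)"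
    by (simp add: fmode_eq_cis g_def)
  have cN: "(2 * of_nat M + 1 :: complex) = of_int N" by (simp add: N_def)
  show ?thesis
  proof (cases "N dvd j")
    case True
    then obtain i where i: "j = N * i" by blast
    have "g m = 1" for m
    proof -
      have "of_int j * node M m = 2 * pi * of_int (i * m)" using N by (simp add: node i)
      then show ?thesis unfolding g_def by (simp only: cis_multiple_2pi Ints_of_int)
    qed
    moreover have "of_nat (card {- int M..int M}) = (of_int N :: complex)" by (simp add: N_def)
    ultimately show ?thesis using True N unfolding fg cN by (simp add: comb_def N_def[symmetric])
  next
    case False
    have w1: "w \<noteq> 1"
    proof
      assume "w = 1"
      then have "sin (2 * pi * of_int j / of_int N) = sin 0 \<and> cos (2 * pi * of_int j / of_int N) = cos 0"
        by (simp add: w_def complex_eq_iff)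
      then obtain i :: int where "2 * pi * of_int j / of_int N = 0 + 2 * pi * of_int i"
        using sin_cos_eq_iff by blast
      then have "real_of_int j = of_int (N * i)" using N by (simp add: field_simps)
      then have "j = N * i" by (simp only: of_int_eq_iff)
      then show False using False by simp
    qed
    define S where "S = (\<Sum>m\<in>{- int M..int M}. g m)"
    have "w * S = (\<Sum>m\<in>{- int M..int M}. g (m + 1))" by (simp add: S_def gS sum_distrib_left)
    also have "\<dots> = (\<Sum>m\<in>{- int M + 1..int M + 1}. g m)"
      by (rule sum.reindex_bij_witness[of _ "\<lambda>m. m - 1" "\<lambda>m. m + 1"]) auto
    also have "\<dots> = S"
    proof -
      have "{- int M + 1..int M + 1} = insert (int M + 1) {- int M + 1..int M}"
        "{- int M..int M} = insert (- int M) {- int M + 1..int M}"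
        by auto
      moreover have "g (int M + 1) = g (- int M)" using gN[of "- int M"] by (simp add: N_def)
      ultimately show ?thesis unfolding S_def by simp
    qed
    finally have "(w - 1) * S = 0" by (simp add: algebra_simps)
    then have "S = 0" using w1 by simp
    then show ?thesis using False unfolding fg S_def by (simp add: comb_def N_def)
  qed
qed

lemma delta_dist: "delta a \<in> distributions"
proof -
  have "cmod (delta a \<phi>) \<le> 1 * (\<Sum>k\<le>0::nat. SUP x. cmod ((dir_deriv (1::real) ^^ k) \<phi> x))" if "\<phi> \<in> test_fun" for \<phi>
    using that by (auto simp: delta_def intro!: cSUP_upper test_fun_bdd)
  then have "\<exists>N::nat. \<exists>C. \<forall>\<phi>\<in>test_fun. cmod (delta a \<phi>) \<le> C * (\<Sum>k\<le>N. SUP x. cmod ((dir_deriv (1::real) ^^ k) \<phi> x))"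
    by blast
  then show ?thesis unfolding distributions_def by (simp add: delta_def test_fun_add_cmult)
qed

lemma dist_sum_cmult:
  assumes "\<And>i. i \<in> I \<Longrightarrow> g i \<in> distributions" "finite I"
  shows "(\<lambda>\<phi>. \<Sum>i\<in>I. c i * g i \<phi>) \<in> distributions"
  using assms(2,1)
proof (induction I rule: finite_induct)
  case (insert a A)
  then show ?case using dist_add_cmult[of "\<lambda>\<phi>. \<Sum>i\<in>A. c i * g i \<phi>" "g a" "c a"] by (simp add: add.commute)
qed (simp add: zero_dist)

text \<open>\<open>F_op\<close> turns nodal values into coefficients that repeat with period 2 M +
  1. The mean that \<open>G_op\<close> subtracts from \<open>fmode n\<close> is
  \<open>comb M n\<close>, and the constant 1 has the coefficients \<open>comb M k\<close> after
  \<open>F_op\<close>; this gives the second term.\<close>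

lemma FG_fmode:
  shows "F_op M (G_op M (dist_of (fmode n))) \<in> distributions"
    "fcoeff (F_op M (G_op M (dist_of (fmode n)))) k = comb M (n - k) - comb M n * comb M k"
proof -
  let ?I = "{- int M..int M}"
  have cr: "cont_rep (dist_of (fmode n)) = fmode n"
    by (intro cont_rep_dist_of continuous_fmode fmode_periodic)
  have G: "cont_rep (G_op M (dist_of (fmode n))) = (\<lambda>\<theta>. fmode n \<theta> - comb M n)"
    unfolding G_op_def cr mean_fmode_node
    by (intro cont_rep_dist_of continuous_intros continuous_fmode) (simp add: fmode_periodic)
  have F: "F_op M (G_op M (dist_of (fmode n))) =
      (\<lambda>\<phi>. \<Sum>m\<in>?I. (2 * pi / (2 * of_nat M + 1) * (fmode n (node M m) - comb M n)) * delta (node M m) \<phi>)"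
    unfolding F_op_def G by (simp add: sum_distrib_left mult.assoc)
  show "F_op M (G_op M (dist_of (fmode n))) \<in> distributions"
    unfolding F by (intro dist_sum_cmult delta_dist) simp
  have "fcoeff (F_op M (G_op M (dist_of (fmode n)))) k =
     1 / (2 * of_nat M + 1) * (\<Sum>m\<in>?I. fmode (n - k) (node M m) - comb M n * fmode (- k) (node M m))"
    unfolding fcoeff_def F
    by (simp add: delta_def fmode_test_fun sum_distrib_left sum_divide_distrib left_diff_distrib fmode_mult[of n _ "-k"] diff_divide_distrib right_diff_distrib)
  also have "\<dots> = 1 / (2 * of_nat M + 1) * (\<Sum>m\<in>?I. fmode (n - k) (node M m)) - comb M n * (1 / (2 * of_nat M + 1) * (\<Sum>m\<in>?I. fmode (- k) (node M m)))"
    by (simp add: sum_subtractf sum_distrib_left right_diff_distrib)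
  also have "\<dots> = comb M (n - k) - comb M n * comb M k"
    unfolding mean_fmode_node by (simp add: comb_def)
  finally show "fcoeff (F_op M (G_op M (dist_of (fmode n)))) k = comb M (n - k) - comb M n * comb M k" .
qed

text \<open>Writing the interpolation basis in modes shows the coefficients to be discrete Fourier
  coefficients of the nodal values; inserting the Fourier series of \<open>g\<close> folds congruent
  frequencies together.\<close>

lemma Q_op_fcoeff:
  assumes g: "g \<in> distributions" and s: "(\<lambda>k. cmod (fcoeff g k)) summable_on UNIV"
  shows "Q_op M g \<in> distributions"
    "\<bar>k\<bar> \<le> int M \<Longrightarrow> fcoeff (Q_op M g) k = (\<Sum>\<^sub>\<infinity>l. fcoeff g l * comb M (l - k))"
    "\<not> \<bar>k\<bar> \<le> int M \<Longrightarrow> fcoeff (Q_op M g) k = 0"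
proof -
  let ?I = "{- int M..int M}"
  let ?N = "2 * of_nat M + 1 :: complex"
  define a where "a k = 1 / ?N * (\<Sum>m\<in>?I. fser (fcoeff g) (node M m) * fmode (- k) (node M m))" for k
  have ib: "interp_basis M m \<theta> = (\<Sum>k\<in>?I. 1 / ?N * (fmode (- k) (node M m) * fmode k \<theta>))" for m \<theta>
  proof -
    have "fmode k (\<theta> - node M m) = fmode (- k) (node M m) * fmode k \<theta>" for k
      by (simp add: fmode_eq_cis cis_mult algebra_simps)
    then show ?thesis by (simp add: interp_basis_def sum_distrib_left)
  qed
  have Q: "Q_op M g = dist_of (\<lambda>\<theta>. \<Sum>k\<in>?I. a k * fmode k \<theta>)"
  proof -
    have "(\<Sum>m\<in>?I. fser (fcoeff g) (node M m) * interp_basis M m \<theta>) = (\<Sum>k\<in>?I. a k * fmode k \<theta>)" for \<theta>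
    proof -
      have "(\<Sum>m\<in>?I. fser (fcoeff g) (node M m) * interp_basis M m \<theta>) =
        (\<Sum>m\<in>?I. \<Sum>k\<in>?I. fser (fcoeff g) (node M m) * (1 / ?N * (fmode (- k) (node M m) * fmode k \<theta>)))"
        by (simp add: ib sum_distrib_left)
      also have "\<dots> = (\<Sum>k\<in>?I. \<Sum>m\<in>?I. fser (fcoeff g) (node M m) * (1 / ?N * (fmode (- k) (node M m) * fmode k \<theta>)))"
        by (rule sum.swap)
      also have "\<dots> = (\<Sum>k\<in>?I. a k * fmode k \<theta>)"
        by (intro sum.cong refl) (simp add: a_def sum_distrib_left sum_distrib_right mult_ac)
      finally show ?thesis .
    qed
    then show ?thesis unfolding Q_op_def cont_rep_eq_fser[OF g s] by simp
  qed
  have "continuous_on UNIV (\<lambda>\<theta>. \<Sum>k\<in>?I. a k * fmode k \<theta>)" by (intro continuous_intros continuous_fmode)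
  then show "Q_op M g \<in> distributions" unfolding Q by (intro dist_of_distribution integrable_circ_continuous)
  have fQ: "fcoeff (Q_op M g) k = (if k \<in> ?I then a k else 0)" for k
    unfolding Q fcoeff_dist_of by (rule fc_sum_fmode) simp
  have Ik: "k \<in> ?I \<longleftrightarrow> \<bar>k\<bar> \<le> int M" by auto
  show "fcoeff (Q_op M g) k = 0" if "\<not> \<bar>k\<bar> \<le> int M"
  proof -
    have "k \<notin> ?I" using Ik that by blast
    then show ?thesis unfolding fQ by (simp only: if_False)
  qed
  assume k: "\<bar>k\<bar> \<le> int M"
  have hs: "((\<lambda>l. fcoeff g l * fmode l x) has_sum fser (fcoeff g) x) UNIV" for x
    unfolding fser_def
    by (rule has_sum_infsum, rule abs_summable_summable) (use s in \<open>simp add: norm_mult\<close>)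
  have "((\<lambda>l. \<Sum>m\<in>A. fcoeff g l * fmode l (node M m) * (1 / ?N * fmode (- k) (node M m))) has_sum
      (\<Sum>m\<in>A. fser (fcoeff g) (node M m) * (1 / ?N * fmode (- k) (node M m)))) UNIV" if "finite A" for A
    using that
  proof (induction A rule: finite_induct)
    case (insert x A)
    show ?case unfolding sum.insert[OF insert(1,2)] by (intro has_sum_add has_sum_cmult_left hs insert.IH)
  qed simp
  from this[of ?I] have "((\<lambda>l. \<Sum>m\<in>?I. fcoeff g l * fmode l (node M m) * (1 / ?N * fmode (- k) (node M m))) has_sum a k) UNIV"
    by (simp add: a_def sum_distrib_left mult_ac)
  moreover have "(\<Sum>m\<in>?I. fcoeff g l * fmode l (node M m) * (1 / ?N * fmode (- k) (node M m))) = fcoeff g l * comb M (l - k)" for l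
    unfolding mean_fmode_node[symmetric] sum_distrib_left
    by (intro sum.cong refl) (simp add: fmode_mult[of l _ "- k", simplified, symmetric])
  ultimately have "((\<lambda>l. fcoeff g l * comb M (l - k)) has_sum a k) UNIV" by simp
  then show "fcoeff (Q_op M g) k = (\<Sum>\<^sub>\<infinity>l. fcoeff g l * comb M (l - k))"
    using fQ k Ik by (simp add: infsumI)
qed

text \<open>The aliased frequencies \<open>l \<noteq> k\<close>, \<open>l \<equiv> k\<close> of a frequency \<open>|k| \<le> M\<close> satisfy \<open>|l| > M\<close>.\<close>

lemma Q_op_aliasing:
  assumes g: "g \<in> distributions" and le: "\<And>k. cmod (fcoeff g k) \<le> G * wt k powr - (s + 3)" and s: "s > 0" and k: "\<bar>k\<bar> \<le> int M"
  shows "cmod (fcoeff (Q_op M g) k - fcoeff g k) \<le> G * (1/2 + real M) powr - (s + 1) * zeta2"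
proof -
  have G: "G \<ge> 0" using order_trans[OF norm_ge_zero le[of 0]] by simp
  have S2: "(\<lambda>l. (G * (1/2 + real M) powr - (s + 1)) * wt l powr - 2) summable_on UNIV"
    by (intro summable_on_cmult_right summable_on_int_inverse) simp
  have S: "(\<lambda>l. cmod (fcoeff g l)) summable_on UNIV"
  proof (rule summable_on_comparison_test)
    show "(\<lambda>l. G * wt l powr - (s + 3)) summable_on UNIV"
      by (intro summable_on_cmult_right summable_on_int_inverse) (use s in simp)
  qed (use le in auto)
  let ?h = "\<lambda>l. if l = k then 0 else fcoeff g l * comb M (l - k)"
  have hle: "cmod (?h l) \<le> (G * (1/2 + real M) powr - (s + 1)) * wt l powr - 2" for l
  proof (cases "l \<noteq> k \<and> (2 * int M + 1) dvd (l - k)")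
    case True
    then have "2 * int M + 1 \<le> \<bar>l - k\<bar>" using dvd_imp_le_int[of "l - k" "2 * int M + 1"] by simp
    then have l: "int M + 1 \<le> \<bar>l\<bar>" using k by linarith
    then have l2: "1/2 + real M \<le> wt l" by simp
    have "cmod (?h l) \<le> G * wt l powr - (s + 3)" using True le[of l] by (simp add: comb_def)
    \<comment> \<open>The exponent is split: s + 1 of it is converted into a power of 1/2 + M, and
      the remaining 2 make the sum over l converge.\<close>
    also have "wt l powr - (s + 3) = wt l powr - (s + 1) * wt l powr - 2"
      by (simp add: powr_add[symmetric] algebra_simps)
    also have "G * (wt l powr - (s + 1) * wt l powr - 2) \<le> G * ((1/2 + real M) powr - (s + 1) * wt l powr - 2)"
      using G s l2 by (intro mult_left_mono mult_right_mono powr_mono2') auto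
    finally show ?thesis by (simp add: mult.assoc)
  next
    case False
    then have "?h l = 0" by (auto simp: comb_def)
    then show ?thesis using G by simp
  qed
  have hs: "(\<lambda>l. cmod (?h l)) summable_on UNIV"
    by (rule summable_on_comparison_test[OF S2]) (use hle in auto)
  have Sg: "(\<lambda>l. fcoeff g l * comb M (l - k)) summable_on UNIV"
    by (rule abs_summable_summable, rule summable_on_comparison_test[OF S]) (auto simp: comb_def norm_mult)
  have "(\<Sum>\<^sub>\<infinity>l. fcoeff g l * comb M (l - k)) = (\<Sum>\<^sub>\<infinity>l. (if l = k then fcoeff g k else 0) + ?h l)"
    by (intro infsum_cong) (simp add: comb_def)
  also have "\<dots> = (\<Sum>\<^sub>\<infinity>l. if l = k then fcoeff g k else 0) + (\<Sum>\<^sub>\<infinity>l. ?h l)"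
  proof (rule infsum_add)
    have "((\<lambda>l. if l = k then fcoeff g k else 0) has_sum fcoeff g k) UNIV"
      by (rule has_sum_finite_neutralI[of "{k}"]) auto
    then show "(\<lambda>l. if l = k then fcoeff g k else 0) summable_on UNIV" by (rule has_sum_imp_summable)
    show "?h summable_on UNIV" by (rule abs_summable_summable[OF hs])
  qed
  also have "(\<Sum>\<^sub>\<infinity>l. if l = k then fcoeff g k else 0) = fcoeff g k"
    by (rule infsumI, rule has_sum_finite_neutralI[of "{k}"]) auto
  finally have "fcoeff (Q_op M g) k - fcoeff g k = (\<Sum>\<^sub>\<infinity>l. ?h l)"
    unfolding Q_op_fcoeff(2)[OF g S k] by simp
  also have "cmod \<dots> \<le> (\<Sum>\<^sub>\<infinity>l. cmod (?h l))" by (rule norm_infsum_bound[OF hs])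
  also have "\<dots> \<le> (\<Sum>\<^sub>\<infinity>l. (G * (1/2 + real M) powr - (s + 1)) * wt l powr - 2)"
    by (intro infsum_mono hs S2 hle)
  also have "\<dots> = (G * (1/2 + real M) powr - (s + 1)) * zeta2"
    unfolding zeta2_def by (rule infsum_cmult_right) (auto intro: summable_on_int_inverse)
  finally show ?thesis .
qed

lemma P_diamond_Q_op:
  assumes g: "g \<in> distributions" and s: "(\<lambda>k. cmod (fcoeff g k)) summable_on UNIV"
  shows "P_diamond (Q_op M g) = trunc (Q_op M g) ({- int M..int M} - {0})"
proof
  fix \<phi>
  have "P_diamond (Q_op M g) \<phi> = (\<Sum>\<^sub>\<infinity>n\<in>{- int M..int M} - {0}. fcoeff (Q_op M g) n * dist_of (fmode n) \<phi>)"
    unfolding P_diamond_def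
    by (rule infsum_cong_neutral) (use Q_op_fcoeff(3)[OF g s] in \<open>auto simp: abs_le_iff\<close>)
  then show "P_diamond (Q_op M g) \<phi> = trunc (Q_op M g) ({- int M..int M} - {0}) \<phi>"
    by (simp add: trunc_def)
qed

text \<open>For s > 1/2, the norm of order -s of a distribution all of whose coefficients have
  modulus 1, such as 2 pi times a Dirac delta.\<close>

definition zeta_norm :: "real \<Rightarrow> real" where
  "zeta_norm s = sqrt (2 * pi * (\<Sum>\<^sub>\<infinity>n. wt n powr (- (2 * s))))"

lemma zeta_norm_nonneg: "0 \<le> zeta_norm s"
  unfolding zeta_norm_def by (intro real_sqrt_ge_zero mult_nonneg_nonneg infsum_nonneg) auto

lemma sob_negative_bounded:
  assumes s: "s > 1/2" and g: "g \<in> distributions" and le: "\<And>k. cmod (fcoeff g k) \<le> 1"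
  shows "g \<in> sob (- s)" "sob_norm (- s) g \<le> zeta_norm s"
proof -
  have S: "(\<lambda>n. wt n powr - (2 * s)) summable_on UNIV" by (rule summable_on_int_inverse) (use s in simp)
  have t: "sob_term (- s) g n \<le> wt n powr - (2 * s)" for n
  proof -
    have "(cmod (fcoeff g n))\<^sup>2 \<le> 1" using le[of n] by (simp add: abs_square_le_1)
    then have "wt n powr - (2 * s) * (cmod (fcoeff g n))\<^sup>2 \<le> wt n powr - (2 * s) * 1" by (rule mult_left_mono) simp
    then show ?thesis by (simp add: sob_term_def)
  qed
  have T: "sob_term (- s) g summable_on UNIV"
    by (rule summable_on_comparison_test[OF S]) (auto simp: t sob_term_nonneg)
  then show "g \<in> sob (- s)" using g by (simp add: sob_def)
  show "sob_norm (- s) g \<le> zeta_norm s"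
    unfolding sob_norm_def zeta_norm_def by (intro real_sqrt_le_mono mult_left_mono infsum_mono T S t) auto
qed

lemma comb_cmod: "cmod (comb M j) \<le> 1" by (simp add: comb_def)

text \<open>If 2 M + 1 divides n, the mode is constant on the nodes and \<open>G_op\<close>
  annihilates it there; otherwise its nodal mean is zero and \<open>G_op\<close> leaves the nodal
  values unchanged.\<close>

lemma FG_fmode_cases:
  shows "comb M n = 1 \<Longrightarrow> comb M (n - k) - comb M n * comb M k = 0"
    and "comb M n \<noteq> 1 \<Longrightarrow> comb M (n - k) - comb M n * comb M k = comb M (n - k)"
proof -
  assume "comb M n = 1"
  then have "(2 * int M + 1) dvd n" by (auto simp: comb_def split: if_splits)
  then have "(2 * int M + 1) dvd (n - k) \<longleftrightarrow> (2 * int M + 1) dvd k"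
    by (metis diff_diff_eq2 add_diff_cancel_left' dvd_diff)
  then show "comb M (n - k) - comb M n * comb M k = 0" using \<open>comb M n = 1\<close> by (simp add: comb_def)
qed (simp add: comb_def split: if_splits)

text \<open>As 0 < |n| <= M, n is no multiple of N, and the error consists of the aliases n + j N
  with j nonzero, all with coefficient -1. The bound |n + j N| >= |j| N/2 separates a power of 1/2 +
  M from a sum over j that converges.\<close>

lemma FG_error_small:
  assumes s: "s > 1/2" and n: "n \<noteq> 0" "\<bar>n\<bar> \<le> int M"
  shows "sob_norm (- s) (dist_of (fmode n) - F_op M (G_op M (dist_of (fmode n)))) \<le> zeta_norm s * (1/2 + real M) powr - s"
proof -
  define N where "N = 2 * int M + 1"
  define d where "d = dist_of (fmode n) - F_op M (G_op M (dist_of (fmode n)))"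
  have N: "N > 0" by (simp add: N_def)
  have "\<not> N dvd n"
  proof
    assume "N dvd n"
    then have "N \<le> \<bar>n\<bar>" using n(1) N dvd_imp_le_int[of n N] by simp
    then show False using n(2) by (simp add: N_def)
  qed
  then have c: "comb M n \<noteq> 1" by (simp add: comb_def N_def)
  have dk: "fcoeff d k = (if k = n then 1 else 0) - comb M (n - k)" for k
    unfolding d_def fcoeff_diff FG_fmode(2) FG_fmode_cases(2)[OF c] by (auto simp: fcoeff_fmode)
  let ?h = "\<lambda>j. n + j * N"
  have inj: "inj_on ?h (- {0})" using N by (auto intro!: inj_onI)
  have supp: "sob_term (- s) d k = 0" if "k \<notin> ?h ` (- {0})" for k
  proof (cases "k = n")
    case False
    have "\<not> N dvd (n - k)"
    proof
      assume "N dvd (n - k)"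
      then obtain i where i: "n - k = N * i" by blast
      have "k \<in> ?h ` (- {0})"
      proof (rule image_eqI)
        show "k = ?h (- i)" using i by (simp add: mult.commute)
        show "- i \<in> - {0}" using i False by auto
      qed
      then show False using that by contradiction
    qed
    then show ?thesis using False by (simp add: sob_term_def dk comb_def N_def)
  qed (simp add: sob_term_def dk comb_def)
  have S: "(\<lambda>j. (1/2 + real M) powr - (2 * s) * wt j powr - (2 * s)) summable_on UNIV"
    by (intro summable_on_cmult_right summable_on_int_inverse) (use s in simp)
  have le: "sob_term (- s) d (?h j) \<le> (1/2 + real M) powr - (2 * s) * wt j powr - (2 * s)" if j: "j \<noteq> 0" for j
  proof -
    have "\<bar>j\<bar> * N \<le> \<bar>?h j\<bar> + \<bar>n\<bar>" using abs_triangle_ineq[of "?h j" "- n"] N by (simp add: abs_mult)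
    moreover have "2 * \<bar>n\<bar> \<le> \<bar>j\<bar> * N"
    proof -
      have "1 * N \<le> \<bar>j\<bar> * N" using j N by (intro mult_right_mono) auto
      moreover have "2 * \<bar>n\<bar> \<le> N" using n(2) by (simp add: N_def)
      ultimately show ?thesis by linarith
    qed
    moreover have "P \<le> a + b \<Longrightarrow> 2 * b \<le> P \<Longrightarrow> P \<le> 2 * a" for P a b :: int by linarith
    ultimately have "\<bar>j\<bar> * N \<le> 2 * \<bar>?h j\<bar>" by blast
    then have "real_of_int (\<bar>j\<bar> * N) \<le> real_of_int (2 * \<bar>?h j\<bar>)" by (simp only: of_int_le_iff)
    then have "(1/2 + real M) * real_of_int \<bar>j\<bar> \<le> real_of_int \<bar>?h j\<bar>"
      by (simp add: N_def algebra_simps)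
    moreover have "wt j = real_of_int \<bar>j\<bar>" using j by (simp add: max_def)
    moreover have "real_of_int \<bar>?h j\<bar> \<le> wt (?h j)" unfolding of_int_le_iff by (rule max.cobounded2)
    ultimately have w: "(1/2 + real M) * wt j \<le> wt (?h j)" by linarith
    have "sob_term (- s) d (?h j) \<le> wt (?h j) powr - (2 * s)"
    proof -
      have "cmod (fcoeff d (?h j)) \<le> 1" unfolding dk using j N comb_cmod by auto
      then have "(cmod (fcoeff d (?h j)))\<^sup>2 \<le> 1" by (simp add: abs_square_le_1)
      then have "wt (?h j) powr - (2 * s) * (cmod (fcoeff d (?h j)))\<^sup>2 \<le> wt (?h j) powr - (2 * s) * 1"
        by (rule mult_left_mono) simp
      then show ?thesis by (simp add: sob_term_def)
    qed
    also have "\<dots> \<le> ((1/2 + real M) * wt j) powr - (2 * s)" using w s by (intro powr_mono2') (auto intro!: mult_pos_pos)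
    also have "\<dots> = (1/2 + real M) powr - (2 * s) * wt j powr - (2 * s)" by (rule powr_mult)
    finally show ?thesis .
  qed
  have Sd: "(\<lambda>j. sob_term (- s) d (?h j)) summable_on - {0}"
    by (rule summable_on_comparison_test[of "\<lambda>j. (1/2 + real M) powr - (2 * s) * wt j powr - (2 * s)"])
       (use le in \<open>auto simp: sob_term_nonneg intro: summable_on_subset_banach[OF S]\<close>)
  have "(\<Sum>\<^sub>\<infinity>k. sob_term (- s) d k) = (\<Sum>\<^sub>\<infinity>k\<in>?h ` (- {0}). sob_term (- s) d k)"
    by (rule infsum_cong_neutral) (use supp in auto)
  also have "\<dots> = (\<Sum>\<^sub>\<infinity>j\<in>- {0}. sob_term (- s) d (?h j))"
    by (subst infsum_reindex[OF inj]) (simp add: o_def)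
  also have "\<dots> \<le> (\<Sum>\<^sub>\<infinity>j. (1/2 + real M) powr - (2 * s) * wt j powr - (2 * s))"
    by (rule infsum_mono_neutral[OF Sd S]) (use le in auto)
  also have "\<dots> = (1/2 + real M) powr - (2 * s) * (\<Sum>\<^sub>\<infinity>j. wt j powr - (2 * s))"
    by (rule infsum_cmult_right) (intro summable_on_int_inverse, use s in simp)
  finally have "sob_norm (- s) d \<le> sqrt (2 * pi * ((1/2 + real M) powr - (2 * s) * (\<Sum>\<^sub>\<infinity>j. wt j powr - (2 * s))))"
    unfolding sob_norm_def by (intro real_sqrt_le_mono mult_left_mono) auto
  also have "\<dots> = zeta_norm s * sqrt ((1/2 + real M) powr - (2 * s))"
    by (simp add: zeta_norm_def real_sqrt_mult mult_ac)
  also have "sqrt ((1/2 + real M) powr - (2 * s)) = (1/2 + real M) powr - s"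
    by (simp add: powr_half_sqrt[symmetric] powr_powr)
  finally show ?thesis unfolding d_def .
qed

text \<open>With e the mode and g its discretization, the error is T (e - g) plus the interpolation
  error of T g. Every coefficient is bounded by a multiple of \<open>q * wt k powr - 1\<close>,
  which is what \<open>sob_of_decay\<close> asks for in order 0. The coefficient \<sigma> enters
  only through linearity of \<open>T\<close> and its bound from order -s to order s + 3.\<close>

lemma relative_ND_discretization:
  assumes T: "is_relative_ND \<sigma> T" and s: "s > 1/2"
  shows "\<exists>C>0. \<forall>M::nat. \<forall>n::int. M \<ge> 1 \<longrightarrow> n \<noteq> 0 \<longrightarrow>
    T (dist_of (fmode n)) - P_diamond (Q_op M (T (F_op M (G_op M (dist_of (fmode n)))))) \<in> sob 0 \<and>
    sob_norm 0 (T (dist_of (fmode n)) - P_diamond (Q_op M (T (F_op M (G_op M (dist_of (fmode n)))))))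
      \<le> C * (real_of_int \<bar>n\<bar> / (1 / 2 + real M)) powr s"
proof -
  obtain C0 where C0: "\<And>f. f \<in> sob_diamond (- s) \<Longrightarrow> T f \<in> sob_diamond (s + 3) \<and> sob_norm (s + 3) (T f) \<le> C0 * sob_norm (- s) f"
    using T unfolding is_relative_ND_def by metis
  \<comment> \<open>The constant supplied by \<open>is_relative_ND\<close> may be negative.\<close>
  define C where "C = max C0 0"
  have C: "C \<ge> 0" "\<And>f. f \<in> sob_diamond (- s) \<Longrightarrow> sob_norm (s + 3) (T f) \<le> C * sob_norm (- s) f"
  proof -
    show "C \<ge> 0" by (simp add: C_def)
    fix f assume "f \<in> sob_diamond (- s)"
    then have "sob_norm (s + 3) (T f) \<le> C0 * sob_norm (- s) f" using C0 by blast
    also have "\<dots> \<le> C * sob_norm (- s) f" by (intro mult_right_mono sob_norm_nonneg) (simp add: C_def)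
    finally show "sob_norm (s + 3) (T f) \<le> C * sob_norm (- s) f" .
  qed
  have dec: "cmod (fcoeff (T f) k) \<le> (C * sob_norm (- s) f) * wt k powr - (s + 3)" if f: "f \<in> sob_diamond (- s)" for f k
  proof -
    have "cmod (fcoeff (T f) k) \<le> sob_norm (s + 3) (T f) * wt k powr - (s + 3)"
      using C0[OF f] by (intro fcoeff_le_sob_norm sob_diamond_sob) blast
    also have "\<dots> \<le> (C * sob_norm (- s) f) * wt k powr - (s + 3)" by (intro mult_right_mono C(2) f) simp
    finally show ?thesis .
  qed
  have Td: "T f \<in> distributions" "fcoeff (T f) 0 = 0" if "f \<in> sob_diamond (- s)" for f
    using C0[OF that] by (auto simp: sob_diamond_def sob_def)
  define A where "A = zeta_norm s"
  have A: "A \<ge> 0" by (simp add: A_def zeta_norm_nonneg)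
  \<comment> \<open>One unit of C A stems from T (e - g); the remaining 1 + \<open>zeta2\<close>
    cover the interpolation error, \<open>zeta2\<close> for frequencies up to M and 1 for those
    beyond.\<close>
  define E where "E = C * A * (2 + zeta2)"
  have E: "E \<ge> 0" using C A zeta2_nonneg by (simp add: E_def)
  have main: "T (dist_of (fmode n)) - P_diamond (Q_op M (T (F_op M (G_op M (dist_of (fmode n)))))) \<in> sob 0 \<and>
    sob_norm 0 (T (dist_of (fmode n)) - P_diamond (Q_op M (T (F_op M (G_op M (dist_of (fmode n)))))))
      \<le> (E * (real_of_int \<bar>n\<bar> / (1 / 2 + real M)) powr s) * sqrt (2 * pi * zeta2)"
    if M: "M \<ge> 1" and n: "n \<noteq> 0" for M :: nat and n :: int
  proof -
    define e where "e = dist_of (fmode n)"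
    define g where "g = F_op M (G_op M e)"
    define h where "h = 1/2 + real M"
    define q where "q = (real_of_int \<bar>n\<bar> / h) powr s"
    have h: "h \<ge> 1" using M by (simp add: h_def)
    have gd: "g \<in> distributions" and gk: "\<And>k. fcoeff g k = comb M (n - k) - comb M n * comb M k"
      unfolding g_def e_def by (rule FG_fmode)+
    have g1: "cmod (fcoeff g k) \<le> 1" for k
      unfolding gk using FG_fmode_cases[of M n k] comb_cmod[of M "n - k"] by (cases "comb M n = 1") auto
    have g0: "fcoeff g 0 = 0" unfolding gk by (simp add: comb_def)
    have g: "g \<in> sob_diamond (- s)" "sob_norm (- s) g \<le> A"
      using sob_negative_bounded[OF s gd g1] g0 by (auto simp: sob_diamond_def A_def)
    have e: "e \<in> sob_diamond (- s)" unfolding e_def by (rule fmode_sob_diamond[OF n])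
    have eg: "e - g \<in> sob_diamond (- s)" by (rule sob_diamond_diff[OF e g(1)])
    have eg1: "cmod (fcoeff (e - g) k) \<le> 1" for k
    proof (cases "comb M n = 1")
      case True
      show ?thesis unfolding fcoeff_diff gk FG_fmode_cases(1)[OF True] by (simp add: e_def fcoeff_fmode)
    next
      case False
      show ?thesis unfolding fcoeff_diff gk FG_fmode_cases(2)[OF False] by (simp add: e_def fcoeff_fmode comb_def)
    qed
    have egA: "sob_norm (- s) (e - g) \<le> A"
      using sob_negative_bounded(2)[OF s sob_distribution[OF sob_diamond_sob[OF eg]] eg1] by (simp add: A_def)
    \<comment> \<open>Since |n| >= 1, \<open>q\<close> dominates the pure rate of the
      discretization.\<close>
    have hq: "h powr - s \<le> q"
    proof -
      have "1 / h \<le> real_of_int \<bar>n\<bar> / h" using n h by (intro divide_right_mono) auto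
      then have "(1 / h) powr s \<le> q" unfolding q_def using s h by (intro powr_mono2) auto
      then show ?thesis using h by (simp add: powr_divide powr_minus_divide)
    qed
    have egq: "sob_norm (- s) (e - g) \<le> A * q"
    proof (cases "\<bar>n\<bar> \<le> int M")
      case True
      have "sob_norm (- s) (e - g) \<le> A * h powr - s"
        using FG_error_small[OF s n True] by (simp add: e_def g_def A_def h_def)
      also have "\<dots> \<le> A * q" by (intro mult_left_mono hq A)
      finally show ?thesis .
    next
      case False
      then have "h \<le> real_of_int \<bar>n\<bar>" unfolding h_def by linarith
      then have "1 powr s \<le> q" unfolding q_def using s h by (intro powr_mono2) auto
      then have "A * 1 \<le> A * q" using A by (intro mult_left_mono) auto
      then show ?thesis using egA by simp
    qed
    define d where "d = T e - P_diamond (Q_op M (T g))"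
    have Tg_S: "(\<lambda>k. cmod (fcoeff (T g) k)) summable_on UNIV"
    proof (rule summable_on_comparison_test)
      show "(\<lambda>k. (C * sob_norm (- s) g) * wt k powr - (s + 3)) summable_on UNIV"
        by (intro summable_on_cmult_right summable_on_int_inverse) (use s in simp)
    qed (use dec[OF g(1)] in auto)
    note PQ = P_diamond_Q_op[OF Td(1)[OF g(1)] Tg_S, of M]
    have dd: "d \<in> distributions"
      unfolding d_def PQ by (intro dist_diff Td e trunc_dist) simp
    have Teg: "fcoeff (T (e - g)) k = fcoeff (T e) k - fcoeff (T g) k" for k
    proof -
      have "T (e - g) = (\<lambda>\<phi>. T e \<phi> + (-1) * T g \<phi>)"
        using T e g(1) unfolding is_relative_ND_def dist_diff_eq by blast
      then show ?thesis by (simp add: fcoeff_def diff_divide_distrib)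
    qed
    have wk: "wt k powr - (s + 3) \<le> wt k powr - 1" for k using s by (intro powr_mono) auto
    have t1: "cmod (fcoeff (T e) k - fcoeff (T g) k) \<le> C * (A * q) * wt k powr - 1" for k
    proof -
      have "cmod (fcoeff (T e) k - fcoeff (T g) k) \<le> (C * sob_norm (- s) (e - g)) * wt k powr - (s + 3)"
        unfolding Teg[symmetric] by (rule dec[OF eg])
      also have "\<dots> \<le> (C * (A * q)) * wt k powr - 1"
        using C A by (intro mult_mono mult_left_mono egq wk) (auto simp: q_def)
      finally show ?thesis .
    qed
    have dk: "cmod (fcoeff d k) \<le> (E * q) * wt k powr - (0 + 1)" for k
    proof -
      consider "k = 0" | "k \<noteq> 0" "\<bar>k\<bar> \<le> int M" | "\<not> \<bar>k\<bar> \<le> int M" by blast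
      then have "cmod (fcoeff d k) \<le> (C * (A * q) + C * A * q * (1 + zeta2)) * wt k powr - 1"
      proof cases
        case 1
        then have "fcoeff d k = 0" by (simp add: d_def PQ fcoeff_diff fcoeff_trunc Td(2)[OF e])
        then show ?thesis using C A zeta2_nonneg by (simp add: q_def)
      next
        case 2
        have kI: "k \<in> {- int M..int M} - {0}" using 2 by auto
        have "fcoeff d k = (fcoeff (T e) k - fcoeff (T g) k) - (fcoeff (Q_op M (T g)) k - fcoeff (T g) k)"
          unfolding d_def PQ fcoeff_diff using kI by (subst fcoeff_trunc) auto
        also have "cmod \<dots> \<le> C * (A * q) * wt k powr - 1 + (C * sob_norm (- s) g) * h powr - (s + 1) * zeta2"
          unfolding h_def by (intro order_trans[OF norm_triangle_ineq4 add_mono] t1 Q_op_aliasing Td g(1) dec 2(2)) (use s in simp)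
        also have "(C * sob_norm (- s) g) * h powr - (s + 1) * zeta2 \<le> (C * A) * (q * wt k powr - 1) * zeta2"
        proof (intro mult_right_mono mult_mono mult_left_mono g(2) zeta2_nonneg)
          \<comment> \<open>For |k| <= M the surplus factor \<open>h powr - 1\<close> of the
            aliasing bound is traded for the decay in k that summation requires.\<close>
          have "wt k \<le> h" using 2 M unfolding h_def by simp
          then have "h powr - 1 \<le> wt k powr - 1" by (intro powr_mono2') auto
          then have "h powr - s * h powr - 1 \<le> q * wt k powr - 1" by (intro mult_mono hq) (auto simp: q_def)
          moreover have "- (s + 1) = - s + - 1" by simp
          ultimately show "h powr - (s + 1) \<le> q * wt k powr - 1" by (simp only: powr_add)
        qed (use C A sob_norm_nonneg in auto)
        finally have "cmod (fcoeff d k) \<le> (C * (A * q) + C * A * q * zeta2) * wt k powr - 1"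
          by (simp add: algebra_simps)
        also have "\<dots> \<le> (C * (A * q) + C * A * q * (1 + zeta2)) * wt k powr - 1"
          using C A by (intro mult_right_mono add_left_mono mult_left_mono) (auto simp: q_def)
        finally show ?thesis .
      next
        case 3
        then have "k \<notin> {- int M..int M} - {0}" by auto
        then have "fcoeff d k = (fcoeff (T e) k - fcoeff (T g) k) + fcoeff (T g) k"
          unfolding d_def PQ fcoeff_diff by (subst fcoeff_trunc) auto
        also have "cmod \<dots> \<le> C * (A * q) * wt k powr - 1 + (C * sob_norm (- s) g) * wt k powr - (s + 3)"
          by (intro order_trans[OF norm_triangle_ineq add_mono] t1 dec g(1))
        also have "(C * sob_norm (- s) g) * wt k powr - (s + 3) \<le> (C * A) * (q * wt k powr - 1)"
        proof (intro mult_mono mult_left_mono g(2))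
          \<comment> \<open>Beyond M the projected interpolant vanishes, and the rate comes from the
            decay of T g itself: wt k to the power -s is at most h to the power -s.\<close>
          have "h \<le> wt k" using 3 unfolding h_def by simp
          then have "wt k powr - s \<le> h powr - s" using s h by (intro powr_mono2') auto
          then have "wt k powr - s * wt k powr - 3 \<le> q * wt k powr - 1"
            using hq by (intro mult_mono powr_mono) (auto simp: q_def)
          moreover have "- (s + 3) = - s + - 3" by simp
          ultimately show "wt k powr - (s + 3) \<le> q * wt k powr - 1" by (simp only: powr_add)
        qed (use C A sob_norm_nonneg in auto)
        finally have "cmod (fcoeff d k) \<le> (C * (A * q) + C * A * q * 1) * wt k powr - 1"
          by (simp add: algebra_simps)
        also have "\<dots> \<le> (C * (A * q) + C * A * q * (1 + zeta2)) * wt k powr - 1"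
          using C A zeta2_nonneg by (intro mult_right_mono add_left_mono mult_left_mono) (auto simp: q_def)
        finally show ?thesis .
      qed
      also have "(C * (A * q) + C * A * q * (1 + zeta2)) * wt k powr - 1 = (E * q) * wt k powr - (0 + 1)"
        by (simp add: E_def algebra_simps)
      finally show ?thesis .
    qed
    from sob_of_decay[OF dd dk] show ?thesis
      by (simp add: d_def e_def g_def q_def h_def)
  qed
  define K where "K = E * sqrt (2 * pi * zeta2) + 1"
  have K: "K > 0" using E zeta2_nonneg by (simp add: K_def add_nonneg_pos)
  show ?thesis
  proof (intro exI[of _ K] conjI K allI impI)
    fix M :: nat and n :: int assume M: "M \<ge> 1" and n: "n \<noteq> 0"
    note m = main[OF M n]
    show "T (dist_of (fmode n)) - P_diamond (Q_op M (T (F_op M (G_op M (dist_of (fmode n)))))) \<in> sob 0" using m by blast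
    have "(E * (real_of_int \<bar>n\<bar> / (1 / 2 + real M)) powr s) * sqrt (2 * pi * zeta2) \<le> K * (real_of_int \<bar>n\<bar> / (1 / 2 + real M)) powr s"
      by (simp add: K_def algebra_simps)
    then show "sob_norm 0 (T (dist_of (fmode n)) - P_diamond (Q_op M (T (F_op M (G_op M (dist_of (fmode n)))))))
      \<le> K * (real_of_int \<bar>n\<bar> / (1 / 2 + real M)) powr s" using m by linarith
  qed
qed

theorem corollary5p3:
  fixes \<sigma> :: "complex \<Rightarrow> complex" and lo hi s :: real
  assumes "\<sigma> \<in> borel_measurable disk"
    and "\<exists>B. AE z in disk. cmod (\<sigma> z) \<le> B"
    and "compact (ess_support (\<lambda>z. \<sigma> z - 1))"
    and "lo > 0" and "hi > 0"
    and "AE z in disk. lo \<le> Re (\<sigma> z) \<and> Re (\<sigma> z) \<le> hi"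
    and "s > 1 / 2"
  shows "\<exists>C>0. \<forall>M::nat. \<forall>n::int. M \<ge> 1 \<longrightarrow> n \<noteq> 0 \<longrightarrow>
    (let e = dist_of (fmode n);
         d = Upsilon \<sigma> e - P_diamond (Q_op M (Upsilon \<sigma> (F_op M (G_op M e))))
     in d \<in> sob 0 \<and>
        sob_norm 0 d \<le> C * (real_of_int \<bar>n\<bar> / (1 / 2 + real M)) powr s)"
proof -
  obtain B where B: "AE z in disk. cmod (\<sigma> z) \<le> B" using assms(2) by blast
  obtain R where R: "0 < R" "R < 1" "AE z in disk. R < cmod z \<longrightarrow> \<sigma> z - 1 = 0"
    using ess_support_radius[OF assms(3)] by blast
  \<comment> \<open>Passing from \<open>B\<close> to \<open>max B lo\<close> meets the condition of
    the locale that the upper bound dominate \<open>lo\<close>.\<close>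
  interpret localized_conductivity \<sigma> lo "max B lo" R
  proof
    show "AE z in disk. cmod (\<sigma> z) \<le> max B lo" using B by eventually_elim simp
    show "AE z in disk. lo \<le> Re (\<sigma> z)" using assms(6) by eventually_elim simp
    show "AE z in disk. R < cmod z \<longrightarrow> \<sigma> z = 1" using R(3) by eventually_elim simp
  qed (use assms R in auto)
  show ?thesis
    using relative_ND_discretization[OF Upsilon_is_relative_ND assms(7)] by (simp add: Let_def)
qed

end
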